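(* Suppose $F\subset\mathrm{Sym}^2(\mathbb R^n)$ is a convex ST-invariant cone subequation with (finite) Riesz characteristic $p=p_F$, write $K=K_p$, and let $u$ be an $F$-subharmonic function defined in a neighborhood of the origin in $\mathbb R^n$. If $p\neq2$, then each tangent $U$ to $u$ at $0$ has averages, for all $r>0$, $$\sup_S U(r\sigma)=\Theta^M(u)K(r),\qquad \frac1{|S|}\int_S U(r\sigma)\,d\sigma=\Theta^S(u)K(r),\qquad \frac1{|B|}\int_B U(rx)\,dx=\Theta^V(u)K(r).$$ In particular, $\Theta^\Psi(U)=\Theta^\Psi(u)$ for $\Psi=M,S,V$. If $p=2$, then all the densities of $u$ and of any tangent $U$ to $u$ at $0$ agree: $$\Theta(u):=\Theta^M(U)=\Theta^S(U)=\Theta^V(U)=\Theta^M(u)=\Theta^S(u)=\Theta^V(u),$$ and, with $\Theta=\Theta(u)$, the averages of a tangent $U$ to $u$ are given, for all $r>0$, by $$\sup_S U(r\sigma)=\Theta\log r,\qquad \frac1{|S|}\int_S U(r\sigma)\,d\sigma=\Theta\log r+\frac1{|S|}\int_S U(\sigma)\,d\sigma,\qquad \frac1{|B|}\int_B U(rx)\,dx=\Theta\log r+\frac1{|B|}\int_B U(x)\,dx.$$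
   Context: Fix $n\ge 2$; $B=\{|x|\le1\}\subset\mathbb R^n$, $S=\partial B$. $\mathrm{Sym}^2(\mathbb R^n)$ is the space of real symmetric $n\times n$ matrices and $\mathcal P=\{A: A\ge 0\}$. A subequation is a nonempty proper closed subset $F\subset \mathrm{Sym}^2(\mathbb R^n)$ with $F+\mathcal P\subset F$. It is a cone if $tF\subset F$ for all $t\ge 0$. It is ST-invariant if there is a subgroup $G\subset O(n)$ acting transitively on $S^{n-1}$ such that $F$ is invariant under $A\mapsto gAg^t$ for all $g\in G$. For a unit vector $e$, $P_e$ and $P_{e^\perp}=I-P_e$ are the orthogonal projections onto $\mathbb R e$ and $e^\perp$. The Riesz characteristic is $p_F=\sup\{\bar p: P_{e^\perp}-(\bar p-1)P_e\in F\}$ (independent of $e$). The Riesz kernel is $K_p(t)=t^{2-p}$ if $1\le p<2$, $K_2(t)=\log t$, $K_p(t)=-t^{2-p}$ if $2<p<\infty$. An upper semi-continuous $u:X\to[-\infty,\infty)$ on an open set $X$, not identically $-\infty$ on any connected component of $X$, is $F$-subharmonic if whenever $\varphi$ is $C^2$ near $x_0\in X$ with $u\le\varphi$ near $x_0$ and equality at $x_0$, one has $D^2\varphi(x_0)\in F$. Averages: $M(u,r)=\sup_{|x|\le r}u$, $S(u,r)=\frac1{|S|}\int_S u(r\sigma)\,d\sigma$, $V(u,r)=\frac1{|B|}\int_B u(rx)\,dx$. Densities at $0$: for $\Psi=M,S,V$, $\Theta^\Psi(u)=\Theta^\Psi(u,0)=\lim_{0<s<r\downarrow0}\frac{\Psi(u,r)-\Psi(u,s)}{K(r)-K(s)}$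 (a decreasing limit which exists and is finite and $\ge0$). Tangential $p$-flow: $u_r(x)=r^{p-2}u(rx)$ if $p>2$; $u_r(x)=r^{p-2}(u(rx)-u(0))$ if $1\le p<2$; $u_r(x)=u(rx)-M(u,r)$ if $p=2$. A tangent to $u$ at $0$ is any $U$ for which there is a sequence $r_j\downarrow0$ with $u_{r_j}\to\overline U$ in $L^1_{\rm loc}(\mathbb R^n)$, $U(x)=\lim_{r\to0}\operatorname{ess\,sup}_{B_r(x)}\overline U$ being the upper semi-continuous representative (an $F$-subharmonic function on $\mathbb R^n$). *)

theory Defs
  imports "HOL-Probability.Essential_Supremum"
begin

section \<open>Subequations\<close>

definition symmetric_matrices :: "(real^'n^'n) set" where
  "symmetric_matrices = {A. transpose A = A}"

definition psd_matrices :: "(real^'n^'n) set" where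
  "psd_matrices = {A \<in> symmetric_matrices. \<forall>v. 0 \<le> v \<bullet> (A *v v)}"

definition subequation :: "(real^'n^'n) set \<Rightarrow> bool" where
  "subequation F \<longleftrightarrow>
     F \<noteq> {} \<and> F \<subset> symmetric_matrices \<and> closed F \<and>
     (\<forall>A\<in>F. \<forall>P\<in>psd_matrices. A + P \<in> F)"

definition orthogonal_subgroup :: "(real^'n^'n) set \<Rightarrow> bool" where
  "orthogonal_subgroup G \<longleftrightarrow>
     G \<subseteq> {g. orthogonal_matrix g} \<and> mat 1 \<in> G \<and>
     (\<forall>g\<in>G. \<forall>h\<in>G. g ** h \<in> G) \<and> (\<forall>g\<in>G. matrix_inv g \<in> G)"

definition ST_invariant :: "(real^'n^'n) set \<Rightarrow> bool" where
  "ST_invariant F \<longleftrightarrow>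
     (\<exists>G. orthogonal_subgroup G \<and>
          (\<forall>x\<in>sphere 0 1. \<forall>y\<in>sphere 0 1. \<exists>g\<in>G. g *v x = y) \<and>
          (\<forall>g\<in>G. \<forall>A\<in>F. g ** A ** transpose g \<in> F))"


section \<open>Riesz characteristic and Riesz kernel\<close>

definition line_proj :: "real^'n \<Rightarrow> real^'n^'n" where
  "line_proj e = (\<chi> i j. e $ i * e $ j)"

text \<open>The Riesz characteristic is computed from a given unit vector \<open>e\<close>; for ST-invariant \<open>F\<close>
  it does not depend on \<open>e\<close>. The supremum is taken in the extended reals, so that it may be infinite.\<close>

definition riesz_characteristic :: "(real^'n^'n) set \<Rightarrow> real^'n \<Rightarrow> ereal" where
  "riesz_characteristic F e =
     (SUP q \<in> {q::real. (mat 1 - line_proj e) - (q - 1) *\<^sub>R line_proj e \<in> F}. ereal q)"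

definition riesz_kernel :: "real \<Rightarrow> real \<Rightarrow> real" where
  "riesz_kernel p t =
     (if p < 2 then t powr (2 - p) else if p = 2 then ln t else - (t powr (2 - p)))"


section \<open>\<open>F\<close>-subharmonic functions\<close>

text \<open>\<open>\<phi>\<close> is of class \<open>C\<^sup>2\<close> on the open set \<open>N\<close>, with gradient \<open>D\<close> and Hessian \<open>H\<close>.\<close>

definition C2_with :: "(real^'n) set \<Rightarrow> (real^'n \<Rightarrow> real) \<Rightarrow> (real^'n \<Rightarrow> real^'n) \<Rightarrow>
    (real^'n \<Rightarrow> real^'n^'n) \<Rightarrow> bool" where
  "C2_with N \<phi> D H \<longleftrightarrow>
     open N \<and>
     (\<forall>x\<in>N. (\<phi> has_derivative (\<lambda>h. D x \<bullet> h)) (at x)) \<and>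
     (\<forall>x\<in>N. (D has_derivative (\<lambda>h. H x *v h)) (at x)) \<and>
     continuous_on N H"

text \<open>Values of \<open>u\<close> outside \<open>X\<close> are irrelevant.\<close>

definition F_subharmonic ::
    "(real^'n^'n) set \<Rightarrow> (real^'n) set \<Rightarrow> (real^'n \<Rightarrow> ereal) \<Rightarrow> bool" where
  "F_subharmonic F X u \<longleftrightarrow>
     (\<forall>x\<in>X. u x < \<infinity>) \<and>
     (\<forall>x\<in>X. \<forall>c. u x < c \<longrightarrow> eventually (\<lambda>y. u y < c) (at x within X)) \<and>
     (\<forall>C\<in>components X. \<exists>x\<in>C. u x \<noteq> - \<infinity>) \<and>
     (\<forall>x\<^sub>0\<in>X. \<forall>N \<phi> D H.
        x\<^sub>0 \<in> N \<and> C2_with N \<phi> D H \<and>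
        eventually (\<lambda>x. u x \<le> ereal (\<phi> x)) (nhds x\<^sub>0) \<and> u x\<^sub>0 = ereal (\<phi> x\<^sub>0)
        \<longrightarrow> H x\<^sub>0 \<in> F)"


section \<open>Averages\<close>

text \<open>Surface measure \<open>\<sigma>\<close> on the unit sphere, in the polar coordinates normalisation
  \<open>\<sigma> A = n \<sqdot> vol {t a | 0 < t \<le> 1, a \<in> A}\<close>; see \<open>emeasure_sphere_measure\<close> below. Here
  \<open>sgn x = x / |x|\<close> is the radial projection.\<close>

definition sphere_measure :: "(real^'n) measure" where
  "sphere_measure = scale_measure (of_nat CARD('n))
     (distr (restrict_space lborel (cball 0 1 - {0})) (restrict_space borel (sphere 0 1)) sgn)"

text \<open>\<open>average M f\<close> is \<open>1/|M| \<integral> f dM\<close> for extended real valued \<open>f\<close>, the integral being that of the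
  positive part minus that of the negative part. It is a finite number only if both are finite,
  since \<open>\<infinity> - \<infinity> = \<infinity>\<close> in \<^typ>\<open>ereal\<close>.\<close>

definition average :: "'a measure \<Rightarrow> ('a \<Rightarrow> ereal) \<Rightarrow> ereal" where
  "average M f =
     (enn2ereal (\<integral>\<^sup>+x. e2ennreal (f x) \<partial>M) - enn2ereal (\<integral>\<^sup>+x. e2ennreal (- f x) \<partial>M))
       / enn2ereal (emeasure M (space M))"

definition avg_M :: "(real^'n \<Rightarrow> ereal) \<Rightarrow> real \<Rightarrow> ereal" where
  "avg_M u r = (SUP x\<in>cball 0 r. u x)"

definition avg_S :: "(real^'n \<Rightarrow> ereal) \<Rightarrow> real \<Rightarrow> ereal" where
  "avg_S u r = average sphere_measure (\<lambda>\<sigma>. u (r *\<^sub>R \<sigma>))"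

definition avg_V :: "(real^'n \<Rightarrow> ereal) \<Rightarrow> real \<Rightarrow> ereal" where
  "avg_V u r = average (lebesgue_on (cball 0 1)) (\<lambda>x. u (r *\<^sub>R x))"


section \<open>Densities and tangents at the origin\<close>

text \<open>The limit over pairs \<open>0 < s < r\<close> as \<open>r\<close> (hence also \<open>s\<close>) tends to \<open>0\<close>, required to exist
  and to be finite.\<close>

definition has_density_at_0 ::
    "real \<Rightarrow> ((real^'n \<Rightarrow> ereal) \<Rightarrow> real \<Rightarrow> ereal) \<Rightarrow> (real^'n \<Rightarrow> ereal) \<Rightarrow> real \<Rightarrow> bool" where
  "has_density_at_0 p \<Psi> u \<theta> \<longleftrightarrow>
     ((\<lambda>(s, r). (\<Psi> u r - \<Psi> u s) / ereal (riesz_kernel p r - riesz_kernel p s))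
        \<longlongrightarrow> ereal \<theta>) (at (0, 0) within {(s, r). 0 < s \<and> s < r})"

definition density_at_0 ::
    "real \<Rightarrow> ((real^'n \<Rightarrow> ereal) \<Rightarrow> real \<Rightarrow> ereal) \<Rightarrow> (real^'n \<Rightarrow> ereal) \<Rightarrow> real" where
  "density_at_0 p \<Psi> u = (THE \<theta>. has_density_at_0 p \<Psi> u \<theta>)"

definition flow :: "real \<Rightarrow> (real^'n \<Rightarrow> ereal) \<Rightarrow> real \<Rightarrow> real^'n \<Rightarrow> ereal" where
  "flow p u r x =
     (if p > 2 then ereal (r powr (p - 2)) * u (r *\<^sub>R x)
      else if p = 2 then u (r *\<^sub>R x) - avg_M u r
      else ereal (r powr (p - 2)) * (u (r *\<^sub>R x) - u 0))"

definition L1_loc :: "(real^'n \<Rightarrow> real) \<Rightarrow> bool" where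
  "L1_loc f \<longleftrightarrow> (\<forall>C. compact C \<longrightarrow> f absolutely_integrable_on C)"

text \<open>Convergence in \<open>L\<^sup>1\<^sub>l\<^sub>o\<^sub>c\<close> is stated through \<open>\<integral>\<^sub>C |g\<^sub>j - f| \<rightarrow> 0\<close>. This allows \<open>g\<^sub>j\<close> to be
  infinite on null sets, and to be meaningful on \<open>C\<close> only for large \<open>j\<close>.\<close>

definition L1_loc_convergent :: "(nat \<Rightarrow> real^'n \<Rightarrow> ereal) \<Rightarrow> (real^'n \<Rightarrow> real) \<Rightarrow> bool" where
  "L1_loc_convergent g f \<longleftrightarrow> L1_loc f \<and>
     (\<forall>C. compact C \<longrightarrow>
        (\<lambda>j. \<integral>\<^sup>+x. e2ennreal \<bar>g j x - ereal (f x)\<bar> \<partial>lebesgue_on C) \<longlonglongrightarrow> 0)"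

definition usc_representative :: "(real^'n \<Rightarrow> real) \<Rightarrow> (real^'n \<Rightarrow> ereal) \<Rightarrow> bool" where
  "usc_representative f U \<longleftrightarrow>
     (\<forall>x. ((\<lambda>r. esssup (lebesgue_on (ball x r)) (\<lambda>y. ereal (f y))) \<longlongrightarrow> U x) (at_right 0))"

definition tangent :: "real \<Rightarrow> (real^'n \<Rightarrow> ereal) \<Rightarrow> (real^'n \<Rightarrow> ereal) \<Rightarrow> bool" where
  "tangent p u U \<longleftrightarrow>
     (\<exists>(r::nat \<Rightarrow> real) Ubar.
        (\<forall>j. 0 < r j) \<and> r \<longlonglongrightarrow> 0 \<and>
        L1_loc_convergent (\<lambda>j. flow p u (r j)) Ubar \<and>
        usc_representative Ubar U)"


section \<open>Sanity checks for the surface measure\<close>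

lemma space_sphere_measure: "space (sphere_measure :: (real^'n) measure) = sphere 0 1"
  by (simp add: sphere_measure_def space_scale_measure space_restrict_space)

lemma sets_sphere_measure:
  "sets (sphere_measure :: (real^'n) measure) = sets (restrict_space borel (sphere 0 1))"
  by (simp add: sphere_measure_def)

lemma emeasure_sphere_measure:
  fixes A :: "(real^'n) set"
  assumes "A \<in> sets sphere_measure"
  shows "emeasure sphere_measure A
           = of_nat CARD('n) * emeasure lborel {x \<in> cball 0 1 - {0}. sgn x \<in> A}"
proof -
  let ?M = "restrict_space lborel (cball 0 1 - {0}) :: (real^'n) measure"
  have "sgn \<in> borel_measurable (borel :: (real^'n) measure)"
    unfolding sgn_div_norm[abs_def] by measurable
  then have *: "sgn \<in> ?M \<rightarrow>\<^sub>M restrict_space borel (sphere 0 1)"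
    by (intro measurable_restrict_space2 measurable_restrict_space1)
       (auto simp: space_restrict_space norm_sgn)
  have "{x \<in> cball 0 1 - {0}. sgn x \<in> A} = sgn -` A \<inter> space ?M"
    by (auto simp: space_restrict_space)
  then show ?thesis
    using * assms
    by (simp add: sphere_measure_def emeasure_distr emeasure_restrict_space)
qed

lemma emeasure_sphere_measure_sphere:
  "emeasure sphere_measure (sphere 0 1 :: (real^'n) set)
     = of_nat CARD('n) * emeasure lborel (cball 0 1 :: (real^'n) set)"
proof -
  have "{x \<in> cball 0 1 - {0}. sgn x \<in> sphere 0 1} = cball 0 1 - {0 :: real^'n}"
    by (auto simp: norm_sgn)
  moreover have "sphere 0 1 \<in> sets (sphere_measure :: (real^'n) measure)"
    by (metis sets.top space_sphere_measure)
  moreover have "emeasure lborel (cball 0 1 - {0 :: real^'n}) = emeasure lborel (cball 0 1 :: (real^'n) set)"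
    by (rule emeasure_Diff_null_set) (auto simp: null_sets_def)
  ultimately show ?thesis
    by (simp add: emeasure_sphere_measure)
qed

end

theory Submission
  imports Defs "HOL-Probability.Probability" "HOL-Real_Asymp.Real_Asymp"
begin

text \<open>
The averages \<open>M\<close>, \<open>S\<close> and \<open>V\<close> of \<open>u\<close> at radius \<open>r\<close> are increasing and convex as functions of the Riesz kernel \<open>K(r)\<close>.
For \<open>M\<close> this is the three spheres theorem (\<open>three_spheres\<close>): by the definition of the Riesz characteristic, the second
derivative of \<open>a K(|x|) + b\<close> leaves \<open>F\<close> after an arbitrarily small perturbation (\<open>barrier\<close>), so that these functions obey
a comparison principle with \<open>u\<close>. For \<open>S\<close> the same argument is applied to the mean of \<open>u\<close> over finitely many rotations in
\<open>G\<close>. There are such means which are almost constant on spheres (\<open>rotation_averaging\<close>), since \<open>G\<close> is transitive there, and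
they are again \<open>F\<close>-subharmonic (\<open>viscosity_orbit_mean\<close>), since \<open>F\<close> is convex and invariant. Finally, \<open>V\<close> is a mean of
\<open>S\<close> over smaller radii.

The slopes of a convex function of \<open>K\<close> decrease to a limit \<open>\<Theta>\<close>, the density. Along the tangential flow the
rescaled averages therefore converge to \<open>\<Theta> K\<close>, up to an additive constant when \<open>p = 2\<close> (\<open>slope_limit_flow\<close>, \<open>slope_limit_log\<close>).
It remains to see that averages pass to the limit, although the flow converges only in \<open>L\<^sup>1\<^sub>l\<^sub>o\<^sub>c\<close>. One inequality is a
Hartogs lemma, \<open>limsup g\<^sub>j \<le> U\<close>, together with Fatou's lemma (\<open>hartogs\<close>, \<open>average_lower\<close>). For the other one,
\<open>U\<close> lies below its means over small balls (\<open>U_le_A\<close>), which are limits of the means of \<open>g\<^sub>j\<close>; averaging over a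
sphere of radius \<open>t\<close> gives a mean of \<open>g\<^sub>j\<close> for a rotationally invariant law on the ball of radius \<open>t + \<rho>\<close>, and hence at
most its spherical average there (\<open>sphere_average_upper\<close>). As the limits are continuous in \<open>t\<close>, one can let \<open>\<rho>\<close> tend to 0.

When \<open>p = 2\<close>, a Harnack estimate (\<open>M_minus_V_bound\<close>) bounds \<open>M - V\<close>. Hence the three densities agree, and the
additive constants exist along a subsequence, which has the same tangent.

All this rests on mean value inequalities. Matrices in \<open>F\<close> have nonnegative trace (\<open>trace_nonneg\<close>), so \<open>u\<close> is subharmonic
in the classical sense; after a linear change of variables the same holds for every operator \<open>(A A\<^sup>t) \<bullet> D\<^sup>2\<close> that is nonnegative
on \<open>F\<close>, and these operators together determine \<open>F\<close> (\<open>separation\<close>).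
\<close>

section \<open>Averages of functions bounded above\<close>

lemma average_prob:
  assumes "prob_space P"
  shows "average P f = enn2ereal (\<integral>\<^sup>+x. e2ennreal (f x) \<partial>P) - enn2ereal (\<integral>\<^sup>+x. e2ennreal (- f x) \<partial>P)"
  using assms by (simp add: average_def prob_space.emeasure_space_1 divide_ereal_def one_ennreal.rep_eq)

lemma average_mono_AE:
  assumes "prob_space P" "AE x in P. f x \<le> g x"
  shows "average P f \<le> average P g"
proof -
  have "(\<integral>\<^sup>+x. e2ennreal (f x) \<partial>P) \<le> (\<integral>\<^sup>+x. e2ennreal (g x) \<partial>P)"
    using assms(2) by (intro nn_integral_mono_AE) (auto elim!: eventually_mono intro: e2ennreal_mono)
  moreover have "(\<integral>\<^sup>+x. e2ennreal (- g x) \<partial>P) \<le> (\<integral>\<^sup>+x. e2ennreal (- f x) \<partial>P)"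
    using assms(2) by (intro nn_integral_mono_AE) (auto elim!: eventually_mono intro: e2ennreal_mono)
  ultimately show ?thesis
    unfolding average_prob[OF assms(1)] by (intro ereal_minus_mono) (auto simp: less_eq_ennreal.rep_eq)
qed

lemma average_cong_AE:
  assumes "prob_space P" "AE x in P. f x = g x"
  shows "average P f = average P g"
  by (intro antisym average_mono_AE[OF assms(1)]; use assms(2) in \<open>auto elim: eventually_mono\<close>)

text \<open>The deficit \<open>c - f\<close> is nonnegative, so statements on averages of functions bounded above reduce to nonnegative integrals.\<close>

lemma average_deficit:
  fixes c :: real
  assumes P: "prob_space P" and f[measurable]: "f \<in> borel_measurable P" and c: "AE x in P. f x \<le> ereal c"
  shows "average P f = ereal c - enn2ereal (\<integral>\<^sup>+x. e2ennreal (ereal c - f x) \<partial>P)"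
proof -
  interpret prob_space P by fact
  let ?A = "\<integral>\<^sup>+x. e2ennreal (f x) \<partial>P" and ?B = "\<integral>\<^sup>+x. e2ennreal (- f x) \<partial>P"
  let ?D = "\<integral>\<^sup>+x. e2ennreal (ereal c - f x) \<partial>P"
  have "(\<integral>\<^sup>+x. e2ennreal (f x) + e2ennreal (ereal c - f x) + ennreal (- c) \<partial>P)
     = (\<integral>\<^sup>+x. e2ennreal (- f x) + ennreal c \<partial>P)"
  proof (rule nn_integral_cong_AE, use c in eventually_elim)
    case (elim x)
    then show ?case
      apply (cases "f x")
        apply (auto simp: ennreal.abs_eq[symmetric] simp flip: ennreal_def)
      subgoal for r
        by (cases "r \<ge> 0"; cases "c \<ge> 0") (auto simp: ennreal_neg simp flip: ennreal_plus)
      done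
  qed
  then have eq: "?A + ?D + ennreal (- c) = ?B + ennreal c"
    by (simp add: nn_integral_add emeasure_space_1)
  have "?A \<le> (\<integral>\<^sup>+x. ennreal c \<partial>P)"
    using c by (intro nn_integral_mono_AE) (auto elim!: eventually_mono simp: ennreal_def intro!: e2ennreal_mono le_max_iff_disj[THEN iffD2])
  also have "\<dots> < \<infinity>" by (simp add: emeasure_space_1)
  finally have A: "?A < \<infinity>" .
  show ?thesis
    unfolding average_prob[OF P]
    using eq A
    apply (cases ?A; cases ?B; cases ?D)
    apply (simp_all add: enn2ereal_ennreal ennreal_neg)
       apply (cases "c \<ge> 0"; simp add: ennreal_neg flip: ennreal_plus)
     apply (metis ennreal_add_eq_top ennreal_neq_top top_neq_ennreal)+
    done
qed

lemma average_real:
  assumes "prob_space P" "integrable P g"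
  shows "average P (\<lambda>x. ereal (g x)) = ereal (\<integral>x. g x \<partial>P)"
proof -
  have "(\<integral>\<^sup>+x. ennreal (g x) \<partial>P) < \<infinity>" "(\<integral>\<^sup>+x. ennreal (- g x) \<partial>P) < \<infinity>"
    using assms(2) by (simp_all add: real_integrable_def less_top)
  then show ?thesis
    unfolding average_prob[OF assms(1)] real_lebesgue_integral_def[OF assms(2)]
    by (cases "\<integral>\<^sup>+x. ennreal (g x) \<partial>P"; cases "\<integral>\<^sup>+x. ennreal (- g x) \<partial>P")
       (simp_all add: enn2ereal_ennreal flip: ennreal_def)
qed

lemma average_cases:
  fixes c :: real
  assumes P: "prob_space P" and f[measurable]: "f \<in> borel_measurable P" and c: "AE x in P. f x \<le> ereal c"
  obtains "average P f = -\<infinity>"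
  | "AE x in P. \<bar>f x\<bar> \<noteq> \<infinity>" "integrable P (\<lambda>x. real_of_ereal (f x))"
    "average P f = ereal (\<integral>x. real_of_ereal (f x) \<partial>P)"
proof (cases "(\<integral>\<^sup>+x. e2ennreal (ereal c - f x) \<partial>P) = \<infinity>")
  case True
  then show ?thesis using that(1) average_deficit[OF assms] by simp
next
  case False
  interpret prob_space P by fact
  have "AE x in P. e2ennreal (ereal c - f x) \<noteq> \<infinity>"
    using False by (intro nn_integral_noteq_infinite) auto
  with c have fin: "AE x in P. \<bar>f x\<bar> \<noteq> \<infinity>"
  proof eventually_elim
    case (elim x)
    then show ?case by (cases "f x") auto
  qed
  have "(\<integral>\<^sup>+x. ennreal (c - real_of_ereal (f x)) \<partial>P) = (\<integral>\<^sup>+x. e2ennreal (ereal c - f x) \<partial>P)"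
    using fin by (intro nn_integral_cong_AE) (auto elim!: eventually_mono simp: ennreal_def)
  moreover have "AE x in P. 0 \<le> c - real_of_ereal (f x)"
    using fin c by eventually_elim (metis diff_ge_0_iff_ge ereal_less_eq(3) ereal_real)
  ultimately have "integrable P (\<lambda>x. c - real_of_ereal (f x))"
    using False by (intro integrableI_nonneg) (auto simp: less_top)
  then have int: "integrable P (\<lambda>x. real_of_ereal (f x))"
    using Bochner_Integration.integrable_diff[OF integrable_const[of c]] by fastforce
  have "average P f = average P (\<lambda>x. ereal (real_of_ereal (f x)))"
    using fin by (intro average_cong_AE[OF P]) (auto elim!: eventually_mono simp: ereal_real)
  then show ?thesis using that(2)[OF fin int] average_real[OF P int] by simp
qed

lemma average_distr:
  assumes P: "prob_space P" and T[measurable]: "T \<in> P \<rightarrow>\<^sub>M M" and f[measurable]: "f \<in> borel_measurable M"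
  shows "average (distr P M T) f = average P (\<lambda>x. f (T x))"
  by (simp add: average_prob P prob_space.prob_space_distr nn_integral_distr)

lemma average_iterated:
  fixes c :: real
  assumes P: "prob_space P" and Q: "prob_space Q"
    and h[measurable]: "h \<in> borel_measurable (P \<Otimes>\<^sub>M Q)" and c: "\<And>x y. h (x, y) \<le> ereal c"
  shows "average P (\<lambda>x. average Q (\<lambda>y. h (x, y))) = average (P \<Otimes>\<^sub>M Q) h"
proof -
  interpret Q: prob_space Q by fact
  have PQ: "prob_space (P \<Otimes>\<^sub>M Q)"
    using P Q by (simp add: prob_space_pair)
  let ?D = "\<lambda>x. \<integral>\<^sup>+y. e2ennreal (ereal c - h (x, y)) \<partial>Q"
  have inner: "average Q (\<lambda>y. h (x, y)) = ereal c - enn2ereal (?D x)" if "x \<in> space P" for x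
    using that by (intro average_deficit[OF Q]) (auto simp: c)
  have D[measurable]: "?D \<in> borel_measurable P" by measurable
  have "average P (\<lambda>x. average Q (\<lambda>y. h (x, y))) = average P (\<lambda>x. ereal c - enn2ereal (?D x))"
    by (rule average_cong_AE[OF P]) (simp add: inner)
  also have "\<dots> = ereal c - enn2ereal (\<integral>\<^sup>+x. e2ennreal (ereal c - (ereal c - enn2ereal (?D x))) \<partial>P)"
    by (rule average_deficit[OF P]) (auto intro!: AE_I2 simp: ereal_diff_le_self)
  also have "(\<integral>\<^sup>+x. e2ennreal (ereal c - (ereal c - enn2ereal (?D x))) \<partial>P) = (\<integral>\<^sup>+x. ?D x \<partial>P)"
  proof (rule nn_integral_cong)
    fix x
    show "e2ennreal (ereal c - (ereal c - enn2ereal (?D x))) = ?D x"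
      by (cases "?D x") (auto simp: enn2ereal_ennreal simp flip: ennreal_def)
  qed
  also have "(\<integral>\<^sup>+x. ?D x \<partial>P) = (\<integral>\<^sup>+z. e2ennreal (ereal c - h z) \<partial>(P \<Otimes>\<^sub>M Q))"
    by (rule Q.nn_integral_fst) measurable
  also have "ereal c - enn2ereal \<dots> = average (P \<Otimes>\<^sub>M Q) h"
    by (rule average_deficit[OF PQ, symmetric]) (auto intro!: AE_I2 simp: c split: prod.splits)
  finally show ?thesis .
qed

text \<open>Fatou's lemma for the deficits.\<close>

lemma average_limsup:
  fixes c :: real
  assumes P: "prob_space P" and f[measurable]: "\<And>j. f j \<in> borel_measurable P" and U[measurable]: "U \<in> borel_measurable P"
    and c: "\<And>j x. x \<in> space P \<Longrightarrow> f j x \<le> ereal c" and Uc: "AE x in P. U x \<le> ereal c"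
    and lim: "AE x in P. limsup (\<lambda>j. f j x) \<le> U x"
  shows "limsup (\<lambda>j. average P (f j)) \<le> average P U"
proof -
  let ?D = "\<lambda>g. \<integral>\<^sup>+x. e2ennreal (ereal c - g x) \<partial>P"
  have "?D U \<le> (\<integral>\<^sup>+x. liminf (\<lambda>j. e2ennreal (ereal c - f j x)) \<partial>P)"
  proof (rule nn_integral_mono_AE, use lim Uc in eventually_elim)
    case (elim x)
    have "e2ennreal (ereal c - U x) \<le> e2ennreal (ereal c - limsup (\<lambda>j. f j x))"
      by (intro e2ennreal_mono ereal_minus_mono elim order_refl)
    also have "\<dots> = e2ennreal (liminf (\<lambda>j. ereal c - f j x))"
      by (subst liminf_ereal_cminus) auto
    also have "\<dots> = liminf (\<lambda>j. e2ennreal (ereal c - f j x))"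
      by (rule Liminf_compose_continuous_mono[symmetric])
         (auto intro!: continuous_on_e2ennreal e2ennreal_mono simp: mono_def)
    finally show ?case .
  qed
  also have "\<dots> \<le> liminf (\<lambda>j. ?D (f j))"
    by (rule nn_integral_liminf) measurable
  finally have D: "?D U \<le> liminf (\<lambda>j. ?D (f j))" .
  have "limsup (\<lambda>j. average P (f j)) = limsup (\<lambda>j. ereal c - enn2ereal (?D (f j)))"
    by (intro arg_cong[where f=limsup] ext average_deficit[OF P f]) (auto simp: c)
  also have "\<dots> = ereal c - liminf (\<lambda>j. enn2ereal (?D (f j)))"
    by (simp add: minus_ereal_def Limsup_add_ereal_left ereal_Limsup_uminus)
  also have "liminf (\<lambda>j. enn2ereal (?D (f j))) = enn2ereal (liminf (\<lambda>j. ?D (f j)))"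
    by (rule Liminf_compose_continuous_mono) (auto intro!: continuous_on_enn2ereal simp: mono_def less_eq_ennreal.rep_eq)
  also have "ereal c - enn2ereal (liminf (\<lambda>j. ?D (f j))) \<le> ereal c - enn2ereal (?D U)"
    using D by (intro ereal_minus_mono order_refl) (simp add: less_eq_ennreal.rep_eq)
  also have "\<dots> = average P U"
    by (rule average_deficit[OF P U Uc, symmetric])
  finally show ?thesis .
qed

section \<open>The uniform distribution on the unit ball\<close>

text \<open>The direction \<open>sgn x\<close> of a point with this distribution is uniform on the sphere, so that spherical averages and
  ball averages are expectations on one probability space.\<close>

definition ball_prob :: "(real^'n) measure" where
  "ball_prob = uniform_measure lborel (cball 0 1)"

lemma unit_ball_emeasure:
  "emeasure lborel (cball (0::real^'n) 1) \<noteq> 0" "emeasure lborel (cball (0::real^'n) 1) \<noteq> \<infinity>"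
proof -
  have "emeasure lborel (ball (0::real^'n) 1) \<le> emeasure lborel (cball (0::real^'n) 1)"
    by (intro emeasure_mono) auto
  moreover have "emeasure lborel (ball (0::real^'n) 1) \<noteq> 0"
    using open_not_negligible[of "ball (0::real^'n) 1"]
    by (auto simp: negligible_iff_null_sets null_sets_def)
  ultimately show "emeasure lborel (cball (0::real^'n) 1) \<noteq> 0" by auto
  show "emeasure lborel (cball (0::real^'n) 1) \<noteq> \<infinity>"
    using emeasure_bounded_finite[of "cball (0::real^'n) 1"] by auto
qed

lemma prob_space_ball_prob: "prob_space (ball_prob :: (real^'n) measure)"
  unfolding ball_prob_def using unit_ball_emeasure[where 'n='n] by (intro prob_space_uniform_measure) auto

lemma sets_ball_prob[measurable_cong, simp]: "sets (ball_prob :: (real^'n) measure) = sets borel"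
  by (simp add: ball_prob_def)

lemma space_ball_prob[simp]: "space (ball_prob :: (real^'n) measure) = UNIV"
  by (simp add: ball_prob_def)

lemma nn_integral_ball_prob:
  fixes f :: "real^'n \<Rightarrow> ennreal"
  assumes [measurable]: "f \<in> borel_measurable borel"
  shows "(\<integral>\<^sup>+x. f x \<partial>ball_prob) = (\<integral>\<^sup>+x. f x * indicator (cball 0 1) x \<partial>lborel) / emeasure lborel (cball (0::real^'n) 1)"
  unfolding ball_prob_def by (rule nn_integral_uniform_measure) auto

lemma AE_ball_prob: "AE x in (ball_prob :: (real^'n) measure). x \<noteq> 0 \<and> norm x \<le> 1 \<and> norm (sgn x) = 1"
proof -
  have "AE x in lborel. x \<noteq> (0::real^'n)"
    by (rule AE_lborel_singleton)
  then show ?thesis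
    unfolding ball_prob_def by (intro AE_uniform_measureI) (auto elim!: eventually_mono simp: norm_sgn)
qed

lemma borel_measurable_sgn_vec[measurable]: "sgn \<in> borel_measurable (borel :: (real^'n) measure)"
  unfolding sgn_div_norm[abs_def] by measurable

lemma norm_orthogonal_matrix:
  fixes g :: "real^'n^'n"
  assumes "orthogonal_matrix g" shows "norm (g *v x) = norm x"
  using orthogonal_transformation_norm[of "(*v) g" x] assms by (simp add: orthogonal_transformation_matrix)

text \<open>An orthogonal image of Lebesgue measure is translation invariant, and hence a multiple of
  Lebesgue measure: this is the uniqueness proof for Haar measure, comparing both iterated integrals of
  \<open>(x, y) \<mapsto> 1\<^sub>A x 1\<^sub>B (x - y)\<close>. Taking for \<open>B\<close> the invariant unit ball shows that the factor is 1.\<close>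

lemma distr_lborel_orthogonal:
  fixes g :: "real^'n^'n"
  assumes g: "orthogonal_matrix g"
  shows "distr lborel borel (\<lambda>x. g *v x) = lborel"
proof (rule measure_eqI)
  define \<mu> where "\<mu> = distr lborel borel (\<lambda>x. g *v x)"
  have gm[measurable]: "(\<lambda>x. g *v x) \<in> borel \<rightarrow>\<^sub>M borel"
    by (intro borel_measurable_continuous_onI continuous_intros)
  have gt: "g *v (transpose g *v x) = x" "transpose g *v (g *v x) = x" for x
    using g by (simp_all add: matrix_vector_mul_assoc orthogonal_matrix_def del: transpose_matrix_vector)
  have sets[simp, measurable_cong]: "sets \<mu> = sets borel" by (simp add: \<mu>_def)
  have lt: "(\<integral>\<^sup>+x. f (t + x) \<partial>lborel) = (\<integral>\<^sup>+x. f x \<partial>lborel)"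
    if [measurable]: "f \<in> borel_measurable borel" for f and t :: "real^'n"
    by (subst (2) lborel_distr_plus[of t, symmetric]) (simp add: nn_integral_distr)
  have mt: "(\<integral>\<^sup>+x. f (t + x) \<partial>\<mu>) = (\<integral>\<^sup>+x. f x \<partial>\<mu>)"
    if [measurable]: "f \<in> borel_measurable borel" for f and t :: "real^'n"
  proof -
    have "(\<integral>\<^sup>+x. f (t + x) \<partial>\<mu>) = (\<integral>\<^sup>+x. f (g *v (transpose g *v t + x)) \<partial>lborel)"
      unfolding \<mu>_def by (subst nn_integral_distr) (simp_all add: matrix_vector_right_distrib gt del: transpose_matrix_vector)
    also have "\<dots> = (\<integral>\<^sup>+x. f (g *v x) \<partial>lborel)"
      by (rule lt) measurable
    finally show ?thesis by (simp add: \<mu>_def nn_integral_distr)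
  qed
  have \<mu>B: "emeasure \<mu> (cball 0 1) = emeasure lborel (cball (0::real^'n) 1)"
  proof -
    have "(\<lambda>x. g *v x) -` cball 0 1 = cball 0 1"
      by (auto simp: norm_orthogonal_matrix[OF g])
    then show ?thesis by (simp add: \<mu>_def emeasure_distr)
  qed
  interpret L: sigma_finite_measure "lborel :: (real^'n) measure" by (rule sigma_finite_lborel)
  have sf: "sigma_finite_measure \<mu>"
  proof
    let ?C = "range (\<lambda>k::nat. cball (0::real^'n) (real k))"
    have "emeasure \<mu> (cball 0 (real k)) = emeasure lborel (cball (0::real^'n) (real k))" for k
    proof -
      have "(\<lambda>x. g *v x) -` cball 0 (real k) = cball 0 (real k)"
        by (auto simp: norm_orthogonal_matrix[OF g])
      then show ?thesis by (simp add: \<mu>_def emeasure_distr)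
    qed
    moreover have "emeasure lborel (cball (0::real^'n) (real k)) \<noteq> \<top>" for k
      using emeasure_bounded_finite[of "cball (0::real^'n) (real k)"] by auto
    moreover have "\<Union>?C = UNIV"
      using real_arch_simple by (auto simp: Bex_def)
    ultimately show "\<exists>A. countable A \<and> A \<subseteq> sets \<mu> \<and> \<Union>A = space \<mu> \<and> (\<forall>a\<in>A. emeasure \<mu> a \<noteq> \<infinity>)"
      by (intro exI[of _ ?C]) (auto simp: \<mu>_def)
  qed
  interpret M: sigma_finite_measure \<mu> by (rule sf)
  interpret LM: pair_sigma_finite "lborel :: (real^'n) measure" \<mu> ..
  fix A assume "A \<in> sets (distr lborel borel (\<lambda>x. g *v x))"
  then have A[measurable]: "A \<in> sets borel" by simp
  let ?B = "cball (0::real^'n) 1"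
  have [measurable]: "?B \<in> sets borel" by simp
  let ?a = "indicator A :: real^'n \<Rightarrow> ennreal" and ?b = "indicator ?B :: real^'n \<Rightarrow> ennreal"
  have sym: "?b (x - y) = ?b (y - x)" for x y by (simp add: indicator_def norm_minus_commute)
  have "emeasure lborel A * emeasure \<mu> ?B = (\<integral>\<^sup>+x. ?a x * (\<integral>\<^sup>+y. ?b y \<partial>\<mu>) \<partial>lborel)"
    by (simp add: nn_integral_multc)
  also have "\<dots> = (\<integral>\<^sup>+x. ?a x * (\<integral>\<^sup>+y. ?b (- x + y) \<partial>\<mu>) \<partial>lborel)"
    by (simp only: mt[of ?b] borel_measurable_indicator[OF \<open>?B \<in> sets borel\<close>])
  also have "\<dots> = (\<integral>\<^sup>+x. \<integral>\<^sup>+y. ?a x * ?b (x - y) \<partial>\<mu> \<partial>lborel)"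
    by (simp add: nn_integral_cmult sym)
  also have "\<dots> = (\<integral>\<^sup>+y. \<integral>\<^sup>+x. ?a x * ?b (x - y) \<partial>lborel \<partial>\<mu>)"
    by (rule LM.Fubini'[symmetric]) measurable
  also have "\<dots> = (\<integral>\<^sup>+y. \<integral>\<^sup>+z. ?a (y + z) * ?b z \<partial>lborel \<partial>\<mu>)"
  proof (rule nn_integral_cong)
    fix y
    show "(\<integral>\<^sup>+x. ?a x * ?b (x - y) \<partial>lborel) = (\<integral>\<^sup>+z. ?a (y + z) * ?b z \<partial>lborel)"
      using lt[of "\<lambda>x. ?a x * ?b (x - y)" y] by simp
  qed
  also have "\<dots> = (\<integral>\<^sup>+z. \<integral>\<^sup>+y. ?a (y + z) * ?b z \<partial>\<mu> \<partial>lborel)"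
    by (rule LM.Fubini') measurable
  also have "\<dots> = (\<integral>\<^sup>+z. (\<integral>\<^sup>+y. ?a y \<partial>\<mu>) * ?b z \<partial>lborel)"
    using mt[of ?a] by (simp add: nn_integral_multc add.commute)
  also have "\<dots> = emeasure \<mu> A * emeasure lborel ?B"
    by (simp add: nn_integral_cmult)
  finally have "emeasure lborel A * emeasure lborel ?B = emeasure \<mu> A * emeasure lborel ?B"
    by (simp add: \<mu>B)
  then have "emeasure lborel A = emeasure \<mu> A"
    using unit_ball_emeasure[where 'n='n] by (auto simp: ennreal_mult_cancel_left mult.commute[of _ "emeasure lborel (cball 0 1)"])
  then show "emeasure (distr lborel borel (\<lambda>x. g *v x)) A = emeasure lborel A" by (simp add: \<mu>_def)
qed simp

lemma distr_ball_prob_orthogonal: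
  fixes g :: "real^'n^'n"
  assumes g: "orthogonal_matrix g"
  shows "distr ball_prob borel (\<lambda>x. g *v x) = ball_prob"
proof (rule measure_eqI)
  have [measurable]: "(\<lambda>x. g *v x) \<in> borel \<rightarrow>\<^sub>M borel"
    by (intro borel_measurable_continuous_onI continuous_intros)
  fix A :: "(real^'n) set" assume "A \<in> sets (distr ball_prob borel (\<lambda>x. g *v x))"
  then have A[measurable]: "A \<in> sets borel" by simp
  have "emeasure lborel (cball 0 1 \<inter> A) = emeasure (distr lborel borel (\<lambda>x. g *v x)) (cball 0 1 \<inter> A)"
    by (simp add: distr_lborel_orthogonal[OF g])
  also have "\<dots> = emeasure lborel ((\<lambda>x. g *v x) -` (cball 0 1 \<inter> A))"
    by (subst emeasure_distr) auto
  also have "(\<lambda>x. g *v x) -` (cball 0 1 \<inter> A) = cball 0 1 \<inter> (\<lambda>x. g *v x) -` A"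
    by (auto simp: norm_orthogonal_matrix[OF g])
  finally show "emeasure (distr ball_prob borel (\<lambda>x. g *v x)) A = emeasure ball_prob A"
    by (subst emeasure_distr) (auto simp: ball_prob_def measurable_sets_borel[OF \<open>(\<lambda>x. g *v x) \<in> borel \<rightarrow>\<^sub>M borel\<close>])
qed simp

lemma sgn_orthogonal_matrix:
  fixes g :: "real^'n^'n"
  assumes "orthogonal_matrix g" shows "sgn (g *v x) = g *v sgn x"
  by (simp add: sgn_div_norm norm_orthogonal_matrix[OF assms] matrix_vector_mult_scaleR)

lemma nn_integral_affine:
  fixes w :: "real^'n \<Rightarrow> ennreal"
  assumes [measurable]: "w \<in> borel_measurable borel" and \<rho>: "\<rho> > 0"
  shows "(\<integral>\<^sup>+z. w (x + \<rho> *\<^sub>R z) * indicator (cball 0 1) z \<partial>lborel) * ennreal (\<rho> ^ CARD('n))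
       = (\<integral>\<^sup>+y. w y * indicator (cball x \<rho>) y \<partial>lborel)"
proof -
  have eq: "indicator (cball x \<rho>) (x + \<rho> *\<^sub>R z) = (indicator (cball 0 1) z :: ennreal)" for z
    using \<rho> by (auto simp: indicator_def dist_norm mult_le_cancel_left1)
  have [measurable]: "(\<lambda>y. w y * indicator (cball x \<rho>) y) \<in> borel_measurable borel"
    by (intro borel_measurable_times_ennreal borel_measurable_indicator) auto
  have [measurable]: "(\<lambda>z. w (x + \<rho> *\<^sub>R z) * indicator (cball 0 1) z) \<in> borel_measurable borel"
    by (intro borel_measurable_times_ennreal borel_measurable_indicator) auto
  have "(\<integral>\<^sup>+y. w y * indicator (cball x \<rho>) y \<partial>lborel)
      = (\<integral>\<^sup>+z. ennreal (\<bar>\<rho>\<bar> ^ CARD('n)) * (w (x + \<rho> *\<^sub>R z) * indicator (cball x \<rho>) (x + \<rho> *\<^sub>R z)) \<partial>lborel)"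
    using \<rho>
    apply (subst lborel_affine[of \<rho> x], simp)
    apply (subst nn_integral_density, simp, simp)
    apply (subst nn_integral_distr, simp, simp)
    apply simp
    done
  then show ?thesis
    using \<rho> by (simp add: eq nn_integral_cmult mult.commute[of _ "ennreal _"])
qed

lemma nn_integral_ball_prob_affine:
  fixes w :: "real^'n \<Rightarrow> ennreal"
  assumes w[measurable]: "w \<in> borel_measurable borel" and \<rho>: "\<rho> > 0"
  shows "(\<integral>\<^sup>+z. w (x + \<rho> *\<^sub>R z) \<partial>ball_prob)
       = (\<integral>\<^sup>+y. w y * indicator (cball x \<rho>) y \<partial>lborel) / (ennreal (\<rho> ^ CARD('n)) * emeasure lborel (cball (0::real^'n) 1))"
proof -
  let ?I = "\<integral>\<^sup>+z. w (x + \<rho> *\<^sub>R z) * indicator (cball 0 1) z \<partial>lborel"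
  have *: "(\<integral>\<^sup>+z. w (x + \<rho> *\<^sub>R z) \<partial>ball_prob) = ?I / emeasure lborel (cball (0::real^'n) 1)"
    by (rule nn_integral_ball_prob) measurable
  obtain b where b: "emeasure lborel (cball (0::real^'n) 1) = ennreal b" "b > 0"
    using unit_ball_emeasure[where 'n='n] by (cases "emeasure lborel (cball (0::real^'n) 1)") (auto simp: less_le)
  have \<rho>n: "\<rho> ^ CARD('n) > 0" using \<rho> by simp
  then have e: "\<rho> ^ CARD('n) * (inverse (\<rho> ^ CARD('n)) * inverse b) = inverse b"
    by (metis less_irrefl mult.assoc mult_1 right_inverse)
  show ?thesis
    unfolding * nn_integral_affine[OF w \<rho>, of x, symmetric] b(1)
    using b(2) \<rho>n
    by (simp add: divide_ennreal_def mult.assoc inverse_ennreal e flip: ennreal_mult)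
qed

text \<open>The points with direction in a set \<open>B\<close> form a cone. By scaling, the part of this cone in the ball of radius
  \<open>t\<close> has a share of that ball which does not depend on \<open>t\<close>: the modulus and the direction are independent.\<close>

lemma distr_ball_prob_polar:
  "distr ball_prob borel (norm :: real^'n \<Rightarrow> real) \<Otimes>\<^sub>M distr ball_prob borel (sgn :: real^'n \<Rightarrow> real^'n)
     = distr ball_prob (borel \<Otimes>\<^sub>M borel) (\<lambda>x::real^'n. (norm x, sgn x))"
proof (rule pair_measure_eqI)
  interpret prob_space "ball_prob :: (real^'n) measure" by (rule prob_space_ball_prob)
  show "sigma_finite_measure (distr (ball_prob :: (real^'n) measure) borel norm)"
    by (intro prob_space_imp_sigma_finite prob_space_distr) simp
  show "sigma_finite_measure (distr (ball_prob :: (real^'n) measure) borel sgn)"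
    by (intro prob_space_imp_sigma_finite prob_space_distr) simp
  show "sets (distr ball_prob borel (norm :: real^'n \<Rightarrow> real) \<Otimes>\<^sub>M distr ball_prob borel (sgn :: real^'n \<Rightarrow> real^'n))
    = sets (distr ball_prob (borel \<Otimes>\<^sub>M borel) (\<lambda>x::real^'n. (norm x, sgn x)))"
    by (simp cong: sets_pair_measure_cong)
  fix A :: "real set" and B :: "(real^'n) set"
  assume "A \<in> sets (distr (ball_prob :: (real^'n) measure) borel norm)"
    "B \<in> sets (distr (ball_prob :: (real^'n) measure) borel sgn)"
  then have A[measurable]: "A \<in> sets borel" and B[measurable]: "B \<in> sets borel" by auto
  let ?b = "emeasure ball_prob (sgn -` B)"
  define M where "M = distr (density ball_prob (indicator (sgn -` B))) borel (norm :: real^'n \<Rightarrow> real)"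
  define N where "N = scale_measure ?b (distr ball_prob borel (norm :: real^'n \<Rightarrow> real))"
  have sB[measurable]: "sgn -` B \<in> sets borel"
    using borel_measurable_sgn_vec by (rule measurable_sets_borel) auto
  have M_eq: "emeasure M C = emeasure ball_prob {x. norm x \<in> C \<and> sgn x \<in> B}" if [measurable]: "C \<in> sets borel" for C
  proof -
    have [measurable]: "(norm -` C :: (real^'n) set) \<in> sets borel"
      using measurable_sets[of norm "borel :: (real^'n) measure" borel C] by simp
    have "emeasure M C = emeasure (density ball_prob (indicator (sgn -` B))) (norm -` C)"
      unfolding M_def by (subst emeasure_distr) auto
    also have "\<dots> = emeasure ball_prob (sgn -` B \<inter> norm -` C)"
      by (subst emeasure_density)
         (auto simp: indicator_inter_arith[symmetric] simp flip: nn_integral_indicator intro!: measurable_sets_borel)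
    finally show ?thesis by (simp add: Collect_conj_eq vimage_def Int_commute)
  qed
  have "M = N"
  proof (rule measure_eqI_lessThan)
    show "sets M = sets borel" "sets N = sets borel" by (auto simp: M_def N_def)
    fix t :: real
    show fin: "emeasure M {t<..} < \<infinity>"
      by (subst M_eq) (auto simp: less_top[symmetric])
    have N_eq: "emeasure N C = ?b * emeasure ball_prob (norm -` C :: (real^'n) set)" if "C \<in> sets borel" for C
      unfolding N_def using that by (simp add: emeasure_distr)
    have tot: "emeasure M UNIV = ?b" "emeasure N UNIV = ?b"
      using emeasure_space_1 by (simp_all add: M_eq N_eq vimage_def)
    have le: "emeasure M {..t} = emeasure N {..t}"
    proof -
      consider "t \<le> 0" | "1 \<le> t" | "0 < t" "t < 1" by linarith
      then show ?thesis
      proof cases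
        case 1
        have nz: "AE x in ball_prob. \<not> (norm (x::real^'n) \<le> t \<and> R x)" for R
          by (rule eventually_mono[OF AE_ball_prob]) (use 1 in \<open>smt (verit) norm_le_zero_iff\<close>)
        have "emeasure ball_prob {x::real^'n. norm x \<le> t} = 0"
          using emeasure_eq_0_AE[OF nz[of "\<lambda>_. True"]] by simp
        moreover have "emeasure ball_prob {x::real^'n. norm x \<le> t \<and> sgn x \<in> B} = 0"
          using emeasure_eq_0_AE[OF nz[of "\<lambda>x. sgn x \<in> B"]] by simp
        ultimately show ?thesis by (simp add: M_eq N_eq vimage_def)
      next
        case 2
        have "emeasure ball_prob {x::real^'n. norm x \<le> t} = emeasure ball_prob (UNIV :: (real^'n) set)"
          by (rule emeasure_eq_AE) (use AE_ball_prob 2 in \<open>auto elim!: eventually_mono\<close>)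
        moreover have "emeasure ball_prob {x::real^'n. norm x \<le> t \<and> sgn x \<in> B} = ?b"
          by (rule emeasure_eq_AE) (use AE_ball_prob 2 in \<open>auto elim!: eventually_mono\<close>)
        ultimately show ?thesis using emeasure_space_1 by (simp add: M_eq N_eq vimage_def)
      next
        case 3
        let ?L = "emeasure lborel (cball (0::real^'n) 1)"
        have key: "emeasure ball_prob {x. norm x \<le> t \<and> sgn x \<in> C} = ennreal (t ^ CARD('n)) * emeasure ball_prob (sgn -` C)"
          if C[measurable]: "C \<in> sets borel" for C :: "(real^'n) set"
        proof -
          have [measurable]: "sgn -` C \<in> sets borel"
            using borel_measurable_sgn_vec by (rule measurable_sets_borel) auto
          let ?w = "\<lambda>x. indicator (sgn -` C) x :: ennreal"
          have "emeasure ball_prob {x. norm x \<le> t \<and> sgn x \<in> C}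
              = emeasure lborel (cball 0 1 \<inter> {x. norm x \<le> t \<and> sgn x \<in> C}) / ?L"
            unfolding ball_prob_def by (rule emeasure_uniform_measure) (auto intro!: measurable_sets_borel)
          also have "cball 0 1 \<inter> {x. norm x \<le> t \<and> sgn x \<in> C} = sgn -` C \<inter> cball 0 t"
            using 3 by auto
          also have "emeasure lborel (sgn -` C \<inter> cball 0 t) = (\<integral>\<^sup>+y. ?w y * indicator (cball 0 t) y \<partial>lborel)"
            by (simp add: indicator_inter_arith[symmetric])
          also have "\<dots> = (\<integral>\<^sup>+z. ?w (0 + t *\<^sub>R z) * indicator (cball 0 1) z \<partial>lborel) * ennreal (t ^ CARD('n))"
            using 3 by (intro nn_integral_affine[symmetric]) auto
          also have "(\<integral>\<^sup>+z. ?w (0 + t *\<^sub>R z) * indicator (cball 0 1) z \<partial>lborel)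
              = (\<integral>\<^sup>+z. ?w z * indicator (cball 0 1) z \<partial>lborel)"
            using 3 by (intro nn_integral_cong) (simp add: indicator_def sgn_scaleR)
          also have "\<dots> * ennreal (t ^ CARD('n)) / ?L = ennreal (t ^ CARD('n)) * ((\<integral>\<^sup>+z. ?w z * indicator (cball 0 1) z \<partial>lborel) / ?L)"
            by (simp add: divide_ennreal_def mult_ac)
          also have "(\<integral>\<^sup>+z. ?w z * indicator (cball 0 1) z \<partial>lborel) / ?L = (\<integral>\<^sup>+z. ?w z \<partial>ball_prob)"
            by (rule nn_integral_ball_prob[symmetric]) measurable
          also have "\<dots> = emeasure ball_prob (sgn -` C)"
            by simp
          finally show ?thesis .
        qed
        have "emeasure ball_prob {x::real^'n. norm x \<le> t} = ennreal (t ^ CARD('n))"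
          using key[of UNIV] emeasure_space_1 by simp
        then show ?thesis
          using key[of B] by (simp add: M_eq N_eq vimage_def mult.commute)
      qed
    qed
    have comp: "{t<..} = UNIV - {..t}" by auto
    have "emeasure M {t<..} = emeasure M UNIV - emeasure M {..t}"
      unfolding comp using fin by (intro emeasure_Diff) (auto simp: M_def M_eq[unfolded M_def])
    also have "\<dots> = emeasure N UNIV - emeasure N {..t}" using tot le by simp
    also have "\<dots> = emeasure N {t<..}"
      unfolding comp by (intro emeasure_Diff[symmetric]) (auto simp: le[symmetric] M_eq, auto simp: N_def)
    finally show "emeasure M {t<..} = emeasure N {t<..}" .
  qed
  then have "emeasure M A = emeasure N A" by simp
  moreover have "emeasure (distr ball_prob (borel \<Otimes>\<^sub>M borel) (\<lambda>x::real^'n. (norm x, sgn x))) (A \<times> B) = emeasure M A"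
    by (subst emeasure_distr) (auto simp: M_eq intro!: arg_cong[where f="emeasure _"])
  moreover have "emeasure N A = emeasure (distr ball_prob borel (norm::real^'n\<Rightarrow>real)) A * emeasure (distr ball_prob borel sgn) B"
    by (simp add: N_def emeasure_distr mult.commute)
  ultimately show "emeasure (distr ball_prob borel (norm::real^'n\<Rightarrow>real)) A * emeasure (distr ball_prob borel sgn) B
     = emeasure (distr ball_prob (borel \<Otimes>\<^sub>M borel) (\<lambda>x::real^'n. (norm x, sgn x))) (A \<times> B)"
    by simp
qed

section \<open>Averages over spheres and balls\<close>

lemma average_scaled:
  assumes P: "prob_space P" and k: "k > 0" and f: "f \<in> borel_measurable borel"
    and nn: "\<And>h. h \<in> borel_measurable borel \<Longrightarrow> (\<integral>\<^sup>+x. h x \<partial>M) = ennreal k * (\<integral>\<^sup>+x. h (T x) \<partial>P)"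
    and M: "emeasure M (space M) = ennreal k"
  shows "average M f = average P (\<lambda>x. f (T x))"
proof -
  have "average M f = (enn2ereal (ennreal k * (\<integral>\<^sup>+x. e2ennreal (f (T x)) \<partial>P))
      - enn2ereal (ennreal k * (\<integral>\<^sup>+x. e2ennreal (- f (T x)) \<partial>P))) / enn2ereal (ennreal k)"
    unfolding average_def M using f
    by (subst (1 2) nn) (auto intro!: measurable_compose[OF _ measurable_e2ennreal])
  then show ?thesis
    unfolding average_prob[OF P] using k
    apply (cases "\<integral>\<^sup>+x. e2ennreal (f (T x)) \<partial>P"; cases "\<integral>\<^sup>+x. e2ennreal (- f (T x)) \<partial>P")
       apply (simp_all add: ennreal_mult_top enn2ereal_ennreal flip: ennreal_mult)
    apply (simp_all add: diff_divide_distrib)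
    done
qed

lemma average_sphere_measure:
  fixes f f' :: "real^'n \<Rightarrow> ereal"
  assumes f'[measurable]: "f' \<in> borel_measurable borel" and eq: "\<And>x. norm x = 1 \<Longrightarrow> f x = f' x"
  shows "average sphere_measure f = average ball_prob (\<lambda>x. f' (sgn x))"
proof -
  let ?L = "emeasure lborel (cball (0::real^'n) 1)"
  obtain b where b: "?L = ennreal b" "b > 0"
    using unit_ball_emeasure[where 'n='n] by (cases ?L) (auto simp: less_le)
  let ?R = "restrict_space lborel (cball 0 1 - {0}) :: (real^'n) measure"
  have s[measurable]: "sgn \<in> ?R \<rightarrow>\<^sub>M restrict_space borel (sphere 0 1)"
    by (intro measurable_restrict_space2 measurable_restrict_space1)
       (auto simp: space_restrict_space norm_sgn)
  have "average sphere_measure f = average sphere_measure f'"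
    unfolding average_def
    by (intro arg_cong2[where f="(/)"] arg_cong2[where f="(-)"] arg_cong[where f=enn2ereal] nn_integral_cong refl)
       (auto simp: space_sphere_measure eq)
  also have "\<dots> = average ball_prob (\<lambda>x. f' (sgn x))"
  proof (rule average_scaled[OF prob_space_ball_prob])
    show "real CARD('n) * b > 0" using b by simp
    show "emeasure sphere_measure (space (sphere_measure :: (real^'n) measure)) = ennreal (real CARD('n) * b)"
      using b by (simp add: space_sphere_measure emeasure_sphere_measure_sphere ennreal_of_nat_eq_real_of_nat flip: ennreal_mult)
    fix h :: "real^'n \<Rightarrow> ennreal" assume h[measurable]: "h \<in> borel_measurable borel"
    have [measurable]: "h \<in> borel_measurable (restrict_space borel (sphere 0 1))"
      by (rule measurable_restrict_space1) fact
    have "(\<integral>\<^sup>+x. h x \<partial>sphere_measure) = of_nat CARD('n) * (\<integral>\<^sup>+x. h (sgn x) \<partial>?R)"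
      unfolding sphere_measure_def
      by (subst nn_integral_scale_measure) (simp_all add: nn_integral_distr)
    also have "(\<integral>\<^sup>+x. h (sgn x) \<partial>?R) = (\<integral>\<^sup>+x. h (sgn x) * indicator (cball 0 1 - {0}) x \<partial>lborel)"
      by (rule nn_integral_restrict_space) simp
    also have "\<dots> = (\<integral>\<^sup>+x. h (sgn x) * indicator (cball 0 1) x \<partial>lborel)"
      by (rule nn_integral_cong_AE, rule eventually_mono[OF AE_lborel_singleton[of 0]])
         (auto simp: indicator_def)
    also have "\<dots> = ennreal b * (\<integral>\<^sup>+x. h (sgn x) \<partial>ball_prob)"
      unfolding b(1)[symmetric] using b
      by (subst nn_integral_ball_prob) (auto simp: ennreal_times_divide ennreal_mult_divide_eq mult.commute[of "ennreal b"])
    finally show "(\<integral>\<^sup>+x. h x \<partial>sphere_measure) = ennreal (real CARD('n) * b) * (\<integral>\<^sup>+x. h (sgn x) \<partial>ball_prob)"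
      using b by (simp add: ennreal_mult ennreal_of_nat_eq_real_of_nat mult.assoc)
  qed fact
  finally show ?thesis .
qed

lemma average_lebesgue_ball:
  fixes f f' :: "real^'n \<Rightarrow> ereal"
  assumes f'[measurable]: "f' \<in> borel_measurable borel" and eq: "\<And>x. norm x \<le> 1 \<Longrightarrow> f x = f' x"
  shows "average (lebesgue_on (cball 0 1)) f = average ball_prob f'"
proof -
  let ?L = "emeasure lborel (cball (0::real^'n) 1)"
  obtain b where b: "?L = ennreal b" "b > 0"
    using unit_ball_emeasure[where 'n='n] by (cases ?L) (auto simp: less_le)
  have "average (lebesgue_on (cball 0 1)) f = average (lebesgue_on (cball 0 1)) f'"
    unfolding average_def
    by (intro arg_cong2[where f="(/)"] arg_cong2[where f="(-)"] arg_cong[where f=enn2ereal] nn_integral_cong refl)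
       (auto simp: space_restrict_space eq)
  also have "\<dots> = average ball_prob (\<lambda>x. f' x)"
  proof (rule average_scaled[OF prob_space_ball_prob])
    show "b > 0" using b by simp
    show "emeasure (lebesgue_on (cball 0 1)) (space (lebesgue_on (cball (0::real^'n) 1))) = ennreal b"
      using b by (simp add: emeasure_restrict_space space_restrict_space)
    fix h :: "real^'n \<Rightarrow> ennreal" assume h[measurable]: "h \<in> borel_measurable borel"
    have "(\<integral>\<^sup>+x. h x \<partial>lebesgue_on (cball 0 1)) = (\<integral>\<^sup>+x. h x * indicator (cball 0 1) x \<partial>lebesgue)"
      by (rule nn_integral_restrict_space) simp
    also have "\<dots> = (\<integral>\<^sup>+x. h x * indicator (cball 0 1) x \<partial>lborel)"
      by (rule nn_integral_completion)
    also have "\<dots> = ennreal b * (\<integral>\<^sup>+x. h x \<partial>ball_prob)"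
      unfolding b(1)[symmetric] using b
      by (subst nn_integral_ball_prob) (auto simp: ennreal_times_divide ennreal_mult_divide_eq mult.commute[of "ennreal b"])
    finally show "(\<integral>\<^sup>+x. h x \<partial>lebesgue_on (cball 0 1)) = ennreal b * (\<integral>\<^sup>+x. h x \<partial>ball_prob)" .
  qed fact
  finally show ?thesis .
qed

text \<open>Integration in polar coordinates: one point of the ball provides the modulus, an independent one the direction.\<close>

lemma average_polar:
  fixes w :: "real^'n \<Rightarrow> ereal"
  assumes w[measurable]: "w \<in> borel_measurable borel" and c: "\<And>x. w x \<le> ereal c"
  shows "average ball_prob (\<lambda>x. w (r *\<^sub>R x))
    = average ball_prob (\<lambda>y::real^'n. average ball_prob (\<lambda>x. w ((r * norm y) *\<^sub>R sgn x)))"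
proof -
  let ?N = "distr ball_prob borel (norm :: real^'n \<Rightarrow> real)" and ?S = "distr ball_prob borel (sgn :: real^'n \<Rightarrow> real^'n)"
  let ?h = "\<lambda>(t, s). w ((r * t) *\<^sub>R s)"
  note P = prob_space_ball_prob[where 'n='n]
  have m[measurable]: "?h \<in> borel_measurable (borel \<Otimes>\<^sub>M borel)" by measurable
  have N: "prob_space ?N" "prob_space ?S"
    by (intro prob_space.prob_space_distr[OF P]; simp)+
  have m2: "?h \<in> borel_measurable (?N \<Otimes>\<^sub>M ?S)"
    using m by (simp cong: measurable_cong_sets sets_pair_measure_cong)
  have "average ball_prob (\<lambda>x. w (r *\<^sub>R x)) = average ball_prob (\<lambda>x. ?h (norm x, sgn x))"
  proof (intro arg_cong[where f="average ball_prob"] ext)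
    show "w (r *\<^sub>R x) = ?h (norm x, sgn x)" for x by (cases "x = 0") (simp_all add: sgn_div_norm mult.assoc)
  qed
  also have "\<dots> = average (distr ball_prob (borel \<Otimes>\<^sub>M borel) (\<lambda>x. (norm x, sgn x))) ?h"
    by (rule average_distr[OF P, symmetric]) measurable
  also have "\<dots> = average (?N \<Otimes>\<^sub>M ?S) ?h"
    by (simp add: distr_ball_prob_polar)
  also have "\<dots> = average ?N (\<lambda>t. average ?S (\<lambda>s. ?h (t, s)))"
    by (rule average_iterated[OF N m2, where c=c, symmetric]) (simp add: c)
  also have "\<dots> = average ?N (\<lambda>t. average ball_prob (\<lambda>x. w ((r * t) *\<^sub>R sgn x)))"
    by (intro arg_cong[where f="average ?N"] ext, simp, rule average_distr[OF P]) measurable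
  also have "\<dots> = average ball_prob (\<lambda>y::real^'n. average ball_prob (\<lambda>x. w ((r * norm y) *\<^sub>R sgn x)))"
  proof (rule average_distr[OF P, of "norm :: real^'n \<Rightarrow> real" borel "\<lambda>t. average ball_prob (\<lambda>x::real^'n. w ((r * t) *\<^sub>R sgn x))"])
    have "(\<lambda>t. average ball_prob (\<lambda>x. w ((r * t) *\<^sub>R sgn x)))
      = (\<lambda>t. ereal c - enn2ereal (\<integral>\<^sup>+x. e2ennreal (ereal c - w ((r * t) *\<^sub>R sgn x)) \<partial>ball_prob))"
      by (intro ext average_deficit[OF P]) (auto simp: c)
    also have "\<dots> \<in> borel_measurable borel"
    proof -
      interpret prob_space "ball_prob :: (real^'n) measure" by (rule P)
      show ?thesis by measurable
    qed
    finally show "(\<lambda>t. average ball_prob (\<lambda>x. w ((r * t) *\<^sub>R sgn x))) \<in> borel_measurable borel" .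
  qed simp
  finally show ?thesis .
qed

section \<open>Means over finite sets of rotations\<close>

text \<open>The rotations form a list and not a set, as the products of two families of rotations are counted with multiplicity.\<close>

definition orbit_mean :: "(real^'n^'n) list \<Rightarrow> (real^'n \<Rightarrow> ereal) \<Rightarrow> real^'n \<Rightarrow> ereal" where
  "orbit_mean gs u x = (\<Sum>g\<leftarrow>gs. u (g *v x)) / ereal (real (length gs))"

definition orbit_mean_real :: "(real^'n^'n) list \<Rightarrow> (real^'n \<Rightarrow> real) \<Rightarrow> real^'n \<Rightarrow> real" where
  "orbit_mean_real gs f x = (\<Sum>g\<leftarrow>gs. f (g *v x)) / real (length gs)"

lemma orbit_mean_eq_real:
  assumes "gs \<noteq> []" "\<And>g. g \<in> set gs \<Longrightarrow> u (g *v x) = ereal (f (g *v x))"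
  shows "orbit_mean gs u x = ereal (orbit_mean_real gs f x)"
proof -
  have "(\<Sum>g\<leftarrow>gs. u (g *v x)) = ereal (\<Sum>g\<leftarrow>gs. f (g *v x))"
    using assms(2) by (induction gs) auto
  then show ?thesis using assms(1) by (simp add: orbit_mean_def orbit_mean_real_def)
qed

lemma orbit_mean_mono:
  assumes "\<And>g. g \<in> set gs \<Longrightarrow> u (g *v x) \<le> v (g *v x)"
  shows "orbit_mean gs u x \<le> orbit_mean gs v x"
proof -
  have "(\<Sum>g\<leftarrow>gs. u (g *v x)) \<le> (\<Sum>g\<leftarrow>gs. v (g *v x))"
    using assms by (induction gs) (auto intro: add_mono)
  then show ?thesis unfolding orbit_mean_def
    by (cases "gs = []") (auto intro!: ereal_divide_right_mono)
qed

lemma orbit_mean_finite: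
  assumes "gs \<noteq> []" "\<And>g. g \<in> set gs \<Longrightarrow> u (g *v x) < \<infinity>" "orbit_mean gs u x \<noteq> -\<infinity>" "g \<in> set gs"
  shows "\<bar>u (g *v x)\<bar> \<noteq> \<infinity>"
proof -
  have ne: "(\<Sum>g\<leftarrow>gs. u (g *v x)) \<noteq> -\<infinity>"
    using assms(1,3) by (auto simp: orbit_mean_def)
  have claim: "(\<Sum>g\<leftarrow>gs. u (g *v x)) \<noteq> -\<infinity> \<Longrightarrow> \<forall>g\<in>set gs. u (g *v x) < \<infinity> \<Longrightarrow>
     (\<forall>g\<in>set gs. \<bar>u (g *v x)\<bar> \<noteq> \<infinity>) \<and> (\<Sum>g\<leftarrow>gs. u (g *v x)) < \<infinity>"
  proof (induction gs)
    case (Cons h gs)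
    then show ?case by (cases "u (h *v x)"; cases "\<Sum>g\<leftarrow>gs. u (g *v x)") auto
  qed simp
  have "\<forall>g\<in>set gs. u (g *v x) < \<infinity>" using assms(2) by blast
  then have "\<forall>g\<in>set gs. \<bar>u (g *v x)\<bar> \<noteq> \<infinity>" using claim[OF ne] by simp
  then show ?thesis using assms(4) by simp
qed

lemma orbit_mean_less_top:
  assumes "gs \<noteq> []" "\<And>g. g \<in> set gs \<Longrightarrow> u (g *v x) < \<infinity>"
  shows "orbit_mean gs u x < \<infinity>"
proof -
  have "(\<Sum>g\<leftarrow>gs. u (g *v x)) < \<infinity>" using assms(2) by (induction gs) auto
  then show ?thesis using assms(1) unfolding orbit_mean_def
    by (cases "\<Sum>g\<leftarrow>gs. u (g *v x)") auto
qed

text \<open>The average of \<open>u (g *v Y)\<close> is the same for all \<open>g\<close>, so \<open>u\<close> and its orbit mean have the same average.\<close>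

lemma average_invariant_le:
  fixes Y :: "'a \<Rightarrow> real^'n" and c c0 :: real
  assumes P: "prob_space P" and Y[measurable]: "Y \<in> P \<rightarrow>\<^sub>M borel"
    and inv: "\<And>g. g \<in> set gs \<Longrightarrow> distr P borel (\<lambda>\<omega>. g *v Y \<omega>) = distr P borel Y"
    and u[measurable]: "u \<in> borel_measurable borel" and c0: "\<And>x. u x \<le> ereal c0"
    and gs: "gs \<noteq> []" and le: "AE \<omega> in P. orbit_mean gs u (Y \<omega>) \<le> ereal c"
  shows "average P (\<lambda>\<omega>. u (Y \<omega>)) \<le> ereal c"
proof -
  interpret prob_space P by fact
  have uY: "(\<lambda>\<omega>. u (Y \<omega>)) \<in> borel_measurable P" by measurable
  show ?thesis
  proof (rule average_cases[OF P uY])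
    show "AE \<omega> in P. u (Y \<omega>) \<le> ereal c0" by (simp add: c0)
    let ?f = "\<lambda>x. real_of_ereal (u x)"
    assume fin: "AE \<omega> in P. \<bar>u (Y \<omega>)\<bar> \<noteq> \<infinity>" and int: "integrable P (\<lambda>\<omega>. ?f (Y \<omega>))"
      and av: "average P (\<lambda>\<omega>. u (Y \<omega>)) = ereal (\<integral>\<omega>. ?f (Y \<omega>) \<partial>P)"
    have gY[measurable]: "(\<lambda>\<omega>. g *v Y \<omega>) \<in> P \<rightarrow>\<^sub>M borel" for g :: "real^'n^'n"
      by (rule measurable_compose[OF Y]) (intro borel_measurable_continuous_onI continuous_intros)
    have fin': "AE \<omega> in P. \<bar>u (g *v Y \<omega>)\<bar> \<noteq> \<infinity>" if "g \<in> set gs" for g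
    proof -
      have "AE x in distr P borel Y. \<bar>u x\<bar> \<noteq> \<infinity>"
        using fin by (subst AE_distr_iff) auto
      then show ?thesis
        unfolding inv[OF that, symmetric] by (subst (asm) AE_distr_iff) auto
    qed
    have int': "integrable P (\<lambda>\<omega>. ?f (g *v Y \<omega>))" and eq': "(\<integral>\<omega>. ?f (g *v Y \<omega>) \<partial>P) = (\<integral>\<omega>. ?f (Y \<omega>) \<partial>P)"
      if "g \<in> set gs" for g
    proof -
      have "integrable (distr P borel Y) ?f" using int by (subst integrable_distr_eq) auto
      then show "integrable P (\<lambda>\<omega>. ?f (g *v Y \<omega>))"
        unfolding inv[OF that, symmetric] by (subst (asm) integrable_distr_eq) auto
      have "(\<integral>\<omega>. ?f (Y \<omega>) \<partial>P) = (\<integral>x. ?f x \<partial>distr P borel Y)" by (subst integral_distr) auto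
      also have "\<dots> = (\<integral>\<omega>. ?f (g *v Y \<omega>) \<partial>P)"
        unfolding inv[OF that, symmetric] by (subst integral_distr) auto
      finally show "(\<integral>\<omega>. ?f (g *v Y \<omega>) \<partial>P) = (\<integral>\<omega>. ?f (Y \<omega>) \<partial>P)" ..
    qed
    have sum: "integrable P (\<lambda>\<omega>. \<Sum>g\<leftarrow>hs. ?f (g *v Y \<omega>)) \<and>
        (\<integral>\<omega>. (\<Sum>g\<leftarrow>hs. ?f (g *v Y \<omega>)) \<partial>P) = length hs * (\<integral>\<omega>. ?f (Y \<omega>) \<partial>P)" if "set hs \<subseteq> set gs" for hs
      using that by (induction hs) (simp_all add: int' eq' algebra_simps)
    have "AE \<omega> in P. \<forall>g\<in>set gs. \<bar>u (g *v Y \<omega>)\<bar> \<noteq> \<infinity>"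
      using fin' by (simp add: AE_finite_all)
    with le have "AE \<omega> in P. orbit_mean_real gs ?f (Y \<omega>) \<le> c"
    proof eventually_elim
      case (elim \<omega>)
      then have "orbit_mean gs u (Y \<omega>) = ereal (orbit_mean_real gs ?f (Y \<omega>))"
        using gs by (intro orbit_mean_eq_real) (auto simp: ereal_real)
      with elim show ?case by simp
    qed
    then have "(\<integral>\<omega>. orbit_mean_real gs ?f (Y \<omega>) \<partial>P) \<le> (\<integral>\<omega>. c \<partial>P)"
      using sum[of gs] by (intro integral_mono_AE) (auto simp: orbit_mean_real_def)
    moreover have "(\<integral>\<omega>. orbit_mean_real gs ?f (Y \<omega>) \<partial>P) = (\<integral>\<omega>. ?f (Y \<omega>) \<partial>P)"
      using sum[of gs] gs by (simp add: orbit_mean_real_def)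
    ultimately show ?thesis using av by (simp add: prob_space)
  qed simp
qed

text \<open>Orthogonal matrices have entries of modulus at most 1, so the closure of \<open>G\<close> is compact.\<close>

lemma finite_net:
  fixes G :: "(real^'n^'n) set"
  assumes "G \<subseteq> {g. orthogonal_matrix g}" "G \<noteq> {}" "\<delta> > 0"
  obtains hs where "hs \<noteq> []" "set hs \<subseteq> G"
    "\<And>g. g \<in> G \<Longrightarrow> \<exists>h\<in>set hs. \<forall>x. norm (g *v x - h *v x) \<le> \<delta> * norm x"
proof -
  have comp: "\<bar>g $ i $ j\<bar> \<le> 1" if "orthogonal_matrix g" for g :: "real^'n^'n" and i j
  proof -
    have "norm (g *v axis j 1) = 1" using norm_orthogonal_matrix[OF that] by simp
    moreover have "(g *v axis j 1) $ i = g $ i $ j"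
      by (simp add: matrix_vector_mult_def axis_def if_distrib sum.delta cong: if_cong)
    ultimately show ?thesis by (metis component_le_norm_cart)
  qed
  have "bounded {g :: real^'n^'n. orthogonal_matrix g}"
  proof (rule boundedI)
    fix g :: "real^'n^'n" assume "g \<in> {g. orthogonal_matrix g}"
    then have g: "orthogonal_matrix g" by simp
    have "norm (g $ i) \<le> real CARD('n)" for i
    proof -
      have "norm (g $ i) \<le> (\<Sum>j\<in>UNIV. \<bar>g $ i $ j\<bar>)" by (rule norm_le_l1_cart)
      also have "\<dots> \<le> (\<Sum>j\<in>(UNIV::'n set). 1)" by (intro sum_mono comp g)
      finally show ?thesis by simp
    qed
    then have "(\<Sum>i\<in>UNIV. norm (g $ i)) \<le> (\<Sum>i\<in>(UNIV::'n set). real CARD('n))" by (intro sum_mono)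
    moreover have "norm g \<le> (\<Sum>i\<in>UNIV. norm (g $ i))"
      unfolding norm_vec_def by (rule L2_set_le_sum) simp
    ultimately show "norm g \<le> real CARD('n) * real CARD('n)" by simp
  qed
  then have "bounded G" using assms(1) bounded_subset by blast
  then have cpt: "compact (closure G)" by (simp add: compact_closure)
  define \<eta> where "\<eta> = \<delta> / real CARD('n)^2"
  have \<eta>: "\<eta> > 0" using assms(3) by (simp add: \<eta>_def)
  have "closure G \<subseteq> (\<Union>h\<in>G. ball h \<eta>)"
  proof
    fix x assume "x \<in> closure G"
    then obtain h where "h \<in> G" "dist h x < \<eta>" using \<eta> unfolding closure_approachable by blast
    then show "x \<in> (\<Union>h\<in>G. ball h \<eta>)" by auto
  qed
  then obtain K where K: "K \<subseteq> G" "finite K" "closure G \<subseteq> (\<Union>h\<in>K. ball h \<eta>)"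
    using compactE_image[OF cpt, of G "\<lambda>h. ball h \<eta>"] by auto
  obtain hs where hs: "set hs = K" using finite_list[OF K(2)] by blast
  show ?thesis
  proof (rule that[of hs])
    show "hs \<noteq> []" using K(3) assms(2) closure_subset[of G] hs by auto
    show "set hs \<subseteq> G" using hs K by simp
    fix g assume "g \<in> G"
    then obtain h where h: "h \<in> K" "dist h g < \<eta>" using K(3) closure_subset[of G] by auto
    have "norm (g *v x - h *v x) \<le> \<delta> * norm x" for x
    proof -
      have *: "\<bar>(g - h) $ i $ j\<bar> \<le> \<eta>" for i j
      proof -
        have "\<bar>(g - h) $ i $ j\<bar> \<le> norm ((g - h) $ i)" by (rule component_le_norm_cart)
        also have "\<dots> \<le> norm (g - h)" by (rule Finite_Cartesian_Product.norm_nth_le)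
        also have "\<dots> \<le> \<eta>" using h by (simp add: dist_norm norm_minus_commute)
        finally show ?thesis .
      qed
      have "onorm ((*v) (g - h)) \<le> real CARD('n) * real CARD('n) * \<eta>"
        by (rule onorm_le_matrix_component) (rule *)
      also have "\<dots> = \<delta>" by (simp add: \<eta>_def power2_eq_square)
      finally have "onorm ((*v) (g - h)) \<le> \<delta>" .
      moreover have "norm ((g - h) *v x) \<le> onorm ((*v) (g - h)) * norm x"
        by (rule onorm) simp
      ultimately show ?thesis
        by (metis matrix_vector_mult_diff_rdistrib mult_right_mono norm_ge_zero order_trans)
    qed
    then show "\<exists>h\<in>set hs. \<forall>x. norm (g *v x - h *v x) \<le> \<delta> * norm x" using h hs by blast
  qed
qed

text \<open>One pair with a small difference improves the obvious bound for the double sum. This is the source of the contraction factor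
  in \<open>rotation_averaging\<close>.\<close>

lemma sum_list_double_le:
  fixes a b :: "'a \<Rightarrow> real" and M e :: real
  assumes "\<And>i j. i \<in> set xs \<Longrightarrow> j \<in> set xs \<Longrightarrow> a i - b j \<le> M"
    and "p \<in> set xs" "q \<in> set xs" "a p - b q \<le> e"
  shows "length xs * ((\<Sum>i\<leftarrow>xs. a i) - (\<Sum>j\<leftarrow>xs. b j)) \<le> ((real (length xs))\<^sup>2 - 1) * M + e"
proof -
  let ?n = "length xs"
  obtain i0 where i0: "i0 < ?n" "xs ! i0 = p" using assms(2) by (auto simp: in_set_conv_nth)
  obtain j0 where j0: "j0 < ?n" "xs ! j0 = q" using assms(3) by (auto simp: in_set_conv_nth)
  define f where "f = (\<lambda>(i, j). a (xs ! i) - b (xs ! j))"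
  let ?I = "{..<?n} \<times> {..<?n}"
  have "?n * ((\<Sum>i\<leftarrow>xs. a i) - (\<Sum>j\<leftarrow>xs. b j)) = (\<Sum>i<?n. \<Sum>j<?n. a (xs ! i) - b (xs ! j))"
    by (simp add: sum_list_sum_nth sum_subtractf atLeast0LessThan right_diff_distrib flip: sum_distrib_left)
  also have "\<dots> = sum f ?I"
    by (simp add: f_def sum.cartesian_product)
  also have "\<dots> = f (i0, j0) + sum f (?I - {(i0, j0)})"
    using i0 j0 by (intro sum.remove) auto
  also have "\<dots> \<le> e + (\<Sum>z\<in>?I - {(i0, j0)}. M)"
    using i0 j0 assms by (intro add_mono sum_mono) (auto simp: f_def)
  also have "(\<Sum>z\<in>?I - {(i0, j0)}. M) = ((real (length xs))\<^sup>2 - 1) * M"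
  proof -
    have "card (?I - {(i0, j0)}) = ?n * ?n - 1"
      using i0 j0 by (subst card_Diff_subset) auto
    moreover have "1 \<le> ?n * ?n" using i0 by (metis One_nat_def Suc_leI mult_pos_pos gr_zeroI less_zeroE)
    ultimately show ?thesis by (simp add: of_nat_diff power2_eq_square)
  qed
  finally show ?thesis by simp
qed

lemma orbit_mean_real_compose:
  assumes "gs \<noteq> []" "hs \<noteq> []"
  shows "orbit_mean_real [g ** h. g \<leftarrow> gs, h \<leftarrow> hs] f x = orbit_mean_real hs (orbit_mean_real gs f) x"
proof -
  have "(\<Sum>k\<leftarrow>[g ** h. g \<leftarrow> gs, h \<leftarrow> hs]. f (k *v x)) = (\<Sum>g\<leftarrow>gs. \<Sum>h\<leftarrow>hs. f (g *v (h *v x)))"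
    by (induction gs) (simp_all add: o_def matrix_vector_mul_assoc)
  also have "\<dots> = (\<Sum>h\<leftarrow>hs. \<Sum>g\<leftarrow>gs. f (g *v (h *v x)))"
    by (induction gs) (simp_all add: sum_list_addf)
  also have "\<dots> = (\<Sum>h\<leftarrow>hs. orbit_mean_real gs f (h *v x)) * length gs"
    unfolding orbit_mean_real_def using assms(1) by (induction hs) (simp_all add: distrib_right)
  finally show ?thesis
    using assms by (simp add: orbit_mean_real_def[of hs] orbit_mean_real_def[of "concat _"] length_concat o_def sum_list_triv)
qed

text \<open>Averaging over a finite \<open>\<delta>\<close>-net of \<open>G\<close> with \<open>N\<close> elements contracts the oscillation on each sphere: by transitivity, for
  any two points \<open>x\<close> and \<open>y\<close> of the sphere some net elements \<open>h1\<close> and \<open>h0\<close> bring \<open>h1 x\<close> close to \<open>h0 y\<close>, so one of the \<open>N\<^sup>2\<close> differences is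
  small, and the factor is \<open>1 - 1/N\<^sup>2\<close>. As rotations are isometries, all the iterated means share the modulus of continuity of \<open>f\<close>.\<close>

lemma rotation_averaging:
  fixes G :: "(real^'n^'n) set" and f :: "real^'n \<Rightarrow> real"
  assumes G: "orthogonal_subgroup G" and trans: "\<forall>x\<in>sphere 0 1. \<forall>y\<in>sphere 0 1. \<exists>g\<in>G. g *v x = y"
    and f: "continuous_on (cball 0 R) f" and e: "\<epsilon> > 0"
  obtains gs where "gs \<noteq> []" "set gs \<subseteq> G"
    "\<And>x y. norm x = norm y \<Longrightarrow> norm x \<le> R \<Longrightarrow> orbit_mean_real gs f x - orbit_mean_real gs f y \<le> \<epsilon>"
proof -
  have orth: "\<And>g. g \<in> G \<Longrightarrow> orthogonal_matrix g" and one: "mat 1 \<in> G"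
    and mult: "\<And>g h. g \<in> G \<Longrightarrow> h \<in> G \<Longrightarrow> g ** h \<in> G"
    using G by (auto simp: orthogonal_subgroup_def)
  have trans': "\<exists>g\<in>G. g *v x = y" if "norm x = norm y" for x y :: "real^'n"
  proof (cases "y = 0")
    case True
    then show ?thesis using that one by (intro bexI[of _ "mat 1"]) auto
  next
    case False
    then have x: "x \<noteq> 0" using that by auto
    obtain g where g: "g \<in> G" "g *v sgn x = sgn y"
      using trans False x by (metis dist_0_norm mem_sphere norm_sgn)
    have "g *v (norm x *\<^sub>R sgn x) = norm y *\<^sub>R sgn y"
      using g that by (simp add: matrix_vector_mult_scaleR)
    then show ?thesis using g False x by (auto simp: sgn_div_norm)
  qed
  have uc: "uniformly_continuous_on (cball 0 R) f"
    using f by (simp add: compact_uniformly_continuous)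
  obtain \<delta> where \<delta>: "\<delta> > 0" "\<And>x y. norm x \<le> R \<Longrightarrow> norm y \<le> R \<Longrightarrow> dist x y < \<delta> \<Longrightarrow> dist (f x) (f y) < \<epsilon> / 2"
  proof -
    have "\<exists>\<delta>>0. \<forall>x\<in>cball 0 R. \<forall>x'\<in>cball 0 R. dist x' x < \<delta> \<longrightarrow> dist (f x') (f x) < \<epsilon> / 2"
      using uc half_gt_zero[OF e] unfolding uniformly_continuous_on_def by blast
    then show ?thesis using that by (metis mem_cball_0)
  qed
  define \<delta>' where "\<delta>' = \<delta> / (2 * (\<bar>R\<bar> + 1))"
  have \<delta>': "\<delta>' > 0" using \<delta>(1) by (simp add: \<delta>'_def)
  have \<delta>'R: "\<delta>' * norm x < \<delta>" if "norm x \<le> R" for x :: "real^'n"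
  proof -
    have "\<delta>' * norm x \<le> \<delta>' * (\<bar>R\<bar> + 1)" using that \<delta>' by (intro mult_left_mono) auto
    also have "\<dots> = \<delta> / 2" unfolding \<delta>'_def by (simp add: field_simps)
    finally show ?thesis using \<delta>(1) by simp
  qed
  obtain hs where hs: "hs \<noteq> []" "set hs \<subseteq> G"
    and net: "\<And>g. g \<in> G \<Longrightarrow> \<exists>h\<in>set hs. \<forall>x. norm (g *v x - h *v x) \<le> \<delta>' * norm x"
    using finite_net[of G \<delta>'] orth one \<delta>' by (metis empty_iff mem_Collect_eq subsetI)
  have "bounded (f ` cball 0 R)"
    using f by (intro compact_imp_bounded compact_continuous_image) auto
  then obtain B where "\<forall>x\<in>cball 0 R. \<bar>f x\<bar> \<le> B"
    unfolding bounded_iff by auto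
  then have B: "\<And>x. norm x \<le> R \<Longrightarrow> \<bar>f x\<bar> \<le> B" by auto
  define m where "m = (real (length hs))\<^sup>2"
  have m: "m \<ge> 1" using hs(1) by (cases hs) (auto simp: m_def)
  define q where "q = 1 - 1 / m"
  have q: "0 \<le> q" "q < 1" using m by (auto simp: q_def)
  \<comment> \<open>every mean in the sequence inherits the modulus of continuity of \<open>f\<close>\<close>
  have modulus: "\<bar>orbit_mean_real gs f x - orbit_mean_real gs f y\<bar> \<le> \<epsilon> / 2"
    if gs: "gs \<noteq> []" "set gs \<subseteq> G" and xy: "norm x \<le> R" "norm y \<le> R" "dist x y < \<delta>" for gs x y
  proof -
    have "\<bar>f (g *v x) - f (g *v y)\<bar> \<le> \<epsilon> / 2" if "g \<in> set gs" for g
    proof -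
      have o: "orthogonal_matrix g" using that gs orth by auto
      have "dist (g *v x) (g *v y) = dist x y"
        by (metis dist_norm matrix_vector_mult_diff_distrib norm_orthogonal_matrix[OF o])
      then show ?thesis using \<delta>(2)[of "g *v x" "g *v y"] xy norm_orthogonal_matrix[OF o]
        by (simp add: dist_real_def)
    qed
    then have "\<bar>\<Sum>g\<leftarrow>gs. f (g *v x) - f (g *v y)\<bar> \<le> real (length gs) * (\<epsilon> / 2)"
    proof (induction gs)
      case (Cons a gs)
      have "\<bar>f (a *v x) - f (a *v y)\<bar> \<le> \<epsilon> / 2"
        "\<bar>\<Sum>g\<leftarrow>gs. f (g *v x) - f (g *v y)\<bar> \<le> real (length gs) * (\<epsilon> / 2)"
        using Cons by auto
      then have "\<bar>(f (a *v x) - f (a *v y)) + (\<Sum>g\<leftarrow>gs. f (g *v x) - f (g *v y))\<bar> \<le> \<epsilon> / 2 + real (length gs) * (\<epsilon> / 2)"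
        by linarith
      also have "\<dots> = real (length (a # gs)) * (\<epsilon> / 2)" by (simp add: distrib_right)
      finally show ?case by simp
    qed simp
    then show ?thesis using gs(1)
      by (simp add: orbit_mean_real_def sum_list_subtractf field_simps flip: diff_divide_distrib)
  qed
  have "\<exists>gs. gs \<noteq> [] \<and> set gs \<subseteq> G \<and> (\<forall>x y. norm x = norm y \<longrightarrow> norm x \<le> R \<longrightarrow>
      orbit_mean_real gs f x - orbit_mean_real gs f y \<le> q ^ k * (2 * B) + \<epsilon> / 2)" for k
  proof (induction k)
    case 0
    have "f (mat 1 *v x) - f (mat 1 *v y) \<le> 2 * B" if "norm x = norm y" "norm x \<le> R" for x y
      using B[of x] B[of y] that by simp
    then show ?case using e one by (intro exI[of _ "[mat 1]"]) (force simp: orbit_mean_real_def)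
  next
    case (Suc k)
    then obtain gs where gs: "gs \<noteq> []" "set gs \<subseteq> G"
      and osc: "\<And>x y. norm x = norm y \<Longrightarrow> norm x \<le> R \<Longrightarrow>
      orbit_mean_real gs f x - orbit_mean_real gs f y \<le> q ^ k * (2 * B) + \<epsilon> / 2" by blast
    let ?w = "orbit_mean_real gs f" and ?M = "q ^ k * (2 * B) + \<epsilon> / 2"
    let ?gs = "[g ** h. g \<leftarrow> gs, h \<leftarrow> hs]"
    have "orbit_mean_real ?gs f x - orbit_mean_real ?gs f y \<le> q ^ Suc k * (2 * B) + \<epsilon> / 2"
      if xy: "norm x = norm y" "norm x \<le> R" for x y
    proof -
      obtain h0 where h0: "h0 \<in> set hs" using hs(1) by (cases hs) auto
      have o: "norm (h *v z) = norm z" if "h \<in> set hs" for h z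
        using norm_orthogonal_matrix orth hs(2) that by blast
      obtain g where g: "g \<in> G" "g *v x = h0 *v y" using trans'[of x "h0 *v y"] o[OF h0] xy by auto
      obtain h1 where h1: "h1 \<in> set hs" "norm (g *v x - h1 *v x) \<le> \<delta>' * norm x" using net[OF g(1)] by blast
      have "dist (h1 *v x) (h0 *v y) < \<delta>"
        using h1(2) g(2) \<delta>'R[OF xy(2)] by (simp add: dist_norm norm_minus_commute)
      then have close: "?w (h1 *v x) - ?w (h0 *v y) \<le> \<epsilon> / 2"
        using modulus[OF gs, of "h1 *v x" "h0 *v y"] o[OF h0] o[OF h1(1)] xy
        by (metis abs_le_D1 order_refl)
      have "real (length hs) * ((\<Sum>h\<leftarrow>hs. ?w (h *v x)) - (\<Sum>h\<leftarrow>hs. ?w (h *v y))) \<le> (m - 1) * ?M + \<epsilon> / 2"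
        using sum_list_double_le[of hs "\<lambda>h. ?w (h *v x)" "\<lambda>h. ?w (h *v y)" ?M h1 h0 "\<epsilon> / 2"]
          osc o h1(1) h0 close xy unfolding m_def by auto
      then have "((\<Sum>h\<leftarrow>hs. ?w (h *v x)) - (\<Sum>h\<leftarrow>hs. ?w (h *v y))) / real (length hs) \<le> ((m - 1) * ?M + \<epsilon> / 2) / m"
        using hs(1) by (simp add: m_def divide_simps power2_eq_square mult.commute mult.left_commute)
      also have "\<dots> = q ^ Suc k * (2 * B) + \<epsilon> / 2"
        using m by (simp add: q_def field_simps)
      finally show ?thesis
        unfolding orbit_mean_real_compose[OF gs(1) hs(1)]
        by (simp add: orbit_mean_real_def[of hs] diff_divide_distrib)
    qed
    moreover have "?gs \<noteq> []" using gs(1) hs(1) by (cases gs; cases hs) auto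
    moreover have "set ?gs \<subseteq> G" using gs(2) hs(2) mult by auto
    ultimately show ?case by blast
  qed
  then obtain GS where GS: "\<And>k. GS k \<noteq> [] \<and> set (GS k) \<subseteq> G \<and> (\<forall>x y. norm x = norm y \<longrightarrow> norm x \<le> R \<longrightarrow>
      orbit_mean_real (GS k) f x - orbit_mean_real (GS k) f y \<le> q ^ k * (2 * B) + \<epsilon> / 2)" by metis
  have "(\<lambda>k. q ^ k * (2 * B)) \<longlonglongrightarrow> 0 * (2 * B)"
    using q by (intro tendsto_mult tendsto_const LIMSEQ_power_zero) auto
  then have "eventually (\<lambda>k. q ^ k * (2 * B) < \<epsilon> / 2) sequentially"
    using e by (intro order_tendstoD(2)[of _ 0]) auto
  then obtain k where k: "q ^ k * (2 * B) < \<epsilon> / 2" by (auto simp: eventually_sequentially)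
  show ?thesis
  proof (rule that[of "GS k"])
    fix x y :: "real^'n" assume "norm x = norm y" "norm x \<le> R"
    then show "orbit_mean_real (GS k) f x - orbit_mean_real (GS k) f y \<le> \<epsilon>"
      using GS[of k] k by (smt (verit) field_sum_of_halves)
  qed (use GS in auto)
qed

section \<open>Linear algebra of convex cone subequations\<close>

lemma line_proj_mult: "line_proj a *v h = (a \<bullet> h) *\<^sub>R (a :: real^'n)"
  by (simp add: line_proj_def matrix_vector_mult_def vec_eq_iff inner_vec_def sum_distrib_right sum_distrib_left mult_ac)

lemma line_proj_symmetric: "transpose (line_proj a) = line_proj (a :: real^'n)"
  by (simp add: line_proj_def transpose_def vec_eq_iff mult.commute)

lemma inner_line_proj: "B \<bullet> line_proj a = a \<bullet> (B *v (a :: real^'n))"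
  by (simp add: line_proj_def inner_vec_def matrix_vector_mult_def sum_distrib_left mult_ac)

lemma inner_mat_1: "B \<bullet> (mat 1 :: real^'n^'n) = trace B"
  by (simp add: inner_vec_def mat_def trace_def if_distrib cong: if_cong)

lemma inner_matrix_trace: "(A :: real^'n^'n) \<bullet> B = trace (transpose A ** B)"
proof -
  have "A \<bullet> B = (\<Sum>j\<in>UNIV. \<Sum>i\<in>UNIV. A $ i $ j * B $ i $ j)"
    unfolding inner_vec_def by (simp add: sum.swap[of "\<lambda>i j. A $ i $ j * B $ i $ j"])
  then show ?thesis by (simp add: trace_def matrix_matrix_mult_def transpose_def)
qed

lemma matrix_inner_transpose: "x \<bullet> (A *v y) = (transpose A *v x) \<bullet> (y :: real^'n)"
  by (metis dot_lmul_matrix inner_commute transpose_matrix_vector)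

lemma trace_conj_sum: "trace A = (\<Sum>i\<in>UNIV. axis i 1 \<bullet> (A *v axis i (1::real)))"
  by (simp add: trace_def inner_axis' matrix_vector_mult_basis column_def)

text \<open>Completing squares: a nonzero row of \<open>B\<close> has a positive diagonal entry, and subtracting the square of a suitable linear form
  removes this row. So \<open>B\<close> is a sum of such squares, indexed by its rows.\<close>

lemma psd_sqrt:
  fixes B :: "real^'n^'n"
  assumes sym: "transpose B = B" and psd: "\<And>v. 0 \<le> v \<bullet> (B *v v)"
  shows "\<exists>A :: real^'n^'n. B = A ** transpose A"
proof -
  have "\<exists>b. B = (\<Sum>k\<in>{i. B $ i \<noteq> 0}. line_proj (b k))"
    using assms
  proof (induction "card {i. B $ i \<noteq> 0}" arbitrary: B rule: less_induct)
    case less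
    note sym = less.prems(1) and psd = less.prems(2)
    have bil: "v \<bullet> (B *v w) = w \<bullet> (B *v v)" for v w
      by (metis inner_commute matrix_inner_transpose sym)
    show ?case
    proof (cases "{i. B $ i \<noteq> 0} = {}")
      case True
      then have "B = 0" by (simp add: vec_eq_iff)
      then show ?thesis by simp
    next
      case False
      then obtain i where i: "B $ i \<noteq> 0" by blast
      let ?e = "axis i (1::real)"
      have Bi: "B *v ?e = B $ i"
        using sym by (simp add: matrix_vector_mult_basis column_def vec_eq_iff transpose_def)
      define d where "d = ?e \<bullet> (B *v ?e)"
      have quad: "(v + t *\<^sub>R ?e) \<bullet> (B *v (v + t *\<^sub>R ?e)) = v \<bullet> (B *v v) + 2 * t * (v \<bullet> (B $ i)) + t\<^sup>2 * d" for v t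
      proof -
        have "(v + t *\<^sub>R ?e) \<bullet> (B *v (v + t *\<^sub>R ?e)) = v \<bullet> (B *v v) + t * (v \<bullet> (B *v ?e)) + t * (?e \<bullet> (B *v v)) + t * t * d"
          by (simp add: d_def matrix_vector_right_distrib matrix_vector_mult_scaleR inner_add_left inner_add_right algebra_simps)
        then show ?thesis using bil[of ?e v] by (simp add: Bi power2_eq_square)
      qed
      have d: "d > 0"
      proof (rule ccontr)
        assume "\<not> d > 0"
        then have d0: "d = 0" using psd[of ?e] by (simp add: d_def)
        have "v \<bullet> (B $ i) = 0" for v
        proof (rule ccontr)
          assume nz: "v \<bullet> (B $ i) \<noteq> 0"
          let ?t = "- (v \<bullet> (B *v v) + 1) / (2 * (v \<bullet> (B $ i)))"
          have "0 \<le> v \<bullet> (B *v v) + 2 * ?t * (v \<bullet> (B $ i))"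
            using psd[of "v + ?t *\<^sub>R ?e"] unfolding quad d0 by (simp only: mult_zero_right add_0_right)
          moreover have "2 * ?t * (v \<bullet> (B $ i)) = - (v \<bullet> (B *v v)) - 1" using nz by (simp add: field_simps)
          ultimately show False by linarith
        qed
        then show False using i by (metis inner_eq_zero_iff)
      qed
      define b0 where "b0 = (1 / sqrt d) *\<^sub>R B $ i"
      define B' where "B' = B - line_proj b0"
      have lp: "line_proj b0 *v v = ((B $ i \<bullet> v) / d) *\<^sub>R B $ i" for v
        using d by (simp add: line_proj_mult b0_def real_sqrt_mult_self field_simps flip: real_sqrt_mult)
      have sym': "transpose B' = B'" using sym
        by (simp add: B'_def transpose_def line_proj_def vec_eq_iff mult.commute)
      have psd': "0 \<le> v \<bullet> (B' *v v)" for v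
      proof -
        let ?t = "- (v \<bullet> B $ i) / d"
        have "0 \<le> v \<bullet> (B *v v) + 2 * ?t * (v \<bullet> (B $ i)) + ?t\<^sup>2 * d"
          using psd[of "v + ?t *\<^sub>R ?e"] unfolding quad .
        also have "\<dots> = v \<bullet> (B *v v) - (v \<bullet> B $ i)\<^sup>2 / d"
          using d by (simp add: field_simps power2_eq_square)
        also have "\<dots> = v \<bullet> (B' *v v)"
          by (simp add: B'_def matrix_vector_mult_diff_rdistrib inner_diff_right lp power2_eq_square inner_commute)
        finally show ?thesis .
      qed
      have row0: "B' $ j = 0" if "B $ j = 0" for j
      proof -
        have "B $ i $ j = 0" using arg_cong[OF sym, of "\<lambda>C. C $ j $ i"] that by (simp add: transpose_def)
        then show ?thesis using that by (simp add: B'_def line_proj_def b0_def vec_eq_iff)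
      qed
      have rowi: "B' $ i = 0"
      proof -
        have "B' *v ?e = B *v ?e - line_proj b0 *v ?e" by (simp add: B'_def matrix_vector_mult_diff_rdistrib)
        also have "\<dots> = 0" using d unfolding lp Bi d_def by (simp add: inner_commute)
        finally have "column i B' = 0" by (simp add: matrix_vector_mult_basis)
        then have "B' $ k $ i = 0" for k by (simp add: column_def vec_eq_iff)
        then show ?thesis using arg_cong[OF sym', of "\<lambda>C. C $ _ $ i"] by (simp add: transpose_def vec_eq_iff)
      qed
      have sub: "{j. B' $ j \<noteq> 0} \<subseteq> {j. B $ j \<noteq> 0} - {i}" using row0 rowi by auto
      then have "card {j. B' $ j \<noteq> 0} < card {j. B $ j \<noteq> 0}"
        using i by (intro psubset_card_mono) auto
      then obtain b where b: "B' = (\<Sum>k\<in>{j. B' $ j \<noteq> 0}. line_proj (b k))"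
        using less.hyps[OF _ sym' psd'] by blast
      define b' where "b' = (\<lambda>k. if k = i then b0 else if B' $ k \<noteq> 0 then b k else 0)"
      have lp0: "line_proj (0::real^'n) = 0" by (simp add: line_proj_def vec_eq_iff)
      have "(\<Sum>k\<in>{j. B $ j \<noteq> 0}. line_proj (b' k)) = line_proj b0 + (\<Sum>k\<in>{j. B $ j \<noteq> 0} - {i}. line_proj (b' k))"
        using i by (subst sum.remove[of _ i]) (auto simp: b'_def)
      also have "(\<Sum>k\<in>{j. B $ j \<noteq> 0} - {i}. line_proj (b' k)) = (\<Sum>k\<in>{j. B' $ j \<noteq> 0}. line_proj (b k))"
        using sub by (intro sum.mono_neutral_cong_right) (auto simp: b'_def lp0)
      also have "line_proj b0 + \<dots> = B" by (subst b[symmetric]) (simp add: B'_def)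
      finally show ?thesis by metis
    qed
  qed
  then obtain b where b0: "B = (\<Sum>k\<in>{i. B $ i \<noteq> 0}. line_proj (b k))" by (rule exE)
  define S where "S = {i. B $ i \<noteq> 0}"
  have b: "B = (\<Sum>k\<in>S. line_proj (b k))" unfolding S_def by (rule b0)
  let ?A = "(\<chi> i k. if k \<in> S then b k $ i else 0) :: real^'n^'n"
  have "B $ i $ j = (?A ** transpose ?A) $ i $ j" for i j
  proof -
    have "B $ i $ j = (\<Sum>k\<in>S. b k $ i * b k $ j)"
      using arg_cong[OF b, of "\<lambda>C. C $ i $ j"] by (simp add: line_proj_def)
    also have "\<dots> = (\<Sum>k\<in>UNIV. ?A $ i $ k * ?A $ j $ k)"
      by (rule sum.mono_neutral_cong_left) auto
    finally show ?thesis by (simp add: matrix_matrix_mult_def transpose_def)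
  qed
  then have "B = ?A ** transpose ?A" by (simp only: vec_eq_iff) blast
  then show ?thesis by (rule exI)
qed

locale transitive_rotations =
  fixes G :: "(real^'n^'n) set"
  assumes subgroup: "orthogonal_subgroup G"
    and transitive: "\<forall>x\<in>sphere 0 1. \<forall>y\<in>sphere 0 1. \<exists>g\<in>G. g *v x = y"
begin

lemma orth: "g \<in> G \<Longrightarrow> orthogonal_matrix g"
  and norm_G: "g \<in> G \<Longrightarrow> norm (g *v x) = norm x"
  using subgroup norm_orthogonal_matrix by (auto simp: orthogonal_subgroup_def)

lemma transpose_G:
  assumes "g \<in> G" shows "transpose g \<in> G"
proof -
  have o: "orthogonal_matrix g" using assms orth by simp
  then have "matrix_inv g = transpose g"
    unfolding orthogonal_matrix_def matrix_inv_def
    by (intro some_equality) (auto, metis matrix_mul_assoc matrix_mul_lid matrix_mul_rid)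
  then show ?thesis using assms subgroup by (auto simp: orthogonal_subgroup_def)
qed

lemma distr_G: "g \<in> G \<Longrightarrow> distr ball_prob borel (\<lambda>x. g *v x) = ball_prob"
  by (rule distr_ball_prob_orthogonal[OF orth])

lemma distr_G_sgn:
  assumes "g \<in> G" shows "distr ball_prob borel (\<lambda>x. g *v (r *\<^sub>R sgn x)) = distr ball_prob borel (\<lambda>x. r *\<^sub>R sgn x)"
proof -
  have [measurable]: "(\<lambda>x. g *v x) \<in> borel \<rightarrow>\<^sub>M borel"
    by (intro borel_measurable_continuous_onI continuous_intros)
  have "distr ball_prob borel (\<lambda>x. r *\<^sub>R sgn x) = distr (distr ball_prob borel (\<lambda>x. g *v x)) borel (\<lambda>x. r *\<^sub>R sgn x)"
    by (simp add: distr_G[OF assms])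
  also have "\<dots> = distr ball_prob borel (\<lambda>x. g *v (r *\<^sub>R sgn x))"
    by (subst distr_distr) (simp_all add: o_def sgn_orthogonal_matrix[OF orth[OF assms]] matrix_vector_mult_scaleR)
  finally show ?thesis ..
qed

lemma integrable_sphere:
  fixes f :: "real^'n \<Rightarrow> real" and A :: "real^'n^'n"
  assumes f: "continuous_on UNIV f"
  shows "integrable ball_prob (\<lambda>y. f (x + r *\<^sub>R (A *v sgn y)))"
proof -
  interpret prob_space "ball_prob :: (real^'n) measure" by (rule prob_space_ball_prob)
  have [measurable]: "f \<in> borel_measurable borel" using f by (rule borel_measurable_continuous_onI)
  have [measurable]: "(\<lambda>x. A *v x) \<in> borel \<rightarrow>\<^sub>M borel"
    by (intro borel_measurable_continuous_onI continuous_intros)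
  have "compact ((\<lambda>y. f (x + r *\<^sub>R (A *v y))) ` cball 0 1)"
    by (intro compact_continuous_image continuous_on_compose2[OF f] continuous_intros) auto
  then obtain B where B: "\<And>y. norm y \<le> 1 \<Longrightarrow> norm (f (x + r *\<^sub>R (A *v y))) \<le> B"
    by (meson bounded_iff compact_imp_bounded image_eqI mem_cball_0)
  show ?thesis
  proof (rule integrable_const_bound[where B=B])
    show "AE y in ball_prob. norm (f (x + r *\<^sub>R (A *v sgn y))) \<le> B"
    proof (rule eventually_mono[OF AE_ball_prob])
      fix y :: "real^'n" assume "y \<noteq> 0 \<and> norm y \<le> 1 \<and> norm (sgn y) = 1"
      then show "norm (f (x + r *\<^sub>R (A *v sgn y))) \<le> B" using B[of "sgn y"] by auto
    qed
  qed measurable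
qed

text \<open>On each sphere the orbit mean has the same average as \<open>f\<close>, and its oscillation is small.\<close>

lemma orbit_mean_real_close:
  fixes f :: "real^'n \<Rightarrow> real"
  assumes f: "continuous_on UNIV f" and e: "\<epsilon> > 0"
  obtains gs where "gs \<noteq> []" "set gs \<subseteq> G"
    "\<And>x. norm x \<le> R \<Longrightarrow> \<bar>orbit_mean_real gs f x - (\<integral>y. f (norm x *\<^sub>R sgn y) \<partial>ball_prob)\<bar> \<le> \<epsilon>"
proof -
  interpret prob_space "ball_prob :: (real^'n) measure" by (rule prob_space_ball_prob)
  obtain gs where gs: "gs \<noteq> []" "set gs \<subseteq> G"
    and osc: "\<And>x y. norm x = norm y \<Longrightarrow> norm x \<le> R \<Longrightarrow> orbit_mean_real gs f x - orbit_mean_real gs f y \<le> \<epsilon>"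
    using rotation_averaging[OF subgroup transitive continuous_on_subset[OF f] e] by (metis subset_UNIV)
  have [measurable]: "f \<in> borel_measurable borel" using f by (rule borel_measurable_continuous_onI)
  have int: "integrable ball_prob (\<lambda>y. f (g *v (r *\<^sub>R sgn y)))" for g :: "real^'n^'n" and r
    using integrable_sphere[OF f, of 0 r g] by (simp add: matrix_vector_mult_scaleR)
  have same: "(\<integral>y. f (g *v (r *\<^sub>R sgn y)) \<partial>ball_prob) = (\<integral>y. f (r *\<^sub>R sgn y) \<partial>ball_prob)" if "g \<in> G" for g r
  proof -
    have [measurable]: "(\<lambda>x. g *v x) \<in> borel \<rightarrow>\<^sub>M borel"
      by (intro borel_measurable_continuous_onI continuous_intros)
    have "(\<integral>y. f (g *v (r *\<^sub>R sgn y)) \<partial>ball_prob) = (\<integral>z. f z \<partial>distr ball_prob borel (\<lambda>y. g *v (r *\<^sub>R sgn y)))"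
      by (subst integral_distr) auto
    also have "\<dots> = (\<integral>y. f (r *\<^sub>R sgn y) \<partial>ball_prob)"
      unfolding distr_G_sgn[OF that] by (subst integral_distr) auto
    finally show ?thesis .
  qed
  show ?thesis
  proof (rule that[OF gs])
    fix x :: "real^'n" assume x: "norm x \<le> R"
    let ?w = "\<lambda>y. orbit_mean_real gs f (norm x *\<^sub>R sgn y)"
    have sum: "integrable ball_prob (\<lambda>y. \<Sum>g\<leftarrow>hs. f (g *v (norm x *\<^sub>R sgn y))) \<and>
        (\<integral>y. (\<Sum>g\<leftarrow>hs. f (g *v (norm x *\<^sub>R sgn y))) \<partial>ball_prob) = length hs * (\<integral>y. f (norm x *\<^sub>R sgn y) \<partial>ball_prob)"
      if "set hs \<subseteq> G" for hs
      using that
    proof (induction hs)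
      case (Cons h hs)
      then show ?case using int[of h "norm x"] same[of h "norm x"]
        by (simp only: list.map sum_list.Cons set_simps insert_subset Bochner_Integration.integral_add
          Bochner_Integration.integrable_add) (simp add: algebra_simps)
    qed simp
    have w: "integrable ball_prob ?w" "(\<integral>y. ?w y \<partial>ball_prob) = (\<integral>y. f (norm x *\<^sub>R sgn y) \<partial>ball_prob)"
      using sum[OF gs(2)] gs(1) by (simp_all add: orbit_mean_real_def)
    have "(\<integral>y. ?w y \<partial>ball_prob) \<le> (\<integral>y. orbit_mean_real gs f x + \<epsilon> \<partial>(ball_prob :: (real^'n) measure))"
    proof (rule integral_mono_AE[OF w(1)])
      show "AE y in ball_prob. ?w y \<le> orbit_mean_real gs f x + \<epsilon>"
      proof (rule eventually_mono[OF AE_ball_prob])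
        fix y :: "real^'n" assume "y \<noteq> 0 \<and> norm y \<le> 1 \<and> norm (sgn y) = 1"
        then show "?w y \<le> orbit_mean_real gs f x + \<epsilon>"
          using osc[of "norm x *\<^sub>R sgn y" x] x by auto
      qed
    qed simp
    moreover have "(\<integral>y. orbit_mean_real gs f x - \<epsilon> \<partial>(ball_prob :: (real^'n) measure)) \<le> (\<integral>y. ?w y \<partial>ball_prob)"
    proof (rule integral_mono_AE[OF _ w(1)])
      show "AE y in ball_prob. orbit_mean_real gs f x - \<epsilon> \<le> ?w y"
      proof (rule eventually_mono[OF AE_ball_prob])
        fix y :: "real^'n" assume "y \<noteq> 0 \<and> norm y \<le> 1 \<and> norm (sgn y) = 1"
        then show "orbit_mean_real gs f x - \<epsilon> \<le> ?w y"
          using osc[of x "norm x *\<^sub>R sgn y"] x by auto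
      qed
    qed simp
    ultimately show "\<bar>orbit_mean_real gs f x - (\<integral>y. f (norm x *\<^sub>R sgn y) \<partial>ball_prob)\<bar> \<le> \<epsilon>"
      using w(2) prob_space[simplified] by (simp add: abs_le_iff)
  qed
qed

lemma orbit_quadratic:
  assumes "gs \<noteq> []"
  shows "orbit_mean_real gs (\<lambda>x. x \<bullet> (A *v x)) x
    = x \<bullet> (((1 / real (length gs)) *\<^sub>R (\<Sum>g\<leftarrow>gs. transpose g ** A ** g)) *v x)"
proof -
  have "(\<Sum>g\<leftarrow>gs. (g *v x) \<bullet> (A *v (g *v x))) = x \<bullet> ((\<Sum>g\<leftarrow>gs. transpose g ** A ** g) *v x)"
  proof (induction gs)
    case (Cons g gs)
    have "(g *v x) \<bullet> (A *v (g *v x)) = x \<bullet> ((transpose g ** A ** g) *v x)"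
    proof -
      have "x \<bullet> ((transpose g ** A ** g) *v x) = x \<bullet> (transpose g *v (A *v (g *v x)))"
        by (simp add: matrix_vector_mul_assoc matrix_mul_assoc del: transpose_matrix_vector)
      also have "\<dots> = (transpose (transpose g) *v x) \<bullet> (A *v (g *v x))"
        by (rule matrix_inner_transpose)
      finally show ?thesis by simp
    qed
    then show ?case using Cons by (simp add: matrix_vector_mult_add_rdistrib inner_add_right)
  qed simp
  then show ?thesis
    by (simp add: orbit_mean_real_def scaleR_matrix_vector_assoc[symmetric])
qed

lemma sphere_mean_quadratic:
  "(\<integral>y. sgn y \<bullet> (A *v sgn y) \<partial>ball_prob) = trace A / CARD('n)" for A :: "real^'n^'n"
proof -
  let ?q = "\<lambda>x. x \<bullet> (A *v x)" and ?m = "\<integral>y. sgn y \<bullet> (A *v sgn y) \<partial>ball_prob"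
  have c: "continuous_on UNIV ?q" by (intro continuous_intros)
  have bound: "\<bar>trace A - CARD('n) * ?m\<bar> \<le> CARD('n) * \<epsilon>" if e: "\<epsilon> > 0" for \<epsilon> :: real
  proof -
    obtain gs where gs: "gs \<noteq> []" "set gs \<subseteq> G"
      and close: "\<And>x. norm x \<le> 1 \<Longrightarrow> \<bar>orbit_mean_real gs ?q x - (\<integral>y. ?q (norm x *\<^sub>R sgn y) \<partial>ball_prob)\<bar> \<le> \<epsilon>"
      by (rule orbit_mean_real_close[OF c e, where R=1]) (rule that)
    let ?N = "(\<Sum>g\<leftarrow>gs. transpose g ** A ** g)"
    have tr: "trace (transpose g ** A ** g) = trace A" if "g \<in> G" for g
    proof -
      have "trace (transpose g ** A ** g) = trace (g ** (transpose g ** A))" by (rule trace_mul_sym)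
      also have "\<dots> = trace A" using orth[OF that] by (simp add: matrix_mul_assoc orthogonal_matrix_def)
      finally show ?thesis .
    qed
    have "trace ?N = length gs * trace A"
      using gs(2)
    proof (induction gs)
      case Nil
      show ?case by (simp add: trace_def)
    next
      case (Cons g gs)
      then show ?case by (simp add: tr trace_add algebra_simps)
    qed
    moreover have "(\<Sum>i\<in>UNIV. orbit_mean_real gs ?q (axis i 1)) = trace ?N / length gs"
      unfolding orbit_quadratic[OF gs(1)]
      by (simp add: trace_conj_sum scaleR_matrix_vector_assoc[symmetric] sum_divide_distrib)
    ultimately have "trace A - CARD('n) * ?m = (\<Sum>i\<in>UNIV. orbit_mean_real gs ?q (axis i 1) - ?m)"
      using gs(1) by (simp add: sum_subtractf)
    also have "\<bar>\<dots>\<bar> \<le> (\<Sum>i\<in>(UNIV::'n set). \<epsilon>)"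
      using close[of "axis _ 1"] by (intro order_trans[OF sum_abs] sum_mono) simp
    finally show ?thesis by simp
  qed
  have "\<bar>trace A - CARD('n) * ?m\<bar> \<le> e" if "e > 0" for e :: real
  proof -
    have "0 < e / real CARD('n)" using that by simp
    from bound[OF this] show ?thesis by simp
  qed
  then have "\<bar>trace A - CARD('n) * ?m\<bar> \<le> 0" by (rule field_le_epsilon) simp
  then show ?thesis by (simp add: field_simps)
qed

lemma sphere_mean_linear: "(\<integral>y. a \<bullet> (A *v sgn y) \<partial>ball_prob) = 0" for a :: "real^'n" and A :: "real^'n^'n"
proof -
  let ?M = "(-1) *\<^sub>R mat 1 :: real^'n^'n"
  have neg: "?M *v x = - x" for x :: "real^'n"
    by (simp only: scaleR_matrix_vector_assoc[symmetric]) simp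
  have "orthogonal_transformation ((*v) ?M)"
    unfolding orthogonal_transformation_def
    by (intro conjI allI matrix_vector_mul_linear) (simp only: neg inner_minus_left inner_minus_right minus_minus)
  then have "orthogonal_matrix ?M"
    by (simp add: orthogonal_transformation_matrix)
  then have "distr ball_prob borel (\<lambda>x. - x) = (ball_prob :: (real^'n) measure)"
    using distr_ball_prob_orthogonal[of ?M] by (simp only: neg)
  moreover have [measurable]: "(\<lambda>x. A *v x) \<in> borel \<rightarrow>\<^sub>M borel"
    by (intro borel_measurable_continuous_onI continuous_intros)
  ultimately have "(\<integral>y. a \<bullet> (A *v sgn y) \<partial>ball_prob) = (\<integral>y. a \<bullet> (A *v sgn y) \<partial>distr ball_prob borel (\<lambda>x. - x))"
    by simp
  also have "\<dots> = (\<integral>y. a \<bullet> (A *v sgn (- y)) \<partial>ball_prob)"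
    by (subst integral_distr) simp_all
  also have "\<dots> = - (\<integral>y. a \<bullet> (A *v sgn y) \<partial>ball_prob)"
    by (simp add: sgn_minus linear_neg[OF matrix_vector_mul_linear])
  finally show ?thesis by simp
qed

end

text \<open>Up to a positive factor, this is the second derivative of \<open>K\<^sub>q(|x|)\<close> at points in direction \<open>e\<close>.\<close>

definition riesz_matrix :: "real^'n \<Rightarrow> real \<Rightarrow> real^'n^'n" where
  "riesz_matrix e q = (mat 1 - line_proj e) - (q - 1) *\<^sub>R line_proj e"

locale riesz_cone = transitive_rotations G for G :: "(real^'n^'n) set" +
  fixes F :: "(real^'n^'n) set" and p :: real
  assumes F: "subequation F" "convex F" "cone F"
    and invariant: "\<And>g A. g \<in> G \<Longrightarrow> A \<in> F \<Longrightarrow> g ** A ** transpose g \<in> F"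
    and riesz: "\<exists>e. norm e = 1 \<and> riesz_characteristic F e = ereal p"
begin

lemma F_sym: "A \<in> F \<Longrightarrow> transpose A = A"
  and F_closed: "closed F" and F_ne: "F \<noteq> {}" and F_proper: "F \<noteq> symmetric_matrices"
  and F_psd: "A \<in> F \<Longrightarrow> P \<in> psd_matrices \<Longrightarrow> A + P \<in> F"
  using F(1) by (auto simp: subequation_def symmetric_matrices_def)

lemma F_scale: "A \<in> F \<Longrightarrow> 0 \<le> c \<Longrightarrow> c *\<^sub>R A \<in> F"
  using F(3) by (auto simp: cone_def)

lemma F_add:
  assumes "A \<in> F" "B \<in> F" shows "A + B \<in> F"
proof -
  have "(1/2) *\<^sub>R A + (1/2) *\<^sub>R B \<in> F" using F(2) assms by (auto simp: convex_def)
  then have "2 *\<^sub>R ((1/2) *\<^sub>R A + (1/2) *\<^sub>R B) \<in> F" by (rule F_scale) simp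
  then show ?thesis by (simp add: scaleR_add_right)
qed

lemma F_0: "0 \<in> F"
  using F_ne F_scale[of _ 0] by auto

lemma psd_in_F: "P \<in> psd_matrices \<Longrightarrow> P \<in> F"
  using F_psd[OF F_0] by simp

lemma psd_scale_id: "0 \<le> c \<Longrightarrow> c *\<^sub>R mat 1 \<in> (psd_matrices :: (real^'n^'n) set)"
  by (simp add: psd_matrices_def symmetric_matrices_def transpose_scalar scaleR_matrix_vector_assoc[symmetric] transpose_mat)

text \<open>Averaging \<open>A\<close> over rotations gives almost a multiple of the identity with the same trace; were the trace
  negative, a negative definite matrix would lie in \<open>F\<close>, and then every symmetric matrix would.\<close>

lemma trace_nonneg:
  assumes A: "A \<in> F" shows "0 \<le> trace A"
proof (rule ccontr)
  assume neg: "\<not> 0 \<le> trace A"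
  let ?q = "\<lambda>x. x \<bullet> (A *v x)"
  \<comment> \<open>half the distance from the average of the quadratic form over the sphere to 0\<close>
  define \<delta> where "\<delta> = - (trace A / CARD('n)) / 2"
  have \<delta>: "\<delta> > 0" using neg by (simp add: \<delta>_def field_simps)
  have c: "continuous_on UNIV ?q" by (intro continuous_intros)
  obtain gs where gs: "gs \<noteq> []" "set gs \<subseteq> G"
    and close: "\<And>x. norm x \<le> 1 \<Longrightarrow> \<bar>orbit_mean_real gs ?q x - (\<integral>y. ?q (norm x *\<^sub>R sgn y) \<partial>ball_prob)\<bar> \<le> \<delta>"
    by (rule orbit_mean_real_close[OF c \<delta>, where R=1]) (rule that)
  define N where "N = (1 / real (length gs)) *\<^sub>R (\<Sum>g\<leftarrow>gs. transpose g ** A ** g)"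
  have "transpose g ** A ** g \<in> F" if "g \<in> G" for g
    using invariant[OF transpose_G[OF that] A] by simp
  then have "(\<Sum>g\<leftarrow>gs. transpose g ** A ** g) \<in> F"
    using gs(2) by (induction gs) (auto intro: F_add F_0)
  then have N: "N \<in> F" unfolding N_def by (intro F_scale) auto
  have neg_def: "v \<bullet> (N *v v) \<le> - \<delta> * (norm v)\<^sup>2" for v
  proof (cases "v = 0")
    case False
    have "sgn v \<bullet> (N *v sgn v) \<le> trace A / CARD('n) + \<delta>"
      using close[of "sgn v"] False unfolding orbit_quadratic[OF gs(1)] N_def[symmetric]
      by (simp add: norm_sgn sphere_mean_quadratic)
    then have "sgn v \<bullet> (N *v sgn v) \<le> - \<delta>" by (simp add: \<delta>_def)
    then have "(norm v)\<^sup>2 * (sgn v \<bullet> (N *v sgn v)) \<le> (norm v)\<^sup>2 * (- \<delta>)" by (intro mult_left_mono) auto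
    moreover have "v \<bullet> (N *v v) = (norm v *\<^sub>R sgn v) \<bullet> (N *v (norm v *\<^sub>R sgn v))"
      using False by (simp add: sgn_div_norm)
    then have "(norm v)\<^sup>2 * (sgn v \<bullet> (N *v sgn v)) = v \<bullet> (N *v v)"
      by (simp add: matrix_vector_mult_scaleR power2_eq_square)
    ultimately show ?thesis by (simp add: mult.commute)
  qed simp
  have "C \<in> F" if C: "C \<in> symmetric_matrices" for C
  proof -
    define t where "t = onorm ((*v) C) / \<delta>"
    have t: "t \<ge> 0" using \<delta> by (simp add: t_def onorm_pos_le)
    have "C - t *\<^sub>R N \<in> psd_matrices"
      unfolding psd_matrices_def
    proof (intro CollectI conjI allI)
      show "C - t *\<^sub>R N \<in> symmetric_matrices"
        using C F_sym[OF N] by (auto simp: symmetric_matrices_def transpose_def vec_eq_iff)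
      fix v
      have "\<bar>v \<bullet> (C *v v)\<bar> \<le> norm v * norm (C *v v)" by (rule Cauchy_Schwarz_ineq2)
      also have "\<dots> \<le> norm v * (onorm ((*v) C) * norm v)" by (intro mult_left_mono onorm) auto
      also have "\<dots> = t * (\<delta> * (norm v)\<^sup>2)" using \<delta> by (simp add: t_def power2_eq_square)
      also have "\<dots> \<le> t * (- (v \<bullet> (N *v v)))" using neg_def[of v] t by (intro mult_left_mono) auto
      finally show "0 \<le> v \<bullet> ((C - t *\<^sub>R N) *v v)"
        by (simp add: matrix_vector_mult_diff_rdistrib scaleR_matrix_vector_assoc[symmetric] inner_diff_right)
    qed
    then have "t *\<^sub>R N + (C - t *\<^sub>R N) \<in> F" by (intro F_psd F_scale N t)
    then show ?thesis by simp
  qed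
  then have "symmetric_matrices \<subseteq> F" by (rule subsetI)
  moreover have "F \<subseteq> symmetric_matrices" using F(1) by (auto simp: subequation_def)
  ultimately show False using F_proper by blast
qed

lemma neg_id_notin:
  assumes "\<delta> > 0" shows "(- \<delta>) *\<^sub>R mat 1 \<notin> F"
proof
  assume "(- \<delta>) *\<^sub>R mat 1 \<in> F"
  then have "0 \<le> trace ((- \<delta>) *\<^sub>R (mat 1 :: real^'n^'n))" by (rule trace_nonneg)
  also have "trace ((- \<delta>) *\<^sub>R (mat 1 :: real^'n^'n)) = - (\<delta> * real CARD('n))" by (simp add: trace_def mat_def)
  finally show False using assms by (simp add: mult_le_0_iff)
qed

lemma line_proj_conj: "g ** line_proj x ** transpose g = line_proj (g *v x)" for g :: "real^'n^'n"
proof -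
  have "(g ** line_proj x ** transpose g) *v v = line_proj (g *v x) *v v" for v
  proof -
    have "x \<bullet> (transpose g *v v) = (g *v x) \<bullet> v"
      using matrix_inner_transpose[of x "transpose g" v] by simp
    then show ?thesis
      unfolding matrix_vector_mul_assoc[symmetric] line_proj_mult matrix_vector_mult_scaleR by simp
  qed
  then show ?thesis by (simp add: matrix_eq)
qed

text \<open>Rescaling \<open>riesz_matrix e p - \<delta> I\<close> so that its restriction to the complement of \<open>e\<close> is the identity again gives
  \<open>riesz_matrix e q\<close> with \<open>q > p\<close>. Transitivity carries \<open>e\<close> to any other unit vector.\<close>

lemma riesz_matrix_notin:
  assumes "norm x = 1" "\<delta> > 0"
  shows "riesz_matrix x p - \<delta> *\<^sub>R mat 1 \<notin> F"
proof -
  obtain e where e: "norm e = 1" "riesz_characteristic F e = ereal p" using riesz by blast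
  have sup: "q \<le> p" if "riesz_matrix e q \<in> F" for q
  proof -
    have "ereal q \<le> riesz_characteristic F e"
      unfolding riesz_characteristic_def by (rule SUP_upper) (use that in \<open>simp add: riesz_matrix_def\<close>)
    then show ?thesis using e by simp
  qed
  have "v \<bullet> ((mat 1 - line_proj e) *v v) \<ge> 0" for v
  proof -
    have "(e \<bullet> v)\<^sup>2 \<le> v \<bullet> v" using Cauchy_Schwarz_ineq[of e v] e by (simp add: power2_norm_eq_inner[symmetric])
    then show ?thesis
      by (simp add: matrix_vector_mult_diff_rdistrib line_proj_mult inner_diff_right power2_eq_square inner_commute)
  qed
  moreover have "transpose (mat 1 - line_proj e) = mat 1 - line_proj e"
    by (auto simp: transpose_def vec_eq_iff line_proj_def mat_def)
  ultimately have "riesz_matrix e 1 \<in> F"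
    by (intro psd_in_F) (simp add: psd_matrices_def symmetric_matrices_def riesz_matrix_def)
  then have p1: "1 \<le> p" by (rule sup)
  have e_notin: "riesz_matrix e p - \<delta> *\<^sub>R mat 1 \<notin> F" if \<delta>: "\<delta> > 0" for \<delta>
  proof
    assume *: "riesz_matrix e p - \<delta> *\<^sub>R mat 1 \<in> F"
    \<comment> \<open>the coefficient \<open>1 - d\<close> must stay positive\<close>
    define d where "d = min \<delta> (1/2)"
    have d: "0 < d" "d < 1" "d \<le> \<delta>" using \<delta> by (auto simp: d_def)
    have "(riesz_matrix e p - \<delta> *\<^sub>R mat 1) + (\<delta> - d) *\<^sub>R mat 1 \<in> F"
      using d by (intro F_psd[OF *] psd_scale_id) simp
    then have "(1 / (1 - d)) *\<^sub>R (riesz_matrix e p - d *\<^sub>R mat 1) \<in> F"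
      using d by (intro F_scale) (auto simp: algebra_simps)
    moreover have "(1 / (1 - d)) *\<^sub>R (riesz_matrix e p - d *\<^sub>R mat 1) = riesz_matrix e (1 + (p - 1 + d) / (1 - d))"
      using d by (simp add: riesz_matrix_def vec_eq_iff mat_def divide_simps) (simp add: algebra_simps)
    ultimately have "1 + (p - 1 + d) / (1 - d) \<le> p" using sup by simp
    then have "(p - 1 + d) \<le> (p - 1) * (1 - d)" using d by (simp add: field_simps)
    then have "d \<le> - (p - 1) * d" by (simp add: algebra_simps)
    moreover have "- (p - 1) * d \<le> 0" using p1 d by (simp add: mult_le_0_iff)
    ultimately show False using d by linarith
  qed
  show ?thesis
  proof
    assume *: "riesz_matrix x p - \<delta> *\<^sub>R mat 1 \<in> F"
    have "x \<in> sphere 0 1" "e \<in> sphere 0 1" using assms e by auto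
    then obtain g where g: "g \<in> G" "g *v x = e" using transitive by blast
    have id: "g ** transpose g = mat 1" using orth[OF g(1)] by (simp add: orthogonal_matrix_def)
    have lin: "g ** (A - B) ** transpose g = g ** A ** transpose g - g ** B ** transpose g"
      "g ** (c *\<^sub>R A) ** transpose g = c *\<^sub>R (g ** A ** transpose g)" for A B c
      by (simp_all add: vec_eq_iff matrix_matrix_mult_def sum_subtractf algebra_simps sum_distrib_left sum_distrib_right)
    have "g ** (riesz_matrix x p - \<delta> *\<^sub>R mat 1) ** transpose g = riesz_matrix e p - \<delta> *\<^sub>R mat 1"
      unfolding riesz_matrix_def lin line_proj_conj g(2) by (simp add: id)
    then show False using invariant[OF g(1) *] e_notin[OF assms(2)] by simp
  qed
qed

text \<open>A hyperplane separates \<open>H\<close> from the closed convex cone \<open>F\<close>. Adding a small multiple of the trace, which is nonnegative on \<open>F\<close>,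
  makes the separating functional positive definite, and then it is of the form \<open>A A\<^sup>t\<close> with \<open>A\<close> invertible.\<close>

lemma separation:
  assumes H: "H \<notin> F" "transpose H = H"
  obtains A :: "real^'n^'n" where "invertible A" "(A ** transpose A) \<bullet> H < 0" "\<And>C. C \<in> F \<Longrightarrow> 0 \<le> (A ** transpose A) \<bullet> C"
proof -
  obtain a b where ab: "a \<bullet> H < b" "\<And>C. C \<in> F \<Longrightarrow> b < a \<bullet> C"
    using separating_hyperplane_closed_point[OF F(2) F_closed H(1)] by auto
  have b: "b < 0" using ab(2)[OF F_0] by simp
  have pos: "0 \<le> a \<bullet> C" if C: "C \<in> F" for C
  proof (rule ccontr)
    assume n: "\<not> 0 \<le> a \<bullet> C"
    have "b < a \<bullet> ((b / (a \<bullet> C)) *\<^sub>R C)"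
      using b n by (intro ab(2) F_scale[OF C] divide_nonpos_nonpos) auto
    then show False using n by simp
  qed
  \<comment> \<open>so small that adding \<open>d\<close> times the trace keeps the functional negative at \<open>H\<close>\<close>
  define d where "d = - (a \<bullet> H) / (2 * (\<bar>trace H\<bar> + 1))"
  have aH: "a \<bullet> H < 0" using ab b by simp
  then have d: "d > 0" by (simp add: d_def field_simps)
  define B where "B = (1/2) *\<^sub>R (a + transpose a) + d *\<^sub>R mat 1"
  have aT: "transpose a \<bullet> C = a \<bullet> C" if "transpose C = C" for C
  proof -
    have "transpose a \<bullet> C = (\<Sum>i\<in>UNIV. \<Sum>j\<in>UNIV. a $ j $ i * C $ j $ i)"
      using that by (auto simp: inner_vec_def transpose_def vec_eq_iff intro!: sum.cong)
    also have "\<dots> = a \<bullet> C" by (subst sum.swap) (simp add: inner_vec_def)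
    finally show ?thesis .
  qed
  have BC: "B \<bullet> C = a \<bullet> C + d * trace C" if "transpose C = C" for C
    using aT[OF that] inner_mat_1[of C] by (simp add: B_def inner_add_left inner_commute[of "mat 1"])
  have lpF: "line_proj v \<in> F" for v
    by (intro psd_in_F) (auto simp: psd_matrices_def symmetric_matrices_def line_proj_symmetric line_proj_mult inner_commute)
  have Bv: "v \<bullet> (B *v v) = a \<bullet> line_proj v + d * (v \<bullet> v)" for v
  proof -
    have "trace (line_proj v) = v \<bullet> v" by (simp add: trace_def line_proj_def inner_vec_def)
    then show ?thesis using BC[OF line_proj_symmetric[of v]] by (simp only: inner_line_proj[of B])
  qed
  have sym: "transpose B = B"
    by (simp add: B_def transpose_def vec_eq_iff mat_def)
  have psd: "0 \<le> v \<bullet> (B *v v)" for v using pos[OF lpF[of v]] d by (simp add: Bv)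
  obtain A :: "real^'n^'n" where A: "B = A ** transpose A" using psd_sqrt[OF sym psd] by blast
  show ?thesis
  proof (rule that[of A])
    have "\<forall>v. transpose A *v v = 0 \<longrightarrow> v = 0"
    proof (intro allI impI)
      fix v assume "transpose A *v v = 0"
      then have "B *v v = 0" unfolding A matrix_vector_mul_assoc[symmetric] by simp
      then have "a \<bullet> line_proj v + d * (v \<bullet> v) = 0" using Bv[of v] by simp
      then have "d * (v \<bullet> v) \<le> 0" using pos[OF lpF[of v]] by linarith
      then have "v \<bullet> v \<le> 0" using d by (simp add: mult_le_0_iff)
      then show "v = 0" by (metis inner_eq_zero_iff inner_ge_zero antisym)
    qed
    then have "\<exists>B'. B' ** transpose A = mat 1" by (simp add: matrix_left_invertible_ker)
    then have "invertible (transpose A)" by (simp add: invertible_left_inverse)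
    then show "invertible A" by (simp add: invertible_det_nz)
    have "a \<bullet> H + d * trace H \<le> a \<bullet> H + d * (\<bar>trace H\<bar> + 1)" using d by (intro add_left_mono mult_left_mono) auto
    also have "d * (\<bar>trace H\<bar> + 1) = - (a \<bullet> H) / 2" by (simp add: d_def field_simps)
    finally show "(A ** transpose A) \<bullet> H < 0" using BC[OF H(2)] aH by (simp add: A)
    show "0 \<le> (A ** transpose A) \<bullet> C" if "C \<in> F" for C
      using BC[OF F_sym[OF that]] pos[OF that] trace_nonneg[OF that] d by (simp add: A)
  qed
qed

end

section \<open>Second order calculus\<close>

definition outer :: "real^'n \<Rightarrow> real^'n \<Rightarrow> real^'n^'n" where
  "outer a b = (\<chi> i j. a $ i * b $ j)"

lemma outer_mult: "outer a b *v h = (b \<bullet> h) *\<^sub>R a"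
  by (simp add: outer_def matrix_vector_mult_def vec_eq_iff inner_vec_def sum_distrib_right sum_distrib_left mult_ac)

lemma trace_outer: "trace (outer a b) = a \<bullet> b"
  by (simp add: trace_def outer_def inner_vec_def)

lemma transpose_outer: "transpose (outer a b) = outer b a"
  by (simp add: transpose_def outer_def vec_eq_iff mult.commute)

lemma continuous_on_outer[continuous_intros]:
  "continuous_on S f \<Longrightarrow> continuous_on S g \<Longrightarrow> continuous_on S (\<lambda>x. outer (f x) (g x))"
  unfolding outer_def by (intro continuous_intros)

text \<open>One computation for ridge polynomials, radial barriers and quadratic polynomials.\<close>

lemma C2_with_ridge_radial:
  fixes a :: "real^'n" and \<alpha> \<alpha>1 \<alpha>2 \<beta> \<beta>1 \<beta>2 :: "real \<Rightarrow> real"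
  assumes \<alpha>: "\<And>s. (\<alpha> has_real_derivative \<alpha>1 s) (at s)" "\<And>s. (\<alpha>1 has_real_derivative \<alpha>2 s) (at s)" "continuous_on UNIV \<alpha>2"
    and \<beta>: "\<And>q. q \<in> J \<Longrightarrow> (\<beta> has_real_derivative \<beta>1 q) (at q)" "\<And>q. q \<in> J \<Longrightarrow> (\<beta>1 has_real_derivative \<beta>2 q) (at q)"
      "continuous_on J \<beta>2" "open J"
  shows "C2_with {x. x \<bullet> x \<in> J} (\<lambda>x. \<alpha> (a \<bullet> x) * \<beta> (x \<bullet> x))
     (\<lambda>x. (\<alpha>1 (a \<bullet> x) * \<beta> (x \<bullet> x)) *\<^sub>R a + (2 * \<alpha> (a \<bullet> x) * \<beta>1 (x \<bullet> x)) *\<^sub>R x)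
     (\<lambda>x. (\<alpha>2 (a \<bullet> x) * \<beta> (x \<bullet> x)) *\<^sub>R outer a a + (2 * \<alpha>1 (a \<bullet> x) * \<beta>1 (x \<bullet> x)) *\<^sub>R (outer a x + outer x a)
        + (4 * \<alpha> (a \<bullet> x) * \<beta>2 (x \<bullet> x)) *\<^sub>R outer x x + (2 * \<alpha> (a \<bullet> x) * \<beta>1 (x \<bullet> x)) *\<^sub>R mat 1)"
proof -
  have dA: "((\<lambda>x. f (a \<bullet> x)) has_derivative (\<lambda>h. f' (a \<bullet> x) * (a \<bullet> h))) (at x)"
    if "\<And>s. (f has_real_derivative f' s) (at s)" for f f' and x :: "real^'n"
    using has_derivative_compose[of "\<lambda>x. a \<bullet> x" "\<lambda>h. a \<bullet> h" x UNIV f "\<lambda>t. f' (a \<bullet> x) * t"] that[of "a \<bullet> x"]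
      bounded_linear_imp_has_derivative[OF bounded_linear_inner_right[of a], of "at x"]
    by (auto simp: has_field_derivative_def)
  have dB: "((\<lambda>x. f (x \<bullet> x)) has_derivative (\<lambda>h. f' (x \<bullet> x) * (2 * (x \<bullet> h)))) (at x)"
    if "(f has_real_derivative f' (x \<bullet> x)) (at (x \<bullet> x))" for f f' and x :: "real^'n"
  proof -
    have "((\<lambda>x. x \<bullet> x) has_derivative (\<lambda>h. 2 * (x \<bullet> h))) (at x)"
      by (auto intro!: derivative_eq_intros simp: inner_commute)
    then show ?thesis
      using has_derivative_compose[of "\<lambda>x. x \<bullet> x" "\<lambda>h. 2 * (x \<bullet> h)" x UNIV f "\<lambda>t. f' (x \<bullet> x) * t"] that
      by (auto simp: has_field_derivative_def)
  qed
  have contd: "continuous_on S (\<lambda>x. f (g x))" if "\<And>s. s \<in> T \<Longrightarrow> (f has_real_derivative f' s) (at s)" "continuous_on S g" "g ` S \<subseteq> T"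
    for f f' :: "real \<Rightarrow> real" and g :: "real^'n \<Rightarrow> real" and S T
    using that by (intro continuous_on_compose2[OF _ that(2), of T f] DERIV_continuous_on[of T f f'])
       (auto intro: has_field_derivative_at_within)
  have op: "open {x::real^'n. x \<bullet> x \<in> J}"
    using continuous_open_preimage[of UNIV "\<lambda>x::real^'n. x \<bullet> x" J] \<beta>(4)
    by (simp add: vimage_def continuous_on_inner)
  let ?N = "{x::real^'n. x \<bullet> x \<in> J}"
  have cont: "continuous_on ?N (\<lambda>x. \<alpha> (a \<bullet> x))" "continuous_on ?N (\<lambda>x. \<alpha>1 (a \<bullet> x))" "continuous_on ?N (\<lambda>x. \<alpha>2 (a \<bullet> x))"
     "continuous_on ?N (\<lambda>x. \<beta> (x \<bullet> x))" "continuous_on ?N (\<lambda>x. \<beta>1 (x \<bullet> x))" "continuous_on ?N (\<lambda>x. \<beta>2 (x \<bullet> x))"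
    by (rule contd[of UNIV, OF \<alpha>(1)] contd[of UNIV, OF \<alpha>(2)] contd[of J, OF \<beta>(1)] contd[of J, OF \<beta>(2)]
        continuous_on_compose2[OF \<alpha>(3)] continuous_on_compose2[OF \<beta>(3)];
        auto intro!: continuous_intros)+
  show ?thesis
    unfolding C2_with_def
  proof (intro conjI ballI op)
    fix x :: "real^'n" assume "x \<in> ?N"
    then have x: "x \<bullet> x \<in> J" by simp
    note d = dA[OF \<alpha>(1), of x] dA[OF \<alpha>(2), of x] dB[of \<beta> \<beta>1 x, OF \<beta>(1)[OF x]] dB[of \<beta>1 \<beta>2 x, OF \<beta>(2)[OF x]]
    show "((\<lambda>x. \<alpha> (a \<bullet> x) * \<beta> (x \<bullet> x)) has_derivative
        (\<lambda>h. ((\<alpha>1 (a \<bullet> x) * \<beta> (x \<bullet> x)) *\<^sub>R a + (2 * \<alpha> (a \<bullet> x) * \<beta>1 (x \<bullet> x)) *\<^sub>R x) \<bullet> h)) (at x)"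
      by (rule has_derivative_eq_rhs[OF has_derivative_mult[OF d(1) d(3)]])
         (auto simp: fun_eq_iff inner_add_left algebra_simps)
    have "((\<lambda>x. (\<alpha>1 (a \<bullet> x) * \<beta> (x \<bullet> x)) *\<^sub>R a + (2 * (\<alpha> (a \<bullet> x) * \<beta>1 (x \<bullet> x))) *\<^sub>R x) has_derivative
        (\<lambda>h. (\<alpha>1 (a \<bullet> x) * (\<beta>1 (x \<bullet> x) * (2 * (x \<bullet> h))) + \<alpha>2 (a \<bullet> x) * (a \<bullet> h) * \<beta> (x \<bullet> x)) *\<^sub>R a
          + ((2 * (\<alpha> (a \<bullet> x) * \<beta>1 (x \<bullet> x))) *\<^sub>R h
          + (2 * (\<alpha> (a \<bullet> x) * (\<beta>2 (x \<bullet> x) * (2 * (x \<bullet> h))) + \<alpha>1 (a \<bullet> x) * (a \<bullet> h) * \<beta>1 (x \<bullet> x))) *\<^sub>R x))) (at x)"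
      by (intro has_derivative_add has_derivative_scaleR_left has_derivative_mult d
          has_derivative_scaleR has_derivative_mult_right has_derivative_ident)
    then show "((\<lambda>x. (\<alpha>1 (a \<bullet> x) * \<beta> (x \<bullet> x)) *\<^sub>R a + (2 * \<alpha> (a \<bullet> x) * \<beta>1 (x \<bullet> x)) *\<^sub>R x) has_derivative
       (*v) ((\<alpha>2 (a \<bullet> x) * \<beta> (x \<bullet> x)) *\<^sub>R outer a a + (2 * \<alpha>1 (a \<bullet> x) * \<beta>1 (x \<bullet> x)) *\<^sub>R (outer a x + outer x a)
        + (4 * \<alpha> (a \<bullet> x) * \<beta>2 (x \<bullet> x)) *\<^sub>R outer x x + (2 * \<alpha> (a \<bullet> x) * \<beta>1 (x \<bullet> x)) *\<^sub>R mat 1)) (at x)"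
      apply (simp only: mult.assoc)
      apply (rule has_derivative_eq_rhs, assumption)
      apply (rule ext)
      apply (simp only: matrix_vector_mult_add_rdistrib scaleR_matrix_vector_assoc[symmetric] outer_mult matrix_vector_mul_lid)
      apply (simp add: algebra_simps scaleR_add_left[symmetric] del: scaleR_add_left)
      apply (simp add: scaleR_add_left algebra_simps)
      done
  next
    show "continuous_on ?N (\<lambda>x. (\<alpha>2 (a \<bullet> x) * \<beta> (x \<bullet> x)) *\<^sub>R outer a a + (2 * \<alpha>1 (a \<bullet> x) * \<beta>1 (x \<bullet> x)) *\<^sub>R (outer a x + outer x a)
        + (4 * \<alpha> (a \<bullet> x) * \<beta>2 (x \<bullet> x)) *\<^sub>R outer x x + (2 * \<alpha> (a \<bullet> x) * \<beta>1 (x \<bullet> x)) *\<^sub>R mat 1)"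
      by (intro continuous_intros cont)
  qed
qed

lemma C2_with_add:
  assumes "C2_with N \<phi> D H" "C2_with N \<psi> E K"
  shows "C2_with N (\<lambda>x. \<phi> x + \<psi> x) (\<lambda>x. D x + E x) (\<lambda>x. H x + K x)"
  using assms unfolding C2_with_def
  by (auto simp: inner_add_left matrix_vector_mult_add_rdistrib
     intro!: derivative_eq_intros continuous_intros)

lemma C2_with_scale:
  assumes "C2_with N \<phi> D H"
  shows "C2_with N (\<lambda>x. c * \<phi> x) (\<lambda>x. c *\<^sub>R D x) (\<lambda>x. c *\<^sub>R H x)"
  using assms unfolding C2_with_def
  by (auto simp: scaleR_matrix_vector_assoc[symmetric] intro!: derivative_eq_intros continuous_intros)

lemma C2_with_const: "open N \<Longrightarrow> C2_with N (\<lambda>x. c) (\<lambda>x. 0) (\<lambda>x. 0)"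
  unfolding C2_with_def by (auto intro!: derivative_eq_intros)

lemma C2_with_subset: "C2_with N \<phi> D H \<Longrightarrow> open M \<Longrightarrow> M \<subseteq> N \<Longrightarrow> C2_with M \<phi> D H"
  unfolding C2_with_def by (auto intro: continuous_on_subset)

lemma C2_with_continuous: "C2_with N \<phi> D H \<Longrightarrow> continuous_on N \<phi>"
  unfolding C2_with_def
  by (meson has_derivative_at_withinI has_derivative_continuous_on)

lemma C2_with_affine:
  fixes A :: "real^'n^'n"
  assumes "C2_with N \<phi> D H"
  shows "C2_with {x. x0 + A *v x \<in> N} (\<lambda>x. \<phi> (x0 + A *v x)) (\<lambda>x. transpose A *v D (x0 + A *v x))
     (\<lambda>x. transpose A ** H (x0 + A *v x) ** A)"
proof -
  let ?L = "\<lambda>x. x0 + A *v x"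
  have dL: "(?L has_derivative (\<lambda>h. A *v h)) (at x)" for x
    by (auto intro!: derivative_eq_intros bounded_linear_imp_has_derivative)
  have cL: "continuous_on UNIV ?L" by (intro continuous_intros)
  have inner: "(transpose A *v d) \<bullet> h = d \<bullet> (A *v h)" for d h
    by (metis dot_lmul_matrix transpose_matrix_vector)
  have cm: "continuous_on S (\<lambda>x. B ** f x ** C)" if "continuous_on S f"
    for S and f :: "real^'n \<Rightarrow> real^'n^'n" and B C :: "real^'n^'n"
    unfolding matrix_matrix_mult_def using that by (intro continuous_intros)
  show ?thesis
    unfolding C2_with_def
  proof (intro conjI ballI)
    show "open {x. ?L x \<in> N}"
      using open_vimage[OF _ cL, of N] assms by (simp add: C2_with_def vimage_def)
    show "continuous_on {x. ?L x \<in> N} (\<lambda>x. transpose A ** H (?L x) ** A)"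
    proof (rule cm)
      show "continuous_on {x. ?L x \<in> N} (\<lambda>x. H (?L x))"
        using assms unfolding C2_with_def
        by (intro continuous_on_compose2[of N H _ ?L] continuous_on_subset[OF cL]) auto
    qed
  next
    fix x assume x: "x \<in> {x. ?L x \<in> N}"
    then have d1: "(\<phi> has_derivative (\<lambda>h. D (?L x) \<bullet> h)) (at (?L x))"
      and d2: "(D has_derivative (\<lambda>h. H (?L x) *v h)) (at (?L x))"
      using assms by (auto simp: C2_with_def)
    show "((\<lambda>x. \<phi> (?L x)) has_derivative (\<lambda>h. (transpose A *v D (?L x)) \<bullet> h)) (at x)"
      unfolding inner by (rule has_derivative_compose[OF dL d1])
    have "((\<lambda>x. transpose A *v D (?L x)) has_derivative (\<lambda>h. transpose A *v (H (?L x) *v (A *v h)))) (at x)"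
      by (rule bounded_linear.has_derivative[OF matrix_vector_mul_bounded_linear has_derivative_compose[OF dL d2]])
    then show "((\<lambda>x. transpose A *v D (?L x)) has_derivative (*v) (transpose A ** H (?L x) ** A)) (at x)"
      by (simp add: matrix_vector_mul_assoc matrix_mul_assoc del: transpose_matrix_vector)
  qed
qed

lemma taylor2:
  fixes \<phi> :: "real^'n \<Rightarrow> real"
  assumes C2: "C2_with N \<phi> D H" and x0: "x0 \<in> N" and sym: "transpose (H x0) = H x0" and e: "\<epsilon> > 0"
  obtains \<delta> where "\<delta> > 0" "\<And>y. norm (y - x0) < \<delta> \<Longrightarrow>
    \<bar>\<phi> y - (\<phi> x0 + D x0 \<bullet> (y - x0) + (y - x0) \<bullet> (H x0 *v (y - x0)) / 2)\<bar> \<le> \<epsilon> * (norm (y - x0))\<^sup>2"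
proof -
  have op: "open N" and d1: "\<And>x. x \<in> N \<Longrightarrow> (\<phi> has_derivative (\<lambda>h. D x \<bullet> h)) (at x)"
    and d2: "(D has_derivative (\<lambda>h. H x0 *v h)) (at x0)"
    using C2 x0 by (auto simp: C2_with_def)
  obtain \<delta>1 where \<delta>1: "\<delta>1 > 0" "ball x0 \<delta>1 \<subseteq> N" using op x0 by (meson openE)
  obtain \<delta>2 where \<delta>2: "\<delta>2 > 0" "\<And>y. norm (y - x0) < \<delta>2 \<Longrightarrow> norm (D y - D x0 - H x0 *v (y - x0)) \<le> \<epsilon> * norm (y - x0)"
    using d2 e unfolding has_derivative_at_alt by blast
  define R where "R y = \<phi> y - (D x0 \<bullet> (y - x0) + (y - x0) \<bullet> (H x0 *v (y - x0)) / 2)" for y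
  have symm: "a \<bullet> (H x0 *v b) = b \<bullet> (H x0 *v a)" for a b
    by (metis dot_lmul_matrix inner_commute sym transpose_matrix_vector)
  have dR: "(R has_derivative (\<lambda>h. (D y - D x0 - H x0 *v (y - x0)) \<bullet> h)) (at y)" if "y \<in> N" for y
  proof -
    have q: "((\<lambda>y. (y - x0) \<bullet> (H x0 *v (y - x0))) has_derivative (\<lambda>h. 2 * ((H x0 *v (y - x0)) \<bullet> h))) (at y)"
    proof -
      have l: "((\<lambda>y. H x0 *v (y - x0)) has_derivative (\<lambda>h. H x0 *v h)) (at y)"
        by (rule bounded_linear.has_derivative[OF matrix_vector_mul_bounded_linear]) (auto intro!: derivative_eq_intros)
      have "((\<lambda>y. (y - x0) \<bullet> (H x0 *v (y - x0))) has_derivative (\<lambda>h. (y - x0) \<bullet> (H x0 *v h) + h \<bullet> (H x0 *v (y - x0)))) (at y)"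
        by (rule has_derivative_inner[OF _ l]) (auto intro!: derivative_eq_intros)
      then show ?thesis by (rule has_derivative_eq_rhs) (auto simp: fun_eq_iff symm[of "y - x0"] inner_commute)
    qed
    show ?thesis unfolding R_def
      by (rule has_derivative_eq_rhs, (rule derivative_intros d1[OF that] q)+)
         (auto simp: fun_eq_iff inner_diff_left)
  qed
  show ?thesis
  proof (rule that[of "min \<delta>1 \<delta>2"])
    show "min \<delta>1 \<delta>2 > 0" using \<delta>1 \<delta>2 by simp
    fix y assume y: "norm (y - x0) < min \<delta>1 \<delta>2"
    let ?S = "cball x0 (norm (y - x0))"
    have S: "?S \<subseteq> N" using y \<delta>1(2) by (auto simp: dist_norm norm_minus_commute)
    have "norm (R y - R x0) \<le> (\<epsilon> * norm (y - x0)) * norm (y - x0)"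
    proof (rule differentiable_bound[of ?S R "\<lambda>z h. (D z - D x0 - H x0 *v (z - x0)) \<bullet> h"])
      show "(R has_derivative (\<lambda>h. (D z - D x0 - H x0 *v (z - x0)) \<bullet> h)) (at z within ?S)" if "z \<in> ?S" for z
        using dR S that by (blast intro: has_derivative_at_withinI)
      fix z assume z: "z \<in> ?S"
      have "norm (D z - D x0 - H x0 *v (z - x0)) \<le> \<epsilon> * norm (z - x0)"
        using z y by (intro \<delta>2(2)) (auto simp: dist_norm norm_minus_commute)
      also have "\<dots> \<le> \<epsilon> * norm (y - x0)"
        using z e by (intro mult_left_mono) (auto simp: dist_norm norm_minus_commute)
      finally have b: "norm (D z - D x0 - H x0 *v (z - x0)) \<le> \<epsilon> * norm (y - x0)" .
      show "onorm (\<lambda>h. (D z - D x0 - H x0 *v (z - x0)) \<bullet> h) \<le> \<epsilon> * norm (y - x0)"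
        by (rule onorm_le) (metis Cauchy_Schwarz_ineq2 b mult_right_mono norm_ge_zero order_trans real_norm_def)
    qed (auto simp: dist_norm norm_minus_commute)
    moreover have "R x0 = \<phi> x0" by (simp add: R_def)
    ultimately show "\<bar>\<phi> y - (\<phi> x0 + D x0 \<bullet> (y - x0) + (y - x0) \<bullet> (H x0 *v (y - x0)) / 2)\<bar> \<le> \<epsilon> * (norm (y - x0))\<^sup>2"
      by (simp add: R_def power2_eq_square algebra_simps)
  qed
qed

section \<open>Upper semicontinuous functions and viscosity comparison\<close>

definition usc_on :: "(real^'n) set \<Rightarrow> (real^'n \<Rightarrow> ereal) \<Rightarrow> bool" where
  "usc_on X u \<longleftrightarrow> (\<forall>x\<in>X. u x < \<infinity> \<and> (\<forall>c. u x < c \<longrightarrow> eventually (\<lambda>y. u y < c) (at x within X)))"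

text \<open>By the symmetry of second derivatives, restricting to test functions with symmetric second derivative is no loss; it makes
  the second derivatives accessible to quadratic forms.\<close>

definition viscosity :: "(real^'n^'n) set \<Rightarrow> (real^'n) set \<Rightarrow> (real^'n \<Rightarrow> ereal) \<Rightarrow> bool" where
  "viscosity F X u \<longleftrightarrow> (\<forall>x0\<in>X. \<forall>N \<phi> D H. x0 \<in> N \<and> C2_with N \<phi> D H \<and> transpose (H x0) = H x0 \<and>
      eventually (\<lambda>x. u x \<le> ereal (\<phi> x)) (nhds x0) \<and> u x0 = ereal (\<phi> x0) \<longrightarrow> H x0 \<in> F)"

lemma usc_on_subset: "usc_on X u \<Longrightarrow> Y \<subseteq> X \<Longrightarrow> usc_on Y u"
  unfolding usc_on_def by (meson filter_leD at_le subset_iff)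

lemma usc_onD:
  assumes "usc_on X u" "x \<in> X" "u x < c"
  obtains \<delta> where "\<delta> > 0" "\<And>y. y \<in> X \<Longrightarrow> dist y x < \<delta> \<Longrightarrow> u y < c"
proof -
  have "eventually (\<lambda>y. u y < c) (at x within X)" using assms by (auto simp: usc_on_def)
  then obtain \<delta> where "\<delta> > 0" "\<And>y. y \<in> X \<Longrightarrow> y \<noteq> x \<Longrightarrow> dist y x < \<delta> \<Longrightarrow> u y < c"
    by (auto simp: eventually_at)
  then show ?thesis using that[of \<delta>] assms(3) by metis
qed

lemma usc_onI:
  assumes "\<And>x. x \<in> X \<Longrightarrow> u x < \<infinity>"
    and "\<And>x c. x \<in> X \<Longrightarrow> u x < c \<Longrightarrow> \<exists>\<delta>>0. \<forall>y\<in>X. dist y x < \<delta> \<longrightarrow> u y < c"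
  shows "usc_on X u"
  unfolding usc_on_def eventually_at using assms by blast

lemma usc_on_minus:
  fixes \<phi> :: "real^'n \<Rightarrow> real"
  assumes u: "usc_on X u" and \<phi>: "continuous_on X \<phi>"
  shows "usc_on X (\<lambda>x. u x - ereal (\<phi> x))"
proof (rule usc_onI)
  fix x assume x: "x \<in> X"
  then have "u x < \<infinity>" using u by (auto simp: usc_on_def)
  then show "u x - ereal (\<phi> x) < \<infinity>" by (cases "u x") auto
  fix c assume c: "u x - ereal (\<phi> x) < c"
  obtain d where d: "u x - ereal (\<phi> x) < ereal d" "ereal d < c" using c ereal_dense2 by blast
  then have "u x < ereal (d + \<phi> x)" by (cases "u x") auto
  then obtain a where a: "u x < ereal a" "a < d + \<phi> x" using ereal_dense2[of "u x" "ereal (d + \<phi> x)"] by auto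
  obtain \<delta>1 where \<delta>1: "\<delta>1 > 0" "\<And>y. y \<in> X \<Longrightarrow> dist y x < \<delta>1 \<Longrightarrow> u y < ereal a"
    using usc_onD[OF u x a(1)] by blast
  obtain \<delta>2 where \<delta>2: "\<delta>2 > 0" "\<And>y. y \<in> X \<Longrightarrow> dist y x < \<delta>2 \<Longrightarrow> dist (\<phi> y) (\<phi> x) < d + \<phi> x - a"
    using \<phi> x a(2) unfolding continuous_on_iff by (meson diff_gt_0_iff_gt)
  have "u y - ereal (\<phi> y) < c" if "y \<in> X" "dist y x < min \<delta>1 \<delta>2" for y
  proof -
    have "u y < ereal a" "dist (\<phi> y) (\<phi> x) < d + \<phi> x - a" using that \<delta>1 \<delta>2 by auto
    then have "u y - ereal (\<phi> y) \<le> ereal d" by (cases "u y") (auto simp: dist_real_def)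
    then show ?thesis using d(2) by order
  qed
  then show "\<exists>\<delta>>0. \<forall>y\<in>X. dist y x < \<delta> \<longrightarrow> u y - ereal (\<phi> y) < c"
    using \<delta>1(1) \<delta>2(1) by (metis min_less_iff_conj)
qed

lemma usc_attains_max:
  assumes "compact C" "C \<noteq> {}" "usc_on C u"
  obtains x where "x \<in> C" "\<And>y. y \<in> C \<Longrightarrow> u y \<le> u x"
proof (rule ccontr)
  assume n: "\<not> thesis"
  have "\<forall>x\<in>C. \<exists>y\<in>C. u x < u y"
  proof (rule ccontr)
    assume "\<not> (\<forall>x\<in>C. \<exists>y\<in>C. u x < u y)"
    then obtain x where "x \<in> C" "\<And>y. y \<in> C \<Longrightarrow> u y \<le> u x" by (auto simp: not_less)
    then show False using that n by blast
  qed
  then obtain f where f: "\<And>x. x \<in> C \<Longrightarrow> f x \<in> C" "\<And>x. x \<in> C \<Longrightarrow> u x < u (f x)" by metis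
  have "\<forall>x\<in>C. \<exists>\<delta>>0. \<forall>y\<in>C. dist y x < \<delta> \<longrightarrow> u y < u (f x)"
    using usc_onD[OF assms(3)] f(2) by metis
  then obtain \<delta> where \<delta>: "\<And>x. x \<in> C \<Longrightarrow> \<delta> x > 0" "\<And>x y. x \<in> C \<Longrightarrow> y \<in> C \<Longrightarrow> dist y x < \<delta> x \<Longrightarrow> u y < u (f x)" by metis
  have "C \<subseteq> (\<Union>x\<in>C. ball x (\<delta> x))" using \<delta>(1) by force
  then obtain K where K: "K \<subseteq> C" "finite K" "C \<subseteq> (\<Union>x\<in>K. ball x (\<delta> x))"
    using compactE_image[OF assms(1), of C "\<lambda>x. ball x (\<delta> x)"] by auto
  have "K \<noteq> {}" using K(3) assms(2) by auto
  then have fin: "finite ((\<lambda>x. u (f x)) ` K)" "(\<lambda>x. u (f x)) ` K \<noteq> {}" using K(2) by auto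
  obtain k where k: "k \<in> K" "u (f k) = Max ((\<lambda>x. u (f x)) ` K)" using Max_in[OF fin] by auto
  have "f k \<in> C" using k K f by auto
  then obtain j where j: "j \<in> K" "dist (f k) j < \<delta> j" using K(3) by (auto simp: dist_commute)
  have "u (f k) < u (f j)" using \<delta>(2)[OF _ \<open>f k \<in> C\<close> j(2)] j(1) K(1) by blast
  moreover have "u (f j) \<le> u (f k)" using k(2) j(1) fin(1) by (metis Max_ge image_eqI)
  ultimately show False by simp
qed

text \<open>At a positive maximum of \<open>u - \<phi>\<close>, the function \<open>\<phi>\<close> plus a constant would be a test function with second derivative outside \<open>F\<close>.\<close>

lemma comparison:
  assumes C: "compact C" and O: "open O'" "O' \<subseteq> C" "O' \<subseteq> X"
    and v: "viscosity F X u" and usc: "usc_on C u"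
    and \<phi>: "C2_with O' \<phi> D H" "continuous_on C \<phi>"
    and H: "\<And>x. x \<in> O' \<Longrightarrow> transpose (H x) = H x" "\<And>x. x \<in> O' \<Longrightarrow> H x \<notin> F"
    and bd: "\<And>x. x \<in> C - O' \<Longrightarrow> u x \<le> ereal (\<phi> x)"
    and x: "x \<in> C"
  shows "u x \<le> ereal (\<phi> x)"
proof (rule ccontr)
  assume n: "\<not> u x \<le> ereal (\<phi> x)"
  have ne: "C \<noteq> {}" using x by auto
  obtain x0 where x0: "x0 \<in> C" "\<And>y. y \<in> C \<Longrightarrow> u y - ereal (\<phi> y) \<le> u x0 - ereal (\<phi> x0)"
    using usc_attains_max[OF C ne usc_on_minus[OF usc \<phi>(2)]] by blast
  have fin: "\<And>y. y \<in> C \<Longrightarrow> u y < \<infinity>" using usc by (auto simp: usc_on_def)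
  have "0 < u x - ereal (\<phi> x)" using n fin[OF x] by (cases "u x") auto
  also have "\<dots> \<le> u x0 - ereal (\<phi> x0)" by (rule x0(2)[OF x])
  finally have pos: "0 < u x0 - ereal (\<phi> x0)" .
  then obtain m where m: "u x0 = ereal (\<phi> x0 + m)" "m > 0" using fin[OF x0(1)] 
    by (cases "u x0") (auto, metis add.commute diff_add_cancel diff_gt_0_iff_gt)
  have x0O: "x0 \<in> O'"
  proof (rule ccontr)
    assume "x0 \<notin> O'"
    then have "u x0 \<le> ereal (\<phi> x0)" using bd x0(1) by blast
    then show False using m by simp
  qed
  have C2: "C2_with O' (\<lambda>x. \<phi> x + m) D H"
    using C2_with_add[OF \<phi>(1) C2_with_const[OF O(1), of m]] by simp
  have "eventually (\<lambda>y. y \<in> O') (nhds x0)" using O(1) x0O by (rule eventually_nhds_in_open)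
  then have "eventually (\<lambda>y. u y \<le> ereal (\<phi> y + m)) (nhds x0)"
  proof eventually_elim
    case (elim y)
    then have "y \<in> C" using O by auto
    then have "u y - ereal (\<phi> y) \<le> ereal m" using x0(2)[of y] m by simp
    then show ?case using fin[OF \<open>y \<in> C\<close>] by (cases "u y") auto
  qed
  then have "H x0 \<in> F"
    using v[unfolded viscosity_def, rule_format, of x0 O' "\<lambda>x. \<phi> x + m" D H] C2 x0O O(3) H(1) m(1) by auto
  then show False using H(2)[OF x0O] by simp
qed

text \<open>A smooth function touched from above by \<open>\<phi>\<close> has smaller second derivatives than \<open>\<phi>\<close>.\<close>

lemma C2_viscosity:
  fixes w :: "real^'n \<Rightarrow> real"
  assumes w: "C2_with N w D H" and H: "\<And>x. x \<in> N \<Longrightarrow> transpose (H x) = H x" "\<And>x. x \<in> N \<Longrightarrow> 0 \<le> trace (H x)"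
  shows "viscosity {A. 0 \<le> trace A} N (\<lambda>x. ereal (w x))"
  unfolding viscosity_def
proof (intro ballI allI impI, elim conjE)
  fix x0 N' \<phi> E K
  assume x0: "x0 \<in> N" "x0 \<in> N'" and \<phi>: "C2_with N' \<phi> E K" "transpose (K x0) = K x0"
    and ev: "eventually (\<lambda>x. ereal (w x) \<le> ereal (\<phi> x)) (nhds x0)" and eq: "ereal (w x0) = ereal (\<phi> x0)"
  let ?M = "N \<inter> N'"
  have op: "open ?M" using w \<phi> by (auto simp: C2_with_def)
  have C2: "C2_with ?M (\<lambda>x. \<phi> x + (-1) * w x) (\<lambda>x. E x + (-1) *\<^sub>R D x) (\<lambda>x. K x + (-1) *\<^sub>R H x)"
    by (rule C2_with_add[OF C2_with_subset[OF \<phi>(1) op] C2_with_scale[OF C2_with_subset[OF w op]]]) auto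
  let ?A = "K x0 + (-1) *\<^sub>R H x0"
  have symA: "transpose ?A = ?A"
    using \<phi>(2) H(1)[OF x0(1)] by (simp add: transpose_def vec_eq_iff)
  have "0 \<le> v \<bullet> (?A *v v)" if v: "norm v = 1" for v
  proof (rule ccontr)
    assume neg: "\<not> 0 \<le> v \<bullet> (?A *v v)"
    define m where "m = - (v \<bullet> (?A *v v))"
    have m: "m > 0" using neg by (simp add: m_def)
    have x0M: "x0 \<in> ?M" using x0 by simp
    obtain \<delta> where \<delta>: "\<delta> > 0" and tay: "\<And>y. norm (y - x0) < \<delta> \<Longrightarrow>
      \<bar>(\<phi> y + (-1) * w y) - ((\<phi> x0 + (-1) * w x0) + (E x0 + (-1) *\<^sub>R D x0) \<bullet> (y - x0) + (y - x0) \<bullet> (?A *v (y - x0)) / 2)\<bar> \<le> (m/4) * (norm (y - x0))\<^sup>2"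
      by (rule taylor2[OF C2 x0M symA, of "m/4"]) (use m in auto)
    obtain \<delta>' where \<delta>': "\<delta>' > 0" "\<And>y. dist y x0 < \<delta>' \<Longrightarrow> w y \<le> \<phi> y"
      using ev unfolding eventually_nhds_metric by auto
    define t where "t = min \<delta> \<delta>' / 2"
    have t: "0 < t" "t < \<delta>" "t < \<delta>'" using \<delta> \<delta>'(1) by (auto simp: t_def)
    let ?d = "(E x0 + (-1) *\<^sub>R D x0) \<bullet> v"
    have ineq: "0 \<le> s * ?d - s\<^sup>2 * m / 2 + (m/4) * s\<^sup>2" if s: "\<bar>s\<bar> = t" for s
    proof -
      let ?y = "x0 + s *\<^sub>R v"
      have ny: "norm (?y - x0) = \<bar>s\<bar>" using v by simp
      have q: "(?y - x0) \<bullet> (?A *v (?y - x0)) = - (s\<^sup>2 * m)"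
        by (simp only: add_diff_cancel_left' matrix_vector_mult_scaleR inner_scaleR_left inner_scaleR_right m_def power2_eq_square)
      have "w ?y \<le> \<phi> ?y" using \<delta>'(2)[of ?y] ny s t by (simp add: dist_norm)
      moreover have "norm (?y - x0) < \<delta>" using ny s t by simp
      note * = abs_le_D1[OF tay[OF this]]
      have lin: "(E x0 + (-1) *\<^sub>R D x0) \<bullet> (?y - x0) = s * ?d" by simp
      ultimately show ?thesis
        using *[unfolded q ny lin power2_abs] eq by simp
    qed
    have "0 \<le> - t\<^sup>2 * m / 2" using ineq[of t] ineq[of "-t"] t by (simp add: field_simps)
    then show False using t m by (simp add: zero_le_mult_iff mult_le_0_iff)
  qed
  then have "0 \<le> trace ?A"
    unfolding trace_conj_sum[of ?A] by (intro sum_nonneg) simp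
  then have "trace (H x0) \<le> trace (K x0)" by (simp add: trace_def sum_subtractf)
  then show "K x0 \<in> {A. 0 \<le> trace A}" using H(2)[OF x0(1)] by simp
qed

text \<open>The sup-convolutions \<open>x \<mapsto> sup\<^sub>y (max (u y) (-k) - k |x - y|)\<close> are Lipschitz and decrease to \<open>u\<close>.\<close>

lemma usc_approx:
  fixes u :: "real^'n \<Rightarrow> ereal"
  assumes K: "compact K" "K \<noteq> {}" and u: "usc_on K u"
  obtains f :: "nat \<Rightarrow> real^'n \<Rightarrow> real" where
    "\<And>k. continuous_on UNIV (f k)" "\<And>k x. f (Suc k) x \<le> f k x" "\<And>k x. x \<in> K \<Longrightarrow> u x \<le> ereal (f k x)"
    "\<And>x. x \<in> K \<Longrightarrow> (\<lambda>k. ereal (f k x)) \<longlonglongrightarrow> u x"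
proof -
  obtain xm where xm: "xm \<in> K" "\<And>y. y \<in> K \<Longrightarrow> u y \<le> u xm" using usc_attains_max[OF K u] by blast
  have "u xm < \<infinity>" using u xm(1) by (auto simp: usc_on_def)
  then obtain c where "u xm < ereal c" using ereal_dense2[of "u xm" \<infinity>] by auto
  then have c: "u y < ereal c" if "y \<in> K" for y using xm(2)[OF that] by order
  define h where "h k y = real_of_ereal (max (u y) (- ereal (real k)))" for k :: nat and y
  have h: "ereal (h k y) = max (u y) (- ereal (real k))" if "y \<in> K" for k y
    unfolding h_def using c[OF that] by (cases "u y") (auto simp: max_def)
  have hc: "h k y \<le> max c 0" if "y \<in> K" for k y
  proof -
    have "ereal (h k y) \<le> ereal (max c 0)"
      unfolding h[OF that] using c[OF that] by (intro max.boundedI) (auto simp: le_max_iff_disj less_imp_le)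
    then show ?thesis by (simp only: ereal_less_eq)
  qed
  define f where "f k x = (SUP y\<in>K. h k y - real k * dist x y)" for k x
  have bdd: "bdd_above ((\<lambda>y. h k y - real k * dist x y) ` K)" for k x
  proof (rule bdd_aboveI2)
    fix y assume "y \<in> K"
    moreover have "0 \<le> real k * dist x y" by simp
    ultimately show "h k y - real k * dist x y \<le> max c 0" using hc[of y k] by linarith
  qed
  have f_ge: "h k y - real k * dist x y \<le> f k x" if "y \<in> K" for k x y
    unfolding f_def by (rule cSUP_upper[OF that bdd])
  have lip: "f k x \<le> f k x' + real k * dist x x'" for k x x'
    unfolding f_def[of k x]
  proof (rule cSUP_least[OF K(2)])
    fix y assume "y \<in> K"
    have "real k * dist x' y \<le> real k * (dist x x' + dist x y)"
      using dist_triangle[of x' y x] by (intro mult_left_mono) (simp_all add: dist_commute)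
    then show "h k y - real k * dist x y \<le> f k x' + real k * dist x x'"
      using f_ge[OF \<open>y \<in> K\<close>, of k x'] by (simp add: distrib_left)
  qed
  show ?thesis
  proof (rule that[of f])
    show "continuous_on UNIV (f k)" for k
    proof (unfold continuous_on_iff, intro ballI allI impI)
      fix x :: "real^'n" and e :: real assume e: "e > 0"
      show "\<exists>d>0. \<forall>x'\<in>UNIV. dist x' x < d \<longrightarrow> dist (f k x') (f k x) < e"
      proof (intro exI[of _ "e / (real k + 1)"] conjI ballI impI)
        show "0 < e / (real k + 1)" using e by simp
        fix x' :: "real^'n" assume d: "dist x' x < e / (real k + 1)"
        have "\<bar>f k x' - f k x\<bar> \<le> real k * dist x' x"
          using lip[of k x' x] lip[of k x x'] by (simp add: dist_commute)
        also have "\<dots> \<le> (real k + 1) * dist x' x" by (intro mult_right_mono) auto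
        also have "\<dots> < e" using d by (simp add: pos_less_divide_eq mult.commute)
        finally show "dist (f k x') (f k x) < e" by (simp add: dist_real_def)
      qed
    qed
    show "f (Suc k) x \<le> f k x" for k x
      unfolding f_def[of "Suc k"]
    proof (rule cSUP_least[OF K(2)])
      fix y assume y: "y \<in> K"
      have "ereal (h (Suc k) y) \<le> ereal (h k y)" unfolding h[OF y] by (intro max.mono) auto
      moreover have "real k * dist x y \<le> real (Suc k) * dist x y" by (intro mult_right_mono) auto
      ultimately show "h (Suc k) y - real (Suc k) * dist x y \<le> f k x" using f_ge[OF y, of k x] by simp
    qed
    show ge: "u x \<le> ereal (f k x)" if x: "x \<in> K" for k x
    proof -
      have "u x \<le> ereal (h k x)" by (simp add: h[OF x])
      also have "\<dots> \<le> ereal (f k x)" using f_ge[OF x, of k x] by simp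
      finally show ?thesis .
    qed
    show "(\<lambda>k. ereal (f k x)) \<longlonglongrightarrow> u x" if x: "x \<in> K" for x
    proof (rule order_tendstoI)
      fix a assume "a < u x"
      then show "\<forall>\<^sub>F k in sequentially. a < ereal (f k x)"
        using ge[OF x] by (intro always_eventually allI) (meson less_le_trans)
    next
      fix a assume "u x < a"
      then obtain b where b: "u x < ereal b" "ereal b < a" using ereal_dense2 by blast
      obtain \<delta> where \<delta>: "\<delta> > 0" "\<And>y. y \<in> K \<Longrightarrow> dist y x < \<delta> \<Longrightarrow> u y < ereal b" using usc_onD[OF u x b(1)] by blast
      define k0 where "k0 = nat \<lceil>max \<bar>b\<bar> ((max c 0 - b) / \<delta>)\<rceil>"
      have "f k x \<le> b" if k: "k \<ge> k0" for k
        unfolding f_def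
      proof (rule cSUP_least[OF K(2)])
        fix y assume y: "y \<in> K"
        have kb: "real k \<ge> \<bar>b\<bar>" "real k \<ge> (max c 0 - b) / \<delta>" using k unfolding k0_def by linarith+
        show "h k y - real k * dist x y \<le> b"
        proof (cases "dist y x < \<delta>")
          case True
          have "ereal (h k y) \<le> ereal b" unfolding h[OF y] using \<delta>(2)[OF y True] kb(1) by auto
          moreover have "0 \<le> real k * dist x y" by simp
          ultimately show ?thesis by (simp only: ereal_less_eq)
        next
          case False
          have "max c 0 - b \<le> real k * \<delta>" using kb(2) \<delta>(1) by (simp add: pos_divide_le_eq)
          also have "\<dots> \<le> real k * dist x y" using False by (intro mult_left_mono) (auto simp: dist_commute)
          finally show ?thesis using hc[OF y, of k] by linarith
        qed
      qed
      then have "ereal (f k x) < a" if "k \<ge> k0" for k using that b(2) by (meson ereal_less_eq(3) le_less_trans)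
      then show "\<forall>\<^sub>F k in sequentially. ereal (f k x) < a" by (auto simp: eventually_sequentially)
    qed
  qed
qed

text \<open>Monotone convergence, for a limit whose average may be \<open>-\<infinity>\<close>.\<close>

lemma average_decreasing_limit:
  fixes f :: "nat \<Rightarrow> real^'n \<Rightarrow> real" and Y :: "'a \<Rightarrow> real^'n"
  assumes P: "prob_space P" and Y[measurable]: "Y \<in> P \<rightarrow>\<^sub>M borel" and u[measurable]: "u \<in> borel_measurable borel"
    and f: "\<And>k. continuous_on UNIV (f k)" "\<And>k x. f (Suc k) x \<le> f k x"
    and lim: "\<And>x. x \<in> K \<Longrightarrow> (\<lambda>k. ereal (f k x)) \<longlonglongrightarrow> u x" and YK: "AE \<omega> in P. Y \<omega> \<in> K" and K: "compact K"
    and less: "average P (\<lambda>\<omega>. u (Y \<omega>)) < ereal c"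
  shows "eventually (\<lambda>k. (\<integral>\<omega>. f k (Y \<omega>) \<partial>P) < c) sequentially"
proof -
  interpret prob_space P by fact
  have fm[measurable]: "f k \<in> borel_measurable borel" for k using f(1) by (rule borel_measurable_continuous_onI)
  have bdd: "\<exists>B. \<forall>x\<in>K. \<bar>f k x\<bar> \<le> B" for k
    using compact_imp_bounded[OF compact_continuous_image[OF continuous_on_subset[OF f(1)] K, of k]]
    by (auto simp: bounded_iff)
  obtain B where B: "\<And>x. x \<in> K \<Longrightarrow> \<bar>f 0 x\<bar> \<le> B" using bdd by blast
  have dec: "decseq (\<lambda>k. f k x)" for x using f(2) by (intro decseq_SucI)
  have fB: "f k x \<le> B" if "x \<in> K" for k x
    using decseqD[OF dec, of 0 k x] B[OF that] by simp
  have int: "integrable P (\<lambda>\<omega>. f k (Y \<omega>))" for k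
  proof -
    obtain B' where "\<And>x. x \<in> K \<Longrightarrow> \<bar>f k x\<bar> \<le> B'" using bdd by blast
    then show ?thesis using YK by (intro integrable_const_bound[of _ B']) (auto elim!: eventually_mono)
  qed
  have uB: "AE \<omega> in P. u (Y \<omega>) \<le> ereal B"
    using YK
  proof eventually_elim
    case (elim \<omega>)
    then show ?case using lim[OF elim] fB by (intro LIMSEQ_le_const2[OF lim[OF elim]]) auto
  qed
  have fBAE: "AE \<omega> in P. ereal (f k (Y \<omega>)) \<le> ereal B" for k
    using YK fB by (auto elim!: eventually_mono)
  let ?D = "\<lambda>v. \<integral>\<^sup>+\<omega>. e2ennreal (ereal B - v \<omega>) \<partial>P"
  have "(\<lambda>k. ?D (\<lambda>\<omega>. ereal (f k (Y \<omega>)))) \<longlonglongrightarrow> ?D (\<lambda>\<omega>. u (Y \<omega>))"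
  proof -
    have [measurable]: "K \<in> sets borel" using K by (simp add: borel_compact)
    have "(\<lambda>k. \<integral>\<^sup>+\<omega>. (if Y \<omega> \<in> K then e2ennreal (ereal B - ereal (f k (Y \<omega>))) else 0) \<partial>P)
      \<longlonglongrightarrow> (\<integral>\<^sup>+\<omega>. (if Y \<omega> \<in> K then e2ennreal (ereal B - u (Y \<omega>)) else 0) \<partial>P)"
    proof (rule nn_integral_LIMSEQ)
      show "incseq (\<lambda>k \<omega>. if Y \<omega> \<in> K then e2ennreal (ereal B - ereal (f k (Y \<omega>))) else 0)"
      proof (intro incseq_SucI le_funI)
        fix k \<omega>
        have "e2ennreal (ereal B - ereal (f k (Y \<omega>))) \<le> e2ennreal (ereal B - ereal (f (Suc k) (Y \<omega>)))"
          using f(2)[of k "Y \<omega>"] by (intro e2ennreal_mono ereal_minus_mono) auto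
        then show "(if Y \<omega> \<in> K then e2ennreal (ereal B - ereal (f k (Y \<omega>))) else 0)
          \<le> (if Y \<omega> \<in> K then e2ennreal (ereal B - ereal (f (Suc k) (Y \<omega>))) else 0)" by simp
      qed
      fix \<omega>
      show "(\<lambda>k. if Y \<omega> \<in> K then e2ennreal (ereal B - ereal (f k (Y \<omega>))) else 0)
        \<longlonglongrightarrow> (if Y \<omega> \<in> K then e2ennreal (ereal B - u (Y \<omega>)) else 0)"
      proof (cases "Y \<omega> \<in> K")
        case True
        have "(\<lambda>k. ereal B - ereal (f k (Y \<omega>))) \<longlonglongrightarrow> ereal B - u (Y \<omega>)"
          by (intro tendsto_diff_ereal_general tendsto_const lim True) simp
        moreover have "continuous_on UNIV e2ennreal"
          by (rule continuous_on_e2ennreal)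
        ultimately have "(\<lambda>k. e2ennreal (ereal B - ereal (f k (Y \<omega>)))) \<longlonglongrightarrow> e2ennreal (ereal B - u (Y \<omega>))"
          by (intro continuous_on_tendsto_compose[where s=UNIV and f=e2ennreal]) auto
        then show ?thesis using True by simp
      qed simp
    qed measurable
    moreover have "(\<integral>\<^sup>+\<omega>. (if Y \<omega> \<in> K then g \<omega> else 0) \<partial>P) = (\<integral>\<^sup>+\<omega>. g \<omega> \<partial>P)" for g
      using YK by (intro nn_integral_cong_AE) (auto elim!: eventually_mono)
    ultimately show ?thesis by simp
  qed
  then have "(\<lambda>k. ereal B - enn2ereal (?D (\<lambda>\<omega>. ereal (f k (Y \<omega>))))) \<longlonglongrightarrow> ereal B - enn2ereal (?D (\<lambda>\<omega>. u (Y \<omega>)))"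
    by (intro tendsto_diff_ereal_general tendsto_const continuous_on_tendsto_compose[where s=UNIV and f=enn2ereal] continuous_on_enn2ereal) auto
  then have "(\<lambda>k. average P (\<lambda>\<omega>. ereal (f k (Y \<omega>)))) \<longlonglongrightarrow> average P (\<lambda>\<omega>. u (Y \<omega>))"
    using average_deficit[OF P _ uB] average_deficit[OF P _ fBAE] by simp
  then have "eventually (\<lambda>k. average P (\<lambda>\<omega>. ereal (f k (Y \<omega>))) < ereal c) sequentially"
    using less by (rule order_tendstoD)
  then show ?thesis by (simp add: average_real[OF P int])
qed

section \<open>Harmonic extension and the mean value inequality\<close>

definition harmonic :: "(real^'n \<Rightarrow> real) \<Rightarrow> bool" where
  "harmonic h \<longleftrightarrow> (\<exists>D H. C2_with UNIV h D H \<and> (\<forall>x. transpose (H x) = H x \<and> trace (H x) = 0))"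

lemma transpose_add': "transpose (A + B) = transpose A + transpose (B :: real^'n^'n)"
  and transpose_scale': "transpose (c *\<^sub>R A) = c *\<^sub>R transpose (A :: real^'n^'n)"
  and transpose_diff': "transpose (A - B) = transpose A - transpose (B :: real^'n^'n)"
  by (simp_all add: transpose_def vec_eq_iff)

lemma trace_scale': "trace (c *\<^sub>R A) = c * trace (A :: real^'n^'n)"
  by (simp add: trace_def sum_distrib_left)

lemma harmonic_add: "harmonic f \<Longrightarrow> harmonic g \<Longrightarrow> harmonic (\<lambda>x. f x + g x)"
  unfolding harmonic_def
proof (elim exE conjE)
  fix D H E K assume a: "C2_with UNIV f D H" "\<forall>x. transpose (H x) = H x \<and> trace (H x) = 0"
    "C2_with UNIV g E K" "\<forall>x. transpose (K x) = K x \<and> trace (K x) = 0"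
  show "\<exists>D H. C2_with UNIV (\<lambda>x. f x + g x) D H \<and> (\<forall>x. transpose (H x) = H x \<and> trace (H x) = 0)"
    by (intro exI conjI, rule C2_with_add[OF a(1) a(3)]) (simp add: a transpose_add' trace_add)
qed

lemma harmonic_scale: "harmonic f \<Longrightarrow> harmonic (\<lambda>x. c * f x)"
  unfolding harmonic_def
proof (elim exE conjE)
  fix D H assume a: "C2_with UNIV f D H" "\<forall>x. transpose (H x) = H x \<and> trace (H x) = 0"
  show "\<exists>D H. C2_with UNIV (\<lambda>x. c * f x) D H \<and> (\<forall>x. transpose (H x) = H x \<and> trace (H x) = 0)"
    by (intro exI conjI, rule C2_with_scale[OF a(1)]) (simp add: a transpose_scale' trace_scale')
qed

lemma harmonic_const: "harmonic (\<lambda>x. c)"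
  unfolding harmonic_def
  by (intro exI conjI, rule C2_with_const) (simp_all add: transpose_def trace_def vec_eq_iff)

lemma harmonic_continuous: "harmonic h \<Longrightarrow> continuous_on UNIV h"
  unfolding harmonic_def using C2_with_continuous by blast

lemma harmonic_compose_orthogonal:
  assumes "harmonic h" "orthogonal_matrix g"
  shows "harmonic (\<lambda>x. h (g *v x))"
proof -
  obtain D H where h: "C2_with UNIV h D H" "\<forall>x. transpose (H x) = H x \<and> trace (H x) = 0"
    using assms(1) unfolding harmonic_def by blast
  have tr: "trace (transpose g ** A ** g) = trace A" for A
  proof -
    have "trace (transpose g ** A ** g) = trace (g ** (transpose g ** A))" by (rule trace_mul_sym)
    also have "\<dots> = trace A" using assms(2) by (simp add: matrix_mul_assoc orthogonal_matrix_def)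
    finally show ?thesis .
  qed
  have "C2_with UNIV (\<lambda>x. h (g *v x)) (\<lambda>x. transpose g *v D (g *v x)) (\<lambda>x. transpose g ** H (g *v x) ** g)"
    using C2_with_affine[OF h(1), of 0 g] by simp
  moreover have "transpose (transpose g ** H x ** g) = transpose g ** H x ** g" for x
    using h(2) by (simp add: matrix_transpose_mul matrix_mul_assoc)
  ultimately show ?thesis unfolding harmonic_def
    by (intro exI conjI allI) (assumption, simp_all only: tr h(2)[rule_format])
qed

lemma harmonic_orbit_mean:
  assumes "harmonic h" "\<And>g. g \<in> set gs \<Longrightarrow> orthogonal_matrix g"
  shows "harmonic (orbit_mean_real gs h)"
proof -
  have "harmonic (\<lambda>x. \<Sum>g\<leftarrow>gs. h (g *v x))"
    using assms(2) by (induction gs) (auto intro!: harmonic_add harmonic_const harmonic_compose_orthogonal[OF assms(1)])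
  then show ?thesis
    using harmonic_scale[of "\<lambda>x. \<Sum>g\<leftarrow>gs. h (g *v x)" "1 / real (length gs)"]
    by (simp add: orbit_mean_real_def[abs_def])
qed

lemma C2_with_sum:
  assumes "finite S" "open N" "\<And>j. j \<in> S \<Longrightarrow> C2_with N (\<phi> j) (D j) (H j)"
  shows "C2_with N (\<lambda>x. \<Sum>j\<in>S. \<phi> j x) (\<lambda>x. \<Sum>j\<in>S. D j x) (\<lambda>x. \<Sum>j\<in>S. H j x)"
  using assms(1,3)
proof (induction S rule: finite_induct)
  case empty
  show ?case using C2_with_const[OF assms(2), of 0] by simp
next
  case (insert j S)
  then show ?case using C2_with_add[of N "\<phi> j" "D j" "H j"] by simp
qed

text \<open>The Laplacian of a monomial in \<open>a \<bullet> x\<close> and \<open>x \<bullet> x\<close> involves only its two neighbours of lower degree, which yields the recursion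
  for the coefficients in \<open>harmonic_ridge\<close>.\<close>

lemma ridge_monomial:
  fixes a :: "real^'n"
  defines "N \<equiv> real CARD('n)"
  shows "\<exists>D H. C2_with UNIV (\<lambda>x. (a \<bullet> x) ^ i * (x \<bullet> x) ^ j) D H \<and> (\<forall>x. transpose (H x) = H x \<and>
    trace (H x) = real i * real (i - 1) * (a \<bullet> a) * ((a \<bullet> x) ^ (i - 2) * (x \<bullet> x) ^ j)
      + 2 * real j * (2 * real i + 2 * real j - 2 + N) * ((a \<bullet> x) ^ i * (x \<bullet> x) ^ (j - 1)))"
proof -
  let ?d1 = "\<lambda>i s. real i * s ^ (i - 1)" and ?d2 = "\<lambda>i s. real i * (real (i - 1) * s ^ (i - 2))"
  have d: "((\<lambda>s. s ^ i) has_real_derivative ?d1 i s) (at s)"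
    "(?d1 i has_real_derivative ?d2 i s) (at s)" for i and s :: real
  proof -
    show "((\<lambda>s. s ^ i) has_real_derivative ?d1 i s) (at s)" using DERIV_pow[of i s] by simp
    show "(?d1 i has_real_derivative ?d2 i s) (at s)"
      using DERIV_cmult[OF DERIV_pow[of "i - 1" s], of "real i"] by (simp add: numeral_2_eq_2)
  qed
  have c: "continuous_on UNIV (?d2 i)" for i by (intro continuous_intros)
  have m1: "?d1 i s * s = real i * s ^ i" for i and s :: real by (cases i) auto
  have m2: "?d2 j s * s = real j * (real (j - 1) * s ^ (j - 1))" for j and s :: real
  proof (cases "j < 2")
    case True
    then have "j = 0 \<or> j = 1" by auto
    then show ?thesis by auto
  next
    case False
    then have "s ^ (j - 1) = s ^ (j - 2) * s" by (metis Suc_1 Suc_diff_Suc not_less_eq power_Suc2 not_less)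
    then show ?thesis by simp
  qed
  let ?H = "\<lambda>x. (?d2 i (a \<bullet> x) * (x \<bullet> x) ^ j) *\<^sub>R outer a a + (2 * ?d1 i (a \<bullet> x) * ?d1 j (x \<bullet> x)) *\<^sub>R (outer a x + outer x a)
        + (4 * (a \<bullet> x) ^ i * ?d2 j (x \<bullet> x)) *\<^sub>R outer x x + (2 * (a \<bullet> x) ^ i * ?d1 j (x \<bullet> x)) *\<^sub>R mat 1"
  have "\<exists>D. C2_with UNIV (\<lambda>x. (a \<bullet> x) ^ i * (x \<bullet> x) ^ j) D ?H"
    using C2_with_ridge_radial[of "\<lambda>s. s ^ i" "?d1 i" "?d2 i" UNIV "\<lambda>s. s ^ j" "?d1 j" "?d2 j" a] d c by auto
  moreover have "transpose (?H x) = ?H x" for x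
    by (simp add: transpose_add' transpose_scale' transpose_outer transpose_mat add.commute)
  moreover have "trace (?H x) = real i * real (i - 1) * (a \<bullet> a) * ((a \<bullet> x) ^ (i - 2) * (x \<bullet> x) ^ j)
      + 2 * real j * (2 * real i + 2 * real j - 2 + N) * ((a \<bullet> x) ^ i * (x \<bullet> x) ^ (j - 1))" for x
  proof -
    have "trace (?H x) = ?d2 i (a \<bullet> x) * (x \<bullet> x) ^ j * (a \<bullet> a) + 4 * (?d1 i (a \<bullet> x) * (a \<bullet> x)) * ?d1 j (x \<bullet> x)
       + 4 * (a \<bullet> x) ^ i * (?d2 j (x \<bullet> x) * (x \<bullet> x)) + 2 * (a \<bullet> x) ^ i * ?d1 j (x \<bullet> x) * N"
      by (simp add: trace_add trace_scale' trace_outer inner_commute trace_I N_def algebra_simps)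
    also have "\<dots> = real i * real (i - 1) * (a \<bullet> a) * ((a \<bullet> x) ^ (i - 2) * (x \<bullet> x) ^ j)
      + 2 * real j * (2 * real i + 2 * real (j - 1) + N) * ((a \<bullet> x) ^ i * (x \<bullet> x) ^ (j - 1))"
      unfolding m1 m2 by (simp add: algebra_simps)
    also have "2 * real j * (2 * real i + 2 * real (j - 1) + N) = 2 * real j * (2 * real i + 2 * real j - 2 + N)"
      by (cases j) (auto simp: algebra_simps)
    finally show ?thesis .
  qed
  ultimately show ?thesis by blast
qed

text \<open>The homogeneous harmonic polynomial with leading ridge term \<open>(a \<bullet> x)\<^sup>k\<close>, a multiple of a Gegenbauer polynomial.
  Its coefficients are chosen so that the Laplacians of consecutive terms telescope.\<close>

lemma harmonic_ridge:
  fixes a :: "real^'n"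
  obtains \<gamma> :: "nat \<Rightarrow> real" where "\<gamma> 0 = 1" "harmonic (\<lambda>x. \<Sum>j\<le>k div 2. \<gamma> j * ((a \<bullet> x) ^ (k - 2 * j) * (x \<bullet> x) ^ j))"
proof -
  define N where "N = real CARD('n)"
  have N: "N > 0" by (simp add: N_def)
  define \<rho> where "\<rho> j = - (real (k - 2 * j) * real (k - 2 * j - 1) * (a \<bullet> a)) / (2 * (real j + 1) * (2 * real k - 2 * real j - 4 + N))" for j
  define \<gamma> where "\<gamma> j = (\<Prod>l<j. \<rho> l)" for j
  let ?m = "\<lambda>i j x. (a \<bullet> x) ^ i * (x \<bullet> x) ^ j"
  define R where "R j D H \<longleftrightarrow> C2_with UNIV (?m (k - 2 * j) j) D H \<and> (\<forall>x. transpose (H x) = H x \<and>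
    trace (H x) = real (k - 2 * j) * real (k - 2 * j - 1) * (a \<bullet> a) * ?m (k - 2 * j - 2) j x
      + 2 * real j * (2 * real (k - 2 * j) + 2 * real j - 2 + N) * ?m (k - 2 * j) (j - 1) x)" for j D H
  have "\<exists>D H. R j D H" for j
    unfolding R_def by (rule ridge_monomial[of a, folded N_def])
  then obtain D H where R: "\<And>j. R j (D j) (H j)" by metis
  have C2: "\<And>j. C2_with UNIV (?m (k - 2 * j) j) (D j) (H j)"
    and sym: "\<And>j x. transpose (H j x) = H j x"
    and tr: "\<And>j x. trace (H j x) = real (k - 2 * j) * real (k - 2 * j - 1) * (a \<bullet> a) * ?m (k - 2 * j - 2) j x
      + 2 * real j * (2 * real (k - 2 * j) + 2 * real j - 2 + N) * ?m (k - 2 * j) (j - 1) x"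
    using R unfolding R_def by (blast, blast, blast)
  let ?T = "\<lambda>K x. \<gamma> K * (real (k - 2 * K) * real (k - 2 * K - 1) * (a \<bullet> a) * ?m (k - 2 * K - 2) K x)"
  have tele: "(\<Sum>j\<le>K. \<gamma> j * trace (H j x)) = ?T K x" if "K \<le> k div 2" for K x
    using that
  proof (induction K)
    case 0
    show ?case by (simp add: tr)
  next
    case (Suc K)
    have k: "2 * K + 2 \<le> k" using Suc.prems by linarith
    then have kr: "real (k - 2 * Suc K) = real k - 2 * real K - 2" by (simp add: of_nat_diff)
    have den: "2 * real k - 2 * real K - 4 + N > 0" using k N by linarith
    have "\<gamma> (Suc K) * (2 * real (Suc K) * (2 * real (k - 2 * Suc K) + 2 * real (Suc K) - 2 + N))
       = \<gamma> K * (\<rho> K * (2 * (real K + 1) * (2 * real k - 2 * real K - 4 + N)))"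
      unfolding kr by (simp add: \<gamma>_def algebra_simps)
    also have "\<rho> K * (2 * (real K + 1) * (2 * real k - 2 * real K - 4 + N)) = - (real (k - 2 * K) * real (k - 2 * K - 1) * (a \<bullet> a))"
      using den unfolding \<rho>_def by (intro nonzero_eq_divide_eq[THEN iffD1]) auto
    finally have rec: "\<gamma> (Suc K) * (2 * real (Suc K) * (2 * real (k - 2 * Suc K) + 2 * real (Suc K) - 2 + N))
       = \<gamma> K * (- (real (k - 2 * K) * real (k - 2 * K - 1) * (a \<bullet> a)))" .
    have idx: "k - 2 * Suc K = k - 2 * K - 2" by simp
    have "(\<Sum>j\<le>Suc K. \<gamma> j * trace (H j x)) = ?T K x + \<gamma> (Suc K) * trace (H (Suc K) x)"
      using Suc by simp
    also have "\<gamma> (Suc K) * trace (H (Suc K) x) = ?T (Suc K) x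
      + \<gamma> (Suc K) * (2 * real (Suc K) * (2 * real (k - 2 * Suc K) + 2 * real (Suc K) - 2 + N)) * ?m (k - 2 * Suc K) K x"
      unfolding tr by (simp add: distrib_left mult.assoc)
    also have "?T K x + \<dots> = ?T (Suc K) x"
      unfolding rec by (simp add: algebra_simps)
    finally show ?case .
  qed
  have zero: "real (k - 2 * (k div 2)) * real (k - 2 * (k div 2) - 1) = 0"
    by (cases "even k") (auto elim!: oddE)
  have h: "harmonic (\<lambda>x. \<Sum>j\<le>k div 2. \<gamma> j * ?m (k - 2 * j) j x)"
    unfolding harmonic_def
  proof (intro exI conjI allI)
    show "C2_with UNIV (\<lambda>x. \<Sum>j\<le>k div 2. \<gamma> j * ?m (k - 2 * j) j x) (\<lambda>x. \<Sum>j\<le>k div 2. \<gamma> j *\<^sub>R D j x) (\<lambda>x. \<Sum>j\<le>k div 2. \<gamma> j *\<^sub>R H j x)"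
      by (intro C2_with_sum C2_with_scale C2) auto
    fix x
    have ts: "transpose (\<Sum>j\<in>S. \<gamma> j *\<^sub>R H j x) = (\<Sum>j\<in>S. \<gamma> j *\<^sub>R H j x)" "trace (\<Sum>j\<in>S. \<gamma> j *\<^sub>R H j x) = (\<Sum>j\<in>S. \<gamma> j * trace (H j x))"
      if "finite S" for S
      using that
      by (induction S rule: finite_induct) (simp_all add: transpose_add' transpose_scale' sym trace_add trace_scale', simp_all add: transpose_def trace_def vec_eq_iff)
    show "transpose (\<Sum>j\<le>k div 2. \<gamma> j *\<^sub>R H j x) = (\<Sum>j\<le>k div 2. \<gamma> j *\<^sub>R H j x)" by (simp add: ts)
    have "trace (\<Sum>j\<le>k div 2. \<gamma> j *\<^sub>R H j x) = ?T (k div 2) x" by (simp only: ts finite_atMost tele[OF order_refl])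
    also have "\<dots> = 0" using zero by simp
    finally show "trace (\<Sum>j\<le>k div 2. \<gamma> j *\<^sub>R H j x) = 0" .
  qed
  show ?thesis by (rule that[OF _ h]) (simp add: \<gamma>_def)
qed

definition harmonic_approx :: "(real^'n \<Rightarrow> real) \<Rightarrow> bool" where
  "harmonic_approx f \<longleftrightarrow> (\<forall>\<epsilon>>0. \<exists>h. harmonic h \<and> (\<forall>x\<in>sphere 0 1. \<bar>h x - f x\<bar> \<le> \<epsilon>))"

lemma harmonic_approx_add:
  assumes "harmonic_approx f" "harmonic_approx g" shows "harmonic_approx (\<lambda>x. f x + g x)"
  unfolding harmonic_approx_def
proof (intro allI impI)
  fix \<epsilon> :: real assume e: "\<epsilon> > 0"
  obtain h where h: "harmonic h" "\<forall>x\<in>sphere 0 1. \<bar>h x - f x\<bar> \<le> \<epsilon>/2" using assms(1) e unfolding harmonic_approx_def by (meson half_gt_zero)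
  obtain k where k: "harmonic k" "\<forall>x\<in>sphere 0 1. \<bar>k x - g x\<bar> \<le> \<epsilon>/2" using assms(2) e unfolding harmonic_approx_def by (meson half_gt_zero)
  have "\<bar>(h x + k x) - (f x + g x)\<bar> \<le> \<epsilon>" if "x \<in> sphere 0 1" for x
    using h(2)[rule_format, OF that] k(2)[rule_format, OF that] by linarith
  then show "\<exists>h. harmonic h \<and> (\<forall>x\<in>sphere 0 1. \<bar>h x - (f x + g x)\<bar> \<le> \<epsilon>)"
    using harmonic_add[OF h(1) k(1)] by blast
qed

lemma harmonic_approx_scale:
  assumes "harmonic_approx f" shows "harmonic_approx (\<lambda>x. c * f x)"
  unfolding harmonic_approx_def
proof (intro allI impI)
  fix \<epsilon> :: real assume e: "\<epsilon> > 0"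
  then have "\<epsilon> / (\<bar>c\<bar> + 1) > 0" by simp
  then obtain h where h: "harmonic h" "\<forall>x\<in>sphere 0 1. \<bar>h x - f x\<bar> \<le> \<epsilon> / (\<bar>c\<bar> + 1)" using assms unfolding harmonic_approx_def by meson
  have "\<bar>c * h x - c * f x\<bar> \<le> \<epsilon>" if "x \<in> sphere 0 1" for x
  proof -
    have "\<bar>c * h x - c * f x\<bar> = \<bar>c\<bar> * \<bar>h x - f x\<bar>" by (simp add: abs_mult[symmetric] right_diff_distrib)
    also have "\<dots> \<le> (\<bar>c\<bar> + 1) * (\<epsilon> / (\<bar>c\<bar> + 1))" using h(2) that by (intro mult_mono) auto
    finally show ?thesis by simp
  qed
  then show "\<exists>h. harmonic h \<and> (\<forall>x\<in>sphere 0 1. \<bar>h x - c * f x\<bar> \<le> \<epsilon>)"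
    using harmonic_scale[OF h(1)] by blast
qed

lemma harmonic_approx_harmonic: "harmonic h \<Longrightarrow> harmonic_approx h"
  unfolding harmonic_approx_def by (intro allI impI exI[of _ h]) auto

lemma harmonic_approx_sum:
  "finite S \<Longrightarrow> (\<And>j. j \<in> S \<Longrightarrow> harmonic_approx (f j)) \<Longrightarrow> harmonic_approx (\<lambda>x. \<Sum>j\<in>S. f j x)"
  by (induction S rule: finite_induct) (auto intro: harmonic_approx_add harmonic_approx_harmonic harmonic_const)

lemma harmonic_approx_limit:
  assumes "\<And>\<epsilon>. \<epsilon> > 0 \<Longrightarrow> \<exists>g. harmonic_approx g \<and> (\<forall>x\<in>sphere 0 1. \<bar>g x - f x\<bar> \<le> \<epsilon>)"
  shows "harmonic_approx f"
  unfolding harmonic_approx_def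
proof (intro allI impI)
  fix \<epsilon> :: real assume e: "\<epsilon> > 0"
  obtain g where g: "harmonic_approx g" "\<forall>x\<in>sphere 0 1. \<bar>g x - f x\<bar> \<le> \<epsilon>/2" using assms[of "\<epsilon>/2"] e by auto
  obtain h where h: "harmonic h" "\<forall>x\<in>sphere 0 1. \<bar>h x - g x\<bar> \<le> \<epsilon>/2" using g(1) e unfolding harmonic_approx_def by (meson half_gt_zero)
  have "\<bar>h x - f x\<bar> \<le> \<epsilon>" if "x \<in> sphere 0 1" for x
    using g(2)[rule_format, OF that] h(2)[rule_format, OF that] by linarith
  then show "\<exists>h. harmonic h \<and> (\<forall>x\<in>sphere 0 1. \<bar>h x - f x\<bar> \<le> \<epsilon>)" using h(1) by blast
qed

text \<open>On the unit sphere \<open>x \<bullet> x = 1\<close>, so \<open>harmonic_ridge\<close> expresses \<open>(a \<bullet> x)\<^sup>k\<close> by a harmonic function and lower powers.\<close>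

lemma harmonic_approx_ridge: "harmonic_approx (\<lambda>x::real^'n. (a \<bullet> x) ^ k)"
proof (induction k rule: less_induct)
  case (less k)
  obtain \<gamma> :: "nat \<Rightarrow> real" where \<gamma>: "\<gamma> 0 = 1" and h: "harmonic (\<lambda>x. \<Sum>j\<le>k div 2. \<gamma> j * ((a \<bullet> x) ^ (k - 2 * j) * (x \<bullet> x) ^ j))"
    by (rule harmonic_ridge[of a k])
  let ?G = "\<lambda>x. \<Sum>j\<le>k div 2. \<gamma> j * ((a \<bullet> x) ^ (k - 2 * j) * (x \<bullet> x) ^ j)"
  let ?g = "\<lambda>x. ?G x + (- 1) * (\<Sum>j\<in>{1..k div 2}. \<gamma> j * (a \<bullet> x) ^ (k - 2 * j))"
  have "harmonic_approx (\<lambda>x. \<Sum>j\<in>{1..k div 2}. \<gamma> j * (a \<bullet> x) ^ (k - 2 * j))"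
  proof (rule harmonic_approx_sum)
    fix j assume j: "j \<in> {1..k div 2}"
    then have "k > 0" by (cases k) auto
    then have "k - 2 * j < k" using j by auto
    from less[OF this] show "harmonic_approx (\<lambda>x. \<gamma> j * (a \<bullet> x) ^ (k - 2 * j))" by (rule harmonic_approx_scale)
  qed simp
  from harmonic_approx_add[OF harmonic_approx_harmonic[OF h] harmonic_approx_scale[OF this, of "- 1"]]
  have "harmonic_approx ?g" .
  moreover have "?g x = (a \<bullet> x) ^ k" if "x \<in> sphere 0 1" for x
  proof -
    have xx: "x \<bullet> x = 1" using that by (simp add: dot_square_norm)
    have "{..k div 2} = insert 0 {1..k div 2}" by auto
    then show ?thesis by (simp add: xx \<gamma>)
  qed
  ultimately show ?case by (intro harmonic_approx_limit) (intro exI[of _ ?g], auto)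
qed

lemma harmonic_approx_exp: "harmonic_approx (\<lambda>x::real^'n. exp (a \<bullet> x))"
proof (rule harmonic_approx_limit)
  fix \<epsilon> :: real assume e: "\<epsilon> > 0"
  let ?M = "norm a"
  have "(\<lambda>n. exp ?M * (inverse (fact n) *\<^sub>R ?M ^ n)) \<longlonglongrightarrow> exp ?M * 0"
    by (intro tendsto_mult tendsto_const summable_LIMSEQ_zero summable_exp_generic)
  then have "eventually (\<lambda>n. exp ?M * (inverse (fact n) *\<^sub>R ?M ^ n) < \<epsilon>) sequentially"
    using e by (intro order_tendstoD(2)[of _ 0]) auto
  then obtain n where n: "exp ?M * (inverse (fact n) * ?M ^ n) < \<epsilon>" by (auto simp: eventually_sequentially)
  let ?g = "\<lambda>x. \<Sum>m\<in>{..<n}. (1 / fact m) * (a \<bullet> x) ^ m"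
  have "harmonic_approx ?g"
    by (intro harmonic_approx_sum harmonic_approx_scale harmonic_approx_ridge) auto
  moreover have "\<bar>?g x - exp (a \<bullet> x)\<bar> \<le> \<epsilon>" if "x \<in> sphere 0 1" for x
  proof -
    have s: "\<bar>a \<bullet> x\<bar> \<le> ?M" using Cauchy_Schwarz_ineq2[of a x] that by simp
    obtain t where t: "\<bar>t\<bar> \<le> \<bar>a \<bullet> x\<bar>" "exp (a \<bullet> x) = (\<Sum>m<n. (a \<bullet> x) ^ m / fact m) + exp t / fact n * (a \<bullet> x) ^ n"
      using Maclaurin_exp_le[of "a \<bullet> x" n] by blast
    have "\<bar>?g x - exp (a \<bullet> x)\<bar> = exp t * (\<bar>a \<bullet> x\<bar> ^ n / fact n)"
      unfolding t(2) by (simp add: abs_mult power_abs)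
    also have "\<dots> \<le> exp ?M * (?M ^ n / fact n)"
      using t(1) s by (intro mult_mono divide_right_mono power_mono) auto
    also have "\<dots> \<le> \<epsilon>" using n by (simp add: field_simps)
    finally show ?thesis .
  qed
  ultimately show "\<exists>g. harmonic_approx g \<and> (\<forall>x\<in>sphere 0 1. \<bar>g x - exp (a \<bullet> x)\<bar> \<le> \<epsilon>)" by blast
qed

inductive exp_sum :: "(real^'n \<Rightarrow> real) \<Rightarrow> bool" where
  base: "exp_sum (\<lambda>x. c * exp (a \<bullet> x))"
| add: "exp_sum f \<Longrightarrow> exp_sum g \<Longrightarrow> exp_sum (\<lambda>x. f x + g x)"

lemma exp_sum_mult:
  assumes "exp_sum f" "exp_sum g" shows "exp_sum (\<lambda>x. f x * g x)"
  using assms(1)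
proof (induction rule: exp_sum.induct)
  case (base c a)
  show ?case using assms(2)
  proof (induction rule: exp_sum.induct)
    case (base d b)
    have "(\<lambda>x. c * exp (a \<bullet> x) * (d * exp (b \<bullet> x))) = (\<lambda>x. (c * d) * exp ((a + b) \<bullet> x))"
      by (simp add: inner_add_left exp_add fun_eq_iff)
    then show ?case using exp_sum.base by metis
  next
    case (add f g)
    then show ?case using exp_sum.add by (simp add: distrib_left)
  qed
next
  case (add f1 f2)
  then show ?case using exp_sum.add by (simp add: distrib_right)
qed

text \<open>The Dirichlet problem on the ball, up to \<open>\<epsilon>\<close>. Exponentials of linear functions span an algebra, so by
  Stone--Weierstrass their sums are dense; each is a limit of ridge polynomials.\<close>

lemma dirichlet_approx:
  fixes f :: "real^'n \<Rightarrow> real"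
  assumes "continuous_on (sphere 0 1) f"
  shows "harmonic_approx f"
proof (rule harmonic_approx_limit)
  fix \<epsilon> :: real assume e: "\<epsilon> > 0"
  interpret function_ring_on "Collect exp_sum" "sphere (0::real^'n) 1"
  proof
    show "continuous_on (sphere 0 1) f" if "f \<in> Collect exp_sum" for f :: "real^'n \<Rightarrow> real"
      using that[unfolded mem_Collect_eq] by (induction rule: exp_sum.induct) (auto intro!: continuous_intros)
    show "(\<lambda>_. c) \<in> Collect exp_sum" for c using exp_sum.base[of c 0] by simp
    fix x y :: "real^'n" assume "x \<noteq> y"
    then have "(x - y) \<bullet> (x - y) \<noteq> 0" by simp
    then have "(x - y) \<bullet> x \<noteq> (x - y) \<bullet> y" by (simp add: inner_diff_right)
    then show "\<exists>f\<in>Collect exp_sum. f x \<noteq> f y"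
      using exp_sum.base[of 1 "x - y"] by (intro bexI[of _ "\<lambda>z. 1 * exp ((x - y) \<bullet> z)"]) auto
  qed (auto intro: exp_sum.add exp_sum_mult)
  obtain g where g: "exp_sum g" "\<forall>x\<in>sphere 0 1. \<bar>f x - g x\<bar> < \<epsilon>"
    using Stone_Weierstrass_basic[OF assms e] by auto
  from g(1) have "harmonic_approx g"
    by (induction rule: exp_sum.induct) (auto intro: harmonic_approx_add harmonic_approx_scale harmonic_approx_exp)
  then show "\<exists>g. harmonic_approx g \<and> (\<forall>x\<in>sphere 0 1. \<bar>g x - f x\<bar> \<le> \<epsilon>)"
    using g(2) by (intro exI[of _ g]) (auto simp: abs_minus_commute less_imp_le)
qed

lemma quadratic_C2:
  "C2_with UNIV (\<lambda>x::real^'n. c + d * (x \<bullet> x)) (\<lambda>x. (2 * d) *\<^sub>R x) (\<lambda>x. (2 * d) *\<^sub>R mat 1)"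
proof -
  have "C2_with {x::real^'n. x \<bullet> x \<in> UNIV} (\<lambda>x. 1 * (c + d * (x \<bullet> x))) (\<lambda>x. (0 * (c + d * (x \<bullet> x))) *\<^sub>R 0 + (2 * 1 * d) *\<^sub>R x)
    (\<lambda>x. (0 * (c + d * (x \<bullet> x))) *\<^sub>R outer 0 0 + (2 * 0 * d) *\<^sub>R (outer 0 x + outer x 0) + (4 * 1 * 0) *\<^sub>R outer x x + (2 * 1 * d) *\<^sub>R mat 1)"
    by (rule C2_with_ridge_radial[of "\<lambda>s. 1" "\<lambda>s. 0" "\<lambda>s. 0" UNIV "\<lambda>q. c + d * q" "\<lambda>q. d" "\<lambda>q. 0" 0])
       (auto intro!: derivative_eq_intros)
  then show ?thesis by simp
qed

text \<open>The function \<open>h + \<epsilon> (1 - |x|\<^sup>2)\<close> agrees with \<open>h\<close> on the sphere and has negative Laplacian.\<close>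

lemma trace_max_principle:
  fixes v :: "real^'n \<Rightarrow> ereal" and h :: "real^'n \<Rightarrow> real"
  assumes v: "viscosity {A. 0 \<le> trace A} X v" "usc_on (cball 0 1) v" "ball 0 1 \<subseteq> X"
    and h: "harmonic h" and le: "\<And>x. norm x = 1 \<Longrightarrow> v x \<le> ereal (h x)" and x: "norm x \<le> 1"
  shows "v x \<le> ereal (h x)"
proof -
  obtain D H where C2: "C2_with UNIV h D H" and H: "\<And>x. transpose (H x) = H x" "\<And>x. trace (H x) = 0"
    using h unfolding harmonic_def by blast
  have "v x \<le> ereal (h x + \<epsilon>)" if e: "\<epsilon> > 0" for \<epsilon>
  proof -
    let ?\<phi> = "\<lambda>x. h x + (\<epsilon> + (-\<epsilon>) * (x \<bullet> x))"
    have "C2_with UNIV ?\<phi> (\<lambda>x. D x + (2 * -\<epsilon>) *\<^sub>R x) (\<lambda>x. H x + (2 * -\<epsilon>) *\<^sub>R mat 1)"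
      by (rule C2_with_add[OF C2 quadratic_C2])
    then have C: "C2_with (ball 0 1) ?\<phi> (\<lambda>x. D x + (2 * -\<epsilon>) *\<^sub>R x) (\<lambda>x. H x + (2 * -\<epsilon>) *\<^sub>R mat 1)"
      and cont: "continuous_on UNIV ?\<phi>"
      using C2_with_subset C2_with_continuous by blast+
    have "v x \<le> ereal (?\<phi> x)"
    proof (rule comparison[OF compact_cball open_ball _ v(3) v(1) v(2) C continuous_on_subset[OF cont]])
      show "transpose (H x + (2 * -\<epsilon>) *\<^sub>R mat 1) = H x + (2 * -\<epsilon>) *\<^sub>R mat 1" for x
        by (simp add: transpose_add' transpose_diff' transpose_scale' transpose_mat H)
      show "H x + (2 * -\<epsilon>) *\<^sub>R mat 1 \<notin> {A. 0 \<le> trace A}" for x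
        using e by (simp add: trace_add trace_sub trace_scale' H trace_I mult_le_0_iff)
      show "v x \<le> ereal (?\<phi> x)" if "x \<in> cball 0 1 - ball 0 1" for x
      proof -
        have "norm x = 1" using that by auto
        then show ?thesis using le[of x] by (simp add: dot_square_norm)
      qed
    qed (use x in auto)
    also have "\<dots> \<le> ereal (h x + \<epsilon>)" using e by simp
    finally show ?thesis .
  qed
  then show ?thesis
    by - (rule ereal_le_epsilon2, simp)
qed

context transitive_rotations
begin

text \<open>Let \<open>h\<close> be harmonic and slightly above \<open>f\<close> on the sphere, so that \<open>v 0 \<le> h 0\<close>. The orbit means of \<open>h\<close> are harmonic with value
  \<open>h 0\<close> at the centre, and on the sphere they are almost equal to the spherical average of \<open>h\<close>; so \<open>h 0\<close> is at most this average.\<close>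

lemma mean_value_sphere:
  fixes v :: "real^'n \<Rightarrow> ereal"
  assumes v: "viscosity {A. 0 \<le> trace A} X v" "usc_on (cball 0 1) v" "ball 0 1 \<subseteq> X"
    and f: "continuous_on UNIV f" and le: "\<And>x. norm x = 1 \<Longrightarrow> v x \<le> ereal (f x)"
  shows "v 0 \<le> ereal (\<integral>y. f (sgn y) \<partial>ball_prob)"
proof -
  interpret prob_space "ball_prob :: (real^'n) measure" by (rule prob_space_ball_prob)
  let ?m = "\<lambda>f. \<integral>y. f (1 *\<^sub>R sgn y) \<partial>(ball_prob :: (real^'n) measure)"
  have "v 0 \<le> ereal (?m f + 3 * \<epsilon>)" if e: "\<epsilon> > 0" for \<epsilon>
  proof -
    have "harmonic_approx (\<lambda>x. f x + \<epsilon>)"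
      by (intro dirichlet_approx continuous_intros continuous_on_subset[OF f]) auto
    then obtain h where h: "harmonic h" "\<And>x. norm x = 1 \<Longrightarrow> \<bar>h x - (f x + \<epsilon>)\<bar> \<le> \<epsilon>"
      using e unfolding harmonic_approx_def by (metis dist_0_norm mem_sphere)
    have hf: "f x \<le> h x" "h x \<le> f x + 2 * \<epsilon>" if "norm x = 1" for x using h(2)[OF that] by linarith+
    have "v 0 \<le> ereal (h 0)"
      by (rule trace_max_principle[OF v h(1)]) (use le hf(1) in \<open>force intro: order_trans\<close>)+
    also have "h 0 \<le> ?m h + \<epsilon>"
    proof -
      have ch: "continuous_on UNIV h" using h(1) by (rule harmonic_continuous)
      obtain gs where gs: "gs \<noteq> []" "set gs \<subseteq> G"
        and close: "\<And>x. norm x \<le> 1 \<Longrightarrow> \<bar>orbit_mean_real gs h x - (\<integral>y. h (norm x *\<^sub>R sgn y) \<partial>ball_prob)\<bar> \<le> \<epsilon>"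
        by (rule orbit_mean_real_close[OF ch e, where R=1]) (rule that)
      let ?w = "orbit_mean_real gs h"
      have hw: "harmonic ?w" using gs(2) orth by (intro harmonic_orbit_mean h(1)) auto
      then obtain D H where C2: "C2_with UNIV ?w D H" and H: "\<And>x. transpose (H x) = H x" "\<And>x. trace (H x) = 0"
        unfolding harmonic_def by blast
      have visc: "viscosity {A. 0 \<le> trace A} UNIV (\<lambda>x. ereal (?w x))"
        by (rule C2_viscosity[OF C2]) (simp_all add: H)
      have "usc_on (cball 0 1) (\<lambda>x. ereal (?w x) - ereal 0)"
      proof -
        have "usc_on (cball 0 1) (\<lambda>x. ereal 0 - ereal (- ?w x))"
          by (rule usc_on_minus) (auto simp: usc_on_def intro!: continuous_intros continuous_on_subset[OF harmonic_continuous[OF hw]])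
        then show ?thesis by simp
      qed
      then have usc: "usc_on (cball 0 1) (\<lambda>x. ereal (?w x))" by simp
      have "ereal (?w 0) \<le> ereal (?m h + \<epsilon>)"
      proof (rule trace_max_principle[OF visc usc _ harmonic_const])
        show "ereal (?w x) \<le> ereal (?m h + \<epsilon>)" if "norm x = 1" for x
          using close[of x] that by simp
      qed auto
      moreover have "?w 0 = h 0" using gs(1) by (simp add: orbit_mean_real_def sum_list_triv)
      ultimately show ?thesis by simp
    qed
    also have "?m h \<le> ?m (\<lambda>x. f x + 2 * \<epsilon>)"
    proof (rule integral_mono_AE)
      show "integrable ball_prob (\<lambda>y. h (1 *\<^sub>R sgn y))" "integrable ball_prob (\<lambda>y. f (1 *\<^sub>R sgn y) + 2 * \<epsilon>)"
        using integrable_sphere[OF harmonic_continuous[OF h(1)], of 0 1 "mat 1"] integrable_sphere[OF f, of 0 1 "mat 1"] by auto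
      show "AE y in ball_prob. h (1 *\<^sub>R sgn y) \<le> f (1 *\<^sub>R sgn y) + 2 * \<epsilon>"
        by (rule eventually_mono[OF AE_ball_prob]) (simp add: hf(2))
    qed
    also have "?m (\<lambda>x. f x + 2 * \<epsilon>) = ?m f + 2 * \<epsilon>"
      using integrable_sphere[OF f, of 0 1 "mat 1"] prob_space[simplified] by simp
    finally show ?thesis by (simp add: algebra_simps)
  qed
  note * = this
  have "v 0 \<le> ereal (?m f) + ereal \<epsilon>" if "\<epsilon> > 0" for \<epsilon>
    using *[of "\<epsilon> / 3"] that by simp
  then have "v 0 \<le> ereal (?m f)" by - (rule ereal_le_epsilon2, simp)
  then show ?thesis by simp
qed

end

section \<open>Mean values over ellipsoids\<close>

lemma usc_on_UNIV_borel:
  assumes "usc_on UNIV u" shows "u \<in> borel_measurable borel"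
proof (rule borel_measurableI_less)
  fix c
  have "open {x. u x < c}"
    unfolding open_dist
  proof (intro ballI)
    fix x assume "x \<in> {x. u x < c}"
    then obtain \<delta> where "\<delta> > 0" "\<And>y. dist y x < \<delta> \<Longrightarrow> u y < c" using usc_onD[OF assms, of x c] by auto
    then show "\<exists>e>0. \<forall>y. dist y x < e \<longrightarrow> y \<in> {x. u x < c}" by auto
  qed
  then show "{x \<in> space borel. u x < c} \<in> sets borel" by simp
qed

lemma usc_cutoff:
  assumes "usc_on (cball x \<rho>) u"
  shows "usc_on UNIV (\<lambda>y. if y \<in> cball x \<rho> then u y else -\<infinity>)"
proof (rule usc_onI)
  show "(if y \<in> cball x \<rho> then u y else -\<infinity>) < \<infinity>" for y using assms by (auto simp: usc_on_def)
  fix y c assume c: "(if y \<in> cball x \<rho> then u y else -\<infinity>) < c"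
  show "\<exists>\<delta>>0. \<forall>z\<in>UNIV. dist z y < \<delta> \<longrightarrow> (if z \<in> cball x \<rho> then u z else -\<infinity>) < c"
  proof (cases "y \<in> cball x \<rho>")
    case True
    then obtain \<delta> where "\<delta> > 0" "\<And>z. z \<in> cball x \<rho> \<Longrightarrow> dist z y < \<delta> \<Longrightarrow> u z < c"
      using usc_onD[OF assms True, of c] c by auto
    moreover have "-\<infinity> < c" using c by (cases c) auto
    ultimately show ?thesis by (intro exI[of _ \<delta>]) auto
  next
    case False
    have "open (- cball x \<rho>)" by auto
    then obtain \<delta> where "\<delta> > 0" "\<And>z. dist z y < \<delta> \<Longrightarrow> z \<in> - cball x \<rho>" using False unfolding open_dist by blast
    then show ?thesis using c False by (intro exI[of _ \<delta>]) auto
  qed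
qed

lemma viscosity_cong:
  assumes "viscosity F X u" "open Y" "Y \<subseteq> X" "\<And>y. y \<in> Y \<Longrightarrow> v y = u y"
  shows "viscosity F Y v"
  unfolding viscosity_def
proof (intro ballI allI impI, elim conjE)
  fix x0 N \<phi> D H assume x0: "x0 \<in> Y" "x0 \<in> N" "C2_with N \<phi> D H" "transpose (H x0) = H x0"
    and ev: "eventually (\<lambda>x. v x \<le> ereal (\<phi> x)) (nhds x0)" and eq: "v x0 = ereal (\<phi> x0)"
  have "eventually (\<lambda>x. u x \<le> ereal (\<phi> x)) (nhds x0)"
    using ev eventually_nhds_in_open[OF assms(2) x0(1)] by eventually_elim (simp add: assms(4))
  then show "H x0 \<in> F"
    using assms(1)[unfolded viscosity_def, rule_format, of x0 N \<phi> D H] x0 eq assms(3,4) by auto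
qed

lemma usc_on_compose:
  assumes u: "usc_on X u" and f: "continuous_on Y f" "\<And>y. y \<in> Y \<Longrightarrow> f y \<in> X"
  shows "usc_on Y (\<lambda>y. u (f y))"
proof (rule usc_onI)
  show "u (f y) < \<infinity>" if "y \<in> Y" for y using u f(2)[OF that] by (auto simp: usc_on_def)
  fix y c assume y: "y \<in> Y" and c: "u (f y) < c"
  obtain \<delta> where \<delta>: "\<delta> > 0" "\<And>x. x \<in> X \<Longrightarrow> dist x (f y) < \<delta> \<Longrightarrow> u x < c" using usc_onD[OF u f(2)[OF y] c] by blast
  obtain d where "d > 0" "\<And>z. z \<in> Y \<Longrightarrow> dist z y < d \<Longrightarrow> dist (f z) (f y) < \<delta>"
    using f(1) y \<delta>(1) unfolding continuous_on_iff by blast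
  then show "\<exists>\<delta>>0. \<forall>z\<in>Y. dist z y < \<delta> \<longrightarrow> u (f z) < c" using \<delta>(2) f(2) by blast
qed

lemma usc_on_add:
  assumes u: "usc_on X u" and v: "usc_on X v"
  shows "usc_on X (\<lambda>x. u x + v x)"
proof (rule usc_onI)
  fix x assume x: "x \<in> X"
  have fin: "u x < \<infinity>" "v x < \<infinity>" using u v x by (auto simp: usc_on_def)
  then show "u x + v x < \<infinity>" by auto
  fix c assume c: "u x + v x < c"
  have "\<exists>a b. u x < ereal a \<and> v x < ereal b \<and> ereal (a + b) \<le> c"
  proof -
    obtain d where d: "u x + v x < ereal d" "ereal d < c" using c ereal_dense2 by blast
    show ?thesis
    proof (cases "u x = -\<infinity>")
      case True
      obtain b where "v x < ereal b" using fin(2) ereal_dense2 by blast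
      then show ?thesis using True d by (intro exI[of _ "d - b"] exI[of _ b]) auto
    next
      case False
      then obtain a0 where a0: "u x = ereal a0" using fin(1) by (cases "u x") auto
      then have "v x < ereal (d - a0)" using d(1) by (cases "v x") auto
      then obtain b where b: "v x < ereal b" "b < d - a0" using ereal_dense2[of "v x" "ereal (d - a0)"] by auto
      then show ?thesis using a0 d(2) by (intro exI[of _ "d - b"] exI[of _ b]) auto
    qed
  qed
  then obtain a b where ab: "u x < ereal a" "v x < ereal b" "ereal (a + b) \<le> c" by blast
  obtain \<delta>1 where \<delta>1: "\<delta>1 > 0" "\<And>y. y \<in> X \<Longrightarrow> dist y x < \<delta>1 \<Longrightarrow> u y < ereal a" using usc_onD[OF u x ab(1)] by blast
  obtain \<delta>2 where \<delta>2: "\<delta>2 > 0" "\<And>y. y \<in> X \<Longrightarrow> dist y x < \<delta>2 \<Longrightarrow> v y < ereal b" using usc_onD[OF v x ab(2)] by blast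
  have "u y + v y < c" if "y \<in> X" "dist y x < min \<delta>1 \<delta>2" for y
  proof -
    have "u y < ereal a" "v y < ereal b" using that \<delta>1(2) \<delta>2(2) by auto
    then have "u y + v y < ereal (a + b)" by (cases "u y"; cases "v y") auto
    then show ?thesis using ab(3) by order
  qed
  then show "\<exists>\<delta>>0. \<forall>y\<in>X. dist y x < \<delta> \<longrightarrow> u y + v y < c"
    using \<delta>1(1) \<delta>2(1) by (intro exI[of _ "min \<delta>1 \<delta>2"]) auto
qed

lemma usc_orbit_mean:
  fixes u :: "real^'n \<Rightarrow> ereal"
  assumes u: "usc_on UNIV u" and gs: "gs \<noteq> []"
  shows "usc_on UNIV (orbit_mean gs u)"
proof -
  have "usc_on UNIV (\<lambda>x. \<Sum>g\<leftarrow>gs. u (g *v x))"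
  proof (induction gs)
    case Nil
    show ?case by (auto simp: usc_on_def)
  next
    case (Cons g gs)
    have "usc_on UNIV (\<lambda>x. u (g *v x))"
      by (rule usc_on_compose[OF u]) (auto intro!: continuous_intros)
    then show ?case using usc_on_add Cons by simp
  qed
  note s = this
  have m: "real (length gs) > 0" using gs by simp
  show ?thesis
  proof (rule usc_onI)
    show "orbit_mean gs u x < \<infinity>" for x
      using u by (intro orbit_mean_less_top gs) (auto simp: usc_on_def)
    fix x c assume "orbit_mean gs u x < c"
    then obtain d where d: "(\<Sum>g\<leftarrow>gs. u (g *v x)) / ereal (real (length gs)) < ereal d" "ereal d < c"
      unfolding orbit_mean_def using ereal_dense2 by blast
    then have "(\<Sum>g\<leftarrow>gs. u (g *v x)) < ereal (d * real (length gs))"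
      using m by (cases "\<Sum>g\<leftarrow>gs. u (g *v x)") (auto simp: field_simps)
    then obtain \<delta> where \<delta>: "\<delta> > 0" "\<And>y. dist y x < \<delta> \<Longrightarrow> (\<Sum>g\<leftarrow>gs. u (g *v y)) < ereal (d * real (length gs))"
      using usc_onD[OF s] by auto
    have "orbit_mean gs u y < c" if "dist y x < \<delta>" for y
    proof -
      have "orbit_mean gs u y \<le> ereal d"
        unfolding orbit_mean_def using \<delta>(2)[OF that] m by (cases "\<Sum>g\<leftarrow>gs. u (g *v y)") (auto simp: field_simps)
      then show ?thesis using d(2) by order
    qed
    then show "\<exists>\<delta>>0. \<forall>y\<in>UNIV. dist y x < \<delta> \<longrightarrow> orbit_mean gs u y < c" using \<delta>(1) by blast
  qed
qed

lemma average_const_le: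
  assumes "prob_space P" "AE x in P. c \<le> f x" "c < \<infinity>"
  shows "c \<le> average P f"
proof (cases c)
  case (real r)
  have "ereal r = average P (\<lambda>x. ereal r)"
    using average_real[OF assms(1), of "\<lambda>_. r"] assms(1) by (simp add: finite_measure.integrable_const prob_space.finite_measure prob_space.prob_space)
  also have "\<dots> \<le> average P f" using assms real by (intro average_mono_AE) auto
  finally show ?thesis using real by simp
qed (use assms in auto)

lemma average_le_const:
  assumes "prob_space P" "AE x in P. f x \<le> c"
  shows "average P f \<le> c"
proof (cases c)
  case (real r)
  have "average P f \<le> average P (\<lambda>x. ereal r)" using assms real by (intro average_mono_AE) auto
  also have "\<dots> = ereal r"
    using average_real[OF assms(1), of "\<lambda>_. r"] assms(1) by (simp add: finite_measure.integrable_const prob_space.finite_measure prob_space.prob_space)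
  finally show ?thesis using real by simp
next
  case MInf
  have "average P f \<le> average P (\<lambda>x. -\<infinity>)" using assms MInf by (intro average_mono_AE) auto
  also have "\<dots> = -\<infinity>"
    by (simp add: average_prob[OF assms(1)] prob_space.emeasure_space_1[OF assms(1)] e2ennreal_neg zero_ennreal.rep_eq)
  finally show ?thesis using MInf by simp
qed auto

context riesz_cone
begin

text \<open>The change of variables carries the half-space of all \<open>C\<close> with \<open>0 \<le> (A A\<^sup>t) \<bullet> C\<close>, which contains \<open>F\<close>, to that of nonnegative trace.\<close>

lemma viscosity_affine:
  fixes A :: "real^'n^'n"
  assumes u: "viscosity F X u" and A: "invertible A" and dual: "\<And>C. C \<in> F \<Longrightarrow> 0 \<le> (A ** transpose A) \<bullet> C"
  shows "viscosity {C. 0 \<le> trace C} {y. x0 + A *v y \<in> X} (\<lambda>y. u (x0 + A *v y))"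
  unfolding viscosity_def
proof (intro ballI allI impI, elim conjE)
  fix y0 N \<phi> D H assume y0: "y0 \<in> {y. x0 + A *v y \<in> X}" "y0 \<in> N" and C2: "C2_with N \<phi> D H" and sym: "transpose (H y0) = H y0"
    and ev: "eventually (\<lambda>y. u (x0 + A *v y) \<le> ereal (\<phi> y)) (nhds y0)" and eq: "u (x0 + A *v y0) = ereal (\<phi> y0)"
  obtain B where B: "A ** B = mat 1" "B ** A = mat 1" using A by (auto simp: invertible_def)
  define \<psi> where "\<psi> x = - (B *v x0) + B *v x" for x
  have \<psi>: "x0 + A *v \<psi> x = x" for x
    by (simp add: \<psi>_def matrix_vector_right_distrib matrix_vector_mult_diff_distrib matrix_vector_mul_assoc B linear_neg[OF matrix_vector_mul_linear])
  let ?x1 = "x0 + A *v y0"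
  have \<psi>1: "\<psi> ?x1 = y0" by (simp add: \<psi>_def matrix_vector_right_distrib matrix_vector_mul_assoc B)
  have C2': "C2_with {x. \<psi> x \<in> N} (\<lambda>x. \<phi> (\<psi> x)) (\<lambda>x. transpose B *v D (\<psi> x)) (\<lambda>x. transpose B ** H (\<psi> x) ** B)"
    unfolding \<psi>_def by (rule C2_with_affine[OF C2])
  have "continuous_on UNIV \<psi>" unfolding \<psi>_def by (intro continuous_intros)
  then have "filterlim \<psi> (nhds (\<psi> ?x1)) (nhds ?x1)"
    by (simp add: continuous_on_eq_continuous_at isCont_def tendsto_at_iff_tendsto_nhds[symmetric])
  then have "eventually (\<lambda>x. u (x0 + A *v \<psi> x) \<le> ereal (\<phi> (\<psi> x))) (nhds ?x1)"
    unfolding \<psi>1 filterlim_iff using ev by blast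
  then have "eventually (\<lambda>x. u x \<le> ereal (\<phi> (\<psi> x))) (nhds ?x1)" by (simp add: \<psi>)
  moreover have "transpose (transpose B ** H (\<psi> ?x1) ** B) = transpose B ** H (\<psi> ?x1) ** B"
    using sym by (simp add: \<psi>1 matrix_transpose_mul matrix_mul_assoc)
  ultimately have "transpose B ** H (\<psi> ?x1) ** B \<in> F"
    using u[unfolded viscosity_def, rule_format, of ?x1 "{x. \<psi> x \<in> N}" "\<lambda>x. \<phi> (\<psi> x)" "\<lambda>x. transpose B *v D (\<psi> x)" "\<lambda>x. transpose B ** H (\<psi> x) ** B"]
      C2' y0 eq \<psi>1 by auto
  then have "0 \<le> (A ** transpose A) \<bullet> (transpose B ** H y0 ** B)" using dual \<psi>1 by simp
  also have "\<dots> = trace (A ** (transpose A ** transpose B) ** (H y0 ** B))"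
    by (simp add: inner_matrix_trace matrix_transpose_mul matrix_mul_assoc)
  also have "transpose A ** transpose B = mat 1" using B by (simp add: matrix_transpose_mul[symmetric] transpose_mat)
  also have "trace (A ** mat 1 ** (H y0 ** B)) = trace (H y0 ** B ** A)"
    by (simp add: trace_mul_sym[of A])
  also have "\<dots> = trace (H y0)" by (simp add: matrix_mul_assoc[symmetric] B)
  finally show "H y0 \<in> {C. 0 \<le> trace C}" by simp
qed

text \<open>By \<open>viscosity_affine\<close> this is the mean value inequality on the unit sphere, applied to continuous functions that
  decrease to \<open>u\<close>.\<close>

lemma mean_value_ellipsoid:
  fixes A :: "real^'n^'n" and c0 :: real
  assumes u: "viscosity F X u" "usc_on UNIV u" "\<And>x. u x \<le> ereal c0"
    and A: "invertible A" and dual: "\<And>C. C \<in> F \<Longrightarrow> 0 \<le> (A ** transpose A) \<bullet> C"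
    and X: "\<And>y. norm y < 1 \<Longrightarrow> x0 + A *v y \<in> X"
  shows "u x0 \<le> average ball_prob (\<lambda>y. u (x0 + A *v sgn y))"
proof -
  note P = prob_space_ball_prob[where 'n='n]
  let ?v = "\<lambda>y. u (x0 + A *v y)"
  have v: "viscosity {C. 0 \<le> trace C} {y. x0 + A *v y \<in> X} ?v" by (rule viscosity_affine[OF u(1) A dual])
  have uv: "usc_on UNIV ?v" by (rule usc_on_compose[OF u(2)]) (auto intro!: continuous_intros)
  then have uv1: "usc_on (cball 0 1) ?v" by (rule usc_on_subset) simp
  have vm[measurable]: "?v \<in> borel_measurable borel" by (rule usc_on_UNIV_borel[OF uv])
  obtain f where f: "\<And>k. continuous_on UNIV (f k)" "\<And>k x. f (Suc k) x \<le> f k x"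
    "\<And>k x. x \<in> cball 0 1 \<Longrightarrow> ?v x \<le> ereal (f k x)" "\<And>x. x \<in> cball 0 1 \<Longrightarrow> (\<lambda>k. ereal (f k x)) \<longlonglongrightarrow> ?v x"
    using usc_approx[OF compact_cball _ uv1] by (metis cball_eq_empty not_one_less_zero)
  have le: "?v 0 \<le> ereal (\<integral>y. f k (sgn y) \<partial>ball_prob)" for k
    by (rule mean_value_sphere[OF v uv1 _ f(1)]) (use X f(3) in auto)
  have "?v 0 \<le> average ball_prob (\<lambda>y. ?v (sgn y))"
  proof (rule ccontr)
    assume "\<not> ?v 0 \<le> average ball_prob (\<lambda>y. ?v (sgn y))"
    then obtain c where c: "average ball_prob (\<lambda>y. ?v (sgn y)) < ereal c" "ereal c < ?v 0"
      using ereal_dense2 by (metis not_le)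
    have "AE y in ball_prob. sgn y \<in> cball (0::real^'n) 1"
      by (rule eventually_mono[OF AE_ball_prob]) auto
    then have "eventually (\<lambda>k. (\<integral>y. f k (sgn y) \<partial>ball_prob) < c) sequentially"
      by (intro average_decreasing_limit[where K="cball 0 1", OF P _ vm f(1,2) f(4) _ compact_cball c(1)]) auto
    then obtain k where "(\<integral>y. f k (sgn y) \<partial>ball_prob) < c" by (auto simp: eventually_sequentially)
    then have "ereal (\<integral>y. f k (sgn y) \<partial>ball_prob) < ereal c" by simp
    then show False using le[of k] c(2) by order
  qed
  then show ?thesis by simp
qed

lemma invertible_scale: "c \<noteq> 0 \<Longrightarrow> invertible (A :: real^'n^'n) \<Longrightarrow> invertible (c *\<^sub>R A)"
proof -
  assume c: "c \<noteq> 0" and "invertible A"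
  then obtain B where "A ** B = mat 1" "B ** A = mat 1" by (auto simp: invertible_def)
  then show ?thesis unfolding invertible_def using c
    by (intro exI[of _ "(1/c) *\<^sub>R B"]) (simp add: matrix_scalar_ac scalar_matrix_assoc[symmetric])
qed

lemma invertible_mat_1: "invertible (mat 1 :: real^'n^'n)"
  unfolding invertible_def by (intro exI[of _ "mat 1"]) simp

lemma mean_value_sphere_average:
  fixes c0 :: real
  assumes u: "viscosity F X u" "usc_on UNIV u" "\<And>x. u x \<le> ereal c0" and X: "ball x0 \<rho> \<subseteq> X" and \<rho>: "\<rho> > 0"
  shows "u x0 \<le> average ball_prob (\<lambda>y. u (x0 + \<rho> *\<^sub>R sgn y))"
proof -
  have mv: "(\<rho> *\<^sub>R mat 1) *v y = \<rho> *\<^sub>R y" for y :: "real^'n"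
    by (simp add: scaleR_matrix_vector_assoc[symmetric])
  have "(\<rho> *\<^sub>R mat 1) ** transpose (\<rho> *\<^sub>R mat 1) = \<rho>\<^sup>2 *\<^sub>R (mat 1 :: real^'n^'n)"
    by (simp add: matrix_eq matrix_vector_mul_assoc[symmetric] transpose_scale' transpose_mat mv scaleR_matrix_vector_assoc[symmetric] power2_eq_square)
  then have "0 \<le> ((\<rho> *\<^sub>R mat 1) ** transpose (\<rho> *\<^sub>R mat 1)) \<bullet> C" if "C \<in> F" for C :: "real^'n^'n"
    using trace_nonneg[OF that] inner_mat_1[of C] by (simp add: inner_commute)
  from mean_value_ellipsoid[OF u invertible_scale[OF _ invertible_mat_1] this, of x0]
  show ?thesis using X \<rho> unfolding mv by (auto simp: dist_norm subset_iff)
qed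

lemma mean_value_ball:
  fixes c0 :: real
  assumes u: "viscosity F X u" "usc_on UNIV u" "\<And>x. u x \<le> ereal c0" and X: "ball x0 \<rho> \<subseteq> X" and \<rho>: "\<rho> > 0"
  shows "u x0 \<le> average ball_prob (\<lambda>z. u (x0 + \<rho> *\<^sub>R z))"
proof -
  note P = prob_space_ball_prob[where 'n='n]
  have [measurable]: "u \<in> borel_measurable borel" by (rule usc_on_UNIV_borel[OF u(2)])
  have "u x0 \<le> average ball_prob (\<lambda>y::real^'n. average ball_prob (\<lambda>x. u (x0 + (\<rho> * norm y) *\<^sub>R sgn x)))"
  proof (rule average_const_le[OF P])
    show "AE y in ball_prob. u x0 \<le> average ball_prob (\<lambda>x. u (x0 + (\<rho> * norm (y::real^'n)) *\<^sub>R sgn x))"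
    proof (rule eventually_mono[OF AE_ball_prob])
      fix y :: "real^'n" assume y: "y \<noteq> 0 \<and> norm y \<le> 1 \<and> norm (sgn y) = 1"
      then have "\<rho> * norm y \<le> \<rho>" using \<rho> by (simp add: mult_le_cancel_left1)
      then show "u x0 \<le> average ball_prob (\<lambda>x. u (x0 + (\<rho> * norm y) *\<^sub>R sgn x))"
        using y \<rho> subset_ball[of "\<rho> * norm y" \<rho> x0] X by (intro mean_value_sphere_average[OF u]) auto
    qed
    show "u x0 < \<infinity>" using u(2) by (auto simp: usc_on_def)
  qed
  also have "\<dots> = average ball_prob (\<lambda>z. u (x0 + \<rho> *\<^sub>R z))"
    by (rule average_polar[where w="\<lambda>z. u (x0 + z)", symmetric]) (use u(3) in auto)
  finally show ?thesis .
qed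

text \<open>A sum of viscosity subsolutions is treated here through mean values. If a test function \<open>\<phi>\<close> touched the orbit mean
  with a second derivative \<open>K\<close> outside \<open>F\<close>, then \<open>separation\<close> would give \<open>A\<close> with \<open>(A A\<^sup>t) \<bullet> K < 0\<close>, so that the average
  of \<open>\<phi>\<close> over a small ellipsoid \<open>x0 + t A S\<close> were below \<open>\<phi> x0\<close>. But \<open>u\<close> satisfies the mean value inequality over all the rotated
  ellipsoids \<open>g (x0 + t A S)\<close>, because \<open>F\<close> is invariant under \<open>G\<close>, and the mean of these inequalities contradicts this.\<close>

lemma viscosity_orbit_mean:
  fixes u :: "real^'n \<Rightarrow> ereal" and c0 :: real
  assumes u: "viscosity F (ball 0 \<rho>) u" "usc_on UNIV u" "\<And>x. u x \<le> ereal c0"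
    and gs: "gs \<noteq> []" "set gs \<subseteq> G"
  shows "viscosity F (ball 0 \<rho>) (orbit_mean gs u)"
  unfolding viscosity_def
proof (intro ballI allI impI, elim conjE)
  fix x0 N \<phi> D K
  assume x0: "x0 \<in> ball 0 \<rho>" "x0 \<in> N" and C2: "C2_with N \<phi> D K" and sym: "transpose (K x0) = K x0"
    and ev: "eventually (\<lambda>x. orbit_mean gs u x \<le> ereal (\<phi> x)) (nhds x0)" and eq: "orbit_mean gs u x0 = ereal (\<phi> x0)"
  note P = prob_space_ball_prob[where 'n='n]
  interpret P: prob_space "ball_prob :: (real^'n) measure" by (rule P)
  show "K x0 \<in> F"
  proof (rule ccontr)
    assume notin: "K x0 \<notin> F"
    obtain \<epsilon> where \<epsilon>: "\<epsilon> > 0" "K x0 + \<epsilon> *\<^sub>R mat 1 \<notin> F"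
    proof -
      have "open (- F)" using F_closed by auto
      then obtain e where e: "e > 0" "\<And>B. dist B (K x0) < e \<Longrightarrow> B \<notin> F" using notin unfolding open_dist by auto
      define n where "n = norm (mat 1 :: real^'n^'n) + 1"
      have n: "n > 0" unfolding n_def by (simp add: add_nonneg_pos)
      let ?e = "e / (2 * n)"
      have "dist (K x0 + ?e *\<^sub>R mat 1) (K x0) = ?e * norm (mat 1 :: real^'n^'n)" using e(1) n by (simp add: dist_norm)
      also have "\<dots> \<le> ?e * n" using e(1) n by (intro mult_left_mono) (auto simp: n_def)
      also have "\<dots> = e / 2" using n by (simp add: field_simps)
      also have "\<dots> < e" using e(1) by simp
      finally have "K x0 + ?e *\<^sub>R mat 1 \<notin> F" by (rule e(2))
      moreover have "?e > 0" using e(1) n by simp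
      ultimately show ?thesis by (rule that[rotated])
    qed
    \<comment> \<open>the multiple of the identity absorbs the remainder in the Taylor expansion of \<open>\<phi>\<close>\<close>
    let ?H = "K x0 + \<epsilon> *\<^sub>R mat 1"
    have symH: "transpose ?H = ?H" using sym by (simp add: transpose_add' transpose_scale' transpose_mat)
    obtain A :: "real^'n^'n" where A: "invertible A" "(A ** transpose A) \<bullet> ?H < 0" "\<And>C. C \<in> F \<Longrightarrow> 0 \<le> (A ** transpose A) \<bullet> C"
      by (rule separation[OF \<epsilon>(2) symH]) (rule that)
    obtain \<delta> where \<delta>: "\<delta> > 0" and tay: "\<And>y. norm (y - x0) < \<delta> \<Longrightarrow>
      \<bar>\<phi> y - (\<phi> x0 + D x0 \<bullet> (y - x0) + (y - x0) \<bullet> (K x0 *v (y - x0)) / 2)\<bar> \<le> (\<epsilon> / 2) * (norm (y - x0))\<^sup>2"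
      by (rule taylor2[OF C2 x0(2) sym, of "\<epsilon> / 2"]) (use \<epsilon>(1) in auto)
    obtain \<delta>' where \<delta>': "\<delta>' > 0" "\<And>y. dist y x0 < \<delta>' \<Longrightarrow> orbit_mean gs u y \<le> ereal (\<phi> y)"
      using ev unfolding eventually_nhds_metric by auto
    define \<eta> where "\<eta> = min (min \<delta> \<delta>') (\<rho> - norm x0)"
    have \<eta>: "\<eta> > 0" "\<eta> \<le> \<delta>" "\<eta> \<le> \<delta>'" "\<eta> \<le> \<rho> - norm x0" using \<delta> \<delta>'(1) x0(1) by (auto simp: \<eta>_def)
    define t where "t = \<eta> / (2 * (onorm ((*v) A) + 1))"
    have on: "onorm ((*v) A) \<ge> 0" by (rule onorm_pos_le) simp
    have t: "t > 0" using \<eta>(1) on by (simp add: t_def)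
    have small: "norm (t *\<^sub>R (A *v y)) < \<eta>" if "norm y \<le> 1" for y
    proof -
      have "norm (A *v y) \<le> onorm ((*v) A) * norm y" by (rule onorm) simp
      also have "\<dots> \<le> onorm ((*v) A) * 1" using that on by (intro mult_left_mono)
      finally have "norm (t *\<^sub>R (A *v y)) \<le> t * (onorm ((*v) A) + 1)" using t by simp
      also have "\<dots> = \<eta> / 2" using on unfolding t_def by (simp add: field_simps)
      finally show ?thesis using \<eta>(1) by simp
    qed
    let ?r = "\<lambda>x. real_of_ereal (u x)"
    let ?Y = "\<lambda>y. x0 + t *\<^sub>R (A *v sgn y)"
    have ufin: "u x < \<infinity>" for x using u(2) by (auto simp: usc_on_def)
    have um[measurable]: "u \<in> borel_measurable borel" by (rule usc_on_UNIV_borel[OF u(2)])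
    have each: "\<bar>u (g *v x0)\<bar> \<noteq> \<infinity>" "AE y in ball_prob. \<bar>u (g *v ?Y y)\<bar> \<noteq> \<infinity>"
        "integrable ball_prob (\<lambda>y. ?r (g *v ?Y y))" "?r (g *v x0) \<le> (\<integral>y. ?r (g *v ?Y y) \<partial>ball_prob)"
      if g: "g \<in> set gs" for g
    proof -
      have gG: "g \<in> G" using g gs by auto
      have og: "orthogonal_matrix g" by (rule orth[OF gG])
      show fin: "\<bar>u (g *v x0)\<bar> \<noteq> \<infinity>" using orbit_mean_finite[where x=x0 and u=u, OF gs(1) ufin _ g] eq by simp
      let ?B = "t *\<^sub>R (g ** A)"
      have inv: "invertible ?B"
        using t A(1) og by (intro invertible_scale invertible_mult) (auto simp: orthogonal_matrix_def invertible_def)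
      have BB: "?B ** transpose ?B = t\<^sup>2 *\<^sub>R (g ** (A ** transpose A) ** transpose g)"
        by (simp add: transpose_scale' matrix_transpose_mul matrix_mul_assoc matrix_scalar_ac scalar_matrix_assoc[symmetric] power2_eq_square)
      have dual: "0 \<le> (?B ** transpose ?B) \<bullet> C" if C: "C \<in> F" for C
      proof -
        have "(g ** (A ** transpose A) ** transpose g) \<bullet> C = trace (g ** ((A ** transpose A) ** transpose g ** C))"
          by (simp add: inner_matrix_trace matrix_transpose_mul matrix_mul_assoc)
        also have "\<dots> = trace (((A ** transpose A) ** transpose g ** C) ** g)" by (rule trace_mul_sym)
        also have "\<dots> = (A ** transpose A) \<bullet> (transpose g ** C ** g)"
          by (simp add: inner_matrix_trace matrix_transpose_mul matrix_mul_assoc)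
        also have "\<dots> \<ge> 0" using A(3) invariant[OF transpose_G[OF gG] C] by simp
        finally show ?thesis unfolding BB by simp
      qed
      have Bv: "g *v x0 + ?B *v y = g *v (x0 + t *\<^sub>R (A *v y))" for y
        by (simp add: matrix_vector_right_distrib matrix_vector_mult_scaleR matrix_vector_mul_assoc scaleR_matrix_vector_assoc[symmetric])
      have inX: "g *v x0 + ?B *v y \<in> ball 0 \<rho>" if "norm y < 1" for y
      proof -
        have "norm (g *v (x0 + t *\<^sub>R (A *v y))) \<le> norm x0 + norm (t *\<^sub>R (A *v y))"
          unfolding norm_orthogonal_matrix[OF og] by (rule norm_triangle_ineq)
        also have "\<dots> < norm x0 + \<eta>" using small[of y] that by simp
        finally show ?thesis unfolding Bv using \<eta>(4) by simp
      qed
      have mv: "u (g *v x0) \<le> average ball_prob (\<lambda>y. u (g *v ?Y y))"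
        using mean_value_ellipsoid[OF u inv dual inX] unfolding Bv .
      have [measurable]: "(\<lambda>x. B *v x) \<in> borel \<rightarrow>\<^sub>M borel" for B :: "real^'n^'n"
        by (intro borel_measurable_continuous_onI continuous_intros)
      have m: "(\<lambda>y. u (g *v ?Y y)) \<in> borel_measurable ball_prob" by measurable
      show "AE y in ball_prob. \<bar>u (g *v ?Y y)\<bar> \<noteq> \<infinity>" "integrable ball_prob (\<lambda>y. ?r (g *v ?Y y))"
        "?r (g *v x0) \<le> (\<integral>y. ?r (g *v ?Y y) \<partial>ball_prob)"
        by (rule average_cases[OF P m, of c0]; use u(3) mv fin in \<open>cases "u (g *v x0)"; simp\<close>)+
    qed
    have sums: "integrable ball_prob (\<lambda>y. \<Sum>g\<leftarrow>hs. ?r (g *v ?Y y)) \<and>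
      (\<Sum>g\<leftarrow>hs. ?r (g *v x0)) \<le> (\<integral>y. (\<Sum>g\<leftarrow>hs. ?r (g *v ?Y y)) \<partial>ball_prob)" if "set hs \<subseteq> set gs" for hs
      using that
    proof (induction hs)
      case (Cons h hs)
      have "integrable ball_prob (\<lambda>y. ?r (h *v ?Y y))" "?r (h *v x0) \<le> (\<integral>y. ?r (h *v ?Y y) \<partial>ball_prob)"
        using each[of h] Cons.prems by auto
      then show ?case using Cons by (simp only: list.map sum_list.Cons set_simps insert_subset
        Bochner_Integration.integral_add Bochner_Integration.integrable_add) (auto intro: add_mono)
    qed simp
    have int: "integrable ball_prob (\<lambda>y. orbit_mean_real gs ?r (?Y y))"
      and le1: "orbit_mean_real gs ?r x0 \<le> (\<integral>y. orbit_mean_real gs ?r (?Y y) \<partial>ball_prob)"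
      using sums[OF order_refl] unfolding orbit_mean_real_def by (auto intro!: divide_right_mono)
    have "ereal (orbit_mean_real gs ?r x0) = orbit_mean gs u x0"
      using each(1) by (intro orbit_mean_eq_real[symmetric] gs(1)) (simp add: ereal_real)
    then have \<phi>0: "orbit_mean_real gs ?r x0 = \<phi> x0" using eq by simp
    let ?q = "\<lambda>y. \<phi> x0 + t * (D x0 \<bullet> (A *v sgn y)) + t\<^sup>2 / 2 * (sgn y \<bullet> ((transpose A ** ?H ** A) *v sgn y))"
    have intl: "integrable ball_prob (\<lambda>y. D x0 \<bullet> (A *v sgn y))" 
      using integrable_sphere[of "\<lambda>x. D x0 \<bullet> x" 0 1 A] by (simp add: continuous_on_inner)
    have intq: "integrable ball_prob (\<lambda>y. sgn y \<bullet> ((transpose A ** ?H ** A) *v sgn y))"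
      using integrable_sphere[of "\<lambda>x. x \<bullet> ((transpose A ** ?H ** A) *v x)" 0 1 "mat 1"]
      by (simp add: continuous_on_inner matrix_vector_mult_linear_continuous_on)
    have allfin: "AE y in ball_prob. \<forall>g\<in>set gs. \<bar>u (g *v ?Y y)\<bar> \<noteq> \<infinity>"
      using each(2) by (simp add: AE_finite_all)
    have "(\<integral>y. orbit_mean_real gs ?r (?Y y) \<partial>ball_prob) \<le> (\<integral>y. ?q y \<partial>ball_prob)"
    proof (rule integral_mono_AE[OF int])
      show "integrable ball_prob ?q" using intl intq by simp
      show "AE y in ball_prob. orbit_mean_real gs ?r (?Y y) \<le> ?q y"
        using allfin AE_ball_prob
      proof eventually_elim
        case (elim y)
        let ?h = "t *\<^sub>R (A *v sgn y)"
        have nh: "norm ?h < \<eta>" using small[of "sgn y"] elim by simp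
        have "ereal (orbit_mean_real gs ?r (?Y y)) = orbit_mean gs u (?Y y)"
          using elim by (intro orbit_mean_eq_real[symmetric] gs(1)) (simp add: ereal_real)
        also have "\<dots> \<le> ereal (\<phi> (?Y y))" using nh \<eta>(3) by (intro \<delta>'(2)) (simp add: dist_norm)
        finally have "orbit_mean_real gs ?r (?Y y) \<le> \<phi> (?Y y)" by simp
        also have "\<dots> \<le> \<phi> x0 + D x0 \<bullet> ?h + ?h \<bullet> (K x0 *v ?h) / 2 + (\<epsilon> / 2) * (norm ?h)\<^sup>2"
          using abs_le_D1[OF tay[of "?Y y"]] nh \<eta>(2) by simp
        also have "(\<epsilon> / 2) * (norm ?h)\<^sup>2 = ?h \<bullet> ((\<epsilon> *\<^sub>R mat 1) *v ?h) / 2"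
          unfolding power2_norm_eq_inner by (simp add: scaleR_matrix_vector_assoc[symmetric])
        also have "\<phi> x0 + D x0 \<bullet> ?h + ?h \<bullet> (K x0 *v ?h) / 2 + ?h \<bullet> ((\<epsilon> *\<^sub>R mat 1) *v ?h) / 2 = \<phi> x0 + D x0 \<bullet> ?h + ?h \<bullet> (?H *v ?h) / 2"
          by (simp add: matrix_vector_mult_add_rdistrib inner_add_right add_divide_distrib)
        also have "?h \<bullet> (?H *v ?h) = t\<^sup>2 * (sgn y \<bullet> ((transpose A ** ?H ** A) *v sgn y))"
        proof -
          have "?h \<bullet> (?H *v ?h) = t\<^sup>2 * ((A *v sgn y) \<bullet> (?H *v (A *v sgn y)))"
            by (simp only: matrix_vector_mult_scaleR inner_scaleR_left inner_scaleR_right power2_eq_square mult.assoc)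
          also have "(A *v sgn y) \<bullet> (?H *v (A *v sgn y)) = sgn y \<bullet> (transpose A *v (?H *v (A *v sgn y)))"
            using matrix_inner_transpose[of "sgn y" "transpose A" "?H *v (A *v sgn y)"] by (simp only: transpose_transpose)
          finally show ?thesis by (simp only: matrix_vector_mul_assoc matrix_mul_assoc)
        qed
        finally show ?case by simp
      qed
    qed
    also have "(\<integral>y. ?q y \<partial>ball_prob) = \<phi> x0 + t * (\<integral>y. D x0 \<bullet> (A *v sgn y) \<partial>ball_prob)
       + t\<^sup>2 / 2 * (\<integral>y. sgn y \<bullet> ((transpose A ** ?H ** A) *v sgn y) \<partial>ball_prob)"
      using intl intq P.prob_space[simplified] by simp
    also have "\<dots> = \<phi> x0 + t\<^sup>2 / 2 * (trace (transpose A ** ?H ** A) / CARD('n))"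
      by (simp only: sphere_mean_linear sphere_mean_quadratic mult_zero_right add_0_right)
    also have "trace (transpose A ** ?H ** A) = (A ** transpose A) \<bullet> ?H"
    proof -
      have "trace (transpose A ** ?H ** A) = trace (A ** (transpose A ** ?H))" by (rule trace_mul_sym)
      then show ?thesis by (simp add: inner_matrix_trace matrix_transpose_mul matrix_mul_assoc)
    qed
    also have "\<phi> x0 + t\<^sup>2 / 2 * ((A ** transpose A) \<bullet> ?H / CARD('n)) < \<phi> x0"
      using A(2) t by (simp add: mult_pos_neg divide_neg_pos)
    finally show False using le1 \<phi>0 by simp
  qed
qed

end

section \<open>Comparison with the Riesz kernel\<close>

abbreviation "rk \<equiv> riesz_kernel"

lemma riesz_kernel_strict_mono: "0 < s \<Longrightarrow> s < t \<Longrightarrow> rk p s < rk p t"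
  unfolding riesz_kernel_def
  by (auto intro: powr_less_mono2 powr_less_mono2_neg)

lemma riesz_kernel_scale:
  assumes "0 < l" "0 < s" "0 < t"
  shows "rk p (l * t) - rk p (l * s) = (if p = 2 then 1 else l powr (2 - p)) * (rk p t - rk p s)"
  using assms unfolding riesz_kernel_def by (auto simp: powr_mult ln_mult algebra_simps)

text \<open>The Riesz kernel as a function of \<open>q = |x|\<^sup>2\<close>, which is smooth in \<open>x\<close>. Its derivative is \<open>kc p q\<^sup>-\<^sup>p\<^sup>/\<^sup>2\<close> in all three cases.\<close>

definition kq :: "real \<Rightarrow> real \<Rightarrow> real" where
  "kq p q = (if p < 2 then q powr ((2 - p) / 2) else if p = 2 then ln q / 2 else - (q powr ((2 - p) / 2)))"

definition kc :: "real \<Rightarrow> real" where "kc p = (if p = 2 then 1/2 else \<bar>2 - p\<bar> / 2)"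

lemma kc_pos: "kc p > 0" by (simp add: kc_def)

lemma kq_norm: "x \<noteq> 0 \<Longrightarrow> kq p (x \<bullet> x) = rk p (norm x)"
proof -
  assume x: "x \<noteq> 0"
  have xx: "x \<bullet> x = norm x powr 2" using x by (simp add: dot_square_norm powr_numeral)
  have "(x \<bullet> x) powr ((2 - p) / 2) = norm x powr (2 - p)" unfolding xx powr_powr by (rule arg_cong2[where f="(powr)"]) (auto simp: field_simps)
  moreover have "ln (x \<bullet> x) = 2 * ln (norm x)" unfolding xx using x by (simp only: ln_powr norm_eq_zero)
  ultimately show ?thesis unfolding kq_def riesz_kernel_def by simp
qed

lemma kq_deriv:
  assumes "q > 0"
  shows "(kq p has_real_derivative kc p * q powr (- p / 2)) (at q)"
    "((\<lambda>q. kc p * q powr (- p / 2)) has_real_derivative kc p * (- p / 2) * q powr (- p / 2 - 1)) (at q)"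
proof -
  consider "p < 2" | "p = 2" | "p > 2" by linarith
  then show "(kq p has_real_derivative kc p * q powr (- p / 2)) (at q)"
  proof cases
    case 1
    have "((\<lambda>q. q powr ((2 - p) / 2)) has_real_derivative ((2 - p) / 2) * q powr ((2 - p) / 2 - 1)) (at q)"
      using assms by (auto intro!: derivative_eq_intros)
    moreover have "(2 - p) / 2 - 1 = - p / 2" by (simp add: field_simps)
    ultimately show ?thesis using 1 by (simp add: kq_def[abs_def] kc_def)
  next
    case 2
    have "((\<lambda>q. ln q / 2) has_real_derivative 1 / q / 2) (at q)"
      using assms by (auto intro!: derivative_eq_intros)
    then show ?thesis using 2 assms by (simp add: kq_def[abs_def] kc_def powr_minus_divide mult.commute)
  next
    case 3
    have "((\<lambda>q. - (q powr ((2 - p) / 2))) has_real_derivative - (((2 - p) / 2) * q powr ((2 - p) / 2 - 1))) (at q)"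
      using assms by (auto intro!: derivative_eq_intros)
    moreover have "(2 - p) / 2 - 1 = - p / 2" by (simp add: field_simps)
    moreover have "kq p = (\<lambda>q. - (q powr ((2 - p) / 2)))" using 3 by (simp add: kq_def[abs_def])
    moreover have "kc p = - ((2 - p) / 2)" using 3 by (simp add: kc_def field_simps)
    ultimately show ?thesis by simp
  qed
  show "((\<lambda>q. kc p * q powr (- p / 2)) has_real_derivative kc p * (- p / 2) * q powr (- p / 2 - 1)) (at q)"
    using assms by (auto intro!: derivative_eq_intros)
qed

lemma outer_self: "outer x x = line_proj x"
  by (simp add: outer_def line_proj_def)

context riesz_cone
begin

text \<open>The second derivative of \<open>a K\<^sub>p(|x|) + b - \<epsilon> |x|\<^sup>2\<close> is a nonnegative multiple of \<open>riesz_matrix (sgn x) p\<close> minus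
  \<open>2 \<epsilon>\<close> times the identity.\<close>

lemma barrier:
  fixes b \<epsilon> :: real
  assumes a: "a \<ge> 0" and e: "\<epsilon> > 0"
  obtains D H where "C2_with {x::real^'n. x \<bullet> x \<in> {0<..}} (\<lambda>x. a * kq p (x \<bullet> x) + b - \<epsilon> * (x \<bullet> x)) D H"
    "\<And>x. x \<noteq> 0 \<Longrightarrow> transpose (H x) = H x \<and> H x \<notin> F"
proof -
  let ?b1 = "\<lambda>q. a * (kc p * q powr (- p / 2)) - \<epsilon>" and ?b2 = "\<lambda>q. a * (kc p * (- p / 2) * q powr (- p / 2 - 1))"
  let ?H = "\<lambda>x::real^'n. (0 * (a * kq p (x \<bullet> x) + b - \<epsilon> * (x \<bullet> x))) *\<^sub>R outer 0 0 + (2 * 0 * ?b1 (x \<bullet> x)) *\<^sub>R (outer 0 x + outer x 0)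
     + (4 * 1 * ?b2 (x \<bullet> x)) *\<^sub>R outer x x + (2 * 1 * ?b1 (x \<bullet> x)) *\<^sub>R mat 1"
  have "C2_with {x::real^'n. x \<bullet> x \<in> {0<..}} (\<lambda>x. 1 * (a * kq p (x \<bullet> x) + b - \<epsilon> * (x \<bullet> x)))
    (\<lambda>x. (0 * (a * kq p (x \<bullet> x) + b - \<epsilon> * (x \<bullet> x))) *\<^sub>R 0 + (2 * 1 * ?b1 (x \<bullet> x)) *\<^sub>R x) ?H"
  proof (rule C2_with_ridge_radial[of "\<lambda>s. 1" "\<lambda>s. 0" "\<lambda>s. 0" "{0<..}" "\<lambda>q. a * kq p q + b - \<epsilon> * q" ?b1 ?b2 0])
    fix q :: real assume "q \<in> {0<..}"
    then have q: "q > 0" by simp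
    show "((\<lambda>q. a * kq p q + b - \<epsilon> * q) has_real_derivative ?b1 q) (at q)"
      by (rule DERIV_cong[OF DERIV_diff[OF DERIV_add[OF DERIV_cmult[OF kq_deriv(1)[OF q]] DERIV_const] DERIV_cmult[OF DERIV_ident]]]) simp
    show "(?b1 has_real_derivative ?b2 q) (at q)"
      by (rule DERIV_cong[OF DERIV_diff[OF DERIV_cmult[OF kq_deriv(2)[OF q]] DERIV_const]]) simp
  qed (auto intro!: continuous_intros)
  then have C2: "C2_with {x::real^'n. x \<bullet> x \<in> {0<..}} (\<lambda>x. a * kq p (x \<bullet> x) + b - \<epsilon> * (x \<bullet> x))
    (\<lambda>x. (0 * (a * kq p (x \<bullet> x) + b - \<epsilon> * (x \<bullet> x))) *\<^sub>R 0 + (2 * 1 * ?b1 (x \<bullet> x)) *\<^sub>R x) ?H" by simp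
  show ?thesis
  proof (rule that[OF C2])
    fix x :: "real^'n" assume x: "x \<noteq> 0"
    let ?q = "x \<bullet> x"
    have q: "?q > 0" using x by simp
    define c where "c = 2 * a * kc p * ?q powr (- p / 2)"
    have c: "c \<ge> 0" using a kc_pos[of p] by (simp add: c_def)
    have lp: "line_proj x = ?q *\<^sub>R line_proj (sgn x)"
    proof -
      have "x = norm x *\<^sub>R sgn x" using x by (simp add: sgn_div_norm)
      then have "line_proj x = line_proj (norm x *\<^sub>R sgn x)" by (rule arg_cong)
      also have "\<dots> = (norm x)\<^sup>2 *\<^sub>R line_proj (sgn x)"
        by (simp add: line_proj_def vec_eq_iff power2_eq_square)
      finally show ?thesis by (simp only: dot_square_norm)
    qed
    have pw: "?q powr (- p / 2 - 1) * ?q = ?q powr (- p / 2)"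
      using q by (simp add: powr_diff)
    have "(4 * ?b2 ?q) *\<^sub>R line_proj x = (- (c * p)) *\<^sub>R line_proj (sgn x)"
    proof -
      have "4 * ?b2 ?q * ?q = 4 * (a * (kc p * (- p / 2) * (?q powr (- p / 2 - 1) * ?q)))" by simp
      also have "\<dots> = - (c * p)" unfolding pw c_def by simp
      finally show ?thesis unfolding lp by simp
    qed
    then have "?H x = (- (c * p)) *\<^sub>R line_proj (sgn x) + (c - 2 * \<epsilon>) *\<^sub>R mat 1"
      by (simp add: outer_self c_def algebra_simps)
    also have "\<dots> = c *\<^sub>R riesz_matrix (sgn x) p - (2 * \<epsilon>) *\<^sub>R mat 1"
      by (simp add: riesz_matrix_def vec_eq_iff algebra_simps)
    finally have H: "?H x = c *\<^sub>R riesz_matrix (sgn x) p - (2 * \<epsilon>) *\<^sub>R mat 1" .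
    have "?H x \<notin> F"
    proof (cases "c = 0")
      case True
      then show ?thesis using neg_id_notin[of "2 * \<epsilon>"] e unfolding H by simp
    next
      case False
      then have c: "c > 0" using c by simp
      show ?thesis
      proof
        assume "?H x \<in> F"
        then have "(1 / c) *\<^sub>R ?H x \<in> F" using c by (intro F_scale) auto
        then have "riesz_matrix (sgn x) p - (2 * \<epsilon> / c) *\<^sub>R mat 1 \<in> F"
          unfolding H using c by (simp add: scaleR_diff_right)
        moreover have "riesz_matrix (sgn x) p - (2 * \<epsilon> / c) *\<^sub>R mat 1 \<notin> F"
          using x c e by (intro riesz_matrix_notin) (auto simp: norm_sgn)
        ultimately show False by simp
      qed
    qed
    moreover have "transpose (?H x) = ?H x" unfolding H
      by (simp add: riesz_matrix_def transpose_diff' transpose_scale' transpose_mat line_proj_symmetric)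
    ultimately show "transpose (?H x) = ?H x \<and> ?H x \<notin> F" by simp
  qed
qed

lemma ereal_le_all_eps: "(\<And>\<epsilon>::real. \<epsilon> > 0 \<Longrightarrow> v \<le> ereal (c + \<epsilon> * d)) \<Longrightarrow> d \<ge> 0 \<Longrightarrow> v \<le> ereal c"
proof (rule ereal_le_epsilon2)
  fix e :: real assume *: "\<And>\<epsilon>::real. \<epsilon> > 0 \<Longrightarrow> v \<le> ereal (c + \<epsilon> * d)" and d: "d \<ge> 0" and e: "e > 0"
  have "e / (d + 1) > 0" using e d by simp
  then have "v \<le> ereal (c + e / (d + 1) * d)" by (rule *)
  also have "\<dots> \<le> ereal (c + e)" using e d by (simp add: field_simps)
  finally show "v \<le> ereal c + ereal e" by simp
qed

lemma annulus_comparison: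
  fixes v :: "real^'n \<Rightarrow> ereal"
  assumes v: "viscosity F (ball 0 \<rho>) v" "usc_on UNIV v" and sr: "0 < s" "s \<le> r" "r \<le> \<rho>" and a: "a \<ge> 0"
    and bd: "\<And>x. norm x = s \<or> norm x = r \<Longrightarrow> v x \<le> ereal (a * rk p (norm x) + b)"
    and x: "s \<le> norm x" "norm x \<le> r"
  shows "v x \<le> ereal (a * rk p (norm x) + b)"
proof (rule ereal_le_all_eps[of _ _ "r\<^sup>2"])
  fix \<epsilon> :: real assume e: "\<epsilon> > 0"
  let ?\<phi> = "\<lambda>x. a * kq p (x \<bullet> x) + (b + \<epsilon> * r\<^sup>2) - \<epsilon> * (x \<bullet> x)"
  obtain D H where C2: "C2_with {x::real^'n. x \<bullet> x \<in> {0<..}} ?\<phi> D H" and H: "\<And>x. x \<noteq> 0 \<Longrightarrow> transpose (H x) = H x \<and> H x \<notin> F"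
    by (rule barrier[OF a e]) (rule that)
  let ?C = "cball 0 r - ball (0::real^'n) s" and ?O = "ball 0 r - cball (0::real^'n) s"
  have O: "open ?O" "?O \<subseteq> ?C" "?O \<subseteq> ball 0 \<rho>" "?O \<subseteq> {x. x \<bullet> x \<in> {0<..}}" using sr by auto
  have C: "?C \<subseteq> {x. x \<bullet> x \<in> {0<..}}" using sr by auto
  have cpt: "compact ?C" by (intro compact_diff compact_cball open_ball)
  have "v x \<le> ereal (?\<phi> x)"
  proof (rule comparison[OF cpt O(1-3) v(1) usc_on_subset[OF v(2)] C2_with_subset[OF C2 O(1) O(4)]
        continuous_on_subset[OF C2_with_continuous[OF C2] C]])
    show "transpose (H y) = H y" "H y \<notin> F" if "y \<in> ?O" for y
    proof -
      have "y \<noteq> 0" using that sr by auto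
      then show "transpose (H y) = H y" "H y \<notin> F" using H[of y] by auto
    qed
    show "v y \<le> ereal (?\<phi> y)" if "y \<in> ?C - ?O" for y
    proof -
      have y: "norm y = s \<or> norm y = r" "y \<noteq> 0" "norm y \<le> r" using that sr by auto
      have "(norm y)\<^sup>2 \<le> r\<^sup>2" using y(3) by (intro power_mono) auto
      then have "\<epsilon> * (y \<bullet> y) \<le> \<epsilon> * r\<^sup>2" using e by (simp add: dot_square_norm)
      then have "ereal (a * rk p (norm y) + b) \<le> ereal (?\<phi> y)" by (simp add: kq_norm[OF y(2)])
      then show ?thesis using bd[OF y(1)] by order
    qed
    show "x \<in> ?C" using x by auto
  qed simp
  also have "?\<phi> x \<le> (a * rk p (norm x) + b) + \<epsilon> * r\<^sup>2"
    using x sr e kq_norm[of x p] by force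
  finally show "v x \<le> ereal ((a * rk p (norm x) + b) + \<epsilon> * r\<^sup>2)" by simp
qed simp

lemma ball_comparison:
  fixes v :: "real^'n \<Rightarrow> ereal"
  assumes v: "viscosity F (ball 0 \<rho>) v" "usc_on UNIV v" and sr: "r \<le> \<rho>"
    and bd: "\<And>x. norm x = r \<Longrightarrow> v x \<le> ereal b" and x: "norm x \<le> r"
  shows "v x \<le> ereal b"
proof (rule ereal_le_all_eps[of _ _ "r\<^sup>2"])
  fix \<epsilon> :: real assume e: "\<epsilon> > 0"
  have C2: "C2_with UNIV (\<lambda>x::real^'n. (b + \<epsilon> * r\<^sup>2) + (-\<epsilon>) * (x \<bullet> x)) (\<lambda>x. (2 * -\<epsilon>) *\<^sub>R x) (\<lambda>x. (2 * -\<epsilon>) *\<^sub>R mat 1)"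
    by (rule quadratic_C2)
  have "v x \<le> ereal ((b + \<epsilon> * r\<^sup>2) + (-\<epsilon>) * (x \<bullet> x))"
  proof (rule comparison[OF compact_cball open_ball ball_subset_cball _ v(1) usc_on_subset[OF v(2)] C2_with_subset[OF C2]
        continuous_on_subset[OF C2_with_continuous[OF C2]]])
    show "transpose ((2 * -\<epsilon>) *\<^sub>R mat 1 :: real^'n^'n) = (2 * -\<epsilon>) *\<^sub>R mat 1" by (simp only: transpose_scale' transpose_mat)
    show "(2 * -\<epsilon>) *\<^sub>R mat 1 \<notin> F" using neg_id_notin[of "2 * \<epsilon>"] e by simp
    show "v y \<le> ereal ((b + \<epsilon> * r\<^sup>2) + (-\<epsilon>) * (y \<bullet> y))" if "y \<in> cball 0 r - ball 0 r" for y
    proof -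
      have "norm y = r" using that by auto
      then show ?thesis using bd[of y] by (simp add: dot_square_norm)
    qed
    show "x \<in> cball 0 r" using x by simp
    show "ball 0 r \<subseteq> ball 0 \<rho>" using sr by auto
  qed auto
  also have "\<dots> \<le> ereal (b + \<epsilon> * r\<^sup>2)" using e by simp
  finally show "v x \<le> ereal (b + \<epsilon> * r\<^sup>2)" .
qed simp

text \<open>The barrier is the function \<open>a K\<^sub>p + b\<close> with the values \<open>cs\<close> and \<open>cr\<close> on the two given spheres.\<close>

lemma three_spheres:
  fixes v :: "real^'n \<Rightarrow> ereal"
  assumes v: "viscosity F (ball 0 \<rho>) v" "usc_on UNIV v" and sr: "0 < s" "s < t" "t < r" "r \<le> \<rho>"
    and cs: "\<And>x. norm x = s \<Longrightarrow> v x \<le> ereal cs" and cr: "\<And>x. norm x = r \<Longrightarrow> v x \<le> ereal cr" and le: "cs \<le> cr"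
    and x: "norm x = t"
  shows "v x \<le> ereal (cs + (cr - cs) * (rk p t - rk p s) / (rk p r - rk p s))"
proof -
  let ?d = "rk p r - rk p s"
  have d: "?d > 0" using riesz_kernel_strict_mono[of s r p] sr by simp
  define a where "a = (cr - cs) / ?d"
  have a: "a \<ge> 0" using le d by (simp add: a_def)
  have ad: "a * ?d = cr - cs" using d by (simp add: a_def)
  have "v x \<le> ereal (a * rk p (norm x) + (cs - a * rk p s))"
  proof (rule annulus_comparison[OF v sr(1) _ sr(4) a])
    fix y :: "real^'n" assume "norm y = s \<or> norm y = r"
    then show "v y \<le> ereal (a * rk p (norm y) + (cs - a * rk p s))"
    proof
      assume "norm y = s" then show ?thesis using cs[of y] by simp
    next
      assume y: "norm y = r"
      have "a * rk p r + (cs - a * rk p s) = cr" using ad by (simp add: algebra_simps)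
      then show ?thesis using cr[of y] y by simp
    qed
  qed (use x sr in auto)
  also have "a * rk p (norm x) + (cs - a * rk p s) = cs + (cr - cs) * (rk p t - rk p s) / ?d"
    unfolding x by (simp add: a_def algebra_simps diff_divide_distrib add_divide_distrib)
  finally show ?thesis .
qed

end

section \<open>Averages of a subharmonic germ\<close>

text \<open>Monotone, and convex as a function of \<open>K\<^sub>p(r)\<close>; the comparison of difference quotients is stated without division.\<close>

definition K_convex :: "real \<Rightarrow> real \<Rightarrow> (real \<Rightarrow> real) \<Rightarrow> bool" where
  "K_convex p \<rho> f \<longleftrightarrow> (\<forall>s r. 0 < s \<and> s \<le> r \<and> r \<le> \<rho> \<longrightarrow> f s \<le> f r) \<and>
    (\<forall>s t r. 0 < s \<and> s < t \<and> t < r \<and> r \<le> \<rho> \<longrightarrow> (f t - f s) * (rk p r - rk p s) \<le> (f r - f s) * (rk p t - rk p s))"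

definition sphere_avg :: "(real^'n \<Rightarrow> ereal) \<Rightarrow> real \<Rightarrow> ereal" where
  "sphere_avg u r = average ball_prob (\<lambda>x. u (r *\<^sub>R sgn x))"

definition ball_avg :: "(real^'n \<Rightarrow> ereal) \<Rightarrow> real \<Rightarrow> ereal" where
  "ball_avg u r = average ball_prob (\<lambda>x. u (r *\<^sub>R x))"

lemma sphere_avg_measurable:
  fixes u :: "real^'n \<Rightarrow> ereal" and c :: real
  assumes u[measurable]: "u \<in> borel_measurable borel" and c: "\<And>x. u x \<le> ereal c"
  shows "sphere_avg u \<in> borel_measurable borel"
proof -
  interpret prob_space "ball_prob :: (real^'n) measure" by (rule prob_space_ball_prob)
  have "sphere_avg u = (\<lambda>t. ereal c - enn2ereal (\<integral>\<^sup>+x. e2ennreal (ereal c - u (t *\<^sub>R sgn x)) \<partial>ball_prob))"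
    unfolding sphere_avg_def[abs_def] by (intro ext average_deficit[OF prob_space_ball_prob]) (auto simp: c)
  also have "\<dots> \<in> borel_measurable borel" by measurable
  finally show ?thesis .
qed

lemma ball_avg_eq:
  fixes u :: "real^'n \<Rightarrow> ereal" and c :: real
  assumes u: "u \<in> borel_measurable borel" and c: "\<And>x. u x \<le> ereal c"
  shows "ball_avg u r = average ball_prob (\<lambda>y::real^'n. sphere_avg u (r * norm y))"
  unfolding ball_avg_def sphere_avg_def by (rule average_polar[OF u c])

text \<open>A function that is \<open>F\<close>-subharmonic near the origin, continued by \<open>-\<infinity>\<close> so that it is upper semicontinuous and bounded above
  everywhere. The averages are studied for radii up to \<open>R\<close>; the mean value inequality is also used for balls of radius \<open>2 R\<close> about points
  of the ball of radius \<open>R\<close>.\<close>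

locale subharmonic_germ = riesz_cone G F p for G F :: "(real^'n^'n) set" and p +
  fixes u :: "real^'n \<Rightarrow> ereal" and R c0 :: real
  assumes R: "R > 0" and usc: "usc_on UNIV u" and visc: "viscosity F (ball 0 (4 * R)) u"
    and c0: "\<And>x. u x \<le> ereal c0"
    and nontrivial: "\<exists>x. norm x < R \<and> u x \<noteq> -\<infinity>"
begin

lemma u_borel[measurable]: "u \<in> borel_measurable borel" by (rule usc_on_UNIV_borel[OF usc])

lemma u_less_top: "u x < \<infinity>" using usc by (auto simp: usc_on_def)

text \<open>Continuous functions decreasing to \<open>u\<close> have spherical averages that decrease to those of \<open>u\<close>; one of them is averaged over
  rotations until it is almost constant on spheres.\<close>

lemma majorant:
  assumes sr: "0 < s" "s \<le> r" and cs: "sphere_avg u s < ereal cs" and cr: "sphere_avg u r < ereal cr"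
  obtains gs where "gs \<noteq> []" "set gs \<subseteq> G" "\<And>x. norm x = s \<Longrightarrow> orbit_mean gs u x \<le> ereal cs"
    "\<And>x. norm x = r \<Longrightarrow> orbit_mean gs u x \<le> ereal cr"
proof -
  note P = prob_space_ball_prob[where 'n='n]
  have ne: "cball 0 r \<noteq> ({}::(real^'n) set)" using sr by auto
  obtain f where f: "\<And>k. continuous_on UNIV (f k)" "\<And>k x. f (Suc k) x \<le> f k x"
    "\<And>k x. x \<in> cball 0 r \<Longrightarrow> u x \<le> ereal (f k x)" "\<And>x. x \<in> cball 0 r \<Longrightarrow> (\<lambda>k. ereal (f k x)) \<longlonglongrightarrow> u x"
    using usc_approx[OF compact_cball ne usc_on_subset[OF usc]] by blast
  have ev: "eventually (\<lambda>k. (\<integral>y. f k (t *\<^sub>R sgn y) \<partial>ball_prob) < c) sequentially"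
    if t: "0 < t" "t \<le> r" and c: "sphere_avg u t < ereal c" for t c
  proof (rule average_decreasing_limit[where K="cball 0 r", OF P _ u_borel f(1,2) f(4) _ compact_cball])
    show "AE y in ball_prob. t *\<^sub>R sgn (y::real^'n) \<in> cball 0 r"
      by (rule eventually_mono[OF AE_ball_prob]) (use t in auto)
  qed (use c in \<open>auto simp: sphere_avg_def\<close>)
  obtain k where k: "(\<integral>y. f k (s *\<^sub>R sgn y) \<partial>ball_prob) < cs" "(\<integral>y. f k (r *\<^sub>R sgn y) \<partial>ball_prob) < cr"
    using eventually_happens'[OF sequentially_bot eventually_conj[OF ev[OF sr(1,2) cs] ev[OF _ _ cr]]] sr by auto
  define \<epsilon> where "\<epsilon> = min (cs - (\<integral>y. f k (s *\<^sub>R sgn y) \<partial>ball_prob)) (cr - (\<integral>y. f k (r *\<^sub>R sgn y) \<partial>ball_prob))"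
  have e: "\<epsilon> > 0" using k by (simp add: \<epsilon>_def)
  obtain gs where gs: "gs \<noteq> []" "set gs \<subseteq> G"
    and close: "\<And>x. norm x \<le> r \<Longrightarrow> \<bar>orbit_mean_real gs (f k) x - (\<integral>y. f k (norm x *\<^sub>R sgn y) \<partial>ball_prob)\<bar> \<le> \<epsilon>"
    by (rule orbit_mean_real_close[OF f(1)[of k] e, where R=r]) (rule that)
  have le: "orbit_mean gs u x \<le> ereal ((\<integral>y. f k (norm x *\<^sub>R sgn y) \<partial>ball_prob) + \<epsilon>)" if x: "norm x \<le> r" for x
  proof -
    have "orbit_mean gs u x \<le> orbit_mean gs (\<lambda>x. ereal (f k x)) x"
    proof (rule orbit_mean_mono)
      fix g assume "g \<in> set gs"
      then show "u (g *v x) \<le> ereal (f k (g *v x))" using norm_G gs x by (intro f(3)) auto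
    qed
    also have "\<dots> = ereal (orbit_mean_real gs (f k) x)" by (rule orbit_mean_eq_real[OF gs(1)]) simp
    also have "\<dots> \<le> ereal ((\<integral>y. f k (norm x *\<^sub>R sgn y) \<partial>ball_prob) + \<epsilon>)" using close[OF x] by (simp add: abs_le_iff)
    finally show ?thesis .
  qed
  show ?thesis
  proof (rule that[OF gs])
    fix x :: "real^'n"
    show "orbit_mean gs u x \<le> ereal cs" if "norm x = s"
      using le[of x] that sr by (intro order_trans[OF le]) (auto simp: \<epsilon>_def)
    show "orbit_mean gs u x \<le> ereal cr" if "norm x = r"
      using le[of x] that sr by (intro order_trans[OF le]) (auto simp: \<epsilon>_def)
  qed
qed

lemma orbit_visc: "gs \<noteq> [] \<Longrightarrow> set gs \<subseteq> G \<Longrightarrow> viscosity F (ball 0 (4 * R)) (orbit_mean gs u)"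
  by (rule viscosity_orbit_mean[OF visc usc c0])

lemma majorant_ball:
  assumes r: "0 < r" "r \<le> 4 * R" and c: "sphere_avg u r < ereal c"
  obtains gs where "gs \<noteq> []" "set gs \<subseteq> G" "\<And>x. norm x \<le> r \<Longrightarrow> orbit_mean gs u x \<le> ereal c"
proof -
  obtain gs where gs: "gs \<noteq> []" "set gs \<subseteq> G" "\<And>x. norm x = r \<Longrightarrow> orbit_mean gs u x \<le> ereal c"
    by (rule majorant[OF r(1) order_refl c c]) (rule that)
  show ?thesis
    by (rule that[OF gs(1,2)], rule ball_comparison[OF orbit_visc[OF gs(1,2)] usc_orbit_mean[OF usc gs(1)] r(2) gs(3)])
qed

lemma sphere_avg_le:
  assumes gs: "gs \<noteq> []" "set gs \<subseteq> G" and le: "\<And>x. norm x = t \<Longrightarrow> orbit_mean gs u x \<le> ereal c" and t: "t \<ge> 0"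
  shows "sphere_avg u t \<le> ereal c"
  unfolding sphere_avg_def
proof (rule average_invariant_le[OF prob_space_ball_prob _ distr_G_sgn u_borel c0 gs(1)])
  show "AE x in ball_prob. orbit_mean gs u (t *\<^sub>R sgn x) \<le> ereal c"
    by (rule eventually_mono[OF AE_ball_prob]) (use le t in auto)
qed (use gs in auto)

lemma ereal_le_real_bound: "(\<And>c::real. y < ereal c \<Longrightarrow> x \<le> ereal c) \<Longrightarrow> x \<le> y"
  by (metis ereal_dense2 not_le order.strict_trans1 order_less_irrefl)

text \<open>By the maximum principle for a mean of \<open>u\<close> over rotations that is close to the spherical average on the larger sphere.\<close>

lemma sphere_avg_mono:
  assumes "0 < s" "s \<le> r" "r \<le> 4 * R" shows "sphere_avg u s \<le> sphere_avg u r"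
proof (rule ereal_le_real_bound)
  fix c assume c: "sphere_avg u r < ereal c"
  obtain gs where "gs \<noteq> []" "set gs \<subseteq> G" "\<And>x. norm x \<le> r \<Longrightarrow> orbit_mean gs u x \<le> ereal c"
    by (rule majorant_ball[OF _ assms(3) c]) (use assms in auto)
  then show "sphere_avg u s \<le> ereal c" using assms by (intro sphere_avg_le) auto
qed

lemma P: "prob_space (ball_prob :: (real^'n) measure)" by (rule prob_space_ball_prob)

lemma sup_ball_attained:
  assumes "0 < r" "r \<le> 4 * R"
  obtains x where "norm x = r" "avg_M u r = u x"
proof -
  have ne: "sphere 0 r \<noteq> ({}::(real^'n) set)" using assms by auto
  obtain x where x: "x \<in> sphere 0 r" "\<And>y. y \<in> sphere 0 r \<Longrightarrow> u y \<le> u x"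
    using usc_attains_max[OF compact_sphere ne usc_on_subset[OF usc]] by blast
  have "u y \<le> u x" if y: "norm y \<le> r" for y
  proof (rule ereal_le_real_bound)
    fix c assume "u x < ereal c"
    then show "u y \<le> ereal c"
      by (intro ball_comparison[OF visc usc assms(2) _ y]) (use x(2) in \<open>force intro: order_trans less_imp_le\<close>)
  qed
  then have "avg_M u r = u x"
    unfolding avg_M_def using x(1) by (intro antisym SUP_least SUP_upper) auto
  then show ?thesis using that x(1) by auto
qed

lemma sphere_avg_le_M: "0 < r \<Longrightarrow> sphere_avg u r \<le> avg_M u r"
  unfolding sphere_avg_def
proof (rule average_le_const[OF P])
  assume r: "0 < r"
  show "AE x in ball_prob. u (r *\<^sub>R sgn x) \<le> avg_M u r"
    unfolding avg_M_def by (rule eventually_mono[OF AE_ball_prob]) (use r in \<open>auto intro!: SUP_upper\<close>)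
qed

end

lemma nn_integral_ball_subset:
  fixes w :: "real^'n \<Rightarrow> ennreal"
  assumes w[measurable]: "w \<in> borel_measurable borel" and pos: "0 < \<rho>" "0 < \<rho>'" and sub: "cball x' \<rho>' \<subseteq> cball x \<rho>"
  shows "ennreal (\<rho>' ^ CARD('n)) * (\<integral>\<^sup>+z. w (x' + \<rho>' *\<^sub>R z) \<partial>ball_prob) \<le> ennreal (\<rho> ^ CARD('n)) * (\<integral>\<^sup>+z. w (x + \<rho> *\<^sub>R z) \<partial>ball_prob)"
proof -
  obtain b where b: "emeasure lborel (cball (0::real^'n) 1) = ennreal b" "b > 0"
    using unit_ball_emeasure[where 'n='n] by (cases "emeasure lborel (cball (0::real^'n) 1)") (auto simp: less_le)
  have eq: "ennreal (r ^ CARD('n)) * (\<integral>\<^sup>+z. w (y + r *\<^sub>R z) \<partial>ball_prob) = (\<integral>\<^sup>+z. w z * indicator (cball y r) z \<partial>lborel) / ennreal b"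
    if r: "r > 0" for r and y :: "real^'n"
  proof -
    let ?I = "\<integral>\<^sup>+z. w z * indicator (cball y r) z \<partial>lborel"
    have rn: "r ^ CARD('n) > 0" using r by simp
    have e: "r ^ CARD('n) * (inverse (r ^ CARD('n)) * inverse b) = inverse b"
      using rn by (metis less_irrefl mult.assoc mult_1 right_inverse)
    have "ennreal (r ^ CARD('n)) * (\<integral>\<^sup>+z. w (y + r *\<^sub>R z) \<partial>ball_prob) = ennreal (r ^ CARD('n)) * (?I / (ennreal (r ^ CARD('n)) * ennreal b))"
      using nn_integral_ball_prob_affine[OF w r, of y] by (simp only: b)
    also have "\<dots> = ?I * (ennreal (r ^ CARD('n)) * inverse (ennreal (r ^ CARD('n)) * ennreal b))"
      by (simp add: divide_ennreal_def mult.left_commute)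
    also have "ennreal (r ^ CARD('n)) * inverse (ennreal (r ^ CARD('n)) * ennreal b) = inverse (ennreal b)"
      using b(2) rn e by (simp add: inverse_ennreal flip: ennreal_mult)
    finally show ?thesis by (simp add: divide_ennreal_def)
  qed
  show ?thesis
    unfolding eq[OF pos(1)] eq[OF pos(2)]
    by (intro divide_right_mono_ennreal nn_integral_mono mult_left_mono) (use sub in \<open>auto simp: indicator_def\<close>)
qed

context subharmonic_germ
begin

text \<open>The mean value inequality at a point where \<open>u\<close> is finite, over a ball that contains the given one.\<close>

lemma ball_avg_finite:
  assumes r: "0 < r" "r \<le> R" shows "ball_avg u r \<noteq> -\<infinity>"
proof -
  obtain y0 where y0: "norm y0 < R" "u y0 \<noteq> -\<infinity>" using nontrivial by blast
  let ?w = "\<lambda>x. e2ennreal (ereal c0 - u x)"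
  have "ball y0 (2 * R) \<subseteq> ball 0 (4 * R)"
  proof
    fix z assume "z \<in> ball y0 (2 * R)"
    then have "norm (z - y0) < 2 * R" by (simp add: dist_norm norm_minus_commute)
    then show "z \<in> ball 0 (4 * R)" using y0(1) norm_triangle_sub[of z y0] R by simp
  qed
  then have "u y0 \<le> average ball_prob (\<lambda>z. u (y0 + (2 * R) *\<^sub>R z))"
    using R by (intro mean_value_ball[OF visc usc c0]) auto
  also have "\<dots> = ereal c0 - enn2ereal (\<integral>\<^sup>+z. ?w (y0 + (2 * R) *\<^sub>R z) \<partial>ball_prob)"
    by (rule average_deficit[OF P]) (auto simp: c0)
  finally have "(\<integral>\<^sup>+z. ?w (y0 + (2 * R) *\<^sub>R z) \<partial>ball_prob) \<noteq> \<infinity>" using y0(2) by auto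
  moreover have "ennreal (r ^ CARD('n)) * (\<integral>\<^sup>+z. ?w (0 + r *\<^sub>R z) \<partial>ball_prob)
     \<le> ennreal ((2 * R) ^ CARD('n)) * (\<integral>\<^sup>+z. ?w (y0 + (2 * R) *\<^sub>R z) \<partial>ball_prob)"
  proof (rule nn_integral_ball_subset)
    show "cball 0 r \<subseteq> cball y0 (2 * R)"
    proof
      fix z :: "real^'n" assume "z \<in> cball 0 r"
      then show "z \<in> cball y0 (2 * R)" using y0(1) norm_triangle_ineq4[of y0 z] r by (simp add: dist_norm)
    qed
  qed (use r R in auto)
  moreover have "ennreal ((2 * R) ^ CARD('n)) * D < \<infinity>" if "D \<noteq> \<infinity>" for D
    using that by (simp add: ennreal_mult_less_top less_top)
  ultimately have fin: "ennreal (r ^ CARD('n)) * (\<integral>\<^sup>+z. ?w (0 + r *\<^sub>R z) \<partial>ball_prob) < \<infinity>"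
    by (meson le_less_trans)
  have "(\<integral>\<^sup>+z. ?w (0 + r *\<^sub>R z) \<partial>ball_prob) \<noteq> \<infinity>"
  proof
    assume "(\<integral>\<^sup>+z. ?w (0 + r *\<^sub>R z) \<partial>ball_prob) = \<infinity>"
    then show False using fin r(1) by (simp add: ennreal_mult_top)
  qed
  moreover have "ball_avg u r = ereal c0 - enn2ereal (\<integral>\<^sup>+z. ?w (0 + r *\<^sub>R z) \<partial>ball_prob)"
    unfolding ball_avg_def by (subst average_deficit[OF P, of _ c0]) (auto simp: c0)
  ultimately show ?thesis
    by (cases "\<integral>\<^sup>+z. ?w (0 + r *\<^sub>R z) \<partial>ball_prob") (auto simp: enn2ereal_ennreal)
qed

lemma ball_avg_le_sphere:
  assumes r: "0 < r" "r \<le> 4 * R" shows "ball_avg u r \<le> sphere_avg u r"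
  unfolding ball_avg_eq[OF u_borel c0]
proof (rule average_le_const[OF P], rule eventually_mono[OF AE_ball_prob])
  fix y :: "real^'n" assume y: "y \<noteq> 0 \<and> norm y \<le> 1 \<and> norm (sgn y) = 1"
  then have "r * norm y \<le> r" using r by (simp add: mult_le_cancel_left1)
  then show "sphere_avg u (r * norm y) \<le> sphere_avg u r" using y r by (intro sphere_avg_mono) auto
qed

lemma avg_M_le_c0: "0 < r \<Longrightarrow> avg_M u r \<le> ereal c0"
  unfolding avg_M_def by (intro SUP_least c0)

definition Mr :: "real \<Rightarrow> real" where "Mr r = real_of_ereal (avg_M u r)"
definition Sr :: "real \<Rightarrow> real" where "Sr r = real_of_ereal (sphere_avg u r)"
definition Vr :: "real \<Rightarrow> real" where "Vr r = real_of_ereal (ball_avg u r)"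

lemma averages_real:
  assumes r: "0 < r" "r \<le> R"
  shows "avg_M u r = ereal (Mr r)" "sphere_avg u r = ereal (Sr r)" "ball_avg u r = ereal (Vr r)"
    "Vr r \<le> Sr r" "Sr r \<le> Mr r"
proof -
  have c: "ball_avg u r \<noteq> -\<infinity>" "ball_avg u r \<le> sphere_avg u r" "sphere_avg u r \<le> avg_M u r" "avg_M u r \<le> ereal c0"
    using ball_avg_finite[OF r] ball_avg_le_sphere[of r] sphere_avg_le_M[of r] avg_M_le_c0[of r] r by auto
  then show "avg_M u r = ereal (Mr r)" "sphere_avg u r = ereal (Sr r)" "ball_avg u r = ereal (Vr r)"
    "Vr r \<le> Sr r" "Sr r \<le> Mr r"
    unfolding Mr_def Sr_def Vr_def
    by (cases "ball_avg u r"; cases "sphere_avg u r"; cases "avg_M u r"; auto)+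
qed

lemma K_diff_pos: "0 < s \<Longrightarrow> s < r \<Longrightarrow> 0 < rk p r - rk p s"
  using riesz_kernel_strict_mono by simp

lemma K_convex_M: "K_convex p R Mr"
  unfolding K_convex_def
proof (intro conjI allI impI; elim conjE)
  show "Mr s \<le> Mr r" if sr: "0 < s" "s \<le> r" "r \<le> R" for s r
  proof -
    have "avg_M u s \<le> avg_M u r" unfolding avg_M_def using sr by (intro SUP_subset_mono) auto
    then show ?thesis using averages_real(1)[of s] averages_real(1)[of r] sr by simp
  qed
  note mono = this
  fix s t r assume sr: "0 < s" "s < t" "t < r" "r \<le> R"
  have b: "u x \<le> ereal (Mr q)" if "norm x = q" "0 < q" "q \<le> R" for x q
  proof -
    have "u x \<le> avg_M u q" unfolding avg_M_def using that by (intro SUP_upper) auto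
    then show ?thesis using averages_real(1)[of q] that by simp
  qed
  obtain x where x: "norm x = t" "avg_M u t = u x" using sup_ball_attained[of t] sr R by auto
  have "u x \<le> ereal (Mr s + (Mr r - Mr s) * (rk p t - rk p s) / (rk p r - rk p s))"
  proof (rule three_spheres[OF visc usc sr(1-3) _ _ _ _ x(1)])
    show "u y \<le> ereal (Mr s)" if "norm y = s" for y using b[OF that] sr by simp
    show "u y \<le> ereal (Mr r)" if "norm y = r" for y using b[OF that] sr by simp
    show "Mr s \<le> Mr r" using mono[of s r] sr by simp
  qed (use sr R in simp)
  moreover have "u x = ereal (Mr t)" using x(2) averages_real(1)[of t] sr by simp
  ultimately have "Mr t \<le> Mr s + (Mr r - Mr s) * (rk p t - rk p s) / (rk p r - rk p s)"
    by (simp only: ereal_less_eq)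
  then have "Mr t - Mr s \<le> (Mr r - Mr s) * (rk p t - rk p s) / (rk p r - rk p s)" by simp
  then show "(Mr t - Mr s) * (rk p r - rk p s) \<le> (Mr r - Mr s) * (rk p t - rk p s)"
    using K_diff_pos[of s r] sr by (simp add: pos_le_divide_eq)
qed

text \<open>The spherical average is squeezed: a suitable mean of \<open>u\<close> over rotations is below it, up to \<open>\<epsilon>\<close>, on two given spheres,
  and this mean has the same spherical average as \<open>u\<close> on the sphere in between.\<close>

lemma K_convex_S: "K_convex p R Sr"
  unfolding K_convex_def
proof (intro conjI allI impI; elim conjE)
  show "Sr s \<le> Sr r" if sr: "0 < s" "s \<le> r" "r \<le> R" for s r
    using sphere_avg_mono[of s r] averages_real(2)[of s] averages_real(2)[of r] sr R by simp
  note mono = this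
  fix s t r assume sr: "0 < s" "s < t" "t < r" "r \<le> R"
  have "Sr t \<le> (Sr s + (Sr r - Sr s) * (rk p t - rk p s) / (rk p r - rk p s)) + \<epsilon>" if e: "\<epsilon> > 0" for \<epsilon>
  proof -
    have cs: "sphere_avg u s < ereal (Sr s + \<epsilon>)" and cr: "sphere_avg u r < ereal (Sr r + \<epsilon>)"
      using averages_real(2)[of s] averages_real(2)[of r] sr e by auto
    obtain gs where gs: "gs \<noteq> []" "set gs \<subseteq> G" "\<And>x. norm x = s \<Longrightarrow> orbit_mean gs u x \<le> ereal (Sr s + \<epsilon>)"
      "\<And>x. norm x = r \<Longrightarrow> orbit_mean gs u x \<le> ereal (Sr r + \<epsilon>)"
      by (rule majorant[OF sr(1) _ cs cr]) (use sr in auto)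
    have "sphere_avg u t \<le> ereal ((Sr s + \<epsilon>) + ((Sr r + \<epsilon>) - (Sr s + \<epsilon>)) * (rk p t - rk p s) / (rk p r - rk p s))"
    proof (rule sphere_avg_le[OF gs(1,2)])
      fix x :: "real^'n" assume x: "norm x = t"
      show "orbit_mean gs u x \<le> ereal ((Sr s + \<epsilon>) + ((Sr r + \<epsilon>) - (Sr s + \<epsilon>)) * (rk p t - rk p s) / (rk p r - rk p s))"
        by (rule three_spheres[OF orbit_visc[OF gs(1,2)] usc_orbit_mean[OF usc gs(1)] sr(1-3) _ gs(3,4) _ x])
           (use sr R mono in auto)
    qed (use sr in auto)
    then show ?thesis using averages_real(2)[of t] sr by simp
  qed
  then have "Sr t \<le> Sr s + (Sr r - Sr s) * (rk p t - rk p s) / (rk p r - rk p s)" by (rule field_le_epsilon)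
  then have "Sr t - Sr s \<le> (Sr r - Sr s) * (rk p t - rk p s) / (rk p r - rk p s)" by simp
  then show "(Sr t - Sr s) * (rk p r - rk p s) \<le> (Sr r - Sr s) * (rk p t - rk p s)"
    using K_diff_pos[of s r] sr by (simp add: pos_le_divide_eq)
qed

lemma Vr_eq:
  assumes r: "0 < r" "r \<le> R"
  shows "integrable ball_prob (\<lambda>y::real^'n. Sr (r * norm y))" "Vr r = (\<integral>y. Sr (r * norm (y::real^'n)) \<partial>ball_prob)"
proof -
  note [measurable] = sphere_avg_measurable[OF u_borel c0]
  have m: "(\<lambda>y::real^'n. sphere_avg u (r * norm y)) \<in> borel_measurable ball_prob" by measurable
  have "sphere_avg u t \<le> ereal c0" for t
    unfolding sphere_avg_def by (rule average_le_const[OF P]) (simp add: c0)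
  then have le: "AE y::real^'n in ball_prob. sphere_avg u (r * norm y) \<le> ereal c0" by simp
  have "integrable ball_prob (\<lambda>y::real^'n. Sr (r * norm y)) \<and> Vr r = (\<integral>y. Sr (r * norm (y::real^'n)) \<partial>ball_prob)"
  proof (rule average_cases[OF P m le])
    assume "average ball_prob (\<lambda>y::real^'n. sphere_avg u (r * norm y)) = -\<infinity>"
    then show ?thesis using ball_avg_finite[OF r] ball_avg_eq[OF u_borel c0, of r] by simp
  next
    assume "integrable ball_prob (\<lambda>y::real^'n. real_of_ereal (sphere_avg u (r * norm y)))"
      "average ball_prob (\<lambda>y::real^'n. sphere_avg u (r * norm y)) = ereal (\<integral>y. real_of_ereal (sphere_avg u (r * norm (y::real^'n))) \<partial>ball_prob)"
    then show ?thesis using averages_real(3)[OF r] ball_avg_eq[OF u_borel c0, of r] by (simp add: Sr_def)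
  qed
  then show "integrable ball_prob (\<lambda>y::real^'n. Sr (r * norm y))" "Vr r = (\<integral>y. Sr (r * norm (y::real^'n)) \<partial>ball_prob)"
    by auto
qed

text \<open>\<open>V\<close> is the mean of the functions \<open>r \<mapsto> S(r |y|)\<close>, and \<open>K\<^sub>p(r |y|)\<close> is an increasing affine function of \<open>K\<^sub>p(r)\<close>.\<close>

lemma K_convex_V: "K_convex p R Vr"
  unfolding K_convex_def
proof (intro conjI allI impI; elim conjE)
  have scale: "0 < r * norm y \<and> r * norm y \<le> r" if "y \<noteq> 0 \<and> norm y \<le> 1 \<and> norm (sgn y) = 1" "0 < r" for y :: "real^'n" and r :: real
    using that by (simp add: mult_le_cancel_left1)
  show "Vr s \<le> Vr r" if sr: "0 < s" "s \<le> r" "r \<le> R" for s r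
  proof -
    have "(\<integral>y. Sr (s * norm (y::real^'n)) \<partial>ball_prob) \<le> (\<integral>y. Sr (r * norm (y::real^'n)) \<partial>ball_prob)"
    proof (rule integral_mono_AE)
      show "AE y::real^'n in ball_prob. Sr (s * norm y) \<le> Sr (r * norm y)"
      proof (rule eventually_mono[OF AE_ball_prob])
        fix y :: "real^'n" assume y: "y \<noteq> 0 \<and> norm y \<le> 1 \<and> norm (sgn y) = 1"
        have "s * norm y \<le> r * norm y" using sr by (intro mult_right_mono) auto
        moreover have "r * norm y \<le> R" using scale[OF y, of r] sr by linarith
        ultimately show "Sr (s * norm y) \<le> Sr (r * norm y)"
          using K_convex_S scale[OF y sr(1)] unfolding K_convex_def by blast
      qed
    qed (use Vr_eq sr in auto)
    then show ?thesis using Vr_eq(2)[of s] Vr_eq(2)[of r] sr by simp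
  qed
  fix s t r assume sr: "0 < s" "s < t" "t < r" "r \<le> R"
  have i: "integrable ball_prob (\<lambda>y::real^'n. Sr (q * norm y))" if "q = s \<or> q = t \<or> q = r" for q
    using Vr_eq(1)[of q] sr that by auto
  have "(\<integral>y. (Sr (t * norm (y::real^'n)) - Sr (s * norm y)) * (rk p r - rk p s) \<partial>ball_prob)
     \<le> (\<integral>y. (Sr (r * norm (y::real^'n)) - Sr (s * norm y)) * (rk p t - rk p s) \<partial>ball_prob)"
  proof (rule integral_mono_AE)
    show "AE y::real^'n in ball_prob. (Sr (t * norm y) - Sr (s * norm y)) * (rk p r - rk p s)
       \<le> (Sr (r * norm y) - Sr (s * norm y)) * (rk p t - rk p s)"
    proof (rule eventually_mono[OF AE_ball_prob])
      fix y :: "real^'n" assume y: "y \<noteq> 0 \<and> norm y \<le> 1 \<and> norm (sgn y) = 1"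
      then have ny: "norm y > 0" by simp
      define l where "l = (if p = 2 then 1 else norm y powr (2 - p))"
      have l: "l > 0" using ny by (simp add: l_def)
      have k: "rk p (b * norm y) - rk p (a * norm y) = l * (rk p b - rk p a)" if "0 < a" "0 < b" for a b
        using riesz_kernel_scale[OF ny that, of p] by (simp add: l_def mult.commute)
      have "s * norm y < t * norm y" "t * norm y < r * norm y" using ny sr by simp_all
      moreover have "r * norm y \<le> R" using scale[OF y, of r] sr by linarith
      moreover have "0 < s * norm y" using ny sr by simp
      ultimately have "(Sr (t * norm y) - Sr (s * norm y)) * (rk p (r * norm y) - rk p (s * norm y))
         \<le> (Sr (r * norm y) - Sr (s * norm y)) * (rk p (t * norm y) - rk p (s * norm y))"
        using K_convex_S unfolding K_convex_def by blast
      then have "l * ((Sr (t * norm y) - Sr (s * norm y)) * (rk p r - rk p s))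
         \<le> l * ((Sr (r * norm y) - Sr (s * norm y)) * (rk p t - rk p s))"
        using k[of s r] k[of s t] sr by (simp add: mult.left_commute)
      then show "(Sr (t * norm y) - Sr (s * norm y)) * (rk p r - rk p s)
         \<le> (Sr (r * norm y) - Sr (s * norm y)) * (rk p t - rk p s)"
        using l by (simp only: mult_le_cancel_left_pos)
    qed
  qed (use i in auto)
  then show "(Vr t - Vr s) * (rk p r - rk p s) \<le> (Vr r - Vr s) * (rk p t - rk p s)"
    using Vr_eq(2)[of s] Vr_eq(2)[of t] Vr_eq(2)[of r] sr i by simp
qed

text \<open>A Harnack estimate: the mean value inequality at a maximum point on the sphere of radius \<open>r\<close> bounds the deficit from \<open>M(3r)\<close>.\<close>

lemma M_minus_V_bound:
  assumes r: "0 < r" "3 * r \<le> R"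
  shows "Mr (3 * r) - Vr r \<le> 2 ^ CARD('n) * (Mr (3 * r) - Mr r)"
proof -
  let ?c = "Mr (3 * r)"
  let ?w = "\<lambda>x. e2ennreal (ereal ?c - u x)"
  have M3: "avg_M u (3 * r) = ereal ?c" using averages_real(1)[of "3 * r"] r by simp
  have uc: "u y \<le> ereal ?c" if "norm y \<le> 3 * r" for y
    unfolding M3[symmetric] avg_M_def using that by (intro SUP_upper) auto
  obtain x where x: "norm x = r" "avg_M u r = u x" using sup_ball_attained[of r] r R by auto
  have ux: "u x = ereal (Mr r)" using averages_real(1)[of r] r x(2) by simp
  have nx: "norm (x + (2 * r) *\<^sub>R z) \<le> 3 * r" if "norm z \<le> 1" for z
  proof -
    have "norm (x + (2 * r) *\<^sub>R z) \<le> norm x + 2 * r * norm z" using norm_triangle_ineq[of x "(2 * r) *\<^sub>R z"] r by simp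
    also have "2 * r * norm z \<le> 2 * r * 1" using that r by (intro mult_left_mono) auto
    finally show ?thesis using x(1) by simp
  qed
  have "ball x (2 * r) \<subseteq> ball 0 (4 * R)"
    using x(1) r R by (auto simp: subset_iff dist_norm) (smt (verit) norm_minus_commute norm_triangle_sub)
  then have "u x \<le> average ball_prob (\<lambda>z. u (x + (2 * r) *\<^sub>R z))"
    using r by (intro mean_value_ball[OF visc usc c0]) auto
  also have "\<dots> = ereal ?c - enn2ereal (\<integral>\<^sup>+z. ?w (x + (2 * r) *\<^sub>R z) \<partial>ball_prob)"
  proof (rule average_deficit[OF P])
    show "AE z in ball_prob. u (x + (2 * r) *\<^sub>R z) \<le> ereal ?c"
      by (rule eventually_mono[OF AE_ball_prob]) (auto intro!: uc nx)
  qed measurable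
  finally obtain D1 where D1: "(\<integral>\<^sup>+z. ?w (x + (2 * r) *\<^sub>R z) \<partial>ball_prob) = ennreal D1" "D1 \<ge> 0" "Mr r \<le> ?c - D1"
    unfolding ux by (cases "\<integral>\<^sup>+z. ?w (x + (2 * r) *\<^sub>R z) \<partial>ball_prob") (auto simp: enn2ereal_ennreal)
  have "ball_avg u r = ereal ?c - enn2ereal (\<integral>\<^sup>+z. ?w (0 + r *\<^sub>R z) \<partial>ball_prob)"
    unfolding ball_avg_def
  proof (subst average_deficit[OF P, of _ ?c])
    show "AE z in ball_prob. u (r *\<^sub>R z) \<le> ereal ?c"
      by (rule eventually_mono[OF AE_ball_prob]) (use r in \<open>auto intro!: uc simp: mult_le_cancel_left1 intro: order_trans[of _ r]\<close>)
  qed simp_all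
  then obtain D2 where D2: "(\<integral>\<^sup>+z. ?w (0 + r *\<^sub>R z) \<partial>ball_prob) = ennreal D2" "D2 \<ge> 0" "Vr r = ?c - D2"
    using averages_real(3)[of r] r by (cases "\<integral>\<^sup>+z. ?w (0 + r *\<^sub>R z) \<partial>ball_prob") (auto simp: enn2ereal_ennreal)
  have "ennreal (r ^ CARD('n)) * ennreal D2 \<le> ennreal ((2 * r) ^ CARD('n)) * ennreal D1"
    unfolding D1(1)[symmetric] D2(1)[symmetric]
  proof (rule nn_integral_ball_subset)
    show "cball 0 r \<subseteq> cball x (2 * r)"
      using x(1) r by (auto simp: subset_iff dist_norm) (smt (verit) norm_triangle_ineq4)
  qed (use r in auto)
  then have "r ^ CARD('n) * D2 \<le> (2 * r) ^ CARD('n) * D1"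
    using D1(2) D2(2) r by (simp add: ennreal_mult[symmetric])
  then have "r ^ CARD('n) * D2 \<le> r ^ CARD('n) * (2 ^ CARD('n) * D1)" by (simp add: power_mult_distrib mult_ac)
  then have "D2 \<le> 2 ^ CARD('n) * D1" using r by simp
  also have "\<dots> \<le> 2 ^ CARD('n) * (?c - Mr r)" using D1(3) by (intro mult_left_mono) auto
  finally show ?thesis using D2(3) by simp
qed

end

section \<open>Densities of functions convex in the Riesz kernel\<close>

text \<open>The slopes with respect to \<open>K\<^sub>p\<close> on pairs \<open>s < r\<close> tend to \<open>\<theta>\<close>, stated without division.\<close>

definition slope_limit :: "real \<Rightarrow> (real \<Rightarrow> real) \<Rightarrow> real \<Rightarrow> bool" where
  "slope_limit p f \<theta> \<longleftrightarrow> (\<forall>\<epsilon>>0. \<exists>\<delta>>0. \<forall>s r. 0 < s \<and> s < r \<and> r < \<delta> \<longrightarrow>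
      \<bar>(f r - f s) - \<theta> * (rk p r - rk p s)\<bar> \<le> \<epsilon> * (rk p r - rk p s))"

text \<open>The slope of a convex function increases in both end points, and \<open>\<theta>\<close> is the infimum of all slopes.\<close>

lemma K_convex_slope_limit:
  assumes f: "K_convex p \<rho> f" and \<rho>: "\<rho> > 0"
  obtains \<theta> where "slope_limit p f \<theta>" "\<theta> \<ge> 0"
proof -
  let ?s = "\<lambda>s r. (f r - f s) / (rk p r - rk p s)"
  have K: "0 < rk p r - rk p s" if "0 < s" "s < r" for s r
    using riesz_kernel_strict_mono[of s r p] that by simp
  have mono: "f s \<le> f r" if "0 < s" "s \<le> r" "r \<le> \<rho>" for s r using f that unfolding K_convex_def by blast
  have conv: "(f t - f s) * (rk p r - rk p s) \<le> (f r - f s) * (rk p t - rk p s)" if "0 < s" "s < t" "t < r" "r \<le> \<rho>" for s t r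
    using f that unfolding K_convex_def by blast
  have m1: "?s s t \<le> ?s s r" if "0 < s" "s < t" "t \<le> r" "r \<le> \<rho>" for s t r
  proof (cases "t = r")
    case False
    then have h: "0 < s" "s < t" "t < r" "r \<le> \<rho>" using that by auto
    show ?thesis using conv[OF h] K[of s t] K[of s r] h by (simp add: divide_simps mult.commute)
  qed simp
  have m2: "?s s r \<le> ?s t r" if "0 < s" "s \<le> t" "t < r" "r \<le> \<rho>" for s t r
  proof (cases "s = t")
    case False
    then have h: "0 < s" "s < t" "t < r" "r \<le> \<rho>" using that by auto
    have "(f r - f s) * (rk p r - rk p t) \<le> (f r - f t) * (rk p r - rk p s)"
      using conv[OF h] by (simp add: algebra_simps)
    then show ?thesis using K[of t r] K[of s r] h by (simp add: divide_simps mult.commute)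
  qed simp
  define S where "S = {?s s r | s r. 0 < s \<and> s < r \<and> r \<le> \<rho>}"
  have S0: "x \<ge> 0" if "x \<in> S" for x
    using that mono K unfolding S_def by (auto intro!: divide_nonneg_pos)
  have bdd: "bdd_below S" using S0 by (rule bdd_belowI)
  have "?s (\<rho>/2) \<rho> \<in> S" unfolding S_def using \<rho> by (intro CollectI exI[of _ "\<rho>/2"] exI[of _ \<rho>]) auto
  then have ne: "S \<noteq> {}" by blast
  define \<theta> where "\<theta> = Inf S"
  have \<theta>0: "\<theta> \<ge> 0" unfolding \<theta>_def using ne S0 by (intro cInf_greatest)
  have "slope_limit p f \<theta>"
    unfolding slope_limit_def
  proof (intro allI impI)
    fix \<epsilon> :: real assume e: "\<epsilon> > 0"
    then obtain x where x: "x \<in> S" "x < \<theta> + \<epsilon>" using cInf_lessD[OF ne, of "\<theta> + \<epsilon>"] by (auto simp: \<theta>_def)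
    then obtain s0 r0 where sr0: "0 < s0" "s0 < r0" "r0 \<le> \<rho>" "x = ?s s0 r0" by (auto simp: S_def)
    show "\<exists>\<delta>>0. \<forall>s r. 0 < s \<and> s < r \<and> r < \<delta> \<longrightarrow> \<bar>(f r - f s) - \<theta> * (rk p r - rk p s)\<bar> \<le> \<epsilon> * (rk p r - rk p s)"
    proof (intro exI[of _ s0] conjI allI impI)
      show "0 < s0" by fact
      fix s r assume sr: "0 < s \<and> s < r \<and> r < s0"
      have "?s s r \<le> ?s s r0" using sr sr0 by (intro m1) auto
      also have "\<dots> \<le> ?s s0 r0" using sr sr0 by (intro m2) auto
      finally have up: "?s s r < \<theta> + \<epsilon>" using x sr0 by simp
      have "?s s r \<in> S" unfolding S_def using sr sr0 by (intro CollectI exI[of _ s] exI[of _ r]) auto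
      then have lo: "\<theta> \<le> ?s s r" unfolding \<theta>_def by (intro cInf_lower bdd)
      have k: "0 < rk p r - rk p s" using K sr by auto
      have "f r - f s = ?s s r * (rk p r - rk p s)" using k by simp
      then have "(f r - f s) - \<theta> * (rk p r - rk p s) = (?s s r - \<theta>) * (rk p r - rk p s)" by (simp only: left_diff_distrib)
      then show "\<bar>(f r - f s) - \<theta> * (rk p r - rk p s)\<bar> \<le> \<epsilon> * (rk p r - rk p s)"
        using up lo k by (simp add: abs_mult)
    qed
  qed
  then show ?thesis using that \<theta>0 by blast
qed

lemma slope_limit_has_density:
  assumes f: "slope_limit p f \<theta>" and \<rho>: "\<rho> > 0" and eq: "\<And>r. 0 < r \<Longrightarrow> r \<le> \<rho> \<Longrightarrow> \<Psi> u r = ereal (f r)"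
  shows "has_density_at_0 p \<Psi> u \<theta>"
  unfolding has_density_at_0_def
proof -
  let ?S = "{(s, r). 0 < s \<and> s < (r::real)}"
  let ?g = "\<lambda>(s, r). (f r - f s) / (rk p r - rk p s)"
  have ev: "eventually (\<lambda>z. P z) (at (0::real, 0::real) within ?S)"
    if "\<And>s r. 0 < s \<Longrightarrow> s < r \<Longrightarrow> r < \<delta> \<Longrightarrow> P (s, r)" "\<delta> > 0" for P \<delta>
    unfolding eventually_at
  proof (intro exI[of _ \<delta>] conjI ballI impI)
    fix z assume z: "z \<in> ?S" "z \<noteq> (0, 0) \<and> dist z (0, 0) < \<delta>"
    obtain s r where sr: "z = (s, r)" by (cases z)
    have "\<bar>r\<bar> \<le> norm (s, r)" using norm_snd_le[of r s] by simp
    then show "P z" using z that(1)[of s r] by (auto simp: sr dist_norm)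
  qed (fact that(2))
  have "(?g \<longlongrightarrow> \<theta>) (at (0, 0) within ?S)"
  proof (rule tendstoI)
    fix e :: real assume e: "e > 0"
    then obtain \<delta> where \<delta>: "\<delta> > 0" "\<And>s r. 0 < s \<Longrightarrow> s < r \<Longrightarrow> r < \<delta> \<Longrightarrow>
      \<bar>(f r - f s) - \<theta> * (rk p r - rk p s)\<bar> \<le> (e/2) * (rk p r - rk p s)"
      using f unfolding slope_limit_def by (meson half_gt_zero)
    show "\<forall>\<^sub>F z in at (0, 0) within ?S. dist (?g z) \<theta> < e"
    proof (rule ev[OF _ \<delta>(1)])
      fix s r assume sr: "0 < s" "s < r" "r < \<delta>"
      have k: "0 < rk p r - rk p s" using riesz_kernel_strict_mono[of s r p] sr by simp
      have "\<bar>(f r - f s) / (rk p r - rk p s) - \<theta>\<bar> = \<bar>(f r - f s) - \<theta> * (rk p r - rk p s)\<bar> / (rk p r - rk p s)"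
      proof -
        have "(f r - f s) / (rk p r - rk p s) - \<theta> = ((f r - f s) - \<theta> * (rk p r - rk p s)) / (rk p r - rk p s)"
          using k by (simp add: diff_divide_distrib)
        then show ?thesis using k by (simp only: abs_divide abs_of_pos)
      qed
      also have "\<dots> \<le> e / 2" using \<delta>(2)[OF sr] k by (simp add: pos_divide_le_eq)
      finally show "dist (?g (s, r)) \<theta> < e" using e by (simp add: dist_real_def)
    qed
  qed
  then have "((\<lambda>z. ereal (?g z)) \<longlongrightarrow> ereal \<theta>) (at (0, 0) within ?S)" by simp
  then show "((\<lambda>(s, r). (\<Psi> u r - \<Psi> u s) / ereal (rk p r - rk p s)) \<longlongrightarrow> ereal \<theta>) (at (0, 0) within ?S)"
  proof (rule Lim_transform_eventually)
    show "\<forall>\<^sub>F z in at (0, 0) within ?S. ereal (?g z) = (case z of (s, r) \<Rightarrow> (\<Psi> u r - \<Psi> u s) / ereal (rk p r - rk p s))"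
    proof (rule ev[OF _ \<rho>])
      fix s r assume sr: "0 < s" "s < r" "r < \<rho>"
      have k: "rk p r - rk p s \<noteq> 0" using riesz_kernel_strict_mono[of s r p] sr by simp
      show "ereal (?g (s, r)) = (case (s, r) of (s, r) \<Rightarrow> (\<Psi> u r - \<Psi> u s) / ereal (rk p r - rk p s))"
        using eq[of s] eq[of r] sr k by simp
    qed
  qed
qed

text \<open>The limit is unique because \<open>(0, 0)\<close> is a limit point of the pairs \<open>0 < s < r\<close>.\<close>

lemma density_at_0_eq:
  assumes "has_density_at_0 p \<Psi> u \<theta>" shows "density_at_0 p \<Psi> u = \<theta>"
  unfolding density_at_0_def
proof (rule the_equality)
  show "has_density_at_0 p \<Psi> u \<theta>" by fact
  fix \<theta>' assume \<theta>': "has_density_at_0 p \<Psi> u \<theta>'"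
  have nb: "at (0::real, 0::real) within {(s, r). 0 < s \<and> s < r} \<noteq> bot"
  proof -
    have "(0::real, 0::real) islimpt {(s, r). 0 < s \<and> s < r}"
      unfolding islimpt_approachable
    proof (intro allI impI)
      fix e :: real assume e: "e > 0"
      have "norm (e/4, e/2) \<le> norm (e/4) + norm (e/2)" by (rule norm_Pair_le)
      also have "\<dots> < e" using e by simp
      finally have "dist (e/4, e/2) (0::real, 0::real) < e" by (simp add: dist_norm)
      then show "\<exists>x'\<in>{(s, r). 0 < s \<and> s < r}. x' \<noteq> (0::real, 0::real) \<and> dist x' (0, 0) < e"
        using e by (intro bexI[of _ "(e/4, e/2)"]) auto
    qed
    then show ?thesis by (simp add: trivial_limit_within)
  qed
  show "\<theta>' = \<theta>"
    using tendsto_unique[OF nb \<theta>'[unfolded has_density_at_0_def] assms[unfolded has_density_at_0_def]] by simp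
qed

lemma slope_limit_multiple: "slope_limit p (\<lambda>r. \<theta> * rk p r + c) \<theta>"
  unfolding slope_limit_def
proof (intro allI impI)
  fix \<epsilon> :: real assume e: "\<epsilon> > 0"
  show "\<exists>\<delta>>0. \<forall>s r. 0 < s \<and> s < r \<and> r < \<delta> \<longrightarrow> \<bar>\<theta> * rk p r + c - (\<theta> * rk p s + c) - \<theta> * (rk p r - rk p s)\<bar> \<le> \<epsilon> * (rk p r - rk p s)"
  proof (intro exI[of _ 1] conjI allI impI)
    fix s r :: real assume "0 < s \<and> s < r \<and> r < 1"
    then have "0 < rk p r - rk p s" using riesz_kernel_strict_mono[of s r p] by simp
    moreover have "\<theta> * rk p r + c - (\<theta> * rk p s + c) - \<theta> * (rk p r - rk p s) = 0" by (simp add: algebra_simps)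
    ultimately show "\<bar>\<theta> * rk p r + c - (\<theta> * rk p s + c) - \<theta> * (rk p r - rk p s)\<bar> \<le> \<epsilon> * (rk p r - rk p s)"
      using e by simp
  qed simp
qed

lemma slope_limit_log:
  assumes f: "slope_limit 2 f \<theta>" and r: "\<And>j. 0 < r j" "r \<longlonglongrightarrow> 0" and t: "t > 0"
  shows "(\<lambda>j. f (r j * t) - f (r j)) \<longlonglongrightarrow> \<theta> * ln t"
proof (rule LIMSEQ_I)
  fix e :: real assume e: "e > 0"
  define \<epsilon> where "\<epsilon> = e / (2 * (\<bar>ln t\<bar> + 1))"
  have eps: "\<epsilon> > 0" using e by (simp add: \<epsilon>_def add_nonneg_pos)
  have eps2: "\<epsilon> * \<bar>ln t\<bar> < e"
  proof -
    have "\<epsilon> * \<bar>ln t\<bar> \<le> \<epsilon> * (\<bar>ln t\<bar> + 1)" using eps by (intro mult_left_mono) auto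
    also have "\<dots> = e / 2" unfolding \<epsilon>_def using add_nonneg_pos[of "\<bar>ln t\<bar>" 1] by (simp add: field_simps)
    finally show ?thesis using e by simp
  qed
  obtain \<delta> where \<delta>: "\<delta> > 0" "\<And>s r. 0 < s \<Longrightarrow> s < r \<Longrightarrow> r < \<delta> \<Longrightarrow> \<bar>(f r - f s) - \<theta> * (ln r - ln s)\<bar> \<le> \<epsilon> * (ln r - ln s)"
    using f eps unfolding slope_limit_def riesz_kernel_def by auto
  have "eventually (\<lambda>j. r j < \<delta> / (t + 1)) sequentially"
    using r(2) \<delta>(1) t by (intro order_tendstoD(2)) auto
  then obtain N where N: "\<And>j. j \<ge> N \<Longrightarrow> r j < \<delta> / (t + 1)" by (auto simp: eventually_sequentially)
  have "norm (f (r j * t) - f (r j) - \<theta> * ln t) < e" if j: "j \<ge> N" for j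
  proof -
    have rj: "r j * (t + 1) < \<delta>" using N[OF j] t by (simp add: pos_less_divide_eq)
    have b: "r j < \<delta>" "r j * t < \<delta>" using rj r(1)[of j] t by (auto simp: distrib_left) (smt (verit) mult_pos_pos)+
    have ln: "ln (r j * t) = ln (r j) + ln t" using r(1)[of j] t by (simp add: ln_mult)
    consider "t = 1" | "t < 1" | "t > 1" by linarith
    then have "\<bar>f (r j * t) - f (r j) - \<theta> * ln t\<bar> \<le> \<epsilon> * \<bar>ln t\<bar>"
    proof cases
      case 2
      have "\<bar>(f (r j) - f (r j * t)) - \<theta> * (ln (r j) - ln (r j * t))\<bar> \<le> \<epsilon> * (ln (r j) - ln (r j * t))"
        using 2 t r(1)[of j] b by (intro \<delta>(2)) auto
      moreover have "ln t < 0" using 2 t by simp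
      ultimately show ?thesis unfolding ln by (simp add: abs_if split: if_splits)
    next
      case 3
      have "\<bar>(f (r j * t) - f (r j)) - \<theta> * (ln (r j * t) - ln (r j))\<bar> \<le> \<epsilon> * (ln (r j * t) - ln (r j))"
        using 3 t r(1)[of j] b by (intro \<delta>(2)) auto
      moreover have "ln t > 0" using 3 t by simp
      ultimately show ?thesis unfolding ln by simp
    qed simp
    then show ?thesis using eps2 by simp
  qed
  then show "\<exists>no. \<forall>n\<ge>no. norm (f (r n * t) - f (r n) - \<theta> * ln t) < e" by blast
qed

text \<open>The kernel tends to \<open>-\<infinity>\<close> at 0, so in the slope on \<open>s < r\<close> with fixed \<open>r\<close> the values at \<open>r\<close> become negligible.\<close>

lemma slope_limit_quotient_infinite:
  assumes p: "p > 2" and f: "slope_limit p f \<theta>"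
  shows "((\<lambda>s. f s / rk p s) \<longlongrightarrow> \<theta>) (at_right 0)"
proof (rule tendstoI)
  fix e :: real assume e: "e > 0"
  obtain \<delta> where \<delta>: "\<delta> > 0" "\<And>s r. 0 < s \<Longrightarrow> s < r \<Longrightarrow> r < \<delta> \<Longrightarrow> \<bar>(f r - f s) - \<theta> * (rk p r - rk p s)\<bar> \<le> (e/4) * (rk p r - rk p s)"
    using f e unfolding slope_limit_def by (metis divide_pos_pos zero_less_numeral)
  define r0 where "r0 = \<delta> / 2"
  have r0: "0 < r0" "r0 < \<delta>" using \<delta>(1) by (auto simp: r0_def)
  define C where "C = \<bar>f r0 - \<theta> * rk p r0\<bar> + \<bar>rk p r0\<bar> * (e/4)"
  have inf: "filterlim (\<lambda>s. s powr (2 - p)) at_top (at_right (0::real))"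
    using p by real_asymp
  have "eventually (\<lambda>s. s powr (2 - p) > 4 * C / e) (at_right (0::real))"
    using inf by (simp add: filterlim_at_top_dense)
  moreover have "eventually (\<lambda>s. 0 < s \<and> s < r0) (at_right (0::real))"
    using r0(1) by (auto simp: eventually_at_right_field)
  ultimately show "\<forall>\<^sub>F s in at_right 0. dist (f s / rk p s) \<theta> < e"
  proof eventually_elim
    case (elim s)
    define k where "k = s powr (2 - p)"
    have k: "k > 0" "rk p s = - k" using elim p by (auto simp: k_def riesz_kernel_def)
    have kC: "C < (e/4) * k" using elim e by (simp add: k_def pos_divide_less_eq mult.commute)
    have A: "\<bar>(f r0 - f s) - \<theta> * (rk p r0 - rk p s)\<bar> \<le> (e/4) * (rk p r0 - rk p s)" using elim r0 by (intro \<delta>(2)) auto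
    have "\<bar>f s - \<theta> * rk p s\<bar> \<le> \<bar>f r0 - \<theta> * rk p r0\<bar> + (e/4) * (rk p r0 - rk p s)"
      using A by (simp add: algebra_simps abs_if split: if_splits)
    also have "\<dots> \<le> C + (e/4) * k"
    proof -
      have "(e/4) * rk p r0 \<le> (e/4) * \<bar>rk p r0\<bar>" using e by (intro mult_left_mono) auto
      then show ?thesis unfolding C_def k(2) by (simp add: algebra_simps)
    qed
    also have "\<dots> < e * k" using kC mult_pos_pos[OF e k(1)] by simp
    finally have B: "\<bar>f s - \<theta> * rk p s\<bar> < e * k" .
    have "f s / rk p s - \<theta> = (f s - \<theta> * rk p s) / rk p s" using k by (simp add: field_simps)
    then have "\<bar>f s / rk p s - \<theta>\<bar> = \<bar>f s - \<theta> * rk p s\<bar> / k" using k by simp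
    also have "\<dots> < e" using B k(1) by (simp add: pos_divide_less_eq)
    finally show ?case by (simp add: dist_real_def)
  qed
qed

text \<open>The kernel tends to 0 at 0, so one end point of the slope can be moved to 0.\<close>

lemma slope_limit_quotient_finite:
  assumes p: "p < 2" and f: "slope_limit p f \<theta>" and f0: "(f \<longlongrightarrow> f0) (at_right 0)"
  shows "((\<lambda>s. (f s - f0) / rk p s) \<longlongrightarrow> \<theta>) (at_right 0)"
proof (rule tendstoI)
  fix e :: real assume e: "e > 0"
  obtain \<delta> where \<delta>: "\<delta> > 0" "\<And>s r. 0 < s \<Longrightarrow> s < r \<Longrightarrow> r < \<delta> \<Longrightarrow> \<bar>(f r - f s) - \<theta> * (rk p r - rk p s)\<bar> \<le> (e/2) * (rk p r - rk p s)"
    using f e unfolding slope_limit_def by (meson half_gt_zero)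
  have k0: "((\<lambda>s. rk p s) \<longlongrightarrow> 0) (at_right 0)"
  proof -
    have "((\<lambda>s::real. s powr (2 - p)) \<longlongrightarrow> 0 powr (2 - p)) (at_right 0)"
      using p by (intro tendsto_powr2) (auto simp: eventually_at_right_field intro!: exI[of _ 1])
    then show ?thesis using p by (simp add: riesz_kernel_def[abs_def])
  qed
  have "eventually (\<lambda>r. 0 < r \<and> r < \<delta>) (at_right (0::real))"
    using \<delta>(1) by (auto simp: eventually_at_right_field)
  then show "\<forall>\<^sub>F s in at_right 0. dist ((f s - f0) / rk p s) \<theta> < e"
  proof eventually_elim
    case (elim r)
    have K: "rk p r > 0" using elim p by (simp add: riesz_kernel_def)
    have "\<bar>(f r - f0) - \<theta> * (rk p r - 0)\<bar> \<le> (e/2) * (rk p r - 0)"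
    proof (rule tendsto_le[of "at_right 0"])
      show "((\<lambda>s. (e/2) * (rk p r - rk p s)) \<longlongrightarrow> (e/2) * (rk p r - 0)) (at_right 0)"
        by (intro tendsto_intros k0)
      show "((\<lambda>s. \<bar>(f r - f s) - \<theta> * (rk p r - rk p s)\<bar>) \<longlongrightarrow> \<bar>(f r - f0) - \<theta> * (rk p r - 0)\<bar>) (at_right 0)"
        by (intro tendsto_intros k0 f0)
      have "eventually (\<lambda>s. 0 < s \<and> s < r) (at_right (0::real))"
        using elim by (auto simp: eventually_at_right_field)
      then show "\<forall>\<^sub>F s in at_right 0. \<bar>(f r - f s) - \<theta> * (rk p r - rk p s)\<bar> \<le> (e/2) * (rk p r - rk p s)"
        by eventually_elim (use elim \<delta>(2) in auto)
    qed simp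
    then have B: "\<bar>(f r - f0) - \<theta> * rk p r\<bar> \<le> (e/2) * rk p r" by simp
    have "(f r - f0) / rk p r - \<theta> = ((f r - f0) - \<theta> * rk p r) / rk p r" using K by (simp add: field_simps)
    then have "\<bar>(f r - f0) / rk p r - \<theta>\<bar> = \<bar>(f r - f0) - \<theta> * rk p r\<bar> / rk p r" using K by simp
    also have "\<dots> \<le> e / 2" using B K by (simp add: pos_divide_le_eq)
    finally show ?case using e by (simp add: dist_real_def)
  qed
qed

text \<open>As \<open>K\<^sub>p\<close> is homogeneous of degree \<open>2 - p\<close>, the flow divides \<open>f (r j * t) - b\<close> by \<open>K\<^sub>p (r j)\<close>, up to the sign.\<close>

lemma slope_limit_flow:
  assumes p: "p \<noteq> 2" and f: "slope_limit p f \<theta>"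
    and b: "p > 2 \<Longrightarrow> b = 0" "p < 2 \<Longrightarrow> (f \<longlongrightarrow> b) (at_right 0)"
    and r: "\<And>j. 0 < r j" "r \<longlonglongrightarrow> 0" and t: "t > 0"
  shows "(\<lambda>j. r j powr (p - 2) * (f (r j * t) - b)) \<longlonglongrightarrow> \<theta> * rk p t"
proof -
  have q: "((\<lambda>s. (f s - b) / rk p s) \<longlongrightarrow> \<theta>) (at_right 0)"
    using slope_limit_quotient_infinite[OF _ f] slope_limit_quotient_finite[OF _ f] b p
    by (cases "p < 2") auto
  have rt: "filterlim (\<lambda>j. r j * t) (at_right 0) sequentially"
  proof -
    have "r j \<noteq> 0" for j using r(1)[of j] by simp
    then show ?thesis
      using tendsto_mult_right[OF r(2), of t] r(1) t by (auto simp: filterlim_at intro!: always_eventually)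
  qed
  have "(\<lambda>j. (f (r j * t) - b) / rk p (r j * t)) \<longlonglongrightarrow> \<theta>"
    using filterlim_compose[OF q rt] .
  then have "(\<lambda>j. (f (r j * t) - b) / rk p (r j * t) * rk p t) \<longlonglongrightarrow> \<theta> * rk p t"
    by (intro tendsto_mult tendsto_const)
  moreover have "(f (r j * t) - b) / rk p (r j * t) * rk p t = r j powr (p - 2) * (f (r j * t) - b)" for j
  proof -
    have k: "rk p (r j * t) = r j powr (2 - p) * rk p t" "rk p t \<noteq> 0"
      using r(1)[of j] t p by (auto simp: riesz_kernel_def powr_mult)
    have "inverse (r j powr (2 - p)) = r j powr (p - 2)" by (simp add: powr_minus[symmetric])
    then show ?thesis unfolding k(1) using k(2) by (simp add: divide_inverse)
  qed
  ultimately show ?thesis by simp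
qed

section \<open>Passing to the limit along the flow\<close>

lemma average_affine:
  fixes a b c :: real
  assumes P: "prob_space P" and h[measurable]: "h \<in> borel_measurable P" and c: "AE x in P. h x \<le> ereal c" and a: "a > 0"
  shows "average P (\<lambda>x. ereal a * (h x - ereal b)) = ereal a * (average P h - ereal b)"
proof -
  have le: "AE x in P. ereal a * (h x - ereal b) \<le> ereal (a * (c - b))"
    using c
  proof eventually_elim
    case (elim x)
    then show ?case using a by (cases "h x") (auto intro!: mult_left_mono)
  qed
  have "(\<integral>\<^sup>+x. e2ennreal (ereal (a * (c - b)) - ereal a * (h x - ereal b)) \<partial>P) = (\<integral>\<^sup>+x. ennreal a * e2ennreal (ereal c - h x) \<partial>P)"
  proof (rule nn_integral_cong_AE, use c in eventually_elim)
    case (elim x)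
    show ?case
    proof (cases "h x")
      case (real y)
      then have "c - y \<ge> 0" using elim by simp
      then have "ennreal a * ennreal (c - y) = ennreal (a * (c - y))" using a by (simp add: ennreal_mult)
      then show ?thesis using real by (simp add: algebra_simps)
    qed (use elim a in \<open>auto simp: ennreal_mult_top\<close>)
  qed
  also have "\<dots> = ennreal a * (\<integral>\<^sup>+x. e2ennreal (ereal c - h x) \<partial>P)" by (rule nn_integral_cmult) measurable
  finally have eq: "(\<integral>\<^sup>+x. e2ennreal (ereal (a * (c - b)) - ereal a * (h x - ereal b)) \<partial>P) = ennreal a * (\<integral>\<^sup>+x. e2ennreal (ereal c - h x) \<partial>P)" .
  have "average P (\<lambda>x. ereal a * (h x - ereal b)) = ereal (a * (c - b)) - enn2ereal (ennreal a * (\<integral>\<^sup>+x. e2ennreal (ereal c - h x) \<partial>P))"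
    using average_deficit[OF P _ le] eq by simp
  moreover have "average P h = ereal c - enn2ereal (\<integral>\<^sup>+x. e2ennreal (ereal c - h x) \<partial>P)"
    by (rule average_deficit[OF P h c])
  ultimately show ?thesis
    using a by (cases "\<integral>\<^sup>+x. e2ennreal (ereal c - h x) \<partial>P")
      (simp_all add: enn2ereal_ennreal ennreal_mult_top algebra_simps flip: ennreal_mult)
qed

lemma average_swap:
  fixes h :: "'a \<Rightarrow> 'b \<Rightarrow> ereal" and c :: real
  assumes P: "prob_space P" and Q: "prob_space Q" and h: "(\<lambda>(x, y). h x y) \<in> borel_measurable (P \<Otimes>\<^sub>M Q)"
    and c: "\<And>x y. h x y \<le> ereal c"
  shows "average P (\<lambda>x. average Q (\<lambda>y. h x y)) = average Q (\<lambda>y. average P (\<lambda>x. h x y))"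
proof -
  interpret P: prob_space P by fact
  interpret Q: prob_space Q by fact
  interpret PQ: pair_sigma_finite P Q ..
  interpret QP: pair_sigma_finite Q P ..
  have QP: "prob_space (Q \<Otimes>\<^sub>M P)" using P Q by (simp add: prob_space_pair)
  have h': "(\<lambda>(y, x). h x y) \<in> borel_measurable (Q \<Otimes>\<^sub>M P)" using measurable_pair_swap[OF h] by simp
  have "average P (\<lambda>x. average Q (\<lambda>y. h x y)) = average (P \<Otimes>\<^sub>M Q) (\<lambda>(x, y). h x y)"
    using average_iterated[OF P Q h, of c] c by simp
  also have "\<dots> = average (distr (Q \<Otimes>\<^sub>M P) (P \<Otimes>\<^sub>M Q) (\<lambda>(x, y). (y, x))) (\<lambda>(x, y). h x y)"
    using PQ.distr_pair_swap by simp
  also have "\<dots> = average (Q \<Otimes>\<^sub>M P) (\<lambda>z. (\<lambda>(x, y). h x y) ((\<lambda>(x, y). (y, x)) z))"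
    by (rule average_distr[OF QP _ h]) (rule measurable_pair_swap')
  also have "\<dots> = average (Q \<Otimes>\<^sub>M P) (\<lambda>(y, x). h x y)"
    by (simp add: case_prod_beta')
  also have "\<dots> = average Q (\<lambda>y. average P (\<lambda>x. h x y))"
    using average_iterated[OF Q P h', of c] c by simp
  finally show ?thesis .
qed

lemma average_L1_close:
  assumes P: "prob_space P" and g[measurable]: "g \<in> borel_measurable P" and f: "integrable P f"
    and H: "(\<integral>\<^sup>+x. e2ennreal \<bar>g x - ereal (f x)\<bar> \<partial>P) \<le> ennreal e" and e: "e \<ge> 0"
  obtains \<alpha> where "average P g = ereal \<alpha>" "\<bar>\<alpha> - (\<integral>x. f x \<partial>P)\<bar> \<le> e"
proof -
  have [measurable]: "f \<in> borel_measurable P" using f by simp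
  let ?H = "\<integral>\<^sup>+x. e2ennreal \<bar>g x - ereal (f x)\<bar> \<partial>P"
  have "?H < \<infinity>" using H by (simp add: le_less_trans ennreal_less_top)
  then have "AE x in P. e2ennreal \<bar>g x - ereal (f x)\<bar> \<noteq> \<infinity>" by (intro nn_integral_noteq_infinite) auto
  then have fin: "AE x in P. \<bar>g x\<bar> \<noteq> \<infinity>"
    by eventually_elim (rename_tac x, case_tac "g x", auto)
  let ?d = "\<lambda>x. real_of_ereal (g x) - f x"
  have dH: "(\<integral>\<^sup>+x. ennreal \<bar>?d x\<bar> \<partial>P) = ?H"
  proof (rule nn_integral_cong_AE, use fin in eventually_elim)
    case (elim x)
    then show ?case by (cases "g x") auto
  qed
  have d: "integrable P ?d"
    by (rule integrableI_bounded) (use dH \<open>?H < \<infinity>\<close> in auto)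
  then have ig: "integrable P (\<lambda>x. real_of_ereal (g x))"
    using Bochner_Integration.integrable_add[OF d f] by simp
  have "average P g = average P (\<lambda>x. ereal (real_of_ereal (g x)))"
    using fin by (intro average_cong_AE[OF P]) (auto elim!: eventually_mono simp: ereal_real)
  also have "\<dots> = ereal (\<integral>x. real_of_ereal (g x) \<partial>P)" by (rule average_real[OF P ig])
  finally have av: "average P g = ereal (\<integral>x. real_of_ereal (g x) \<partial>P)" .
  have "\<bar>(\<integral>x. real_of_ereal (g x) \<partial>P) - (\<integral>x. f x \<partial>P)\<bar> = \<bar>\<integral>x. ?d x \<partial>P\<bar>" using ig f by simp
  also have "\<dots> \<le> (\<integral>x. \<bar>?d x\<bar> \<partial>P)" by (rule integral_abs_bound)
  also have "\<dots> \<le> e"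
  proof -
    have "ennreal (\<integral>x. \<bar>?d x\<bar> \<partial>P) = (\<integral>\<^sup>+x. ennreal \<bar>?d x\<bar> \<partial>P)"
      using d by (intro nn_integral_eq_integral[symmetric]) auto
    then have "ennreal (\<integral>x. \<bar>?d x\<bar> \<partial>P) \<le> ennreal e" using dH H by metis
    then show ?thesis using e ennreal_le_iff by blast
  qed
  finally show ?thesis using that av by blast
qed

lemma AE_ball_prob_affine:
  fixes x :: "real^'n"
  assumes "AE y in lborel. Q y" "\<rho> > 0"
  shows "AE z in ball_prob. Q (x + \<rho> *\<^sub>R z)"
proof -
  obtain N where N: "N \<in> null_sets lborel" "{y. \<not> Q y} \<subseteq> N" using AE_E[OF assms(1)] by (auto simp: null_sets_def)
  then have [measurable]: "N \<in> sets borel" by (auto simp: null_sets_def)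
  have "(\<integral>\<^sup>+z. indicator N (x + \<rho> *\<^sub>R z) \<partial>ball_prob) = (\<integral>\<^sup>+y. indicator N y * indicator (cball x \<rho>) y \<partial>lborel) / (ennreal (\<rho> ^ CARD('n)) * emeasure lborel (cball (0::real^'n) 1))"
    by (rule nn_integral_ball_prob_affine) (use assms in auto)
  also have "(\<integral>\<^sup>+y. indicator N y * indicator (cball x \<rho>) y \<partial>lborel) \<le> (\<integral>\<^sup>+y. indicator N y \<partial>lborel)"
    by (intro nn_integral_mono) (auto simp: indicator_def)
  then have "(\<integral>\<^sup>+y. indicator N y * indicator (cball x \<rho>) y \<partial>lborel) = 0" using N(1) by (simp add: null_sets_def)
  finally have "(\<integral>\<^sup>+z. indicator N (x + \<rho> *\<^sub>R z) \<partial>ball_prob) = 0" by simp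
  then have "AE z in ball_prob. indicator N (x + \<rho> *\<^sub>R z) = (0::ennreal)"
    by (subst (asm) nn_integral_0_iff_AE) auto
  then show ?thesis by eventually_elim (use N(2) in \<open>auto simp: indicator_def split: if_splits\<close>)
qed

text \<open>The rescaled functions \<open>a j * (u (r j x) - b j)\<close> cover the tangential flow for all \<open>p\<close>: for \<open>p = 2\<close> the factor is 1 and \<open>b j\<close> is a maximum
  of \<open>u\<close>, otherwise \<open>b j\<close> is constant. They converge to \<open>f\<close> in \<open>L\<^sup>1\<^sub>l\<^sub>o\<^sub>c\<close>, and \<open>U\<close>, the upper semicontinuous representative
  of \<open>f\<close>, is characterised by essential upper bounds on balls.\<close>

locale tangent_germ = subharmonic_germ G F p u R c0 for G F :: "(real^'n^'n) set" and p u R c0 +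
  fixes r a b :: "nat \<Rightarrow> real" and f :: "real^'n \<Rightarrow> real" and U :: "real^'n \<Rightarrow> ereal" and m :: "real \<Rightarrow> real"
  assumes r: "\<And>j. 0 < r j" "r \<longlonglongrightarrow> 0" and a: "\<And>j. 0 < a j"
    and f_borel[measurable]: "f \<in> borel_measurable borel"
    and f_int: "\<And>L. (\<integral>\<^sup>+x. ennreal \<bar>f x\<bar> * indicator (cball 0 L) x \<partial>lborel) < \<infinity>"
    and conv: "\<And>L. (\<lambda>j. \<integral>\<^sup>+x. e2ennreal \<bar>ereal (a j) * (u (r j *\<^sub>R x) - ereal (b j)) - ereal (f x)\<bar> * indicator (cball 0 L) x \<partial>lborel) \<longlonglongrightarrow> 0"
    and U_ub: "\<And>x c \<rho>. \<rho> > 0 \<Longrightarrow> (AE y in lborel. y \<in> ball x \<rho> \<longrightarrow> ereal (f y) \<le> c) \<Longrightarrow> U x \<le> c"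
    and U_lb: "\<And>x c. U x < c \<Longrightarrow> \<exists>\<rho>>0. AE y in lborel. y \<in> ball x \<rho> \<longrightarrow> ereal (f y) \<le> c"
    and m: "\<And>t. 0 < t \<Longrightarrow> (\<lambda>j. a j * (Mr (r j * t) - b j)) \<longlonglongrightarrow> m t" and m_cont: "\<And>t. 0 < t \<Longrightarrow> isCont m t"
begin

text \<open>For small \<open>r j\<close>, the maximum of \<open>g j\<close> on the ball of radius \<open>t\<close> is \<open>C t j\<close>. The number \<open>err L \<rho> j\<close> bounds the error of averages
  over balls of radius \<open>\<rho>\<close> inside the ball of radius \<open>L\<close> when \<open>g j\<close> is replaced by \<open>f\<close>.\<close>

definition g :: "nat \<Rightarrow> real^'n \<Rightarrow> ereal" where "g j x = ereal (a j) * (u (r j *\<^sub>R x) - ereal (b j))"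
definition C :: "real \<Rightarrow> nat \<Rightarrow> real" where "C t j = a j * (Mr (r j * t) - b j)"
definition E :: "real \<Rightarrow> nat \<Rightarrow> ennreal" where
  "E L j = (\<integral>\<^sup>+x. e2ennreal \<bar>g j x - ereal (f x)\<bar> * indicator (cball 0 L) x \<partial>lborel)"
definition err :: "real \<Rightarrow> real \<Rightarrow> nat \<Rightarrow> real" where
  "err L \<rho> j = enn2real (E L j / (ennreal (\<rho> ^ CARD('n)) * emeasure lborel (cball (0::real^'n) 1)))"
definition A :: "real^'n \<Rightarrow> real \<Rightarrow> real" where "A x \<rho> = (\<integral>z. f (x + \<rho> *\<^sub>R z) \<partial>ball_prob)"

lemma g_borel[measurable]: "g j \<in> borel_measurable borel"
  unfolding g_def[abs_def] by measurable

lemma g_le: "g j x \<le> ereal (a j * (c0 - b j))"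
  unfolding g_def using c0[of "r j *\<^sub>R x"] a[of j] by (cases "u (r j *\<^sub>R x)") (auto intro!: mult_left_mono)

lemma C_lim: "0 < t \<Longrightarrow> C t \<longlonglongrightarrow> m t" unfolding C_def using m by simp

lemma scale_small: "0 < t \<Longrightarrow> 0 < d \<Longrightarrow> eventually (\<lambda>j. r j * t < d) sequentially"
  using tendsto_mult_right[OF r(2), of t] by (intro order_tendstoD(2)[of _ 0]) auto

lemma g_le_C:
  assumes t: "0 < t" shows "eventually (\<lambda>j. \<forall>x. norm x \<le> t \<longrightarrow> g j x \<le> ereal (C t j)) sequentially"
  using scale_small[OF t R]
proof eventually_elim
  case (elim j)
  show ?case
  proof (intro allI impI)
    fix x :: "real^'n" assume x: "norm x \<le> t"
    have "u (r j *\<^sub>R x) \<le> avg_M u (r j * t)"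
      unfolding avg_M_def using x r(1)[of j] by (intro SUP_upper) (simp add: mult_left_mono)
    also have "\<dots> = ereal (Mr (r j * t))" using elim r(1)[of j] t by (intro averages_real) auto
    finally show "g j x \<le> ereal (C t j)"
      unfolding g_def C_def using a[of j] by (cases "u (r j *\<^sub>R x)") (auto intro!: mult_left_mono)
  qed
qed

lemma E_lim: "E L \<longlonglongrightarrow> 0" unfolding E_def g_def using conv by simp

lemma vol_pos: "\<rho> > 0 \<Longrightarrow> \<exists>b>0. ennreal (\<rho> ^ CARD('n)) * emeasure lborel (cball (0::real^'n) 1) = ennreal b"
proof -
  assume \<rho>: "\<rho> > 0"
  obtain b where "emeasure lborel (cball (0::real^'n) 1) = ennreal b" "b > 0"
    using unit_ball_emeasure[where 'n='n] by (cases "emeasure lborel (cball (0::real^'n) 1)") (auto simp: less_le)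
  then show ?thesis using \<rho> by (intro exI[of _ "\<rho> ^ CARD('n) * b"]) (auto simp: ennreal_mult)
qed

lemma err_lim:
  assumes \<rho>: "\<rho> > 0" shows "err L \<rho> \<longlonglongrightarrow> 0"
proof -
  obtain b where b: "b > 0" "ennreal (\<rho> ^ CARD('n)) * emeasure lborel (cball (0::real^'n) 1) = ennreal b" using vol_pos[OF \<rho>] by blast
  have "(\<lambda>j. ennreal (1/b) * E L j) \<longlonglongrightarrow> ennreal (1/b) * 0" by (intro ennreal_tendsto_cmult E_lim) simp
  moreover have "E L j / ennreal b = ennreal (1/b) * E L j" for j
    using b(1) by (simp add: divide_ennreal_def inverse_ennreal mult.commute inverse_eq_divide)
  ultimately have "(\<lambda>j. E L j / ennreal b) \<longlonglongrightarrow> ennreal 0" by simp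
  then show ?thesis unfolding err_def[abs_def] b(2) by (intro tendsto_enn2real) auto
qed

lemma f_avg_int:
  assumes \<rho>: "\<rho> > 0" shows "integrable ball_prob (\<lambda>z. f (x + \<rho> *\<^sub>R z))"
proof (rule integrableI_bounded)
  obtain b where b: "b > 0" "ennreal (\<rho> ^ CARD('n)) * emeasure lborel (cball (0::real^'n) 1) = ennreal b" using vol_pos[OF \<rho>] by blast
  have "(\<integral>\<^sup>+z. ennreal (norm (f (x + \<rho> *\<^sub>R z))) \<partial>ball_prob) = (\<integral>\<^sup>+y. ennreal \<bar>f y\<bar> * indicator (cball x \<rho>) y \<partial>lborel) / ennreal b"
    using nn_integral_ball_prob_affine[of "\<lambda>y. ennreal \<bar>f y\<bar>" \<rho> x] \<rho> b(2) by simp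
  also have "(\<integral>\<^sup>+y. ennreal \<bar>f y\<bar> * indicator (cball x \<rho>) y \<partial>lborel) \<le> (\<integral>\<^sup>+y. ennreal \<bar>f y\<bar> * indicator (cball 0 (norm x + \<rho>)) y \<partial>lborel)"
  proof (intro nn_integral_mono mult_left_mono)
    fix y :: "real^'n"
    show "indicator (cball x \<rho>) y \<le> (indicator (cball 0 (norm x + \<rho>)) y :: ennreal)"
      using norm_triangle_sub[of y x] by (auto simp: indicator_def dist_norm norm_minus_commute)
  qed simp
  then have "(\<integral>\<^sup>+y. ennreal \<bar>f y\<bar> * indicator (cball x \<rho>) y \<partial>lborel) / ennreal b < \<infinity>"
    using le_less_trans[OF _ f_int[of "norm x + \<rho>"]] b(1) by (simp add: ennreal_divide_eq_top_iff less_top[symmetric])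
  finally show "(\<integral>\<^sup>+z. ennreal (norm (f (x + \<rho> *\<^sub>R z))) \<partial>ball_prob) < \<infinity>" .
qed simp

lemma L1_avg:
  assumes \<rho>: "\<rho> > 0" and L: "norm x + \<rho> \<le> L" and fin: "E L j < \<infinity>"
  obtains \<alpha> where "average ball_prob (\<lambda>z. g j (x + \<rho> *\<^sub>R z)) = ereal \<alpha>" "\<bar>\<alpha> - A x \<rho>\<bar> \<le> err L \<rho> j"
proof -
  obtain b where b: "b > 0" "ennreal (\<rho> ^ CARD('n)) * emeasure lborel (cball (0::real^'n) 1) = ennreal b" using vol_pos[OF \<rho>] by blast
  let ?w = "\<lambda>y. e2ennreal \<bar>g j y - ereal (f y)\<bar>"
  have "(\<integral>\<^sup>+z. ?w (x + \<rho> *\<^sub>R z) \<partial>ball_prob) = (\<integral>\<^sup>+y. ?w y * indicator (cball x \<rho>) y \<partial>lborel) / ennreal b"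
    using nn_integral_ball_prob_affine[of ?w \<rho> x] \<rho> b(2) by simp
  also have "\<dots> \<le> E L j / ennreal b"
    unfolding E_def
  proof (intro divide_right_mono_ennreal nn_integral_mono mult_left_mono)
    fix y :: "real^'n"
    show "indicator (cball x \<rho>) y \<le> (indicator (cball 0 L) y :: ennreal)"
      using norm_triangle_sub[of y x] L by (auto simp: indicator_def dist_norm norm_minus_commute)
  qed simp
  also have "\<dots> = ennreal (err L \<rho> j)"
  proof -
    have "E L j / ennreal b < \<infinity>" using fin b(1) by (auto simp: ennreal_divide_eq_top_iff less_top[symmetric])
    then show ?thesis unfolding err_def b(2) by (simp add: less_top)
  qed
  finally show ?thesis
    using average_L1_close[OF P _ f_avg_int[OF \<rho>], of "\<lambda>z. g j (x + \<rho> *\<^sub>R z)" x "err L \<rho> j"] that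
    unfolding A_def by (auto simp: err_def)
qed

lemma E_fin: "eventually (\<lambda>j. E L j < \<infinity>) sequentially"
  using order_tendstoD(2)[OF E_lim[of L], of \<top>] by simp

text \<open>Where \<open>f\<close> exceeds the bound \<open>c j\<close> for \<open>g j\<close>, it does so by at most \<open>|g j - f|\<close>, so the excess vanishes in the limit.\<close>

lemma U_le_lim:
  assumes \<rho>: "\<rho> > 0" and ev: "eventually (\<lambda>j. \<forall>y\<in>ball x \<rho>. g j y \<le> ereal (c j)) sequentially" and c: "c \<longlonglongrightarrow> c'"
  shows "U x \<le> ereal c'"
proof (rule ereal_le_epsilon2)
  fix e :: real assume e: "e > 0"
  let ?B = "ball x \<rho>" and ?L = "norm x + \<rho>"
  have "eventually (\<lambda>j. c j < c' + e) sequentially" using c e by (intro order_tendstoD(2)) auto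
  with ev have "eventually (\<lambda>j. (\<integral>\<^sup>+y. e2ennreal (ereal (f y) - ereal (c' + e)) * indicator ?B y \<partial>lborel) \<le> E ?L j) sequentially"
  proof eventually_elim
    case (elim j)
    show ?case unfolding E_def
    proof (rule nn_integral_mono)
      fix y :: "real^'n"
      show "e2ennreal (ereal (f y) - ereal (c' + e)) * indicator ?B y \<le> e2ennreal \<bar>g j y - ereal (f y)\<bar> * indicator (cball 0 ?L) y"
      proof (cases "y \<in> ?B")
        case True
        then have "g j y \<le> ereal (c j)" using elim by blast
        then have "ereal (f y) - ereal (c' + e) \<le> \<bar>g j y - ereal (f y)\<bar>" using elim(2) by (cases "g j y") auto
        then have "e2ennreal (ereal (f y) - ereal (c' + e)) \<le> e2ennreal \<bar>g j y - ereal (f y)\<bar>" by (rule e2ennreal_mono)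
        moreover have "y \<in> cball 0 ?L" using True norm_triangle_sub[of y x] by (auto simp: dist_norm norm_minus_commute)
        ultimately show ?thesis using True by simp
      qed simp
    qed
  qed
  then have "(\<integral>\<^sup>+y. e2ennreal (ereal (f y) - ereal (c' + e)) * indicator ?B y \<partial>lborel) \<le> 0"
    using E_lim[of ?L] by (intro tendsto_lowerbound[of "E ?L" 0 sequentially]) auto
  then have "AE y in lborel. e2ennreal (ereal (f y) - ereal (c' + e)) * indicator ?B y = 0"
    by (subst nn_integral_0_iff_AE[symmetric]) (measurable, auto)
  then have "AE y in lborel. y \<in> ?B \<longrightarrow> ereal (f y) \<le> ereal (c' + e)"
    by eventually_elim (auto simp: ennreal_eq_0_iff)
  then have "U x \<le> ereal (c' + e)" by (rule U_ub[OF \<rho>])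
  then show "U x \<le> ereal c' + ereal e" by simp
qed

lemma U_le_m_ball: "norm x < t \<Longrightarrow> U x \<le> ereal (m t)"
proof -
  assume x: "norm x < t"
  then have t: "0 < t" by (meson norm_ge_zero order_le_less_trans)
  have "eventually (\<lambda>j. \<forall>y\<in>ball x (t - norm x). g j y \<le> ereal (C t j)) sequentially"
    using g_le_C[OF t]
  proof eventually_elim
    case (elim j)
    have "norm y \<le> t" if "y \<in> ball x (t - norm x)" for y
      using that norm_triangle_sub[of y x] by (auto simp: dist_norm norm_minus_commute)
    then show ?case using elim by blast
  qed
  then show ?thesis using x by (intro U_le_lim[OF _ _ C_lim[OF t]]) auto
qed

lemma U_le_m:
  assumes t: "0 < t" and x: "norm x \<le> t" shows "U x \<le> ereal (m t)"
proof -
  have "((\<lambda>t. ereal (m t)) \<longlongrightarrow> ereal (m t)) (at_right t)"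
    using m_cont[OF t] by (auto simp: isCont_def intro: tendsto_mono[OF at_le])
  moreover have "eventually (\<lambda>s. U x \<le> ereal (m s)) (at_right t)"
    unfolding eventually_at_right_field using x U_le_m_ball by (intro exI[of _ "t + 1"]) auto
  ultimately show ?thesis by (intro tendsto_lowerbound) auto
qed

lemma U_usc: "usc_on UNIV U"
proof (rule usc_onI)
  show "U x < \<infinity>" for x using U_le_m_ball[of x "norm x + 1"] by (auto intro: le_less_trans)
  fix x c assume "U x < c"
  then obtain c' where c': "U x < c'" "c' < c" using dense by blast
  then obtain \<rho> where \<rho>: "\<rho> > 0" "AE y in lborel. y \<in> ball x \<rho> \<longrightarrow> ereal (f y) \<le> c'" using U_lb by blast
  have "U y \<le> c'" if y: "dist y x < \<rho> / 2" for y
  proof (rule U_ub[of "\<rho>/2"])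
    have "ball y (\<rho>/2) \<subseteq> ball x \<rho>"
    proof
      fix z assume "z \<in> ball y (\<rho>/2)"
      then have "dist x z < \<rho>" using y dist_triangle[of x z y] by (simp add: dist_commute)
      then show "z \<in> ball x \<rho>" by simp
    qed
    then show "AE z in lborel. z \<in> ball y (\<rho>/2) \<longrightarrow> ereal (f z) \<le> c'"
      using \<rho>(2) by (auto elim!: eventually_mono)
  qed (use \<rho> in simp)
  then show "\<exists>\<delta>>0. \<forall>y\<in>UNIV. dist y x < \<delta> \<longrightarrow> U y < c" using \<rho>(1) c'(2)
    by (intro exI[of _ "\<rho>/2"]) (auto intro: le_less_trans)
qed

lemma U_borel[measurable]: "U \<in> borel_measurable borel" by (rule usc_on_UNIV_borel[OF U_usc])

lemma g_mean_value:
  assumes \<rho>: "\<rho> > 0" and j: "r j * (norm x + \<rho>) < 4 * R"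
  shows "g j x \<le> average ball_prob (\<lambda>z. g j (x + \<rho> *\<^sub>R z))"
proof -
  have rj: "0 < r j" by (rule r)
  have "ball (r j *\<^sub>R x) (r j * \<rho>) \<subseteq> ball 0 (4 * R)"
  proof
    fix z assume "z \<in> ball (r j *\<^sub>R x) (r j * \<rho>)"
    then have "norm (z - r j *\<^sub>R x) < r j * \<rho>" by (simp add: dist_norm norm_minus_commute)
    then have "norm z < r j * norm x + r j * \<rho>" using norm_triangle_sub[of z "r j *\<^sub>R x"] rj by simp
    then show "z \<in> ball 0 (4 * R)" using j by (simp add: distrib_left)
  qed
  then have "u (r j *\<^sub>R x) \<le> average ball_prob (\<lambda>z. u (r j *\<^sub>R x + (r j * \<rho>) *\<^sub>R z))"
    using rj \<rho> by (intro mean_value_ball[OF visc usc c0]) auto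
  then have "g j x \<le> ereal (a j) * (average ball_prob (\<lambda>z. u (r j *\<^sub>R x + (r j * \<rho>) *\<^sub>R z)) - ereal (b j))"
    unfolding g_def using a[of j] by (intro ereal_mult_left_mono ereal_minus_mono) auto
  also have "\<dots> = average ball_prob (\<lambda>z. ereal (a j) * (u (r j *\<^sub>R x + (r j * \<rho>) *\<^sub>R z) - ereal (b j)))"
    by (rule average_affine[OF P _ _ a, of _ c0, symmetric]) (auto simp: c0)
  also have "\<dots> = average ball_prob (\<lambda>z. g j (x + \<rho> *\<^sub>R z))"
    by (simp add: g_def scaleR_add_right)
  finally show ?thesis .
qed

text \<open>A Hartogs type estimate: the mean value inequality bounds \<open>g j\<close> by its averages over balls of a fixed radius, and these
  converge, uniformly in the centre, to the averages of \<open>f\<close>, which \<open>U x\<close> controls.\<close>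

lemma hartogs:
  assumes "U x < ereal c"
  obtains \<delta> where "\<delta> > 0" "eventually (\<lambda>j. \<forall>y\<in>ball x \<delta>. g j y < ereal c) sequentially"
proof -
  obtain c' where c': "U x < ereal c'" "c' < c" using assms ereal_dense2[OF assms] by auto
  obtain \<rho> where \<rho>: "\<rho> > 0" "AE y in lborel. y \<in> ball x \<rho> \<longrightarrow> ereal (f y) \<le> ereal c'" using U_lb[OF c'(1)] by blast
  let ?\<rho> = "\<rho> / 2" and ?L = "norm x + \<rho>"
  have \<rho>2: "?\<rho> > 0" using \<rho> by simp
  have "eventually (\<lambda>j. err ?L ?\<rho> j < c - c') sequentially"
    using err_lim[OF \<rho>2] c'(2) by (intro order_tendstoD(2)) auto
  moreover have "eventually (\<lambda>j. r j * ?L < 4 * R) sequentially" using \<rho>(1) R by (intro scale_small) (auto simp: add_nonneg_pos)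
  ultimately have "eventually (\<lambda>j. \<forall>y\<in>ball x ?\<rho>. g j y < ereal c) sequentially"
    using E_fin[of ?L]
  proof eventually_elim
    case (elim j)
    show ?case
    proof
      fix y assume y: "y \<in> ball x ?\<rho>"
      then have ny: "norm y + ?\<rho> \<le> ?L" using norm_triangle_sub[of y x] by (auto simp: dist_norm norm_minus_commute)
      obtain \<alpha> where \<alpha>: "average ball_prob (\<lambda>z. g j (y + ?\<rho> *\<^sub>R z)) = ereal \<alpha>" "\<bar>\<alpha> - A y ?\<rho>\<bar> \<le> err ?L ?\<rho> j"
        by (rule L1_avg[OF \<rho>2 ny elim(3)]) (rule that)
      have "A y ?\<rho> \<le> (\<integral>z. c' \<partial>(ball_prob :: (real^'n) measure))"
        unfolding A_def
      proof (rule integral_mono_AE[OF f_avg_int[OF \<rho>2]])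
        interpret prob_space "ball_prob :: (real^'n) measure" by (rule P)
        show "integrable (ball_prob :: (real^'n) measure) (\<lambda>z. c')" by simp
        have "AE z in ball_prob. y + ?\<rho> *\<^sub>R z \<in> ball x \<rho> \<longrightarrow> ereal (f (y + ?\<rho> *\<^sub>R z)) \<le> ereal c'"
          by (rule AE_ball_prob_affine[OF \<rho>(2) \<rho>2])
        then show "AE z in ball_prob. f (y + ?\<rho> *\<^sub>R z) \<le> c'"
          using AE_ball_prob
        proof eventually_elim
          case (elim z)
          have "dist x (y + ?\<rho> *\<^sub>R z) \<le> dist x y + ?\<rho> * norm z"
            using dist_triangle[of x "y + ?\<rho> *\<^sub>R z" y] \<rho>2 by (simp add: dist_norm)
          also have "\<dots> < \<rho>"
          proof -
            have "?\<rho> * norm z \<le> ?\<rho> * 1" using elim(2) \<rho>2 by (intro mult_left_mono) auto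
            then show ?thesis using y by simp
          qed
          finally show ?case using elim(1) by simp
        qed
      qed
      also have "\<dots> = c'" using prob_space.prob_space[OF P] by simp
      finally have "\<alpha> < c" using \<alpha>(2) elim(1) by linarith
      moreover have "g j y \<le> ereal \<alpha>"
      proof -
        have "r j * (norm y + ?\<rho>) \<le> r j * ?L" using ny r(1)[of j] by (intro mult_left_mono) auto
        then show ?thesis using g_mean_value[OF \<rho>2, of j y] elim(2) \<alpha>(1) by simp
      qed
      ultimately show "g j y < ereal c" by (meson ereal_less(2) le_less_trans less_ereal.simps(1))
    qed
  qed
  then show ?thesis using that \<rho>2 by blast
qed

lemma limsup_g_le: "limsup (\<lambda>j. g j x) \<le> U x"
proof (rule ccontr)
  assume "\<not> limsup (\<lambda>j. g j x) \<le> U x"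
  then obtain c where c: "U x < ereal c" "ereal c < limsup (\<lambda>j. g j x)" using ereal_dense2[of "U x" "limsup (\<lambda>j. g j x)"] by (auto simp: not_le)
  obtain \<delta> where "\<delta> > 0" "eventually (\<lambda>j. \<forall>y\<in>ball x \<delta>. g j y < ereal c) sequentially" by (rule hartogs[OF c(1)]) (rule that)
  then have "eventually (\<lambda>j. g j x \<le> ereal c) sequentially" by (auto elim!: eventually_mono intro: less_imp_le)
  then have "limsup (\<lambda>j. g j x) \<le> ereal c" by (rule Limsup_bounded)
  then show False using c(2) by simp
qed

text \<open>If \<open>U\<close> were below \<open>c < m t\<close> on the sphere, then by \<open>hartogs\<close> and compactness all \<open>g j\<close> with \<open>j\<close> large would be, too; but their
  maxima over the sphere tend to \<open>m t\<close>.\<close>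

lemma sup_sphere:
  assumes t: "0 < t" shows "(SUP \<sigma>\<in>sphere 0 1. U (t *\<^sub>R \<sigma>)) = ereal (m t)"
proof (rule antisym)
  show "(SUP \<sigma>\<in>sphere 0 1. U (t *\<^sub>R \<sigma>)) \<le> ereal (m t)"
    using t by (intro SUP_least U_le_m) auto
  show "ereal (m t) \<le> (SUP \<sigma>\<in>sphere 0 1. U (t *\<^sub>R \<sigma>))"
  proof (rule ccontr)
    assume "\<not> ereal (m t) \<le> (SUP \<sigma>\<in>sphere 0 1. U (t *\<^sub>R \<sigma>))"
    then obtain c where c: "(SUP \<sigma>\<in>sphere 0 1. U (t *\<^sub>R \<sigma>)) < ereal c" "c < m t"
      using ereal_dense2[of "SUP \<sigma>\<in>sphere 0 1. U (t *\<^sub>R \<sigma>)" "ereal (m t)"] by (auto simp: not_le)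
    have Uc: "U x < ereal c" if "x \<in> sphere 0 t" for x
    proof -
      have "x = t *\<^sub>R ((1/t) *\<^sub>R x)" "(1/t) *\<^sub>R x \<in> sphere 0 1" using that t by auto
      then have "U x \<le> (SUP \<sigma>\<in>sphere 0 1. U (t *\<^sub>R \<sigma>))" by (metis SUP_upper)
      then show ?thesis using c(1) by order
    qed
    have "\<forall>x\<in>sphere 0 t. \<exists>\<delta>>0. eventually (\<lambda>j. \<forall>y\<in>ball x \<delta>. g j y < ereal c) sequentially"
    proof
      fix x :: "real^'n" assume "x \<in> sphere 0 t"
      from hartogs[OF Uc[OF this]] show "\<exists>\<delta>>0. eventually (\<lambda>j. \<forall>y\<in>ball x \<delta>. g j y < ereal c) sequentially" by blast
    qed
    from bchoice[OF this] obtain \<delta> where "\<forall>x\<in>sphere 0 t. \<delta> x > 0 \<and> eventually (\<lambda>j. \<forall>y\<in>ball x (\<delta> x). g j y < ereal c) sequentially" ..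
    then have \<delta>: "\<And>x. x \<in> sphere 0 t \<Longrightarrow> \<delta> x > 0"
      "\<And>x. x \<in> sphere 0 t \<Longrightarrow> eventually (\<lambda>j. \<forall>y\<in>ball x (\<delta> x). g j y < ereal c) sequentially" by auto
    have "sphere 0 t \<subseteq> (\<Union>x\<in>sphere 0 t. ball x (\<delta> x))" using \<delta>(1) by force
    then obtain K where K: "K \<subseteq> sphere 0 t" "finite K" "sphere 0 t \<subseteq> (\<Union>x\<in>K. ball x (\<delta> x))"
      using compactE_image[OF compact_sphere, of "sphere 0 t" "\<lambda>x. ball x (\<delta> x)" 0 t] by auto
    have "eventually (\<lambda>j. \<forall>x\<in>K. \<forall>y\<in>ball x (\<delta> x). g j y < ereal c) sequentially"
      using K(1,2) \<delta>(2) by (intro eventually_ball_finite) auto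
    then have "eventually (\<lambda>j. C t j \<le> c) sequentially"
      using scale_small[OF t R]
    proof eventually_elim
      case (elim j)
      have rt: "0 < r j * t" using r(1)[of j] t by simp
      obtain x where x: "norm x = r j * t" "avg_M u (r j * t) = u x"
        using sup_ball_attained[OF rt] elim(2) R by auto
      let ?y = "(1 / r j) *\<^sub>R x"
      have rj: "r j > 0" by (rule r)
      have "?y \<in> sphere 0 t" using x(1) rj t by simp
      then have "g j ?y < ereal c" using elim(1) K(3) by blast
      moreover have "g j ?y = ereal (C t j)"
        using averages_real(1)[OF rt] elim(2) x(2) rj unfolding g_def C_def by simp
      ultimately show ?case by simp
    qed
    then have "m t \<le> c" by (rule tendsto_upperbound[OF C_lim[OF t]]) simp
    then show False using c(2) by simp
  qed
qed

text \<open>Fatou's lemma, with the common upper bound that \<open>C t j\<close> provides for large \<open>j\<close>.\<close>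

lemma average_lower:
  assumes Q: "prob_space Q" and Y[measurable]: "Y \<in> Q \<rightarrow>\<^sub>M borel" and Yt: "AE \<omega> in Q. norm (Y \<omega>) \<le> t" and t: "0 < t"
    and lim: "(\<lambda>j. average Q (\<lambda>\<omega>. g j (Y \<omega>))) \<longlonglongrightarrow> l"
  shows "l \<le> average Q (\<lambda>\<omega>. U (Y \<omega>))"
proof -
  let ?c = "m t + 1"
  let ?h = "\<lambda>j \<omega>. min (g j (Y \<omega>)) (ereal ?c)"
  have "eventually (\<lambda>j. C t j < ?c) sequentially" using C_lim[OF t] by (intro order_tendstoD(2)) auto
  with g_le_C[OF t] have "eventually (\<lambda>j. average Q (\<lambda>\<omega>. g j (Y \<omega>)) = average Q (?h j)) sequentially"
  proof eventually_elim
    case (elim j)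
    show ?case
    proof (rule average_cong_AE[OF Q], use Yt in eventually_elim)
      case (elim \<omega>)
      then have "g j (Y \<omega>) \<le> ereal (C t j)" using \<open>\<forall>x. norm x \<le> t \<longrightarrow> g j x \<le> ereal (C t j)\<close> by blast
      then have "g j (Y \<omega>) \<le> ereal ?c" using \<open>C t j < ?c\<close> by (meson ereal_less_eq(3) less_imp_le order_trans)
      then show ?case by (simp add: min_def)
    qed
  qed
  then have "(\<lambda>j. average Q (?h j)) \<longlonglongrightarrow> l" using lim by (rule Lim_transform_eventually[rotated])
  then have "l = limsup (\<lambda>j. average Q (?h j))" by (intro lim_imp_Limsup[symmetric]) auto
  also have "\<dots> \<le> average Q (\<lambda>\<omega>. U (Y \<omega>))"
  proof (rule average_limsup[OF Q, where c="?c"])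
    show "AE \<omega> in Q. U (Y \<omega>) \<le> ereal ?c"
      using Yt
    proof eventually_elim
      case (elim \<omega>)
      have "U (Y \<omega>) \<le> ereal (m t)" by (rule U_le_m[OF t elim])
      then show ?case by (rule order_trans) simp
    qed
    show "AE \<omega> in Q. limsup (\<lambda>j. ?h j \<omega>) \<le> U (Y \<omega>)"
    proof (rule AE_I2)
      fix \<omega>
      have "limsup (\<lambda>j. ?h j \<omega>) \<le> limsup (\<lambda>j. g j (Y \<omega>))" by (intro Limsup_mono always_eventually allI) simp
      also have "\<dots> \<le> U (Y \<omega>)" by (rule limsup_g_le)
      finally show "limsup (\<lambda>j. ?h j \<omega>) \<le> U (Y \<omega>)" .
    qed
  qed auto
  finally show ?thesis .
qed

end

section \<open>Averages of tangents\<close>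

text \<open>The deficit \<open>c - h\<close> is nonnegative, so its integral over the larger ball is at least that over the smaller one.\<close>

lemma average_ball_subset:
  fixes h :: "real^'n \<Rightarrow> ereal" and c \<alpha> \<rho> \<rho>' :: real
  assumes h[measurable]: "h \<in> borel_measurable borel" and pos: "0 < \<rho>" "0 < \<rho>'" and sub: "cball x' \<rho>' \<subseteq> cball x \<rho>"
    and c: "\<And>y. y \<in> cball x \<rho> \<Longrightarrow> h y \<le> ereal c" and \<alpha>: "average ball_prob (\<lambda>z. h (x' + \<rho>' *\<^sub>R z)) \<le> ereal \<alpha>"
  shows "average ball_prob (\<lambda>z. h (x + \<rho> *\<^sub>R z)) \<le> ereal (c - (\<rho>' / \<rho>) ^ CARD('n) * (c - \<alpha>))"
proof -
  note P = prob_space_ball_prob[where 'n='n]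
  let ?I = "\<integral>\<^sup>+z. e2ennreal (ereal c - h (x + \<rho> *\<^sub>R z)) \<partial>ball_prob"
  let ?I' = "\<integral>\<^sup>+z. e2ennreal (ereal c - h (x' + \<rho>' *\<^sub>R z)) \<partial>ball_prob"
  have mem: "x + r *\<^sub>R z \<in> cball x r" if "norm z \<le> 1" "0 < r" for x z :: "real^'n" and r
    using that mult_left_mono[of "norm z" 1 r] by (simp add: dist_norm)
  have av: "average ball_prob (\<lambda>z. h (x + \<rho> *\<^sub>R z)) = ereal c - enn2ereal ?I"
    by (rule average_deficit[OF P]) (use mem pos c in \<open>auto intro!: eventually_mono[OF AE_ball_prob]\<close>)
  have av': "average ball_prob (\<lambda>z. h (x' + \<rho>' *\<^sub>R z)) = ereal c - enn2ereal ?I'"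
    by (rule average_deficit[OF P]) (use mem pos c sub in \<open>force intro!: eventually_mono[OF AE_ball_prob]\<close>)+
  have le: "ennreal (\<rho>' ^ CARD('n)) * ?I' \<le> ennreal (\<rho> ^ CARD('n)) * ?I"
    by (rule nn_integral_ball_subset[OF _ pos sub, of "\<lambda>y. e2ennreal (ereal c - h y)"]) measurable
  show ?thesis
  proof (cases ?I)
    case top
    then show ?thesis using av by simp
  next
    case (real i)
    have r': "0 < \<rho>' ^ CARD('n)" "0 < \<rho> ^ CARD('n)" using pos by auto
    obtain i' where i': "?I' = ennreal i'" "i' \<ge> 0"
    proof (cases ?I')
      case top
      then have "ennreal (\<rho>' ^ CARD('n)) * ?I' = \<top>" using pos by (simp add: ennreal_mult_top)
      then show ?thesis using le real r' by (simp add: top_unique ennreal_mult_eq_top_iff)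
    qed (rule that)
    have "\<rho>' ^ CARD('n) * i' \<le> \<rho> ^ CARD('n) * i"
      using le real i' r' by (simp flip: ennreal_mult add: ennreal_le_iff)
    then have q: "(\<rho>' / \<rho>) ^ CARD('n) * i' \<le> i" using r' by (simp add: power_divide field_simps)
    have "c - \<alpha> \<le> i'" using \<alpha> av' i' by (simp add: enn2ereal_ennreal)
    then have "(\<rho>' / \<rho>) ^ CARD('n) * (c - \<alpha>) \<le> (\<rho>' / \<rho>) ^ CARD('n) * i'" using pos by (intro mult_left_mono) auto
    then show ?thesis using q av real by (simp add: enn2ereal_ennreal)
  qed
qed

context transitive_rotations
begin

text \<open>The law of the sum of a random point of a sphere and an independent random point of a ball is invariant under \<open>G\<close>.\<close>

lemma distr_G_pair:
  assumes g: "g \<in> G"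
  shows "distr (ball_prob \<Otimes>\<^sub>M ball_prob) borel (\<lambda>(x, z). g *v (s *\<^sub>R sgn x + t *\<^sub>R z)) =
    distr (ball_prob \<Otimes>\<^sub>M ball_prob) borel (\<lambda>(x, z). s *\<^sub>R sgn x + t *\<^sub>R (z::real^'n))" (is "?L = distr ?PP borel ?Y")
proof -
  let ?B = "ball_prob :: (real^'n) measure"
  interpret prob_space ?B by (rule prob_space_ball_prob)
  have [measurable]: "(\<lambda>x. g *v x) \<in> borel \<rightarrow>\<^sub>M borel"
    by (intro borel_measurable_continuous_onI continuous_intros)
  have B: "distr ?B ?B (\<lambda>x. g *v x) = ?B"
    using distr_G[OF g] by (simp cong: distr_cong)
  have "?B \<Otimes>\<^sub>M ?B = distr ?B ?B (\<lambda>x. g *v x) \<Otimes>\<^sub>M distr ?B ?B (\<lambda>x. g *v x)" by (simp add: B)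
  also have "\<dots> = distr ?PP ?PP (\<lambda>(x, z). (g *v x, g *v z))"
    by (rule pair_measure_distr) (simp_all add: B sigma_finite_measure_axioms)
  finally have "distr ?PP borel ?Y = distr (distr ?PP ?PP (\<lambda>(x, z). (g *v x, g *v z))) borel ?Y" by simp
  also have "\<dots> = distr ?PP borel (?Y \<circ> (\<lambda>(x, z). (g *v x, g *v z)))"
    by (rule distr_distr) measurable
  also have "?Y \<circ> (\<lambda>(x, z). (g *v x, g *v z)) = (\<lambda>(x, z). g *v (s *\<^sub>R sgn x + t *\<^sub>R z))"
    by (auto simp: fun_eq_iff sgn_orthogonal_matrix[OF orth[OF g]] matrix_vector_right_distrib matrix_vector_mult_scaleR)
  finally show ?thesis by simp
qed

end

context tangent_germ
begin

text \<open>For \<open>y\<close> within distance \<open>\<eta>\<close> of \<open>x\<close>, the value \<open>g j y\<close> is at most the average over the ball of radius \<open>\<rho> + \<eta>\<close> about \<open>y\<close>. This ball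
  contains the fixed ball of radius \<open>\<rho>\<close> about \<open>x\<close>, and the ratio of their volumes tends to 1 as \<open>\<eta>\<close> tends to 0.\<close>

lemma U_le_A:
  assumes \<rho>: "\<rho> > 0" shows "U x \<le> ereal (A x \<rho>)"
proof -
  let ?L = "norm x + 3 * \<rho>"
  have L: "?L > 0" using \<rho> by (simp add: add_nonneg_pos)
  let ?q = "\<lambda>\<eta>. (\<rho> / (\<rho> + \<eta>)) ^ CARD('n)"
  have b: "U x \<le> ereal (m ?L - ?q \<eta> * (m ?L - A x \<rho>))" if \<eta>: "0 < \<eta>" "\<eta> < \<rho>" for \<eta>
  proof (rule U_le_lim[OF \<eta>(1)])
    let ?c = "\<lambda>j. C ?L j - ?q \<eta> * (C ?L j - (A x \<rho> + err ?L \<rho> j))"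
    have "?c \<longlonglongrightarrow> m ?L - ?q \<eta> * (m ?L - (A x \<rho> + 0))"
      by (intro tendsto_intros C_lim[OF L] err_lim[OF \<rho>])
    then show "?c \<longlonglongrightarrow> m ?L - ?q \<eta> * (m ?L - A x \<rho>)" by simp
    show "eventually (\<lambda>j. \<forall>y\<in>ball x \<eta>. g j y \<le> ereal (?c j)) sequentially"
      using g_le_C[OF L] E_fin[of ?L] scale_small[OF L, of "4 * R", OF mult_pos_pos[OF zero_less_numeral R]]
    proof eventually_elim
      case (elim j)
      show ?case
      proof
        fix y assume y: "y \<in> ball x \<eta>"
        have ny: "norm y < norm x + \<eta>" using y norm_triangle_sub[of y x] by (simp add: dist_norm norm_minus_commute)
        have "r j * (norm y + (\<rho> + \<eta>)) \<le> r j * ?L" using ny \<eta> r(1)[of j] by (intro mult_left_mono) auto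
        then have "g j y \<le> average ball_prob (\<lambda>z. g j (y + (\<rho> + \<eta>) *\<^sub>R z))"
          using elim(3) \<rho> \<eta> by (intro g_mean_value) auto
        also have "\<dots> \<le> ereal (?c j)"
        proof (rule average_ball_subset[where x'=x])
          show "cball x \<rho> \<subseteq> cball y (\<rho> + \<eta>)" using y by (simp add: cball_subset_cball_iff dist_commute)
          show "g j z \<le> ereal (C ?L j)" if "z \<in> cball y (\<rho> + \<eta>)" for z
          proof -
            have "norm z \<le> norm y + (\<rho> + \<eta>)" using that norm_triangle_sub[of z y] by (simp add: dist_norm norm_minus_commute)
            then have "norm z \<le> ?L" using ny \<eta> by simp
            then show ?thesis using elim(1) by blast
          qed
          obtain \<alpha> where \<alpha>: "average ball_prob (\<lambda>z. g j (x + \<rho> *\<^sub>R z)) = ereal \<alpha>" "\<bar>\<alpha> - A x \<rho>\<bar> \<le> err ?L \<rho> j"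
            by (rule L1_avg[OF \<rho> _ elim(2)]) (use \<rho> in \<open>auto intro: that\<close>)
          then show "average ball_prob (\<lambda>z. g j (x + \<rho> *\<^sub>R z)) \<le> ereal (A x \<rho> + err ?L \<rho> j)" by auto
        qed (use \<rho> \<eta> in auto)
        finally show "g j y \<le> ereal (?c j)" .
      qed
    qed
  qed
  have "((\<lambda>\<eta>. m ?L - ?q \<eta> * (m ?L - A x \<rho>)) \<longlongrightarrow> m ?L - (\<rho> / (\<rho> + 0)) ^ CARD('n) * (m ?L - A x \<rho>)) (at_right 0)"
    using \<rho> by (intro tendsto_intros) auto
  then have "((\<lambda>\<eta>. ereal (m ?L - ?q \<eta> * (m ?L - A x \<rho>))) \<longlongrightarrow> ereal (A x \<rho>)) (at_right 0)"
    using \<rho> by simp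
  moreover have "eventually (\<lambda>\<eta>. U x \<le> ereal (m ?L - ?q \<eta> * (m ?L - A x \<rho>))) (at_right 0)"
    unfolding eventually_at_right_field using b \<rho> by auto
  ultimately show ?thesis by (intro tendsto_lowerbound) auto
qed

lemma U_average_le:
  assumes \<rho>: "\<rho> > 0" and x: "norm x \<le> t" and fin: "E (t + \<rho>) j < \<infinity>"
  shows "U x - ereal (err (t + \<rho>) \<rho> j) \<le> average ball_prob (\<lambda>z. g j (x + \<rho> *\<^sub>R z))"
proof -
  obtain \<alpha> where \<alpha>: "average ball_prob (\<lambda>z. g j (x + \<rho> *\<^sub>R z)) = ereal \<alpha>" "\<bar>\<alpha> - A x \<rho>\<bar> \<le> err (t + \<rho>) \<rho> j"
    by (rule L1_avg[OF \<rho> _ fin]) (use x in \<open>auto intro: that\<close>)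
  have "U x - ereal (err (t + \<rho>) \<rho> j) \<le> ereal (A x \<rho>) - ereal (err (t + \<rho>) \<rho> j)"
    by (intro ereal_minus_mono U_le_A \<rho> order_refl)
  also have "\<dots> \<le> ereal \<alpha>" using \<alpha>(2) by simp
  finally show ?thesis using \<alpha>(1) by simp
qed

lemma average_U_double:
  assumes X[measurable]: "X \<in> ball_prob \<rightarrow>\<^sub>M borel" and Xt: "AE x in ball_prob. norm (X x) \<le> t" and t: "t > 0"
    and \<rho>: "\<rho> > 0" and fin: "E (t + \<rho>) j < \<infinity>"
  shows "average ball_prob (\<lambda>x. U (X x)) - ereal (err (t + \<rho>) \<rho> j)
    \<le> average ball_prob (\<lambda>x::real^'n. average ball_prob (\<lambda>z. g j (X x + \<rho> *\<^sub>R z)))"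
proof -
  let ?e = "err (t + \<rho>) \<rho> j"
  have "average ball_prob (\<lambda>x. U (X x)) - ereal ?e = average ball_prob (\<lambda>x. ereal 1 * (U (X x) - ereal ?e))"
    by (subst average_affine[OF P, where c="m t"]) (use Xt U_le_m[OF t] in \<open>auto elim!: eventually_mono\<close>)
  also have "\<dots> \<le> average ball_prob (\<lambda>x. average ball_prob (\<lambda>z. g j (X x + \<rho> *\<^sub>R z)))"
    by (rule average_mono_AE[OF P]) (use Xt U_average_le[OF \<rho> _ fin] in \<open>auto elim!: eventually_mono\<close>)
  finally show ?thesis .
qed

text \<open>The points \<open>t sgn x + \<rho> z\<close> at which \<open>g j\<close> is averaged have a \<open>G\<close>-invariant law on the ball of radius \<open>t + \<rho>\<close>, and some mean of \<open>u\<close> over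
  rotations is bounded there by almost its average over the bounding sphere.\<close>

lemma sphere_average_upper:
  assumes t: "t > 0" and \<rho>: "\<rho> > 0" and fin: "E (t + \<rho>) j < \<infinity>" and small: "r j * (t + \<rho>) < R"
  shows "sphere_avg U t - ereal (err (t + \<rho>) \<rho> j) \<le> ereal (a j * (Sr (r j * (t + \<rho>)) - b j))"
proof -
  let ?B = "ball_prob :: (real^'n) measure" and ?d = "r j * (t + \<rho>)"
  let ?Y = "\<lambda>(x, z). (r j * t) *\<^sub>R sgn x + (r j * \<rho>) *\<^sub>R (z :: real^'n)"
  have PP: "prob_space (?B \<Otimes>\<^sub>M ?B)" using P by (simp add: prob_space_pair)
  have rj: "r j > 0" by (rule r)
  have d: "0 < ?d" using rj t \<rho> by simp
  have Y[measurable]: "?Y \<in> (?B \<Otimes>\<^sub>M ?B) \<rightarrow>\<^sub>M borel" by measurable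
  have AEY: "AE \<omega> in ?B \<Otimes>\<^sub>M ?B. norm (?Y \<omega>) \<le> ?d"
  proof -
    interpret B: prob_space ?B by (rule P)
    interpret BB: pair_sigma_finite ?B ?B ..
    have "AE x in ?B. AE z in ?B. norm (?Y (x, z)) \<le> ?d"
      using AE_ball_prob
    proof eventually_elim
      case (elim x)
      show ?case using AE_ball_prob
      proof eventually_elim
        case (elim z)
        have "norm (?Y (x, z)) \<le> r j * t + (r j * \<rho>) * norm z"
          using rj t \<rho> norm_triangle_ineq[of "(r j * t) *\<^sub>R sgn x" "(r j * \<rho>) *\<^sub>R z"] \<open>x \<noteq> 0 \<and> _\<close> by simp
        also have "\<dots> \<le> r j * t + (r j * \<rho>) * 1" using elim rj \<rho> by (intro add_left_mono mult_left_mono) auto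
        finally show ?case by (simp add: algebra_simps)
      qed
    qed
    then show ?thesis by (intro BB.AE_pair_measure) measurable
  qed
  have "average (?B \<Otimes>\<^sub>M ?B) (\<lambda>\<omega>. u (?Y \<omega>)) \<le> ereal (Sr ?d)"
  proof (rule ereal_le_real_bound)
    fix c assume "ereal (Sr ?d) < ereal c"
    then have "sphere_avg u ?d < ereal c" using averages_real(2)[OF d] small by simp
    from majorant_ball[OF d _ this] small R obtain gs where gs: "gs \<noteq> []" "set gs \<subseteq> G" "\<And>x. norm x \<le> ?d \<Longrightarrow> orbit_mean gs u x \<le> ereal c" by auto
    show "average (?B \<Otimes>\<^sub>M ?B) (\<lambda>\<omega>. u (?Y \<omega>)) \<le> ereal c"
    proof (rule average_invariant_le[OF PP Y _ _ c0 gs(1)])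
      fix g' assume "g' \<in> set gs"
      then show "distr (?B \<Otimes>\<^sub>M ?B) borel (\<lambda>\<omega>. g' *v ?Y \<omega>) = distr (?B \<Otimes>\<^sub>M ?B) borel ?Y"
        using distr_G_pair[of g' "r j * t" "r j * \<rho>"] gs(2) by (auto simp: case_prod_beta')
    qed (use AEY gs(3) in \<open>auto elim!: eventually_mono\<close>)
  qed
  then have le: "ereal (a j) * (average (?B \<Otimes>\<^sub>M ?B) (\<lambda>\<omega>. u (?Y \<omega>)) - ereal (b j)) \<le> ereal (a j * (Sr ?d - b j))"
    using a[of j] by (cases "average (?B \<Otimes>\<^sub>M ?B) (\<lambda>\<omega>. u (?Y \<omega>))") (auto intro!: mult_left_mono)
  have "sphere_avg U t - ereal (err (t + \<rho>) \<rho> j) \<le> average ?B (\<lambda>x. average ?B (\<lambda>z. g j (t *\<^sub>R sgn x + \<rho> *\<^sub>R z)))"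
    unfolding sphere_avg_def using t by (intro average_U_double t \<rho> fin eventually_mono[OF AE_ball_prob]) auto
  also have "\<dots> = average (?B \<Otimes>\<^sub>M ?B) (\<lambda>(x, z). g j (t *\<^sub>R sgn x + \<rho> *\<^sub>R z))"
    using average_iterated[OF P P, where c="a j * (c0 - b j)" and h="\<lambda>(x, z). g j (t *\<^sub>R sgn x + \<rho> *\<^sub>R z)"] g_le by simp
  also have "\<dots> = average (?B \<Otimes>\<^sub>M ?B) (\<lambda>\<omega>. ereal (a j) * (u (?Y \<omega>) - ereal (b j)))"
    by (simp add: g_def case_prod_beta' scaleR_add_right)
  also have "\<dots> = ereal (a j) * (average (?B \<Otimes>\<^sub>M ?B) (\<lambda>\<omega>. u (?Y \<omega>)) - ereal (b j))"
    by (rule average_affine[OF PP _ _ a, of _ c0]) (auto simp: c0)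
  finally show ?thesis using le by (rule order_trans)
qed

text \<open>Exchanging the two averages leaves, for every \<open>z\<close>, the average of \<open>g j\<close> over the ball of radius \<open>t\<close> about \<open>\<rho> z\<close>. It contains the ball of
  radius \<open>t - \<rho>\<close> about the origin.\<close>

lemma ball_average_upper:
  assumes t: "t > 0" and \<rho>: "0 < \<rho>" "\<rho> < t" and fin: "E (t + \<rho>) j < \<infinity>" and small: "r j * (t + \<rho>) < R"
    and gC: "\<forall>x. norm x \<le> t + \<rho> \<longrightarrow> g j x \<le> ereal (C (t + \<rho>) j)"
  shows "ball_avg U t - ereal (err (t + \<rho>) \<rho> j)
    \<le> ereal (C (t + \<rho>) j - ((t - \<rho>) / t) ^ CARD('n) * (C (t + \<rho>) j - a j * (Vr (r j * (t - \<rho>)) - b j)))"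
proof -
  let ?B = "ball_prob :: (real^'n) measure" and ?d = "r j * (t - \<rho>)"
  have rj: "r j > 0" by (rule r)
  have d: "0 < ?d" "?d \<le> R"
  proof -
    have "r j * (t - \<rho>) \<le> r j * (t + \<rho>)" using rj \<rho> by (intro mult_left_mono) auto
    then show "?d \<le> R" using small by linarith
  qed (use rj \<rho> in simp)
  have V: "average ?B (\<lambda>x. g j (0 + (t - \<rho>) *\<^sub>R x)) \<le> ereal (a j * (Vr ?d - b j))"
  proof -
    have "average ?B (\<lambda>x. g j (0 + (t - \<rho>) *\<^sub>R x)) = ereal (a j) * (average ?B (\<lambda>x. u (?d *\<^sub>R x)) - ereal (b j))"
      unfolding g_def by (subst average_affine[OF P _ _ a, of _ c0, symmetric]) (auto simp: c0)
    also have "average ?B (\<lambda>x. u (?d *\<^sub>R x)) = ereal (Vr ?d)"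
      using averages_real(3)[OF d] by (simp add: ball_avg_def)
    finally show ?thesis by simp
  qed
  have "ball_avg U t - ereal (err (t + \<rho>) \<rho> j) \<le> average ?B (\<lambda>x. average ?B (\<lambda>z. g j (t *\<^sub>R x + \<rho> *\<^sub>R z)))"
    unfolding ball_avg_def using t by (intro average_U_double t \<rho> fin eventually_mono[OF AE_ball_prob]) auto
  also have "\<dots> = average ?B (\<lambda>z. average ?B (\<lambda>x. g j (t *\<^sub>R x + \<rho> *\<^sub>R z)))"
    by (rule average_swap[OF P P, where c="a j * (c0 - b j)"]) (auto simp: g_le)
  also have "\<dots> \<le> ereal (C (t + \<rho>) j - ((t - \<rho>) / t) ^ CARD('n) * (C (t + \<rho>) j - a j * (Vr ?d - b j)))"
  proof (rule average_le_const[OF P], rule eventually_mono[OF AE_ball_prob])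
    fix z :: "real^'n" assume z: "z \<noteq> 0 \<and> norm z \<le> 1 \<and> norm (sgn z) = 1"
    have nz: "norm (\<rho> *\<^sub>R z) \<le> \<rho>" using z \<rho> mult_left_mono[of "norm z" 1 \<rho>] by simp
    have "average ?B (\<lambda>x. g j (\<rho> *\<^sub>R z + t *\<^sub>R x)) \<le> ereal (C (t + \<rho>) j - ((t - \<rho>) / t) ^ CARD('n) * (C (t + \<rho>) j - a j * (Vr ?d - b j)))"
    proof (rule average_ball_subset[OF _ _ _ _ _ V])
      show "cball 0 (t - \<rho>) \<subseteq> cball (\<rho> *\<^sub>R z) t"
      proof
        fix y :: "real^'n" assume "y \<in> cball 0 (t - \<rho>)"
        then show "y \<in> cball (\<rho> *\<^sub>R z) t" using nz norm_triangle_ineq4[of "\<rho> *\<^sub>R z" y] by (simp only: mem_cball dist_norm) simp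
      qed
      show "g j y \<le> ereal (C (t + \<rho>) j)" if "y \<in> cball (\<rho> *\<^sub>R z) t" for y
      proof -
        have "norm (y - \<rho> *\<^sub>R z) \<le> t" using that by (simp add: dist_norm norm_minus_commute)
        then have "norm y \<le> t + \<rho>" using nz norm_triangle_sub[of y "\<rho> *\<^sub>R z"] by linarith
        then show ?thesis using gC by blast
      qed
    qed (use t \<rho> in auto)
    then show "average ?B (\<lambda>x. g j (t *\<^sub>R x + \<rho> *\<^sub>R z)) \<le> ereal (C (t + \<rho>) j - ((t - \<rho>) / t) ^ CARD('n) * (C (t + \<rho>) j - a j * (Vr ?d - b j)))"
      by (simp add: add.commute)
  qed
  finally show ?thesis .
qed

lemma sphere_average_limit:
  assumes s: "\<And>t. 0 < t \<Longrightarrow> (\<lambda>j. a j * (Sr (r j * t) - b j)) \<longlonglongrightarrow> s t" and cont: "isCont s t" and t: "0 < t"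
  shows "sphere_avg U t = ereal (s t)"
proof (rule antisym)
  have "sphere_avg U t \<le> ereal (s (t + \<rho>))" if \<rho>: "\<rho> > 0" for \<rho>
  proof -
    have tr: "0 < t + \<rho>" using t \<rho> by simp
    have "(\<lambda>j. ereal (err (t + \<rho>) \<rho> j + a j * (Sr (r j * (t + \<rho>)) - b j))) \<longlonglongrightarrow> ereal (0 + s (t + \<rho>))"
      by (intro tendsto_intros err_lim[OF \<rho>] s[OF tr])
    moreover have "eventually (\<lambda>j. sphere_avg U t \<le> ereal (err (t + \<rho>) \<rho> j + a j * (Sr (r j * (t + \<rho>)) - b j))) sequentially"
      using E_fin[of "t + \<rho>"] scale_small[OF tr R]
    proof eventually_elim
      case (elim j)
      show ?case using sphere_average_upper[OF t \<rho> elim] by (cases "sphere_avg U t") auto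
    qed
    ultimately show ?thesis by (intro tendsto_lowerbound) auto
  qed
  then have "eventually (\<lambda>\<rho>. sphere_avg U t \<le> ereal (s (t + \<rho>))) (at_right 0)"
    by (auto simp: eventually_at_right_field intro!: exI[of _ 1])
  moreover have "((\<lambda>\<rho>. ereal (s (t + \<rho>))) \<longlongrightarrow> ereal (s t)) (at_right 0)"
  proof -
    have "((\<lambda>\<rho>. s (t + \<rho>)) \<longlongrightarrow> s (t + 0)) (at_right 0)"
      using cont by (intro isCont_tendsto_compose[of _ s] tendsto_intros) auto
    then show ?thesis by (intro tendsto_intros) simp
  qed
  ultimately show "sphere_avg U t \<le> ereal (s t)" by (intro tendsto_lowerbound) auto
  show "ereal (s t) \<le> sphere_avg U t"
    unfolding sphere_avg_def
  proof (rule average_lower[OF P _ _ t])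
    have "eventually (\<lambda>j. ereal (a j * (Sr (r j * t) - b j)) = average ball_prob (\<lambda>x. g j (t *\<^sub>R sgn x))) sequentially"
      using scale_small[OF t R]
    proof eventually_elim
      case (elim j)
      have "average ball_prob (\<lambda>x. g j (t *\<^sub>R sgn x)) = ereal (a j) * (average ball_prob (\<lambda>x::real^'n. u ((r j * t) *\<^sub>R sgn x)) - ereal (b j))"
        unfolding g_def by (subst average_affine[OF P _ _ a, of _ c0, symmetric]) (auto simp: c0)
      also have "average ball_prob (\<lambda>x::real^'n. u ((r j * t) *\<^sub>R sgn x)) = ereal (Sr (r j * t))"
        using averages_real(2)[of "r j * t"] elim r(1)[of j] t by (simp add: sphere_avg_def)
      finally show ?case by simp
    qed
    then show "(\<lambda>j. average ball_prob (\<lambda>x. g j (t *\<^sub>R sgn x))) \<longlonglongrightarrow> ereal (s t)"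
      by (rule Lim_transform_eventually[rotated]) (intro tendsto_intros s t)
  qed (use t in \<open>auto intro!: eventually_mono[OF AE_ball_prob]\<close>)
qed

lemma ball_average_limit:
  assumes v: "\<And>t. 0 < t \<Longrightarrow> (\<lambda>j. a j * (Vr (r j * t) - b j)) \<longlonglongrightarrow> v t" and cont: "isCont v t" and t: "0 < t"
  shows "ball_avg U t = ereal (v t)"
proof (rule antisym)
  let ?b = "\<lambda>\<rho>. m (t + \<rho>) - ((t - \<rho>) / t) ^ CARD('n) * (m (t + \<rho>) - v (t - \<rho>))"
  have "ball_avg U t \<le> ereal (?b \<rho>)" if \<rho>: "\<rho> > 0" "\<rho> < t" for \<rho>
  proof -
    have tr: "0 < t + \<rho>" "0 < t - \<rho>" using t \<rho> by auto
    let ?c = "\<lambda>j. C (t + \<rho>) j - ((t - \<rho>) / t) ^ CARD('n) * (C (t + \<rho>) j - a j * (Vr (r j * (t - \<rho>)) - b j))"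
    have "(\<lambda>j. ereal (err (t + \<rho>) \<rho> j + ?c j)) \<longlonglongrightarrow> ereal (0 + ?b \<rho>)"
      by (intro tendsto_intros err_lim[OF \<rho>(1)] v[OF tr(2)] C_lim[OF tr(1)])
    moreover have "eventually (\<lambda>j. ball_avg U t \<le> ereal (err (t + \<rho>) \<rho> j + ?c j)) sequentially"
      using E_fin[of "t + \<rho>"] scale_small[OF tr(1) R] g_le_C[OF tr(1)]
    proof eventually_elim
      case (elim j)
      show ?case using ball_average_upper[OF t \<rho> elim] by (cases "ball_avg U t") auto
    qed
    ultimately show ?thesis by (intro tendsto_lowerbound) auto
  qed
  then have "eventually (\<lambda>\<rho>. ball_avg U t \<le> ereal (?b \<rho>)) (at_right 0)"
    using t by (auto simp: eventually_at_right_field intro!: exI[of _ t])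
  moreover have "((\<lambda>\<rho>. ereal (?b \<rho>)) \<longlongrightarrow> ereal (v t)) (at_right 0)"
  proof -
    have m0: "((\<lambda>\<rho>. m (t + \<rho>)) \<longlongrightarrow> m (t + 0)) (at_right 0)"
      using m_cont[OF t] by (intro isCont_tendsto_compose[of _ m] tendsto_intros) auto
    have v0: "((\<lambda>\<rho>. v (t - \<rho>)) \<longlongrightarrow> v (t - 0)) (at_right 0)"
      using cont by (intro isCont_tendsto_compose[of _ v] tendsto_intros) auto
    have "((\<lambda>\<rho>. ereal (?b \<rho>)) \<longlongrightarrow> ereal (m (t + 0) - ((t - 0) / t) ^ CARD('n) * (m (t + 0) - v (t - 0)))) (at_right 0)"
      using t by (intro tendsto_intros m0 v0) auto
    then show ?thesis using t by simp
  qed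
  ultimately show "ball_avg U t \<le> ereal (v t)" by (intro tendsto_lowerbound) auto
  show "ereal (v t) \<le> ball_avg U t"
    unfolding ball_avg_def
  proof (rule average_lower[OF P _ _ t])
    have "eventually (\<lambda>j. ereal (a j * (Vr (r j * t) - b j)) = average ball_prob (\<lambda>x. g j (t *\<^sub>R x))) sequentially"
      using scale_small[OF t R]
    proof eventually_elim
      case (elim j)
      have "average ball_prob (\<lambda>x. g j (t *\<^sub>R x)) = ereal (a j) * (average ball_prob (\<lambda>x::real^'n. u ((r j * t) *\<^sub>R x)) - ereal (b j))"
        unfolding g_def by (subst average_affine[OF P _ _ a, of _ c0, symmetric]) (auto simp: c0)
      also have "average ball_prob (\<lambda>x::real^'n. u ((r j * t) *\<^sub>R x)) = ereal (Vr (r j * t))"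
        using averages_real(3)[of "r j * t"] elim r(1)[of j] t by (simp add: ball_avg_def)
      finally show ?case by simp
    qed
    then show "(\<lambda>j. average ball_prob (\<lambda>x. g j (t *\<^sub>R x))) \<longlonglongrightarrow> ereal (v t)"
      by (rule Lim_transform_eventually[rotated]) (intro tendsto_intros v t)
  qed (use t in \<open>auto intro!: eventually_mono[OF AE_ball_prob]\<close>)
qed

lemma sup_ball: "0 < t \<Longrightarrow> avg_M U t = ereal (m t)"
proof (rule antisym)
  assume t: "0 < t"
  show "avg_M U t \<le> ereal (m t)" unfolding avg_M_def by (rule SUP_least) (use U_le_m[OF t] in auto)
  have "(SUP \<sigma>\<in>sphere 0 1. U (t *\<^sub>R \<sigma>)) \<le> avg_M U t"
    unfolding avg_M_def by (rule SUP_least, rule SUP_upper) (use t in auto)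
  then show "ereal (m t) \<le> avg_M U t" using sup_sphere[OF t] by simp
qed

end

section \<open>From subharmonic functions near the origin to germs\<close>

text \<open>A nonempty open subset of the ball has positive measure.\<close>

lemma average_infinite_on_ball:
  fixes h :: "real^'n \<Rightarrow> ereal" and c \<rho> \<epsilon> :: real
  assumes h[measurable]: "h \<in> borel_measurable borel" and c: "\<And>x. h x \<le> ereal c" and \<rho>: "\<rho> > 0" and \<epsilon>: "\<epsilon> > 0"
    and z: "dist y z < \<rho>" and inf: "\<And>x. dist z x < \<epsilon> \<Longrightarrow> h x = -\<infinity>"
  shows "average ball_prob (\<lambda>x. h (y + \<rho> *\<^sub>R x)) = -\<infinity>"
proof (rule average_cases[OF prob_space_ball_prob, where f="\<lambda>x. h (y + \<rho> *\<^sub>R x)" and c=c])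
  let ?L = "emeasure lborel (cball (0::real^'n) 1)"
  assume "AE x in ball_prob. \<bar>h (y + \<rho> *\<^sub>R x)\<bar> \<noteq> \<infinity>"
  moreover have "(AE x in ball_prob. Q x) \<longleftrightarrow> (AE x in lborel. x \<in> cball 0 1 \<longrightarrow> Q x)" if "Measurable.pred borel Q" for Q :: "real^'n \<Rightarrow> bool"
    unfolding ball_prob_def by (rule AE_uniform_measure) (use unit_ball_emeasure[where 'n='n] that in \<open>auto simp: less_top[symmetric]\<close>)
  ultimately have "AE x in lborel. x \<in> cball 0 1 \<longrightarrow> \<bar>h (y + \<rho> *\<^sub>R x)\<bar> \<noteq> \<infinity>" by simp
  then have ae: "AE x in lborel. x \<notin> ball ((1/\<rho>) *\<^sub>R (z - y)) (\<epsilon> / \<rho>) \<inter> ball 0 1"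
  proof eventually_elim
    case (elim x)
    show ?case
    proof
      assume x: "x \<in> ball ((1/\<rho>) *\<^sub>R (z - y)) (\<epsilon> / \<rho>) \<inter> ball 0 1"
      have "z - (y + \<rho> *\<^sub>R x) = \<rho> *\<^sub>R ((1/\<rho>) *\<^sub>R (z - y) - x)" using \<rho> by (simp add: scaleR_diff_right)
      then have "dist z (y + \<rho> *\<^sub>R x) = \<rho> * dist ((1/\<rho>) *\<^sub>R (z - y)) x" using \<rho> by (simp add: dist_norm)
      also have "\<dots> < \<rho> * (\<epsilon> / \<rho>)" using x \<rho> by (intro mult_strict_left_mono) auto
      finally have "h (y + \<rho> *\<^sub>R x) = -\<infinity>" using \<rho> by (intro inf) simp
      then show False using elim x by auto
    qed
  qed
  let ?S = "ball ((1/\<rho>) *\<^sub>R (z - y)) (\<epsilon> / \<rho>) \<inter> ball 0 1"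
  have "norm (z - y) < \<rho>" using z by (simp add: dist_norm norm_minus_commute)
  then have "norm ((1/\<rho>) *\<^sub>R (z - y)) < 1" unfolding norm_scaleR using \<rho> by (simp add: field_simps)
  then have "(1/\<rho>) *\<^sub>R (z - y) \<in> ?S" using \<rho> \<epsilon> by (simp del: scaleR_diff_right)
  then have "?S \<noteq> {}" by blast
  then have "\<not> negligible ?S" by (intro open_not_negligible open_Int open_ball)
  moreover have "?S \<in> null_sets lborel" using ae by (subst AE_iff_null_sets) auto
  then have "negligible ?S" by (simp add: negligible_iff_null_sets null_sets_completionI)
  ultimately show ?thesis by simp
qed (auto simp: c)

context riesz_cone
begin

text \<open>The set of points near which \<open>u = -\<infinity>\<close> is open. It is also closed in \<open>X\<close>: all points near a limit point are
  centres of balls which meet it in an open set, and the mean value inequality gives \<open>u = -\<infinity>\<close> at these centres. So, if nonempty, it would contain a whole component of \<open>X\<close>.\<close>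

lemma finite_values_dense:
  assumes X: "open X" and u: "usc_on X u" "viscosity F X u" and comp: "\<forall>C\<in>components X. \<exists>x\<in>C. u x \<noteq> -\<infinity>"
    and x0: "x0 \<in> X" and \<epsilon>: "\<epsilon> > 0"
  shows "\<exists>y. dist x0 y < \<epsilon> \<and> y \<in> X \<and> u y \<noteq> -\<infinity>"
proof (rule ccontr)
  assume no: "\<not> ?thesis"
  define Z where "Z = {x\<in>X. \<exists>\<epsilon>>0. \<forall>y\<in>ball x \<epsilon> \<inter> X. u y = -\<infinity>}"
  have x0Z: "x0 \<in> Z" using no x0 \<epsilon> by (auto simp: Z_def)
  have nearZ: "\<exists>\<rho>>0. (\<exists>z\<in>Z. dist x z < \<rho>) \<longrightarrow> x \<in> Z" if x: "x \<in> X" for x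
  proof -
    obtain \<rho>0 where \<rho>0: "\<rho>0 > 0" "cball x \<rho>0 \<subseteq> X" using open_contains_cball[of X] X x by blast
    define \<rho> where "\<rho> = \<rho>0 / 3"
    have \<rho>: "\<rho> > 0" "cball x (3 * \<rho>) \<subseteq> X" using \<rho>0 by (auto simp: \<rho>_def)
    let ?u = "\<lambda>y. if y \<in> cball x (3 * \<rho>) then u y else -\<infinity>"
    have usc: "usc_on UNIV ?u" by (rule usc_cutoff[OF usc_on_subset[OF u(1) \<rho>(2)]])
    have visc: "viscosity F (ball x (3 * \<rho>)) ?u"
      by (rule viscosity_cong[OF u(2)]) (use \<rho>(2) in \<open>auto simp: less_imp_le\<close>)
    obtain xm where xm: "xm \<in> cball x (3 * \<rho>)" "\<And>y. y \<in> cball x (3 * \<rho>) \<Longrightarrow> u y \<le> u xm"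
      by (rule usc_attains_max[OF compact_cball _ usc_on_subset[OF u(1) \<rho>(2)]]) (use \<rho> in \<open>auto intro: that\<close>)
    have "u xm < \<infinity>" using u(1) xm(1) \<rho>(2) by (auto simp: usc_on_def)
    then obtain c where c: "u xm \<le> ereal c" by (cases "u xm") auto
    have uc: "?u y \<le> ereal c" for y using xm(2)[of y] c by auto
    have "x \<in> Z" if z: "z \<in> Z" "dist x z < \<rho>" for z
    proof -
      obtain \<epsilon> where e: "\<epsilon> > 0" "\<forall>y\<in>ball z \<epsilon> \<inter> X. u y = -\<infinity>" using z(1) by (auto simp: Z_def)
      have "u y = -\<infinity>" if y: "y \<in> ball x \<rho>" for y
      proof -
        have "?u y \<le> average ball_prob (\<lambda>w. ?u (y + (2 * \<rho>) *\<^sub>R w))"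
        proof (rule mean_value_ball[OF visc usc uc])
          show "ball y (2 * \<rho>) \<subseteq> ball x (3 * \<rho>)"
          proof
            fix w assume "w \<in> ball y (2 * \<rho>)"
            then show "w \<in> ball x (3 * \<rho>)" using y dist_triangle[of x w y] by simp
          qed
        qed (use \<rho> in simp)
        also have "\<dots> = -\<infinity>"
        proof (rule average_infinite_on_ball[OF usc_on_UNIV_borel[OF usc] uc _ e(1), of _ _ z])
          show "dist y z < 2 * \<rho>" using y z(2) dist_triangle[of y z x] by (simp add: dist_commute)
          show "?u w = -\<infinity>" if "dist z w < \<epsilon>" for w using e(2) that \<rho>(2) by auto
        qed (use \<rho> in simp)
        finally show ?thesis using y \<rho> by (auto split: if_splits)
      qed
      then show ?thesis using \<rho>(1) x by (auto simp: Z_def)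
    qed
    then show ?thesis using \<rho>(1) by blast
  qed
  have oZ: "openin (top_of_set X) Z"
    unfolding openin_contains_ball
  proof (intro conjI ballI)
    show "Z \<subseteq> X" by (auto simp: Z_def)
    fix x assume "x \<in> Z"
    then obtain \<epsilon> where e: "\<epsilon> > 0" "\<forall>y\<in>ball x \<epsilon> \<inter> X. u y = -\<infinity>" by (auto simp: Z_def)
    have "ball x (\<epsilon>/2) \<inter> X \<subseteq> Z"
    proof
      fix y assume y: "y \<in> ball x (\<epsilon>/2) \<inter> X"
      have "u w = -\<infinity>" if "w \<in> ball y (\<epsilon>/2) \<inter> X" for w
        using e(2) that y dist_triangle[of x w y] by auto
      then show "y \<in> Z" using y e(1) unfolding Z_def by (auto intro!: exI[of _ "\<epsilon>/2"])
    qed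
    then show "\<exists>e>0. ball x e \<inter> X \<subseteq> Z" using e(1) by (intro exI[of _ "\<epsilon>/2"]) auto
  qed
  have cZ: "openin (top_of_set X) (X - Z)"
    unfolding openin_contains_ball
  proof (intro conjI ballI)
    fix x assume x: "x \<in> X - Z"
    then obtain \<rho> where "\<rho> > 0" "(\<exists>z\<in>Z. dist x z < \<rho>) \<longrightarrow> x \<in> Z" using nearZ by blast
    then show "\<exists>e>0. ball x e \<inter> X \<subseteq> X - Z" using x by (intro exI[of _ \<rho>]) auto
  qed auto
  let ?C = "connected_component_set X x0"
  have C: "?C \<in> components X" using x0 by (rule componentsI)
  have CX: "?C \<subseteq> X" by (rule connected_component_subset)
  have x0C: "x0 \<in> ?C" using x0 by simp
  obtain y where y: "y \<in> ?C" "u y \<noteq> -\<infinity>" using comp C by blast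
  have yZ: "y \<notin> Z"
  proof
    assume "y \<in> Z"
    then obtain \<epsilon> where "\<epsilon> > 0" "\<forall>w\<in>ball y \<epsilon> \<inter> X. u w = -\<infinity>" "y \<in> X" by (auto simp: Z_def)
    then have "u y = -\<infinity>" by auto
    then show False using y(2) by simp
  qed
  have restrict: "openin (top_of_set ?C) (?C \<inter> W)" if W: "openin (top_of_set X) W" for W
  proof -
    obtain T where "open T" "W = X \<inter> T" using W by (auto simp: openin_open)
    moreover have "?C \<inter> (X \<inter> T) = ?C \<inter> T" using CX by blast
    ultimately show ?thesis by (simp add: openin_open_Int)
  qed
  note o1 = restrict[OF oZ] and o2 = restrict[OF cZ]
  have "connected ?C" by (rule connected_connected_component)
  then show False
    unfolding connected_openin
    using o1 o2 x0Z x0C y(1) yZ CX by blast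
qed

end

lemma subharmonic_germ_exists:
  fixes F :: "(real^'n^'n) set" and X :: "(real^'n) set" and w :: "real^'n \<Rightarrow> ereal"
  assumes F: "subequation F" "convex F" "cone F" "ST_invariant F" and e: "norm e = 1" "riesz_characteristic F e = ereal p"
    and X: "open X" "0 \<in> X" and w: "F_subharmonic F X w"
  obtains G u R c0 where "subharmonic_germ G F p u R c0" "\<And>x. norm x \<le> 4 * R \<Longrightarrow> w x = u x"
proof -
  obtain G where G: "orthogonal_subgroup G" "\<forall>x\<in>sphere 0 1. \<forall>y\<in>sphere 0 1. \<exists>g\<in>G. g *v x = y"
    "\<forall>g\<in>G. \<forall>A\<in>F. g ** A ** transpose g \<in> F" using F(4) by (auto simp: ST_invariant_def)
  interpret riesz_cone G F p
    by unfold_locales (use F e G in auto)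
  have usc: "usc_on X w" and comp: "\<forall>C\<in>components X. \<exists>x\<in>C. w x \<noteq> -\<infinity>"
    using w unfolding F_subharmonic_def usc_on_def by auto
  have visc: "viscosity F X w"
    unfolding viscosity_def using w unfolding F_subharmonic_def by blast
  obtain R0 where R0: "R0 > 0" "cball 0 R0 \<subseteq> X" using open_contains_cball[of X] X by blast
  define R where "R = R0 / 4"
  have R: "R > 0" "cball 0 (4 * R) \<subseteq> X" using R0 by (auto simp: R_def)
  let ?u = "\<lambda>y. if y \<in> cball 0 (4 * R) then w y else -\<infinity>"
  have usc': "usc_on (cball 0 (4 * R)) w" by (rule usc_on_subset[OF usc R(2)])
  obtain xm where xm: "xm \<in> cball 0 (4 * R)" "\<And>y. y \<in> cball 0 (4 * R) \<Longrightarrow> w y \<le> w xm"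
    by (rule usc_attains_max[OF compact_cball _ usc']) (use R in \<open>auto intro: that\<close>)
  have "w xm < \<infinity>" using usc' xm(1) by (auto simp: usc_on_def)
  then obtain c where c: "w xm \<le> ereal c" by (cases "w xm") auto
  obtain y where y: "dist 0 y < R" "w y \<noteq> -\<infinity>" using finite_values_dense[OF X(1) usc visc comp X(2) R(1)] by blast
  have "subharmonic_germ G F p ?u R c"
  proof unfold_locales
    show "0 < R" by fact
    show "usc_on UNIV ?u" by (rule usc_cutoff[OF usc'])
    show "viscosity F (ball 0 (4 * R)) ?u"
      by (rule viscosity_cong[OF visc]) (use R(2) in \<open>auto simp: less_imp_le\<close>)
    show "?u x \<le> ereal c" for x using xm(2)[of x] c by auto
    show "\<exists>x. norm x < R \<and> ?u x \<noteq> -\<infinity>" using y R(1) by (intro exI[of _ y]) auto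
  qed
  then show ?thesis by (rule that) simp
qed

lemma avg_S_eq:
  fixes u v :: "real^'n \<Rightarrow> ereal"
  assumes [measurable]: "v \<in> borel_measurable borel" and eq: "\<And>x. norm x \<le> r \<Longrightarrow> u x = v x" and r: "0 < r"
  shows "avg_S u r = sphere_avg v r"
  unfolding avg_S_def sphere_avg_def
  by (rule average_sphere_measure) (use eq r in auto)

lemma avg_V_eq:
  fixes u v :: "real^'n \<Rightarrow> ereal"
  assumes [measurable]: "v \<in> borel_measurable borel" and eq: "\<And>x. norm x \<le> r \<Longrightarrow> u x = v x" and r: "0 < r"
  shows "avg_V u r = ball_avg v r"
  unfolding avg_V_def ball_avg_def
  by (rule average_lebesgue_ball) (use eq r in \<open>auto simp: mult_left_le\<close>)

text \<open>The logarithm is unbounded near 0, so different slopes would drive the functions apart.\<close>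

lemma slope_limit_bounded_difference:
  assumes f: "slope_limit 2 f \<theta>" and f': "slope_limit 2 f' \<theta>'" and \<rho>: "\<rho> > 0" and B: "\<And>r. 0 < r \<Longrightarrow> r \<le> \<rho> \<Longrightarrow> \<bar>f r - f' r\<bar> \<le> B"
  shows "\<theta> = \<theta>'"
proof -
  have "\<bar>\<theta> - \<theta>'\<bar> \<le> e" if e: "e > 0" for e
  proof -
    obtain d where d: "d > 0" "\<And>s r. 0 < s \<Longrightarrow> s < r \<Longrightarrow> r < d \<Longrightarrow> \<bar>(f r - f s) - \<theta> * (rk 2 r - rk 2 s)\<bar> \<le> (e/4) * (rk 2 r - rk 2 s)"
      using f e unfolding slope_limit_def by (metis divide_pos_pos zero_less_numeral)
    obtain d' where d': "d' > 0" "\<And>s r. 0 < s \<Longrightarrow> s < r \<Longrightarrow> r < d' \<Longrightarrow> \<bar>(f' r - f' s) - \<theta>' * (rk 2 r - rk 2 s)\<bar> \<le> (e/4) * (rk 2 r - rk 2 s)"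
      using f' e unfolding slope_limit_def by (metis divide_pos_pos zero_less_numeral)
    define r where "r = min \<rho> (min (d/2) (d'/2))"
    have r: "0 < r" "r \<le> \<rho>" "r < d" "r < d'" using \<rho> d(1) d'(1) by (auto simp: r_def)
    have B0: "B \<ge> 0" using B[OF r(1,2)] by linarith
    \<comment> \<open>over the range from \<open>r exp (-k)\<close> to \<open>r\<close>, the bound \<open>2 B\<close> is negligible against \<open>e k\<close>\<close>
    define k where "k = 4 * B / e + 1"
    have k: "k > 0" "2 * B \<le> k * e / 2" using B0 e by (auto simp: k_def field_simps add_nonneg_pos)
    let ?s = "r * exp (- k)"
    have s: "0 < ?s" "?s < r" using r k by auto
    have lk: "rk 2 r - rk 2 ?s = k" using r by (simp add: riesz_kernel_def ln_mult)
    have "\<bar>(\<theta> - \<theta>') * k\<bar> \<le> \<bar>(f r - f ?s) - \<theta> * k\<bar> + \<bar>(f' r - f' ?s) - \<theta>' * k\<bar> + \<bar>f r - f' r\<bar> + \<bar>f ?s - f' ?s\<bar>"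
      by (simp add: algebra_simps)
    also have "\<dots> \<le> (e/4) * k + (e/4) * k + B + B"
      using d(2)[OF s r(3)] d'(2)[OF s r(4)] B[OF r(1,2)] B[OF s(1)] s(2) r(2) unfolding lk by (intro add_mono) auto
    also have "\<dots> \<le> e * k" using k(2) by (simp add: field_simps)
    finally have "\<bar>\<theta> - \<theta>'\<bar> * k \<le> e * k" using k(1) by (simp add: abs_mult)
    then show ?thesis using k(1) by simp
  qed
  then have "\<bar>\<theta> - \<theta>'\<bar> \<le> 0" by (rule field_le_epsilon) simp
  then show ?thesis by simp
qed

lemma L1_loc_borel_version:
  fixes h :: "real^'n \<Rightarrow> real"
  assumes h: "L1_loc h"
  obtains f where "f \<in> borel_measurable borel" "AE x in lborel. h x = f x" "h \<in> borel_measurable lebesgue"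
    "\<And>L. (\<integral>\<^sup>+x. ennreal \<bar>f x\<bar> * indicator (cball 0 L) x \<partial>lborel) < \<infinity>"
proof -
  have int: "integrable lebesgue (\<lambda>x. indicator (cball 0 L) x *\<^sub>R h x)" for L
    using h by (auto simp: L1_loc_def set_integrable_def)
  have m: "h \<in> borel_measurable lebesgue"
  proof (rule borel_measurable_LIMSEQ_real)
    show "(\<lambda>x. indicator (cball 0 (real n)) x *\<^sub>R h x) \<in> borel_measurable lebesgue" for n
      using int by (rule borel_measurable_integrable)
    fix x :: "real^'n"
    obtain N :: nat where N: "norm x \<le> real N" using real_arch_simple by blast
    have "eventually (\<lambda>n. indicator (cball 0 (real n)) x *\<^sub>R h x = h x) sequentially"
      using eventually_ge_at_top[of N]
    proof eventually_elim
      case (elim n)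
      then show ?case using N by (simp add: indicator_def order_trans[OF N])
    qed
    then show "(\<lambda>n. indicator (cball 0 (real n)) x *\<^sub>R h x) \<longlonglongrightarrow> h x" by (rule tendsto_eventually)
  qed
  obtain f where f: "f \<in> borel_measurable lborel" "AE x in lborel. h x = f x"
    using completion_ex_borel_measurable_real[OF m] by blast
  have "(\<integral>\<^sup>+x. ennreal \<bar>f x\<bar> * indicator (cball 0 L) x \<partial>lborel) < \<infinity>" for L
  proof -
    have "(\<integral>\<^sup>+x. ennreal \<bar>f x\<bar> * indicator (cball 0 L) x \<partial>lborel) = (\<integral>\<^sup>+x. ennreal (norm (indicator (cball 0 L) x *\<^sub>R h x)) \<partial>lborel)"
      by (rule nn_integral_cong_AE, use f(2) in eventually_elim) (auto simp: indicator_def)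
    also have "\<dots> = (\<integral>\<^sup>+x. ennreal (norm (indicator (cball 0 L) x *\<^sub>R h x)) \<partial>lebesgue)" by (simp add: nn_integral_completion)
    also have "\<dots> < \<infinity>" using int[of L] by (simp add: integrable_iff_bounded)
    finally show ?thesis .
  qed
  then show ?thesis using that f m by auto
qed

lemma usc_representative_upper:
  fixes h :: "real^'n \<Rightarrow> real"
  assumes h: "h \<in> borel_measurable lebesgue" and U: "usc_representative h U" and \<rho>: "\<rho> > 0" and ae: "AE y in lborel. y \<in> ball x \<rho> \<longrightarrow> ereal (h y) \<le> c"
  shows "U x \<le> c"
proof -
  have "eventually (\<lambda>r. esssup (lebesgue_on (ball x r)) (\<lambda>y. ereal (h y)) \<le> c) (at_right 0)"
    unfolding eventually_at_right_field
  proof (intro exI[of _ \<rho>] conjI allI impI)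
    fix r assume r: "0 < r" "r < \<rho>"
    have [measurable]: "(\<lambda>y. ereal (h y)) \<in> borel_measurable (lebesgue_on (ball x r))"
      using h by (intro measurable_restrict_space1) simp
    have "AE y in lebesgue. y \<in> ball x r \<longrightarrow> ereal (h y) \<le> c"
      using AE_completion[OF ae] by eventually_elim (use r in auto)
    then have "AE y in lebesgue_on (ball x r). ereal (h y) \<le> c" by (subst AE_restrict_space_iff) auto
    then show "esssup (lebesgue_on (ball x r)) (\<lambda>y. ereal (h y)) \<le> c" by (intro esssup_I) auto
  qed (rule \<rho>)
  moreover have "((\<lambda>r. esssup (lebesgue_on (ball x r)) (\<lambda>y. ereal (h y))) \<longlongrightarrow> U x) (at_right 0)"
    using U by (simp add: usc_representative_def)
  ultimately show ?thesis by (intro tendsto_upperbound) auto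
qed

lemma usc_representative_lower:
  fixes h :: "real^'n \<Rightarrow> real"
  assumes U: "usc_representative h U" and c: "U x < c"
  shows "\<exists>\<rho>>0. AE y in lborel. y \<in> ball x \<rho> \<longrightarrow> ereal (h y) \<le> c"
proof -
  have "((\<lambda>r. esssup (lebesgue_on (ball x r)) (\<lambda>y. ereal (h y))) \<longlongrightarrow> U x) (at_right 0)"
    using U by (simp add: usc_representative_def)
  then have "eventually (\<lambda>r. esssup (lebesgue_on (ball x r)) (\<lambda>y. ereal (h y)) < c) (at_right 0)"
    using c by (rule order_tendstoD)
  then obtain b where b: "b > 0" "\<And>r. 0 < r \<Longrightarrow> r < b \<Longrightarrow> esssup (lebesgue_on (ball x r)) (\<lambda>y. ereal (h y)) < c"
    unfolding eventually_at_right_field by auto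
  have s: "esssup (lebesgue_on (ball x (b/2))) (\<lambda>y. ereal (h y)) < c" using b by simp
  have "AE y in lebesgue_on (ball x (b/2)). ereal (h y) \<le> c"
    using esssup_AE[of "\<lambda>y. ereal (h y)" "lebesgue_on (ball x (b/2))"] by eventually_elim (use s in order)
  then have "AE y in lebesgue. y \<in> ball x (b/2) \<longrightarrow> ereal (h y) \<le> c" by (subst (asm) AE_restrict_space_iff) auto
  then have "AE y in lborel. y \<in> ball x (b/2) \<longrightarrow> ereal (h y) \<le> c" by (simp add: AE_completion_iff)
  then show ?thesis using b(1) by (intro exI[of _ "b/2"]) auto
qed

section \<open>The averages of tangents\<close>

context subharmonic_germ
begin

lemma slope_limits:
  obtains \<theta>M \<theta>S \<theta>V where "slope_limit p Mr \<theta>M" "slope_limit p Sr \<theta>S" "slope_limit p Vr \<theta>V"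
  by (metis K_convex_slope_limit K_convex_M K_convex_S K_convex_V R)

lemma V_ge_u0: "0 < r \<Longrightarrow> r \<le> 4 * R \<Longrightarrow> u 0 \<le> ball_avg u r"
  using mean_value_ball[OF visc usc c0, of 0 r] by (simp add: ball_avg_def subset_ball)

text \<open>For \<open>p < 2\<close> the kernel is bounded near 0, and so is a function whose slopes converge. Thus \<open>M\<close> has a finite limit, which is \<open>u 0\<close> by upper
  semicontinuity; \<open>S\<close> and \<open>V\<close> lie between \<open>u 0\<close> and \<open>M\<close>.\<close>

lemma averages_tendsto_value:
  assumes p: "p < 2"
  obtains b where "u 0 = ereal b" "(Mr \<longlongrightarrow> b) (at_right 0)" "(Sr \<longlongrightarrow> b) (at_right 0)" "(Vr \<longlongrightarrow> b) (at_right 0)"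
proof -
  obtain \<theta> where \<theta>: "slope_limit p Mr \<theta>" "\<theta> \<ge> 0" by (rule K_convex_slope_limit[OF K_convex_M R])
  obtain d where d: "d > 0" "\<And>s r. 0 < s \<Longrightarrow> s < r \<Longrightarrow> r < d \<Longrightarrow> \<bar>(Mr r - Mr s) - \<theta> * (rk p r - rk p s)\<bar> \<le> 1 * (rk p r - rk p s)"
    using \<theta>(1) unfolding slope_limit_def by (metis zero_less_one)
  define r0 where "r0 = d / 2"
  have r0: "0 < r0" "r0 < d" using d(1) by (auto simp: r0_def)
  have lower: "Mr r0 - (\<theta> + 1) * rk p r0 \<le> Mr s" if s: "0 < s" "s < r0" for s
  proof -
    have "Mr r0 - Mr s \<le> (\<theta> + 1) * (rk p r0 - rk p s)" using d(2)[OF s r0(2)] by (simp add: algebra_simps abs_le_iff)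
    also have "\<dots> \<le> (\<theta> + 1) * rk p r0" using \<theta>(2) p by (intro mult_left_mono) (auto simp: riesz_kernel_def)
    finally show ?thesis by simp
  qed
  have upper: "eventually (\<lambda>s. Mr s < c) (at_right 0)" if c: "u 0 < ereal c" for c
  proof -
    obtain c' where c': "u 0 < ereal c'" "c' < c" using ereal_dense2[OF c] by auto
    obtain \<delta> where \<delta>: "\<delta> > 0" "\<And>y. dist y 0 < \<delta> \<Longrightarrow> u y < ereal c'" by (rule usc_onD[OF usc UNIV_I c'(1)]) auto
    show ?thesis unfolding eventually_at_right_field
    proof (intro exI[of _ "min \<delta> R"] conjI allI impI)
      fix s assume s: "0 < s" "s < min \<delta> R"
      have "avg_M u s \<le> ereal c'" unfolding avg_M_def by (rule SUP_least, rule less_imp_le, rule \<delta>(2)) (use s in auto)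
      then show "Mr s < c" using averages_real(1)[of s] s c'(2) by simp
    qed (use \<delta>(1) R in simp)
  qed
  have "u 0 \<noteq> -\<infinity>"
  proof
    assume "u 0 = -\<infinity>"
    then have "eventually (\<lambda>s. Mr s < Mr r0 - (\<theta> + 1) * rk p r0) (at_right 0)" by (intro upper) simp
    then obtain b where b: "b > 0" "\<And>s. 0 < s \<Longrightarrow> s < b \<Longrightarrow> Mr s < Mr r0 - (\<theta> + 1) * rk p r0"
      unfolding eventually_at_right_field by auto
    have "0 < min b r0 / 2" "min b r0 / 2 < b" "min b r0 / 2 < r0" using b(1) r0(1) by linarith+
    then show False using b(2)[of "min b r0 / 2"] lower[of "min b r0 / 2"] by linarith
  qed
  then obtain b where b: "u 0 = ereal b" using u_less_top[of 0] by (cases "u 0") auto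
  have evR: "eventually (\<lambda>s. 0 < s \<and> s \<le> R) (at_right (0::real))"
    unfolding eventually_at_right_field using R by (intro exI[of _ R]) auto
  have bV: "b \<le> Vr s" if "0 < s" "s \<le> R" for s
    using V_ge_u0[of s] averages_real(3)[OF that] b that R by simp
  have M: "(Mr \<longlongrightarrow> b) (at_right 0)"
  proof (rule order_tendstoI)
    fix c assume "c < b"
    show "eventually (\<lambda>s. c < Mr s) (at_right 0)"
      using evR
    proof eventually_elim
      case (elim s)
      then show ?case using bV[of s] averages_real(4,5)[of s] \<open>c < b\<close> by auto
    qed
  qed (use upper b in simp)
  have S: "(Sr \<longlongrightarrow> b) (at_right 0)"
  proof (rule tendsto_sandwich[OF _ _ tendsto_const M])
    show "eventually (\<lambda>s. b \<le> Sr s) (at_right 0)" using evR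
    proof eventually_elim
      case (elim s)
      then show ?case using bV[of s] averages_real(4)[of s] by auto
    qed
    show "eventually (\<lambda>s. Sr s \<le> Mr s) (at_right 0)" using evR by eventually_elim (use averages_real(5) in auto)
  qed
  have V: "(Vr \<longlongrightarrow> b) (at_right 0)"
  proof (rule tendsto_sandwich[OF _ _ tendsto_const S])
    show "eventually (\<lambda>s. b \<le> Vr s) (at_right 0)" using evR by eventually_elim (use bV in auto)
    show "eventually (\<lambda>s. Vr s \<le> Sr s) (at_right 0)" using evR by eventually_elim (use averages_real(4) in auto)
  qed
  show ?thesis by (rule that[OF b M S V])
qed

text \<open>In the Harnack estimate, \<open>M(3r) - M(r)\<close> stays bounded because \<open>ln (3r) - ln r\<close> is constant.\<close>

lemma log_averages_close:
  assumes p: "p = 2"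
  obtains \<rho> B where "0 < \<rho>" "\<rho> \<le> R" "\<And>r. 0 < r \<Longrightarrow> r \<le> \<rho> \<Longrightarrow> Mr r - Vr r \<le> B"
proof -
  obtain \<theta> where \<theta>: "slope_limit p Mr \<theta>" by (rule K_convex_slope_limit[OF K_convex_M R])
  obtain d where d: "d > 0" "\<And>s r. 0 < s \<Longrightarrow> s < r \<Longrightarrow> r < d \<Longrightarrow> \<bar>(Mr r - Mr s) - \<theta> * (rk p r - rk p s)\<bar> \<le> 1 * (rk p r - rk p s)"
    using \<theta>(1) unfolding slope_limit_def by (metis zero_less_one)
  show ?thesis
  proof (rule that)
    let ?\<rho> = "min (d / 4) (R / 3)"
    show "0 < ?\<rho>" "?\<rho> \<le> R" using d(1) R by auto
    fix r assume r: "0 < r" "r \<le> ?\<rho>"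
    have R3: "3 * r \<le> R" "3 * r < d" using r d(1) by auto
    have K: "rk p (3 * r) - rk p r = ln 3" using r p by (simp add: riesz_kernel_def ln_mult)
    have "\<bar>(Mr (3 * r) - Mr r) - \<theta> * ln 3\<bar> \<le> 1 * ln 3"
      using d(2)[of r "3 * r"] r R3 unfolding K by simp
    then have "Mr (3 * r) - Mr r \<le> (\<theta> + 1) * ln 3" by (simp add: algebra_simps abs_le_iff)
    then have "2 ^ CARD('n) * (Mr (3 * r) - Mr r) \<le> 2 ^ CARD('n) * ((\<theta> + 1) * ln 3)" by (intro mult_left_mono) auto
    moreover have "Mr r \<le> Mr (3 * r)"
    proof -
      have "avg_M u r \<le> avg_M u (3 * r)" unfolding avg_M_def using r by (intro SUP_subset_mono) auto
      then show ?thesis using averages_real(1)[of r] averages_real(1)[of "3 * r"] r R3 by simp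
    qed
    ultimately show "Mr r - Vr r \<le> 2 ^ CARD('n) * ((\<theta> + 1) * ln 3)"
      using M_minus_V_bound[OF r(1) R3(1)] by linarith
  qed
qed

lemma log_densities_agree:
  assumes p: "p = 2" and \<theta>: "slope_limit p Mr \<theta>M" "slope_limit p Sr \<theta>S" "slope_limit p Vr \<theta>V"
  shows "\<theta>S = \<theta>M" "\<theta>V = \<theta>M"
proof -
  obtain \<rho> B where \<rho>: "0 < \<rho>" "\<rho> \<le> R" "\<And>r. 0 < r \<Longrightarrow> r \<le> \<rho> \<Longrightarrow> Mr r - Vr r \<le> B"
    by (rule log_averages_close[OF p]) (rule that)
  have "\<bar>Sr r - Mr r\<bar> \<le> B \<and> \<bar>Vr r - Mr r\<bar> \<le> B" if "0 < r" "r \<le> \<rho>" for r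
    using \<rho>(3)[OF that] averages_real(4,5)[of r] that \<rho>(2) by auto
  then show "\<theta>S = \<theta>M" "\<theta>V = \<theta>M"
    using slope_limit_bounded_difference[OF _ _ \<rho>(1)] \<theta> p by blast+
qed

end

lemma isCont_riesz_kernel: "t > 0 \<Longrightarrow> isCont (rk p) t"
proof -
  assume t: "t > 0"
  have "isCont (\<lambda>t. t powr (2 - p)) t" "isCont (\<lambda>t. - (t powr (2 - p))) t" "isCont ln t"
    using t by (auto intro!: continuous_intros)
  then show ?thesis unfolding riesz_kernel_def[abs_def] by (cases "p < 2"; cases "p = 2") simp_all
qed

text \<open>The germ \<open>u\<close> is a function on the whole space; \<open>w\<close> is the given function, which agrees with it near the origin.\<close>

locale subharmonic_function = subharmonic_germ G F p u R c0 for G F :: "(real^'n^'n) set" and p u R c0 +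
  fixes w :: "real^'n \<Rightarrow> ereal"
  assumes w: "\<And>x. norm x \<le> 4 * R \<Longrightarrow> w x = u x"
begin

lemma averages_w:
  assumes "0 < r" "r \<le> R"
  shows "avg_M w r = ereal (Mr r)" "avg_S w r = ereal (Sr r)" "avg_V w r = ereal (Vr r)"
proof -
  have eq: "w x = u x" if "norm x \<le> r" for x using that assms R by (intro w) auto
  have "avg_M w r = avg_M u r" unfolding avg_M_def by (rule SUP_cong) (auto simp: eq)
  then show "avg_M w r = ereal (Mr r)" using averages_real(1)[OF assms] by simp
  show "avg_S w r = ereal (Sr r)" using avg_S_eq[OF u_borel eq assms(1)] averages_real(2)[OF assms] by simp
  show "avg_V w r = ereal (Vr r)" using avg_V_eq[OF u_borel eq assms(1)] averages_real(3)[OF assms] by simp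
qed

lemma densities:
  assumes "slope_limit p Mr \<theta>M" "slope_limit p Sr \<theta>S" "slope_limit p Vr \<theta>V"
  shows "has_density_at_0 p avg_M w \<theta>M" "has_density_at_0 p avg_S w \<theta>S" "has_density_at_0 p avg_V w \<theta>V"
  by (rule slope_limit_has_density[OF assms(1) R], erule (1) averages_w)
    (rule slope_limit_has_density[OF assms(2) R], erule (1) averages_w,
     rule slope_limit_has_density[OF assms(3) R], erule (1) averages_w)

lemma tangent_averages:
  fixes r a b :: "nat \<Rightarrow> real" and m s v :: "real \<Rightarrow> real"
  assumes r: "\<And>j. 0 < r j" "r \<longlonglongrightarrow> 0" and a: "\<And>j. 0 < a j"
    and conv: "L1_loc_convergent (\<lambda>j. flow p w (r j)) h" and U: "usc_representative h U"
    and flow: "\<And>j x. r j \<le> R \<Longrightarrow> norm (r j *\<^sub>R x) \<le> 4 * R \<Longrightarrow> flow p w (r j) x = ereal (a j) * (u (r j *\<^sub>R x) - ereal (b j))"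
    and m: "\<And>t. 0 < t \<Longrightarrow> (\<lambda>j. a j * (Mr (r j * t) - b j)) \<longlonglongrightarrow> m t" "\<And>t. 0 < t \<Longrightarrow> isCont m t"
    and s: "\<And>t. 0 < t \<Longrightarrow> (\<lambda>j. a j * (Sr (r j * t) - b j)) \<longlonglongrightarrow> s t" "\<And>t. 0 < t \<Longrightarrow> isCont s t"
    and v: "\<And>t. 0 < t \<Longrightarrow> (\<lambda>j. a j * (Vr (r j * t) - b j)) \<longlonglongrightarrow> v t" "\<And>t. 0 < t \<Longrightarrow> isCont v t"
    and t: "0 < t"
  shows "(SUP \<sigma>\<in>sphere 0 1. U (t *\<^sub>R \<sigma>)) = ereal (m t)" "avg_M U t = ereal (m t)"
    "avg_S U t = ereal (s t)" "avg_V U t = ereal (v t)"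
proof -
  have hL: "L1_loc h" using conv by (simp add: L1_loc_convergent_def)
  obtain f where f: "f \<in> borel_measurable borel" "AE x in lborel. h x = f x" "h \<in> borel_measurable lebesgue"
    "\<And>L. (\<integral>\<^sup>+x. ennreal \<bar>f x\<bar> * indicator (cball 0 L) x \<partial>lborel) < \<infinity>"
    by (rule L1_loc_borel_version[OF hL]) (rule that)
  interpret tangent_germ G F p u R c0 r a b f U m
  proof unfold_locales
    show "0 < r j" for j by (rule r)
    show "r \<longlonglongrightarrow> 0" by (rule r)
    show "0 < a j" for j by (rule a)
    show "f \<in> borel_measurable borel" by (rule f)
    show "(\<integral>\<^sup>+x. ennreal \<bar>f x\<bar> * indicator (cball 0 L) x \<partial>lborel) < \<infinity>" for L by (rule f)
    show "(\<lambda>j. a j * (Mr (r j * t) - b j)) \<longlonglongrightarrow> m t" "isCont m t" if "0 < t" for t using m that by auto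
    show "(\<lambda>j. \<integral>\<^sup>+x. e2ennreal \<bar>ereal (a j) * (u (r j *\<^sub>R x) - ereal (b j)) - ereal (f x)\<bar> * indicator (cball 0 L) x \<partial>lborel) \<longlonglongrightarrow> 0" for L
    proof (rule Lim_transform_eventually)
      show "(\<lambda>j. \<integral>\<^sup>+x. e2ennreal \<bar>flow p w (r j) x - ereal (h x)\<bar> \<partial>lebesgue_on (cball 0 L)) \<longlonglongrightarrow> 0"
        using conv by (simp add: L1_loc_convergent_def)
      have "(\<lambda>j. r j * L) \<longlonglongrightarrow> 0 * L" by (intro tendsto_intros r)
      then have "eventually (\<lambda>j. r j * L < 4 * R) sequentially" using R by (intro order_tendstoD(2)) auto
      moreover have "eventually (\<lambda>j. r j < R) sequentially" using r(2) R by (rule order_tendstoD(2))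
      ultimately show "eventually (\<lambda>j. (\<integral>\<^sup>+x. e2ennreal \<bar>flow p w (r j) x - ereal (h x)\<bar> \<partial>lebesgue_on (cball 0 L)) =
          (\<integral>\<^sup>+x. e2ennreal \<bar>ereal (a j) * (u (r j *\<^sub>R x) - ereal (b j)) - ereal (f x)\<bar> * indicator (cball 0 L) x \<partial>lborel)) sequentially"
      proof eventually_elim
        case (elim j)
        have "(\<integral>\<^sup>+x. e2ennreal \<bar>flow p w (r j) x - ereal (h x)\<bar> \<partial>lebesgue_on (cball 0 L)) =
          (\<integral>\<^sup>+x. e2ennreal \<bar>flow p w (r j) x - ereal (h x)\<bar> * indicator (cball 0 L) x \<partial>lebesgue)"
          by (rule nn_integral_restrict_space) simp
        also have "\<dots> = (\<integral>\<^sup>+x. e2ennreal \<bar>flow p w (r j) x - ereal (h x)\<bar> * indicator (cball 0 L) x \<partial>lborel)"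
          by (rule nn_integral_completion)
        also have "\<dots> = (\<integral>\<^sup>+x. e2ennreal \<bar>ereal (a j) * (u (r j *\<^sub>R x) - ereal (b j)) - ereal (f x)\<bar> * indicator (cball 0 L) x \<partial>lborel)"
        proof (rule nn_integral_cong_AE, use f(2) in eventually_elim)
          fix x :: "real^'n" assume hf: "h x = f x"
          show "e2ennreal \<bar>flow p w (r j) x - ereal (h x)\<bar> * indicator (cball 0 L) x =
            e2ennreal \<bar>ereal (a j) * (u (r j *\<^sub>R x) - ereal (b j)) - ereal (f x)\<bar> * indicator (cball 0 L) x"
          proof (cases "x \<in> cball 0 L")
            case True
            then have "r j * norm x \<le> r j * L" using r(1)[of j] by (intro mult_left_mono) auto
            then have "r j * norm x \<le> 4 * R" using elim(1) by linarith
            then have "norm (r j *\<^sub>R x) \<le> 4 * R" using r(1)[of j] by simp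
            then show ?thesis using flow[of j x] elim hf by simp
          qed simp
        qed
        finally show ?case .
      qed
    qed
    show "U x \<le> c" if \<rho>: "\<rho> > 0" and ae: "AE y in lborel. y \<in> ball x \<rho> \<longrightarrow> ereal (f y) \<le> c" for x c \<rho>
    proof (rule usc_representative_upper[OF f(3) U \<rho>])
      show "AE y in lborel. y \<in> ball x \<rho> \<longrightarrow> ereal (h y) \<le> c" using ae f(2) by eventually_elim auto
    qed
    show "\<exists>\<rho>>0. AE y in lborel. y \<in> ball x \<rho> \<longrightarrow> ereal (f y) \<le> c" if c: "U x < c" for x c
    proof -
      obtain \<rho> where "\<rho> > 0" and ae: "AE y in lborel. y \<in> ball x \<rho> \<longrightarrow> ereal (h y) \<le> c"
        using usc_representative_lower[OF U c] by blast
      moreover have "AE y in lborel. y \<in> ball x \<rho> \<longrightarrow> ereal (f y) \<le> c" using ae f(2) by eventually_elim auto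
      ultimately show ?thesis by blast
    qed
  qed
  show "(SUP \<sigma>\<in>sphere 0 1. U (t *\<^sub>R \<sigma>)) = ereal (m t)" by (rule sup_sphere[OF t])
  show "avg_M U t = ereal (m t)" by (rule sup_ball[OF t])
  show "avg_S U t = ereal (s t)" using avg_S_eq[OF U_borel _ t] sphere_average_limit[OF s(1) s(2)[OF t] t] by simp
  show "avg_V U t = ereal (v t)" using avg_V_eq[OF U_borel _ t] ball_average_limit[OF v(1) v(2)[OF t] t] by simp
qed

lemma power_tangent_averages:
  assumes p: "p \<noteq> 2" and U: "tangent p w U" and \<theta>: "slope_limit p Mr \<theta>M" "slope_limit p Sr \<theta>S" "slope_limit p Vr \<theta>V"
    and t: "0 < t"
  shows "(SUP \<sigma>\<in>sphere 0 1. U (t *\<^sub>R \<sigma>)) = ereal (\<theta>M * rk p t)" "avg_M U t = ereal (\<theta>M * rk p t)"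
    "avg_S U t = ereal (\<theta>S * rk p t)" "avg_V U t = ereal (\<theta>V * rk p t)"
proof -
  obtain r h where r: "\<And>j. 0 < r j" "r \<longlonglongrightarrow> 0" and conv: "L1_loc_convergent (\<lambda>j. flow p w (r j)) h"
    and h: "usc_representative h U" using U unfolding tangent_def by blast
  obtain b where b: "p > 2 \<Longrightarrow> b = 0" "p < 2 \<Longrightarrow> u 0 = ereal b" "p < 2 \<Longrightarrow> (Mr \<longlongrightarrow> b) (at_right 0)"
    "p < 2 \<Longrightarrow> (Sr \<longlongrightarrow> b) (at_right 0)" "p < 2 \<Longrightarrow> (Vr \<longlongrightarrow> b) (at_right 0)"
  proof (cases "p < 2")
    case True
    show ?thesis by (rule averages_tendsto_value[OF True], rule that) (use True in auto)
  qed (use that[of 0] in auto)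
  have a: "0 < r j powr (p - 2)" for j using r(1)[of j] by simp
  have fl: "flow p w (r j) x = ereal (r j powr (p - 2)) * (u (r j *\<^sub>R x) - ereal b)" if "norm (r j *\<^sub>R x) \<le> 4 * R" for j x
  proof -
    have "w (r j *\<^sub>R x) = u (r j *\<^sub>R x)" "w 0 = u 0" using that R by (auto intro!: w)
    then show ?thesis using b p by (auto simp: flow_def)
  qed
  have lim: "(\<lambda>j. r j powr (p - 2) * (f (r j * t) - b)) \<longlonglongrightarrow> \<theta> * rk p t"
    if "slope_limit p f \<theta>" "p < 2 \<Longrightarrow> (f \<longlongrightarrow> b) (at_right 0)" "0 < t" for f \<theta> t
    by (rule slope_limit_flow[OF p that(1) b(1) that(2) r that(3)])
  have cont: "isCont (\<lambda>t. \<theta> * rk p t) t" if "0 < t" for \<theta> t using isCont_riesz_kernel[OF that] by (intro continuous_intros)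
  show "(SUP \<sigma>\<in>sphere 0 1. U (t *\<^sub>R \<sigma>)) = ereal (\<theta>M * rk p t)" "avg_M U t = ereal (\<theta>M * rk p t)"
    "avg_S U t = ereal (\<theta>S * rk p t)" "avg_V U t = ereal (\<theta>V * rk p t)"
    using tangent_averages[OF r a conv h fl lim[OF \<theta>(1) b(3)] cont lim[OF \<theta>(2) b(4)] cont lim[OF \<theta>(3) b(5)] cont t] by auto
qed

text \<open>The differences \<open>S - M\<close> and \<open>V - M\<close> are bounded along the flow, so they converge along a subsequence, which defines the same tangent.
  Their limits are the constants \<open>c\<close> and \<open>d\<close>.\<close>

lemma log_tangent_averages:
  assumes p: "p = 2" and U: "tangent p w U" and \<theta>: "slope_limit p Mr \<theta>" "slope_limit p Sr \<theta>" "slope_limit p Vr \<theta>"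
  obtains c d where "\<And>t. 0 < t \<Longrightarrow> (SUP \<sigma>\<in>sphere 0 1. U (t *\<^sub>R \<sigma>)) = ereal (\<theta> * ln t)" "\<And>t. 0 < t \<Longrightarrow> avg_M U t = ereal (\<theta> * ln t)"
    "\<And>t. 0 < t \<Longrightarrow> avg_S U t = ereal (\<theta> * ln t + c)" "\<And>t. 0 < t \<Longrightarrow> avg_V U t = ereal (\<theta> * ln t + d)"
proof -
  obtain r h where r: "\<And>j. 0 < r j" "r \<longlonglongrightarrow> 0" and conv: "L1_loc_convergent (\<lambda>j. flow p w (r j)) h"
    and h: "usc_representative h U" using U unfolding tangent_def by blast
  obtain \<rho> B where \<rho>: "0 < \<rho>" "\<rho> \<le> R" "\<And>r. 0 < r \<Longrightarrow> r \<le> \<rho> \<Longrightarrow> Mr r - Vr r \<le> B"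
    by (rule log_averages_close[OF p]) (rule that)
  \<comment> \<open>the bound holds only from some index on, and clipping affects no later terms\<close>
  define clip where "clip y = max (- \<bar>B\<bar>) (min \<bar>B\<bar> y)" for y
  have "range (\<lambda>j. (clip (Sr (r j) - Mr (r j)), clip (Vr (r j) - Mr (r j)))) \<subseteq> {- \<bar>B\<bar>..\<bar>B\<bar>} \<times> {- \<bar>B\<bar>..\<bar>B\<bar>}"
    by (auto simp: clip_def)
  then have "bounded (range (\<lambda>j. (clip (Sr (r j) - Mr (r j)), clip (Vr (r j) - Mr (r j)))))"
    by (rule bounded_subset[rotated]) (intro bounded_Times bounded_closed_interval)
  \<comment> \<open>a common subsequence for both differences\<close>
  from bounded_imp_convergent_subsequence[OF this] obtain l \<sigma> where \<sigma>: "strict_mono \<sigma>"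
    and l: "((\<lambda>j. (clip (Sr (r j) - Mr (r j)), clip (Vr (r j) - Mr (r j)))) \<circ> \<sigma>) \<longlonglongrightarrow> l"
    by blast
  define q where "q = r \<circ> \<sigma>"
  have q: "\<And>j. 0 < q j" "q \<longlonglongrightarrow> 0" using r LIMSEQ_subseq_LIMSEQ[OF r(2) \<sigma>] by (auto simp: q_def)
  have small: "eventually (\<lambda>j. q j < \<rho>) sequentially" using q(2) \<rho>(1) by (rule order_tendstoD(2))
  have close: "clip (Sr (q j) - Mr (q j)) = Sr (q j) - Mr (q j)" "clip (Vr (q j) - Mr (q j)) = Vr (q j) - Mr (q j)" if "q j < \<rho>" for j
    using \<rho>(3)[OF q(1)[of j]] averages_real(4,5)[OF q(1)[of j]] that \<rho>(2) by (auto simp: clip_def)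
  have S: "(\<lambda>j. Sr (q j) - Mr (q j)) \<longlonglongrightarrow> fst l"
  proof (rule Lim_transform_eventually)
    show "(\<lambda>j. clip (Sr (q j) - Mr (q j))) \<longlonglongrightarrow> fst l" using tendsto_fst[OF l] by (simp add: q_def o_def)
    show "eventually (\<lambda>j. clip (Sr (q j) - Mr (q j)) = Sr (q j) - Mr (q j)) sequentially" using small by eventually_elim (rule close)
  qed
  have V: "(\<lambda>j. Vr (q j) - Mr (q j)) \<longlonglongrightarrow> snd l"
  proof (rule Lim_transform_eventually)
    show "(\<lambda>j. clip (Vr (q j) - Mr (q j))) \<longlonglongrightarrow> snd l" using tendsto_snd[OF l] by (simp add: q_def o_def)
    show "eventually (\<lambda>j. clip (Vr (q j) - Mr (q j)) = Vr (q j) - Mr (q j)) sequentially" using small by eventually_elim (rule close)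
  qed
  have conv': "L1_loc_convergent (\<lambda>j. flow p w (q j)) h"
    unfolding L1_loc_convergent_def
  proof (intro conjI allI impI)
    show "L1_loc h" using conv by (simp add: L1_loc_convergent_def)
    fix K :: "(real^'n) set" assume "compact K"
    then have "(\<lambda>j. \<integral>\<^sup>+x. e2ennreal \<bar>flow p w (r j) x - ereal (h x)\<bar> \<partial>lebesgue_on K) \<longlonglongrightarrow> 0"
      using conv by (simp add: L1_loc_convergent_def)
    from LIMSEQ_subseq_LIMSEQ[OF this \<sigma>] show "(\<lambda>j. \<integral>\<^sup>+x. e2ennreal \<bar>flow p w (q j) x - ereal (h x)\<bar> \<partial>lebesgue_on K) \<longlonglongrightarrow> 0"
      by (simp add: q_def o_def)
  qed
  have fl: "flow p w (q j) x = ereal 1 * (u (q j *\<^sub>R x) - ereal (Mr (q j)))" if "q j \<le> R" "norm (q j *\<^sub>R x) \<le> 4 * R" for j x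
    using averages_w(1)[OF q(1) that(1)] w[OF that(2)] p by (simp add: flow_def one_ereal_def[symmetric])
  have lim: "(\<lambda>j. 1 * (f (q j * t) - Mr (q j))) \<longlonglongrightarrow> \<theta> * ln t + c"
    if f: "slope_limit p f \<theta>" and c: "(\<lambda>j. f (q j) - Mr (q j)) \<longlonglongrightarrow> c" and t: "0 < t" for f c t
  proof -
    have "slope_limit 2 f \<theta>" using f p by simp
    from tendsto_add[OF slope_limit_log[OF this q t] c] show ?thesis by simp
  qed
  have cont: "isCont (\<lambda>t. \<theta> * ln t + c) t" if "0 < t" for c t using that by (intro continuous_intros) auto
  have c0': "(\<lambda>j. Mr (q j) - Mr (q j)) \<longlonglongrightarrow> 0" by simp
  note * = tangent_averages[OF q zero_less_one conv' h fl lim[OF \<theta>(1) c0'] cont lim[OF \<theta>(2) S] cont lim[OF \<theta>(3) V] cont]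
  show ?thesis by (rule that) (use * in auto)
qed

end

theorem theorem1p6:
  fixes F :: "(real^'n^'n) set" and X :: "(real^'n) set" and u :: "real^'n \<Rightarrow> ereal"
    and e :: "real^'n" and p :: real
  assumes "CARD('n) \<ge> 2"
    and "subequation F" and "convex F" and "cone F" and "ST_invariant F"
    and "norm e = 1" and "riesz_characteristic F e = ereal p"
    and "open X" and "0 \<in> X" and "F_subharmonic F X u"
  shows
    "(\<forall>\<Psi>\<in>{avg_M, avg_S, avg_V}. \<exists>\<theta>. has_density_at_0 p \<Psi> u \<theta>) \<and>
     (p \<noteq> 2 \<longrightarrow>
        (\<forall>U. tangent p u U \<longrightarrow>
          (\<forall>r>0.
             (SUP \<sigma>\<in>sphere 0 1. U (r *\<^sub>R \<sigma>)) = ereal (density_at_0 p avg_M u * riesz_kernel p r) \<and>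
             average sphere_measure (\<lambda>\<sigma>. U (r *\<^sub>R \<sigma>))
               = ereal (density_at_0 p avg_S u * riesz_kernel p r) \<and>
             average (lebesgue_on (cball 0 1)) (\<lambda>x. U (r *\<^sub>R x))
               = ereal (density_at_0 p avg_V u * riesz_kernel p r)) \<and>
          (\<forall>\<Psi>\<in>{avg_M, avg_S, avg_V}.
             (\<exists>\<theta>. has_density_at_0 p \<Psi> U \<theta>) \<and> density_at_0 p \<Psi> U = density_at_0 p \<Psi> u))) \<and>
     (p = 2 \<longrightarrow>
        density_at_0 p avg_M u = density_at_0 p avg_S u \<and> density_at_0 p avg_S u = density_at_0 p avg_V u \<and>
        (\<forall>U. tangent p u U \<longrightarrow>
          (\<forall>\<Psi>\<in>{avg_M, avg_S, avg_V}.
             (\<exists>\<theta>. has_density_at_0 p \<Psi> U \<theta>) \<and> density_at_0 p \<Psi> U = density_at_0 p avg_M u) \<and>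
          \<bar>average sphere_measure U\<bar> \<noteq> \<infinity> \<and>
          \<bar>average (lebesgue_on (cball 0 1)) U\<bar> \<noteq> \<infinity> \<and>
          (\<forall>r>0.
             (SUP \<sigma>\<in>sphere 0 1. U (r *\<^sub>R \<sigma>)) = ereal (density_at_0 p avg_M u * ln r) \<and>
             average sphere_measure (\<lambda>\<sigma>. U (r *\<^sub>R \<sigma>))
               = ereal (density_at_0 p avg_M u * ln r) + average sphere_measure U \<and>
             average (lebesgue_on (cball 0 1)) (\<lambda>x. U (r *\<^sub>R x))
               = ereal (density_at_0 p avg_M u * ln r) + average (lebesgue_on (cball 0 1)) U)))"
proof -
  obtain G u' R c0 where germ: "subharmonic_germ G F p u' R c0" and eq: "\<And>x. norm x \<le> 4 * R \<Longrightarrow> u x = u' x"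
    by (rule subharmonic_germ_exists[OF assms(2-10)]) (rule that)
  interpret subharmonic_germ G F p u' R c0 by (rule germ)
  interpret subharmonic_function G F p u' R c0 u by unfold_locales (rule eq)
  obtain \<theta>M \<theta>S \<theta>V where \<theta>: "slope_limit p Mr \<theta>M" "slope_limit p Sr \<theta>S" "slope_limit p Vr \<theta>V" by (rule slope_limits)
  note d = densities[OF \<theta>]
  note D = d[THEN density_at_0_eq]
  have one: "(0::real) < 1" by simp
  have *: "(\<forall>r>0.
             (SUP \<sigma>\<in>sphere 0 1. U (r *\<^sub>R \<sigma>)) = ereal (\<theta>M * riesz_kernel p r) \<and>
             avg_S U r = ereal (\<theta>S * riesz_kernel p r) \<and> avg_V U r = ereal (\<theta>V * riesz_kernel p r)) \<and>
      has_density_at_0 p avg_M U \<theta>M \<and> has_density_at_0 p avg_S U \<theta>S \<and> has_density_at_0 p avg_V U \<theta>V"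
    if p: "p \<noteq> 2" and U: "tangent p u U" for U
  proof -
    note f = power_tangent_averages[OF p U \<theta>]
    have "has_density_at_0 p avg_M U \<theta>M" "has_density_at_0 p avg_S U \<theta>S" "has_density_at_0 p avg_V U \<theta>V"
      using f by (auto intro!: slope_limit_has_density[OF slope_limit_multiple[of p _ 0] one])
    then show ?thesis using f by auto
  qed
  have **: "\<exists>c d. (\<forall>r>0. (SUP \<sigma>\<in>sphere 0 1. U (r *\<^sub>R \<sigma>)) = ereal (\<theta>M * ln r) \<and>
             avg_S U r = ereal (\<theta>M * ln r + c) \<and> avg_V U r = ereal (\<theta>M * ln r + d)) \<and>
      has_density_at_0 p avg_M U \<theta>M \<and> has_density_at_0 p avg_S U \<theta>M \<and> has_density_at_0 p avg_V U \<theta>M"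
    if p: "p = 2" and U: "tangent p u U" for U
  proof -
    have \<theta>': "slope_limit p Sr \<theta>M" "slope_limit p Vr \<theta>M" using log_densities_agree[OF p \<theta>] \<theta> by auto
    obtain c d where f: "\<And>t. 0 < t \<Longrightarrow> (SUP \<sigma>\<in>sphere 0 1. U (t *\<^sub>R \<sigma>)) = ereal (\<theta>M * ln t)" "\<And>t. 0 < t \<Longrightarrow> avg_M U t = ereal (\<theta>M * ln t)"
      "\<And>t. 0 < t \<Longrightarrow> avg_S U t = ereal (\<theta>M * ln t + c)" "\<And>t. 0 < t \<Longrightarrow> avg_V U t = ereal (\<theta>M * ln t + d)"
      by (rule log_tangent_averages[OF p U \<theta>(1) \<theta>']) (rule that)
    have K: "rk p = ln" using p by (auto simp: riesz_kernel_def)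
    have "has_density_at_0 p avg_M U \<theta>M" "has_density_at_0 p avg_S U \<theta>M" "has_density_at_0 p avg_V U \<theta>M"
      using f slope_limit_has_density[OF slope_limit_multiple[of p \<theta>M 0] one, of avg_M U]
        slope_limit_has_density[OF slope_limit_multiple[of p \<theta>M c] one, of avg_S U]
        slope_limit_has_density[OF slope_limit_multiple[of p \<theta>M d] one, of avg_V U] unfolding K by auto
    then show ?thesis using f by blast
  qed
  have agree: "density_at_0 p avg_M u = density_at_0 p avg_S u" "density_at_0 p avg_S u = density_at_0 p avg_V u" if "p = 2"
    using log_densities_agree[OF that \<theta>] D by simp_all
  have log: "(\<forall>\<Psi>\<in>{avg_M, avg_S, avg_V}. (\<exists>\<theta>. has_density_at_0 p \<Psi> U \<theta>) \<and> density_at_0 p \<Psi> U = density_at_0 p avg_M u) \<and>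
          \<bar>average sphere_measure U\<bar> \<noteq> \<infinity> \<and> \<bar>average (lebesgue_on (cball 0 1)) U\<bar> \<noteq> \<infinity> \<and>
          (\<forall>r>0. (SUP \<sigma>\<in>sphere 0 1. U (r *\<^sub>R \<sigma>)) = ereal (density_at_0 p avg_M u * ln r) \<and>
             average sphere_measure (\<lambda>\<sigma>. U (r *\<^sub>R \<sigma>)) = ereal (density_at_0 p avg_M u * ln r) + average sphere_measure U \<and>
             average (lebesgue_on (cball 0 1)) (\<lambda>x. U (r *\<^sub>R x))
               = ereal (density_at_0 p avg_M u * ln r) + average (lebesgue_on (cball 0 1)) U)"
    if p: "p = 2" and U: "tangent p u U" for U
  proof -
    obtain c d where f: "\<And>r. 0 < r \<Longrightarrow> (SUP \<sigma>\<in>sphere 0 1. U (r *\<^sub>R \<sigma>)) = ereal (\<theta>M * ln r)"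
      "\<And>r. 0 < r \<Longrightarrow> avg_S U r = ereal (\<theta>M * ln r + c)" "\<And>r. 0 < r \<Longrightarrow> avg_V U r = ereal (\<theta>M * ln r + d)"
      and h: "has_density_at_0 p avg_M U \<theta>M" "has_density_at_0 p avg_S U \<theta>M" "has_density_at_0 p avg_V U \<theta>M"
      using **[OF p U] by blast
    have "average sphere_measure U = ereal c" "average (lebesgue_on (cball 0 1)) U = ereal d"
      using f(2,3)[of 1] by (simp_all add: avg_S_def avg_V_def)
    then show ?thesis using f h h[THEN density_at_0_eq] D by (auto simp: avg_S_def avg_V_def)
  qed
  have power: "(\<forall>r>0.
             (SUP \<sigma>\<in>sphere 0 1. U (r *\<^sub>R \<sigma>)) = ereal (density_at_0 p avg_M u * riesz_kernel p r) \<and>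
             average sphere_measure (\<lambda>\<sigma>. U (r *\<^sub>R \<sigma>)) = ereal (density_at_0 p avg_S u * riesz_kernel p r) \<and>
             average (lebesgue_on (cball 0 1)) (\<lambda>x. U (r *\<^sub>R x)) = ereal (density_at_0 p avg_V u * riesz_kernel p r)) \<and>
          (\<forall>\<Psi>\<in>{avg_M, avg_S, avg_V}.
             (\<exists>\<theta>. has_density_at_0 p \<Psi> U \<theta>) \<and> density_at_0 p \<Psi> U = density_at_0 p \<Psi> u)"
    if p: "p \<noteq> 2" and U: "tangent p u U" for U
    using *[OF p U] D density_at_0_eq by (fastforce simp: avg_S_def avg_V_def)
  have exist: "\<forall>\<Psi>\<in>{avg_M, avg_S, avg_V}. \<exists>\<theta>. has_density_at_0 p \<Psi> u \<theta>" using d by auto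
  show ?thesis
    by (rule conjI[OF exist conjI], rule impI, rule allI, rule impI, erule (1) power,
        rule impI, rule conjI, erule agree(1), rule conjI, erule agree(2), rule allI, rule impI, erule (1) log)
qed

end
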